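(* Let $X=\{X(t),t\in\mathbb{R}^N\}$ be a centered continuous $\mathbb{R}^d$-valued Gaussian random field with i.i.d. component processes, and let $I\subset\mathbb{R}^N$ be a compact interval. Suppose that the assumptions (A1), (A2), (A3) stated in the context hold, and that $d\ge Q$, where $Q=\sum_{j=1}^N \frac{1}{\alpha_j}$ and $\alpha_j=(1+\gamma_j)^{-1}$. Let $F\subset\mathbb{R}^d$ be a bounded set satisfying the following condition: there exist constants $\theta\in[0,d-Q]$, $C_F\in(0,\infty)$ and $\kappa\in[0,(d-\theta)/Q)$ such that $$\lambda_d\big(F^{(r)}\big)\le C_F\, r^{d-\theta}\Big(\log\log(1/r)\Big)^{\kappa}$$ for all sufficiently small $r>0$, where $\lambda_d$ is Lebesgue measure on $\mathbb{R}^d$ and $F^{(r)}=\{x\in\mathbb{R}^d:\inf_{y\in F}|x-y|\le r\}$ is the closed $r$-neighborhood of $F$. Then $X^{-1}(F)\cap I=\emptyset$ almost surely.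
   Context: $X(t)=(X_1(t),\dots,X_d(t))$, $t\in\mathbb{R}^N$, is a centered $\mathbb{R}^d$-valued Gaussian random field with continuous sample paths on a probability space $(\Omega,\mathcal{F},\mathbb{P})$, whose component processes $X_1,\dots,X_d$ are i.i.d. For finite constants $c_j<d_j$ ($1\le j\le N$), $I=\prod_{j=1}^N[c_j,d_j]$ and, for $\epsilon>0$, $I^{(\epsilon)}=\prod_{j=1}^N(c_j-\epsilon,d_j+\epsilon)$. For a random vector $Y$, $\|Y\|_{L^2}=(\mathbb{E}|Y|^2)^{1/2}$. $X^{-1}(F)=\{t\in\mathbb{R}^N: X(t)\in F\}$. Gaussian noise: for a Borel measure $\nu$ on $\mathbb{R}_+=[0,\infty)$, an $\mathbb{R}^d$-valued Gaussian noise with control measure $\nu$ is a set function $A\mapsto W(A)$ defined on the Borel sets $\mathcal{B}(\mathbb{R}_+)$ with values in $L^2(\Omega,\mathcal{F},\mathbb{P};\mathbb{R}^d)$ such that each $W(A)$ is a centered normal random vector with covariance matrix $\nu(A)I_d$, and $W(A\cup B)=W(A)+W(B)$ with $W(A)$ and $W(B)$ independent whenever $A\cap B=\emptyset$. (A1) There are a Gaussian random field $\{W(A,t):A\in\mathcal{B}(\mathbb{R}_+),t\in\mathbb{R}^N\}$ and $\epsilon_0>0$ such that: (a1) for all $t\in I^{(\epsilon_0)}$, $A\mapsto W(A,t)$ is an $\mathbb{R}^d$-valued Gaussian noise with a control measure $\nu_t$ such that $W(\mathbb{R}_+,t)=X(t)$, and when $A\cap B=\emptyset$, $W(A,\cdot)$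 and $W(B,\cdot)$ are independent; (a2) there exist constants $a_0\ge0$, $c_0>0$, $\gamma_j>0$ ($1\le j\le N$) such that for all $a_0\le a<b\le+\infty$ and all $s,t\in I^{(\epsilon_0)}$, $$\big\|W([a,b),s)-X(s)-W([a,b),t)+X(t)\big\|_{L^2}\le c_0\Big[\sum_{j=1}^N a^{\gamma_j}|s_j-t_j|+b^{-1}\Big]$$ and $$\big\|W([0,a_0),s)-W([0,a_0),t)\big\|_{L^2}\le c_0\sum_{j=1}^N|s_j-t_j|.$$ Set $\alpha_j=(1+\gamma_j)^{-1}$ and $\Delta(s,t)=\sum_{j=1}^N|s_j-t_j|^{\alpha_j}$ for $s,t\in\mathbb{R}^N$. (A2) There exists $d_0>0$ such that $\|X_i(t)\|_{L^2}\ge d_0$ for all $t\in I^{(\epsilon_0)}$ and all $1\le i\le d$. (A3) There exists $\rho_0>0$ with the following property: for each $t\in I$ there exist $t'=t'(t)\in I^{(\epsilon_0)}$, $\delta_j=\delta_j(t)\in(\alpha_j,1]$ for $1\le j\le N$, and $C=C(t)>0$, such that $$\Big|\mathbb{E}\big[X_i(t')\big(X_i(s)-X_i(\bar s)\big)\big]\Big|\le C\sum_{j=1}^N|s_j-\bar s_j|^{\delta_j}$$ for all $1\le i\le d$ and all $s,\bar s\in I^{(\epsilon_0)}$ with $\max\{\Delta(t,s),\Delta(t,\bar s)\}\le2\rho_0$. *)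

theory Defs
  imports "HOL-Probability.Probability"
begin

text \<open>
  Normal laws may be degenerate: a constant random variable counts as normal with variance zero.
\<close>

definition normal_rv :: "'w measure \<Rightarrow> ('w \<Rightarrow> real) \<Rightarrow> bool" where
  "normal_rv M Y \<longleftrightarrow> Y \<in> borel_measurable M \<and>
     ((\<exists>\<mu> \<sigma>. \<sigma> > 0 \<and> distributed M lborel Y (\<lambda>x. ennreal (normal_density \<mu> \<sigma> x))) \<or>
      (\<exists>\<mu>. AE \<omega> in M. Y \<omega> = \<mu>))"

definition normal_vector :: "'w measure \<Rightarrow> ('w \<Rightarrow> real ^ 'd) \<Rightarrow> bool" where
  "normal_vector M Y \<longleftrightarrow> (\<forall>v. normal_rv M (\<lambda>\<omega>. v \<bullet> Y \<omega>))"

definition centered :: "'w measure \<Rightarrow> ('w \<Rightarrow> real ^ 'd) \<Rightarrow> bool" where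
  "centered M Y \<longleftrightarrow> integrable M Y \<and> (\<integral>\<omega>. Y \<omega> \<partial>M) = 0"

definition covariance_matrix :: "'w measure \<Rightarrow> ('w \<Rightarrow> real ^ 'd) \<Rightarrow> real ^ 'd ^ 'd" where
  "covariance_matrix M Y = (\<chi> i j. \<integral>\<omega>. (Y \<omega> $ i - (\<integral>\<omega>'. Y \<omega>' $ i \<partial>M)) *
                                      (Y \<omega> $ j - (\<integral>\<omega>'. Y \<omega>' $ j \<partial>M)) \<partial>M)"

text \<open>
  A family of random vectors indexed by \<open>T\<close> is Gaussian when all its finite-dimensional
  distributions are multivariate normal, i.e. when every finite linear combination of components is
  normal. The mean is not required to vanish.
\<close>

definition gaussian_field ::
    "'w measure \<Rightarrow> 'i set \<Rightarrow> ('i \<Rightarrow> 'w \<Rightarrow> real ^ 'd) \<Rightarrow> bool" where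
  "gaussian_field M T Y \<longleftrightarrow>
     (\<forall>J v. finite J \<and> J \<subseteq> T \<longrightarrow> normal_rv M (\<lambda>\<omega>. \<Sum>i\<in>J. v i \<bullet> Y i \<omega>))"

definition L2_nrm :: "'w measure \<Rightarrow> ('w \<Rightarrow> 'b::real_normed_vector) \<Rightarrow> real" where
  "L2_nrm M Y = sqrt (\<integral>\<omega>. (norm (Y \<omega>))\<^sup>2 \<partial>M)"

definition iid_components :: "'w measure \<Rightarrow> (real ^ 'n \<Rightarrow> 'w \<Rightarrow> real ^ 'd) \<Rightarrow> bool" where
  "iid_components M X \<longleftrightarrow>
     prob_space.indep_vars M (\<lambda>_. Pi\<^sub>M UNIV (\<lambda>_. borel)) (\<lambda>i \<omega> t. X t \<omega> $ i) UNIV \<and>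
     (\<forall>i j. distr M (Pi\<^sub>M UNIV (\<lambda>_. borel)) (\<lambda>\<omega> t. X t \<omega> $ i) =
            distr M (Pi\<^sub>M UNIV (\<lambda>_. borel)) (\<lambda>\<omega> t. X t \<omega> $ j))"

definition indep_fields ::
    "'w measure \<Rightarrow> (real ^ 'n \<Rightarrow> 'w \<Rightarrow> real ^ 'd) \<Rightarrow> (real ^ 'n \<Rightarrow> 'w \<Rightarrow> real ^ 'd) \<Rightarrow> bool" where
  "indep_fields M Y Z \<longleftrightarrow>
     prob_space.indep_var M (Pi\<^sub>M UNIV (\<lambda>_. borel)) (\<lambda>\<omega> t. Y t \<omega>)
                            (Pi\<^sub>M UNIV (\<lambda>_. borel)) (\<lambda>\<omega> t. Z t \<omega>)"

abbreviation borel_Rplus :: "real measure" where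
  "borel_Rplus \<equiv> restrict_space borel {0..}"

text \<open>
  Values of a noise are elements of \<open>L\<^sup>2\<close>, so identities between them hold almost surely. The
  covariance of \<open>W(A)\<close> being \<open>\<nu>(A)\<close> times the identity forces \<open>\<nu>(A)\<close> to be finite.
\<close>

definition gaussian_noise ::
    "'w measure \<Rightarrow> real measure \<Rightarrow> (real set \<Rightarrow> 'w \<Rightarrow> real ^ 'd) \<Rightarrow> bool" where
  "gaussian_noise M \<nu> W \<longleftrightarrow>
     sets \<nu> = sets borel_Rplus \<and>
     (\<forall>A\<in>sets borel_Rplus.
        W A \<in> borel_measurable M \<and> integrable M (\<lambda>\<omega>. (norm (W A \<omega>))\<^sup>2) \<and>
        normal_vector M (W A) \<and> centered M (W A) \<and>
        emeasure \<nu> A < \<infinity> \<and> covariance_matrix M (W A) = mat (measure \<nu> A)) \<and>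
     (\<forall>A\<in>sets borel_Rplus. \<forall>B\<in>sets borel_Rplus. A \<inter> B = {} \<longrightarrow>
        (AE \<omega> in M. W (A \<union> B) \<omega> = W A \<omega> + W B \<omega>) \<and>
        prob_space.indep_var M borel (W A) borel (W B))"

text \<open>The interval \<open>I\<close> is \<open>cbox lo hi\<close>; the following is its open enlargement.\<close>

definition enlarged :: "real ^ 'n \<Rightarrow> real ^ 'n \<Rightarrow> real \<Rightarrow> (real ^ 'n) set" where
  "enlarged lo hi \<epsilon> = {t. \<forall>j. lo $ j - \<epsilon> < t $ j \<and> t $ j < hi $ j + \<epsilon>}"

definition alpha :: "('n \<Rightarrow> real) \<Rightarrow> 'n \<Rightarrow> real" where
  "alpha \<gamma> j = inverse (1 + \<gamma> j)"

definition Q_dim :: "('n::finite \<Rightarrow> real) \<Rightarrow> real" where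
  "Q_dim \<gamma> = (\<Sum>j\<in>UNIV. 1 / alpha \<gamma> j)"

definition Delta :: "('n \<Rightarrow> real) \<Rightarrow> real ^ 'n \<Rightarrow> real ^ 'n \<Rightarrow> real" where
  "Delta \<gamma> s t = (\<Sum>j\<in>UNIV. \<bar>s $ j - t $ j\<bar> powr alpha \<gamma> j)"

text \<open>
  The numbers \<open>\<epsilon>\<^sub>0\<close> and \<open>\<gamma>\<^sub>j\<close> are parameters because the other assumptions and the
  exponents \<open>\<alpha>\<^sub>j\<close> refer to them; the noise and the remaining constants are quantified inside.
  The right endpoint \<open>b\<close> is an extended real, with \<open>1/\<infinity> = 0\<close>.
\<close>

definition assumption_A1 ::
    "'w measure \<Rightarrow> (real ^ 'n \<Rightarrow> 'w \<Rightarrow> real ^ 'd) \<Rightarrow> real ^ 'n \<Rightarrow> real ^ 'n \<Rightarrow> real \<Rightarrow>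
     ('n \<Rightarrow> real) \<Rightarrow> bool" where
  "assumption_A1 M X lo hi \<epsilon>0 \<gamma> \<longleftrightarrow> \<epsilon>0 > 0 \<and> (\<forall>j. \<gamma> j > 0) \<and>
     (\<exists>W :: real set \<Rightarrow> real ^ 'n \<Rightarrow> 'w \<Rightarrow> real ^ 'd.
        gaussian_field M (sets borel_Rplus \<times> UNIV) (\<lambda>(A, t). W A t) \<and>
        (\<forall>t\<in>enlarged lo hi \<epsilon>0.
           (\<exists>\<nu>. gaussian_noise M \<nu> (\<lambda>A. W A t)) \<and> (AE \<omega> in M. W {0..} t \<omega> = X t \<omega>)) \<and>
        (\<forall>A\<in>sets borel_Rplus. \<forall>B\<in>sets borel_Rplus. A \<inter> B = {} \<longrightarrow> indep_fields M (W A) (W B)) \<and>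
        (\<exists>a0 c0 :: real. a0 \<ge> 0 \<and> c0 > 0 \<and>
           (\<forall>a (b::ereal). \<forall>s\<in>enlarged lo hi \<epsilon>0. \<forall>t\<in>enlarged lo hi \<epsilon>0.
              a0 \<le> a \<and> ereal a < b \<longrightarrow>
              L2_nrm M (\<lambda>\<omega>. W {x. a \<le> x \<and> ereal x < b} s \<omega> - X s \<omega>
                            - W {x. a \<le> x \<and> ereal x < b} t \<omega> + X t \<omega>)
                \<le> c0 * ((\<Sum>j\<in>UNIV. a powr \<gamma> j * \<bar>s $ j - t $ j\<bar>) + real_of_ereal (inverse b))) \<and>
           (\<forall>s\<in>enlarged lo hi \<epsilon>0. \<forall>t\<in>enlarged lo hi \<epsilon>0.
              L2_nrm M (\<lambda>\<omega>. W {0..<a0} s \<omega> - W {0..<a0} t \<omega>) \<le> c0 * (\<Sum>j\<in>UNIV. \<bar>s $ j - t $ j\<bar>))))"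

definition assumption_A2 ::
    "'w measure \<Rightarrow> (real ^ 'n \<Rightarrow> 'w \<Rightarrow> real ^ 'd) \<Rightarrow> real ^ 'n \<Rightarrow> real ^ 'n \<Rightarrow> real \<Rightarrow> bool" where
  "assumption_A2 M X lo hi \<epsilon>0 \<longleftrightarrow>
     (\<exists>d0>0. \<forall>t\<in>enlarged lo hi \<epsilon>0. \<forall>i. L2_nrm M (\<lambda>\<omega>. X t \<omega> $ i) \<ge> d0)"

definition assumption_A3 ::
    "'w measure \<Rightarrow> (real ^ 'n \<Rightarrow> 'w \<Rightarrow> real ^ 'd) \<Rightarrow> real ^ 'n \<Rightarrow> real ^ 'n \<Rightarrow> real \<Rightarrow>
     ('n \<Rightarrow> real) \<Rightarrow> bool" where
  "assumption_A3 M X lo hi \<epsilon>0 \<gamma> \<longleftrightarrow>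
     (\<exists>\<rho>0>0. \<forall>t\<in>cbox lo hi. \<exists>t'\<in>enlarged lo hi \<epsilon>0. \<exists>\<delta> :: 'n \<Rightarrow> real. \<exists>C>0.
        (\<forall>j. alpha \<gamma> j < \<delta> j \<and> \<delta> j \<le> 1) \<and>
        (\<forall>i. \<forall>s\<in>enlarged lo hi \<epsilon>0. \<forall>s'\<in>enlarged lo hi \<epsilon>0.
           max (Delta \<gamma> t s) (Delta \<gamma> t s') \<le> 2 * \<rho>0 \<longrightarrow>
           \<bar>\<integral>\<omega>. X t' \<omega> $ i * (X s \<omega> $ i - X s' \<omega> $ i) \<partial>M\<bar>
             \<le> C * (\<Sum>j\<in>UNIV. \<bar>s $ j - s' $ j\<bar> powr \<delta> j)))"

text \<open>
  The library sets \<open>infdist x {} = 0\<close>, whereas here the infimum over the empty set is \<open>\<infinity>\<close>, so the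
  empty set has empty neighbourhoods.
\<close>

definition closed_nbhd :: "'a::metric_space set \<Rightarrow> real \<Rightarrow> 'a set" where
  "closed_nbhd F r = {x. F \<noteq> {} \<and> infdist x F \<le> r}"

end

theory Submission
  imports Defs "HOL-Real_Asymp.Real_Asymp"
begin

text \<open>
  Consider a dyadic grid with spacing \<open>2 powr (- k (1 + \<gamma> j))\<close> in direction \<open>j\<close>, so that a box of
  scale \<open>k\<close> has the natural size for fluctuations of order \<open>2 powr - k\<close> and a unit cube holds about
  \<open>2 powr (k Q)\<close> boxes. The restrictions of the noise to disjoint frequency bands are independent; the
  oscillation of the field over a box of scale \<open>k\<close> comes mainly from the frequencies near \<open>2 ^ k\<close>.
  Hence, along a sparse sequence of scales, the events that the oscillation of the field around a
  given point is smaller than typical by a factor of order \<open>(log n) powr (1/Q)\<close> are nearly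
  independent, and the small-ball estimate makes it very likely that such a calm scale exists
  between \<open>n\<close> and \<open>2 n\<close>. Cover the cube by the boxes of first calm scale; what is left is covered by
  so few boxes of scale \<open>2 n\<close> that the modulus of continuity suffices there.

  Near \<open>t0\<close> the low-frequency part \<open>W {0..<a} t0\<close> is a nondegenerate Gaussian vector. Subtracting its
  regression leaves a residual that is independent of it, and calmness can be read off from the
  residual, so the probability that the field hits \<open>F\<close> in a calm box is at most a constant times
  the volume of a neighbourhood of \<open>F\<close> of the size of the oscillation. By the volume assumption these
  probabilities add up to a power of \<open>log n\<close> with exponent \<open>\<kappa> - 1\<close> when \<open>d - \<theta> = Q\<close>, which tends to 0; a larger
  \<open>d - \<theta>\<close> reduces to this case.
\<close>

section \<open>Laws determined by linear functionals\<close>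

text \<open>The hitting estimate needs a nondegenerate Gaussian vector independent of everything
  that selects the boxes, while calmness depends on the whole field. The low-frequency vector at
  \<open>t0\<close> reconciles the two: disjoint bands are uncorrelated, so its covariance with the
  field at \<open>s\<close> is its covariance with the low-frequency part at \<open>s\<close>, which
  is Lipschitz in \<open>s\<close>. Hence the regression oscillates by a multiple of
  \<open>2 powr (- k * (1 + \<beta>))\<close> on a box of scale \<open>k\<close>, and passing to the
  residual only changes the constant in the definition of calm. Two exponents must balance. Calm by
  a factor \<open>2 powr - J\<close> has probability at least
  \<open>exp (- C * 2 powr (J * Q)) / 4\<close>; with \<open>2 powr (J * Q)\<close> about
  \<open>\<tau> * ln n\<close> and \<open>\<tau>\<close> small this is at least
  \<open>n powr (- 1/2) / 4\<close>. Bands reaching from \<open>2 ^ (k - u)\<close> to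
  \<open>2 ^ (k + u)\<close> with \<open>u\<close> about \<open>log 2 n\<close> push the remaining
  frequencies below \<open>2 powr - J\<close> and leave about \<open>n / ln n\<close> independent
  trials. So the probability of finding no calm scale decays faster than any power of
  \<open>n\<close>, which absorbs the polynomial loss of the modulus of continuity.\<close>

lemma (in prob_space) integrable_bounded_mult:
  fixes w f :: "'a \<Rightarrow> real"
  assumes "w \<in> borel_measurable M" "f \<in> borel_measurable M"
    and "\<And>\<omega>. \<omega> \<in> space M \<Longrightarrow> \<bar>w \<omega>\<bar> \<le> K" "\<And>\<omega>. \<bar>f \<omega>\<bar> \<le> 1"
  shows "integrable M (\<lambda>\<omega>. w \<omega> * f \<omega>)"
proof (rule integrable_const_bound[where B = K])
  show "AE \<omega> in M. norm (w \<omega> * f \<omega>) \<le> K"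
  proof (rule AE_I2)
    fix \<omega> assume "\<omega> \<in> space M"
    then have "\<bar>w \<omega>\<bar> * \<bar>f \<omega>\<bar> \<le> K * 1"
      using assms(3,4) by (intro mult_mono) (auto intro: order_trans[OF abs_ge_zero])
    then show "norm (w \<omega> * f \<omega>) \<le> K" by (simp add: abs_mult)
  qed
qed (use assms in measurable)

text \<open>Dividing both weights by their common mass, read off at \<open>s = c = 0\<close>, turns
  the two sides into laws of real random variables, and these are determined by their characteristic
  functions. The phase \<open>c\<close> lets a real cosine identity carry both the real and the
  imaginary part.\<close>

lemma weighted_law_eqI:
  fixes w :: "'a \<Rightarrow> real" and w' :: "'b \<Rightarrow> real" and U :: "'a \<Rightarrow> real" and V :: "'b \<Rightarrow> real"
  assumes "prob_space M" "prob_space N"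
    and [measurable]: "w \<in> borel_measurable M" "U \<in> borel_measurable M"
      "w' \<in> borel_measurable N" "V \<in> borel_measurable N"
    and w: "\<And>\<omega>. \<omega> \<in> space M \<Longrightarrow> 0 \<le> w \<omega> \<and> w \<omega> \<le> K"
    and w': "\<And>\<omega>. \<omega> \<in> space N \<Longrightarrow> 0 \<le> w' \<omega> \<and> w' \<omega> \<le> K"
    and eq: "\<And>s c. (\<integral>\<omega>. w \<omega> * cos (c + s * U \<omega>) \<partial>M) = (\<integral>\<omega>. w' \<omega> * cos (c + s * V \<omega>) \<partial>N)"
    and B: "B \<in> sets borel"
  shows "(\<integral>\<omega>. w \<omega> * indicator B (U \<omega>) \<partial>M) = (\<integral>\<omega>. w' \<omega> * indicator B (V \<omega>) \<partial>N)"
proof -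
  interpret M: prob_space M by fact
  interpret N: prob_space N by fact
  have absw: "\<And>\<omega>. \<omega> \<in> space M \<Longrightarrow> \<bar>w \<omega>\<bar> \<le> K" "\<And>\<omega>. \<omega> \<in> space N \<Longrightarrow> \<bar>w' \<omega>\<bar> \<le> K"
    using w w' by auto
  define m where "m = (\<integral>\<omega>. w \<omega> \<partial>M)"
  have m': "m = (\<integral>\<omega>. w' \<omega> \<partial>N)" using eq[of 0 0] by (simp add: m_def)
  have [simp]: "integrable M w" "integrable N w'"
    using M.integrable_const_bound[where B=K and f=w] N.integrable_const_bound[where B=K and f=w']
      absw by auto
  have nnw: "AE \<omega> in M. 0 \<le> w \<omega>" "AE \<omega> in N. 0 \<le> w' \<omega>" using w w' by auto
  show ?thesis
  proof (cases "m = 0")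
    case True
    have "AE \<omega> in M. w \<omega> = 0"
      using integral_nonneg_eq_0_iff_AE[of M w] nnw True by (simp add: m_def)
    then have a: "(\<integral>\<omega>. w \<omega> * indicator B (U \<omega>) \<partial>M) = (\<integral>\<omega>. 0 \<partial>M)"
      using B by (intro integral_cong_AE) (auto)
    have "AE \<omega> in N. w' \<omega> = 0"
      using integral_nonneg_eq_0_iff_AE[of N w'] nnw True m' by (simp)
    then have "(\<integral>\<omega>. w' \<omega> * indicator B (V \<omega>) \<partial>N) = (\<integral>\<omega>. 0 \<partial>N)"
      using B by (intro integral_cong_AE) (auto)
    with a show ?thesis by simp
  next
    case False
    moreover have "0 \<le> m" unfolding m_def by (rule integral_nonneg_AE) (use nnw in auto)
    ultimately have mpos: "m > 0" by simp
    let ?M = "density M (\<lambda>\<omega>. ennreal (w \<omega> / m))" and ?N = "density N (\<lambda>\<omega>. ennreal (w' \<omega> / m))"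
    have pM: "prob_space ?M"
    proof (rule prob_spaceI)
      have "emeasure ?M (space ?M) = (\<integral>\<^sup>+\<omega>. ennreal (w \<omega> / m) \<partial>M)"
        by (subst emeasure_density) (auto intro!: nn_integral_cong)
      also have "\<dots> = ennreal (\<integral>\<omega>. w \<omega> / m \<partial>M)"
        using nnw mpos by (intro nn_integral_eq_integral) auto
      also have "(\<integral>\<omega>. w \<omega> / m \<partial>M) = 1" using mpos by (simp add: m_def)
      finally show "emeasure ?M (space ?M) = 1" by simp
    qed
    have pN: "prob_space ?N"
    proof (rule prob_spaceI)
      have "emeasure ?N (space ?N) = (\<integral>\<^sup>+\<omega>. ennreal (w' \<omega> / m) \<partial>N)"
        by (subst emeasure_density) (auto intro!: nn_integral_cong)
      also have "\<dots> = ennreal (\<integral>\<omega>. w' \<omega> / m \<partial>N)"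
        using nnw mpos by (intro nn_integral_eq_integral) auto
      also have "(\<integral>\<omega>. w' \<omega> / m \<partial>N) = 1" using mpos by (simp add: m')
      finally show "emeasure ?N (space ?N) = 1" by simp
    qed
    have rM: "real_distribution (distr ?M borel U)"
      by (rule prob_space.real_distribution_distr[OF pM]) simp
    have rN: "real_distribution (distr ?N borel V)"
      by (rule prob_space.real_distribution_distr[OF pN]) simp
    have reint: "(\<integral>x. f x \<partial>distr ?M borel U) = (\<integral>\<omega>. w \<omega> * f (U \<omega>) \<partial>M) / m"
      "(\<integral>x. f x \<partial>distr ?N borel V) = (\<integral>\<omega>. w' \<omega> * f (V \<omega>) \<partial>N) / m"
      if [measurable]: "f \<in> borel_measurable borel" for f :: "real \<Rightarrow> real"
    proof -
      have "(\<integral>x. f x \<partial>distr ?M borel U) = (\<integral>\<omega>. (w \<omega> / m) *\<^sub>R f (U \<omega>) \<partial>M)"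
        using nnw mpos by (subst integral_distr, simp, simp, subst integral_density) auto
      then show "(\<integral>x. f x \<partial>distr ?M borel U) = (\<integral>\<omega>. w \<omega> * f (U \<omega>) \<partial>M) / m" by simp
      have "(\<integral>x. f x \<partial>distr ?N borel V) = (\<integral>\<omega>. (w' \<omega> / m) *\<^sub>R f (V \<omega>) \<partial>N)"
        using nnw mpos by (subst integral_distr, simp, simp, subst integral_density) auto
      then show "(\<integral>x. f x \<partial>distr ?N borel V) = (\<integral>\<omega>. w' \<omega> * f (V \<omega>) \<partial>N) / m" by simp
    qed
    have "char (distr ?M borel U) = char (distr ?N borel V)"
    proof
      fix t
      have char_Re_Im: "Re (char P t) = (\<integral>x. cos (0 + t * x) \<partial>P)" "Im (char P t) = (\<integral>x. cos (- pi/2 + t * x) \<partial>P)"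
        if "real_distribution P" for P
      proof -
        interpret P: real_distribution P by fact
        have i: "integrable P (\<lambda>x. iexp (t * x))"
          by (rule P.integrable_const_bound[where B=1]) (auto simp: norm_exp_i_times)
        show "Re (char P t) = (\<integral>x. cos (0 + t * x) \<partial>P)"
          unfolding char_def using i by (subst integral_Re[symmetric]) (auto simp: Re_exp)
        have c: "cos (x - pi / 2) = sin x" for x :: real by (simp add: cos_diff)
        show "Im (char P t) = (\<integral>x. cos (- pi/2 + t * x) \<partial>P)"
          unfolding char_def using i by (subst integral_Im[symmetric]) (auto simp: Im_exp c)
      qed
      show "char (distr ?M borel U) t = char (distr ?N borel V) t"
        unfolding complex_eq_iff char_Re_Im[OF rM] char_Re_Im[OF rN]
          using eq[of 0 t] eq[of "- pi / 2" t] by (simp add: reint)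
    qed
    then have "distr ?M borel U = distr ?N borel V"
      by (rule Levy_uniqueness[OF rM rN])
    then have "(\<integral>x. indicator B x \<partial>distr ?M borel U) = (\<integral>x. indicator B x \<partial>distr ?N borel V :: real)"
      by simp
    then show ?thesis using mpos B by (simp only: reint borel_measurable_indicator) simp
  qed
qed

text \<open>Linear functionals determine the joint law. Coordinates are moved one at a time out of
  the cosine and into a product of indicators, so each step uses uniqueness on the real line
  only.\<close>

lemma Cramer_Wold_rectangles:
  fixes U :: "'i \<Rightarrow> 'a \<Rightarrow> real" and V :: "'i \<Rightarrow> 'b \<Rightarrow> real"
  assumes "prob_space M" "prob_space N" "finite I"
    and U: "\<And>i. i \<in> I \<Longrightarrow> U i \<in> borel_measurable M"
    and V: "\<And>i. i \<in> I \<Longrightarrow> V i \<in> borel_measurable N"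
    and eq: "\<And>v c. (\<integral>\<omega>. cos (c + (\<Sum>i\<in>I. v i * U i \<omega>)) \<partial>M) = (\<integral>\<omega>. cos (c + (\<Sum>i\<in>I. v i * V i \<omega>)) \<partial>N)"
    and B: "\<And>i. i \<in> I \<Longrightarrow> B i \<in> sets borel"
  shows "measure M {\<omega>\<in>space M. \<forall>i\<in>I. U i \<omega> \<in> B i} = measure N {\<omega>\<in>space N. \<forall>i\<in>I. V i \<omega> \<in> B i}"
proof -
  interpret M: prob_space M by fact
  interpret N: prob_space N by fact
  \<comment> \<open>\<open>S\<close> collects the coordinates already confined to their sets
    \<open>B i\<close>; the remaining ones are still tested by a cosine.\<close>
  define WM where "WM S v c \<omega> = (\<Prod>i\<in>S. indicator (B i) (U i \<omega>)) * cos (c + (\<Sum>i\<in>I-S. v i * U i \<omega>))" for S v c \<omega>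
  define WN where "WN S v c \<omega> = (\<Prod>i\<in>S. indicator (B i) (V i \<omega>)) * cos (c + (\<Sum>i\<in>I-S. v i * V i \<omega>))" for S v c \<omega>
  have pr01: "0 \<le> (\<Prod>i\<in>S. indicator (B i) (f i) :: real)" "(\<Prod>i\<in>S. indicator (B i) (f i) :: real) \<le> 1" for S f
    by (auto intro!: prod_nonneg prod_le_1)
  have "\<forall>v c. (\<integral>\<omega>. WM S v c \<omega> \<partial>M) = (\<integral>\<omega>. WN S v c \<omega> \<partial>N)" if "S \<subseteq> I" for S
  proof -
    have "finite S" using that assms(3) finite_subset by auto
    then show ?thesis using that
    proof (induction S)
      case empty
      then show ?case using eq by (simp add: WM_def WN_def)
    next
      case (insert k S)
      then have kS: "k \<in> I" "S \<subseteq> I" "k \<notin> S" "finite S" by auto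
      have fin: "finite (I - S)" "finite (I - insert k S)" using assms(3) by auto
      have split: "(\<Sum>i\<in>I-S. g i) = g k + (\<Sum>i\<in>I-insert k S. g i)" for g :: "'i \<Rightarrow> real"
        using kS fin by (subst sum.remove[of _ k]) (auto intro!: arg_cong[where f="sum g"])
      have [measurable]: "U k \<in> borel_measurable M" "V k \<in> borel_measurable N"
        using U V kS by auto
      have mU: "(\<lambda>\<omega>. \<Prod>i\<in>S. indicator (B i) (U i \<omega>) :: real) \<in> borel_measurable M"
        using kS U B by (intro borel_measurable_prod borel_measurable_indicator' ) (auto simp: subset_eq)
      have mV: "(\<lambda>\<omega>. \<Prod>i\<in>S. indicator (B i) (V i \<omega>) :: real) \<in> borel_measurable N"
        using kS V B by (intro borel_measurable_prod borel_measurable_indicator' ) (auto simp: subset_eq)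
      have lU: "(\<lambda>\<omega>. (\<Sum>i\<in>T. v i * U i \<omega>)) \<in> borel_measurable M" if "T \<subseteq> I" for v T
        using U that by (intro borel_measurable_sum) (auto simp: subset_eq)
      have lV: "(\<lambda>\<omega>. (\<Sum>i\<in>T. v i * V i \<omega>)) \<in> borel_measurable N" if "T \<subseteq> I" for v T
        using V that by (intro borel_measurable_sum) (auto simp: subset_eq)
      \<comment> \<open>Using \<open>1 + cos\<close> in place of \<open>cos\<close> makes the weight
        nonnegative, as \<open>weighted_law_eqI\<close> demands.\<close>
      have key: "(\<integral>\<omega>. ((\<Prod>i\<in>S. indicator (B i) (U i \<omega>)) * (1 + cos (c + (\<Sum>i\<in>I-insert k S. v i * U i \<omega>)))) * indicator (B k) (U k \<omega>) \<partial>M)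
          = (\<integral>\<omega>. ((\<Prod>i\<in>S. indicator (B i) (V i \<omega>)) * (1 + cos (c + (\<Sum>i\<in>I-insert k S. v i * V i \<omega>)))) * indicator (B k) (V k \<omega>) \<partial>N)"
        for v c
      proof (rule weighted_law_eqI[where K=2])
        note [measurable] = mU mV lU[of "I-insert k S" v, simplified] lV[of "I-insert k S" v, simplified]
        show "(\<lambda>\<omega>. (\<Prod>i\<in>S. indicator (B i) (U i \<omega>)) * (1 + cos (c + (\<Sum>i\<in>I-insert k S. v i * U i \<omega>)))) \<in> borel_measurable M"
          by measurable
        show "(\<lambda>\<omega>. (\<Prod>i\<in>S. indicator (B i) (V i \<omega>)) * (1 + cos (c + (\<Sum>i\<in>I-insert k S. v i * V i \<omega>)))) \<in> borel_measurable N"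
          by measurable
        have bd: "0 \<le> p * (1 + cos x) \<and> p * (1 + cos x) \<le> 2" if "0 \<le> p" "p \<le> 1" for p x :: real
        proof -
          have "0 \<le> 1 + cos x" "1 + cos x \<le> 2" using cos_ge_minus_one[of x] cos_le_one[of x] by linarith+
          then have "p * (1 + cos x) \<le> 1 * 2" using that by (intro mult_mono) auto
          then show ?thesis using that \<open>0 \<le> 1 + cos x\<close> by auto
        qed
        show "0 \<le> (\<Prod>i\<in>S. indicator (B i) (U i \<omega>)) * (1 + cos (c + (\<Sum>i\<in>I-insert k S. v i * U i \<omega>))) \<and>
           (\<Prod>i\<in>S. indicator (B i) (U i \<omega>)) * (1 + cos (c + (\<Sum>i\<in>I-insert k S. v i * U i \<omega>))) \<le> 2" for \<omega>
          by (rule bd[OF pr01])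
        show "0 \<le> (\<Prod>i\<in>S. indicator (B i) (V i \<omega>)) * (1 + cos (c + (\<Sum>i\<in>I-insert k S. v i * V i \<omega>))) \<and>
           (\<Prod>i\<in>S. indicator (B i) (V i \<omega>)) * (1 + cos (c + (\<Sum>i\<in>I-insert k S. v i * V i \<omega>))) \<le> 2" for \<omega>
          by (rule bd[OF pr01])
        fix s c'
        \<comment> \<open>The coefficient vectors of the three cosines that the product-to-sum
          formula produces; the induction hypothesis applies to each.\<close>
        define v1 where "v1 = v(k := s)"
        define v2 where "v2 = (\<lambda>i. - v i)(k := s)"
        define v0 where "v0 = (\<lambda>i. 0::real)(k := s)"
        have trig: "p * (1 + cos (c + L)) * cos (c' + s * x) =
           p * cos (c' + s*x) + (p * cos ((c + c') + (s * x + L)) + p * cos ((c' - c) + (s*x - L))) / 2" for p L x :: real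
        proof -
          have "cos (c + L) * cos (c' + s*x) = (cos ((c + L) - (c' + s*x)) + cos ((c+L) + (c'+s*x)))/2"
            by (rule cos_times_cos)
          also have "cos ((c + L) - (c' + s*x)) = cos ((c'-c) + (s*x - L))"
            by (subst cos_minus[symmetric]) (simp add: algebra_simps)
          finally show ?thesis by (simp add: algebra_simps add_divide_distrib)
        qed
        have sums: "(\<Sum>i\<in>I-S. v1 i * Z i) = s * Z k + (\<Sum>i\<in>I-insert k S. v i * Z i)"
          "(\<Sum>i\<in>I-S. v2 i * Z i) = s * Z k - (\<Sum>i\<in>I-insert k S. v i * Z i)"
          "(\<Sum>i\<in>I-S. v0 i * Z i) = s * Z k" for Z
          unfolding split by (auto simp: v1_def v2_def v0_def sum_negf[symmetric] intro!: sum.cong sum.neutral)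
        have "(\<integral>\<omega>. (\<Prod>i\<in>S. indicator (B i) (U i \<omega>)) * (1 + cos (c + (\<Sum>i\<in>I-insert k S. v i * U i \<omega>))) * cos (c' + s * U k \<omega>) \<partial>M)
          = (\<integral>\<omega>. WM S v0 c' \<omega> + (WM S v1 (c+c') \<omega> + WM S v2 (c'-c) \<omega>)/2 \<partial>M)"
          by (intro Bochner_Integration.integral_cong refl) (simp add: trig WM_def sums)
        also have "\<dots> = (\<integral>\<omega>. WM S v0 c' \<omega> \<partial>M) + ((\<integral>\<omega>. WM S v1 (c+c') \<omega> \<partial>M) + (\<integral>\<omega>. WM S v2 (c'-c) \<omega> \<partial>M))/2"
        proof -
          have "integrable M (WM S v c)" for v c unfolding WM_def
            using mU lU[of "I-S" v] by (intro M.integrable_bounded_mult[where K=1]) (auto simp: pr01 abs_prod)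
          then show ?thesis by simp
        qed
        also have "\<dots> = (\<integral>\<omega>. WN S v0 c' \<omega> \<partial>N) + ((\<integral>\<omega>. WN S v1 (c+c') \<omega> \<partial>N) + (\<integral>\<omega>. WN S v2 (c'-c) \<omega> \<partial>N))/2"
          using insert.IH kS by simp
        also have "\<dots> = (\<integral>\<omega>. WN S v0 c' \<omega> + (WN S v1 (c+c') \<omega> + WN S v2 (c'-c) \<omega>)/2 \<partial>N)"
        proof -
          have "integrable N (WN S v c)" for v c unfolding WN_def
            using mV lV[of "I-S" v] by (intro N.integrable_bounded_mult[where K=1]) (auto simp: pr01 abs_prod)
          then show ?thesis by simp
        qed
        also have "\<dots> = (\<integral>\<omega>. (\<Prod>i\<in>S. indicator (B i) (V i \<omega>)) * (1 + cos (c + (\<Sum>i\<in>I-insert k S. v i * V i \<omega>))) * cos (c' + s * V k \<omega>) \<partial>N)"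
          by (intro Bochner_Integration.integral_cong refl) (simp add: trig WN_def sums)
        finally show "(\<integral>\<omega>. (\<Prod>i\<in>S. indicator (B i) (U i \<omega>)) * (1 + cos (c + (\<Sum>i\<in>I-insert k S. v i * U i \<omega>))) * cos (c' + s * U k \<omega>) \<partial>M) =
          (\<integral>\<omega>. (\<Prod>i\<in>S. indicator (B i) (V i \<omega>)) * (1 + cos (c + (\<Sum>i\<in>I-insert k S. v i * V i \<omega>))) * cos (c' + s * V k \<omega>) \<partial>N)" .
      qed (use assms kS in auto)
      have Mu: "integrable M (WM (insert k S) v c)" for v c unfolding WM_def
          using kS mU lU[of "I-insert k S" v] B[of k]
          by (intro M.integrable_bounded_mult[where K=1]) (auto simp: pr01 abs_prod simp del: prod.insert, auto simp: kS)
      have Mv: "integrable N (WN (insert k S) v c)" for v c unfolding WN_def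
          using kS mV lV[of "I-insert k S" v] B[of k]
          by (intro N.integrable_bounded_mult[where K=1]) (auto simp: pr01 abs_prod simp del: prod.insert, auto simp: kS)
      have eM: "((\<Prod>i\<in>S. indicator (B i) (U i \<omega>)) * (1 + cos (c + (\<Sum>i\<in>I-insert k S. v i * U i \<omega>)))) * indicator (B k) (U k \<omega>)
           = WM (insert k S) (\<lambda>_. 0) 0 \<omega> + WM (insert k S) v c \<omega>" for v c \<omega>
        using kS by (simp add: WM_def algebra_simps)
      have eN: "((\<Prod>i\<in>S. indicator (B i) (V i \<omega>)) * (1 + cos (c + (\<Sum>i\<in>I-insert k S. v i * V i \<omega>)))) * indicator (B k) (V k \<omega>)
           = WN (insert k S) (\<lambda>_. 0) 0 \<omega> + WN (insert k S) v c \<omega>" for v c \<omega>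
        using kS by (simp add: WN_def algebra_simps)
      have *: "(\<integral>\<omega>. WM (insert k S) (\<lambda>_. 0) 0 \<omega> \<partial>M) + (\<integral>\<omega>. WM (insert k S) v c \<omega> \<partial>M)
          = (\<integral>\<omega>. WN (insert k S) (\<lambda>_. 0) 0 \<omega> \<partial>N) + (\<integral>\<omega>. WN (insert k S) v c \<omega> \<partial>N)" for v c
        using key[of c v] Mu Mv by (simp add: eM eN)
      \<comment> \<open>At \<open>v = 0\<close> and \<open>c = 0\<close> the identity
        \<open>*\<close> is twice the constant term, so that term agrees on both sides and cancels
        from the general case.\<close>
      show ?case using *[of "\<lambda>_. 0" 0] * by (metis add_left_cancel field_sum_of_halves mult_2 mult_left_cancel zero_neq_numeral)
    qed
  qed
  from this[OF order_refl] have "(\<integral>\<omega>. WM I (\<lambda>_. 0) 0 \<omega> \<partial>M) = (\<integral>\<omega>. WN I (\<lambda>_. 0) 0 \<omega> \<partial>N)" by blast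
  moreover have "(\<integral>\<omega>. WM I (\<lambda>_. 0) 0 \<omega> \<partial>M) = measure M {\<omega>\<in>space M. \<forall>i\<in>I. U i \<omega> \<in> B i}"
  proof -
    have "(\<integral>\<omega>. WM I (\<lambda>_. 0) 0 \<omega> \<partial>M) = (\<integral>\<omega>. indicator {\<omega>\<in>space M. \<forall>i\<in>I. U i \<omega> \<in> B i} \<omega> \<partial>M)"
      using assms(3) by (intro Bochner_Integration.integral_cong refl) (auto simp: WM_def indicator_def prod.neutral)
    also have "\<dots> = measure M {\<omega>\<in>space M. \<forall>i\<in>I. U i \<omega> \<in> B i}"
      by (simp add: Int_absorb2)
    finally show ?thesis .
  qed
  moreover have "(\<integral>\<omega>. WN I (\<lambda>_. 0) 0 \<omega> \<partial>N) = measure N {\<omega>\<in>space N. \<forall>i\<in>I. V i \<omega> \<in> B i}"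
  proof -
    have "(\<integral>\<omega>. WN I (\<lambda>_. 0) 0 \<omega> \<partial>N) = (\<integral>\<omega>. indicator {\<omega>\<in>space N. \<forall>i\<in>I. V i \<omega> \<in> B i} \<omega> \<partial>N)"
      using assms(3) by (intro Bochner_Integration.integral_cong refl) (auto simp: WN_def indicator_def prod.neutral)
    also have "\<dots> = measure N {\<omega>\<in>space N. \<forall>i\<in>I. V i \<omega> \<in> B i}"
      by (simp add: Int_absorb2)
    finally show ?thesis .
  qed
  ultimately show ?thesis by simp
qed

section \<open>Linear spaces of Gaussian variables\<close>

text \<open>Closure under linear combinations encodes joint normality of every finite family of
  members; no joint density has to exist. With the means equal to zero, all joint laws are
  determined by second moments.\<close>

locale gaussian_space = prob_space M for M :: "'w measure" +
  fixes H :: "('w \<Rightarrow> real) set"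
  assumes zero_mem: "(\<lambda>_. 0) \<in> H"
    and add_mem: "\<And>Y Z. Y \<in> H \<Longrightarrow> Z \<in> H \<Longrightarrow> (\<lambda>\<omega>. Y \<omega> + Z \<omega>) \<in> H"
    and scale_mem: "\<And>c Y. Y \<in> H \<Longrightarrow> (\<lambda>\<omega>. c * Y \<omega>) \<in> H"
    and normal_mem: "\<And>Y. Y \<in> H \<Longrightarrow> normal_rv M Y"
    and mean_mem: "\<And>Y. Y \<in> H \<Longrightarrow> expectation Y = 0"
begin

lemma measurable_mem [measurable_dest]: "Y \<in> H \<Longrightarrow> Y \<in> borel_measurable M"
  using normal_mem by (auto simp: normal_rv_def)

lemma diff_mem: "Y \<in> H \<Longrightarrow> Z \<in> H \<Longrightarrow> (\<lambda>\<omega>. Y \<omega> - Z \<omega>) \<in> H"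
  using add_mem[OF _ scale_mem[of Z "-1"], of Y] by simp

lemma sum_mem: "(\<And>i. i \<in> A \<Longrightarrow> Y i \<in> H) \<Longrightarrow> (\<lambda>\<omega>. \<Sum>i\<in>A. Y i \<omega>) \<in> H"
  by (induction A rule: infinite_finite_induct) (auto intro: zero_mem add_mem)

definition sd :: "('w \<Rightarrow> real) \<Rightarrow> real" where
  "sd Y = sqrt (expectation (\<lambda>\<omega>. (Y \<omega>)\<^sup>2))"

lemma sd_nonneg [simp]: "0 \<le> sd Y"
  by (simp add: sd_def)

lemma sd_sq: "(sd Y)\<^sup>2 = expectation (\<lambda>\<omega>. (Y \<omega>)\<^sup>2)"
  by (simp add: sd_def)

text \<open>Stated so that the degenerate case \<open>sd Y = 0\<close> is included.\<close>

lemma law_mem: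
  assumes Y: "Y \<in> H"
  shows "distr M borel Y = distr std_normal_distribution borel (\<lambda>x. sd Y * x)"
proof -
  interpret N: real_distribution std_normal_distribution by (rule real_dist_normal_dist)
  note [measurable] = measurable_mem[OF Y]
  consider \<mu> \<sigma> where "\<sigma> > 0" "distributed M lborel Y (\<lambda>x. ennreal (normal_density \<mu> \<sigma> x))"
    | \<mu> where "AE \<omega> in M. Y \<omega> = \<mu>"
    using normal_mem[OF Y] by (auto simp: normal_rv_def)
  then show ?thesis
  proof cases
    case (1 \<mu> \<sigma>)
    have mu: "\<mu> = 0" using normal_distributed_expectation[OF 1] mean_mem[OF Y] by simp
    have "expectation (\<lambda>\<omega>. (Y \<omega>)\<^sup>2) = \<sigma>\<^sup>2"
      using normal_distributed_variance[OF 1] mean_mem[OF Y] by simp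
    then have sd: "sd Y = \<sigma>" using 1(1) by (simp add: sd_def)
    have "distributed M lborel (\<lambda>x. (Y x - 0)/\<sigma>) std_normal_density"
      using normal_standard_normal_convert[OF 1(1), of Y 0] 1(2) by (simp add: mu)
    then have "distr M lborel (\<lambda>x. Y x / \<sigma>) = std_normal_distribution"
      by (simp add: distributed_def)
    then have "distr (distr M lborel (\<lambda>x. Y x / \<sigma>)) borel (\<lambda>x. \<sigma> * x) = distr std_normal_distribution borel (\<lambda>x. \<sigma> * x)"
      by simp
    then show ?thesis using 1(1) by (simp add: distr_distr comp_def sd)
  next
    case (2 \<mu>)
    have "expectation Y = \<mu>"
      using integral_cong_AE[of Y M "\<lambda>_. \<mu>"] 2 by (simp add: prob_space)
    then have 0: "AE \<omega> in M. Y \<omega> = 0" using 2 mean_mem[OF Y] by simp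
    have "expectation (\<lambda>\<omega>. (Y \<omega>)\<^sup>2) = expectation (\<lambda>\<omega>. 0)"
      using 0 by (intro integral_cong_AE) auto
    then have "sd Y = 0" by (simp add: sd_def)
    moreover have "distr M borel Y = distr M borel (\<lambda>_. 0)"
      using 0 by (intro distr_cong_AE) auto
    moreover have "distr M borel (\<lambda>_. 0::real) = distr std_normal_distribution borel (\<lambda>_. 0)"
      by (rule measure_eqI) (auto simp: emeasure_distr emeasure_space_1 N.emeasure_space_1 indicator_def vimage_def)
    ultimately show ?thesis by simp
  qed
qed

lemma expectation_mem:
  fixes g :: "real \<Rightarrow> 'b::{banach, second_countable_topology}"
  assumes Y: "Y \<in> H" and [measurable]: "g \<in> borel_measurable borel"
  shows "expectation (\<lambda>\<omega>. g (Y \<omega>)) = (\<integral>x. g (sd Y * x) \<partial>std_normal_distribution)"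
proof -
  note [measurable] = measurable_mem[OF Y]
  have "expectation (\<lambda>\<omega>. g (Y \<omega>)) = (\<integral>x. g x \<partial>distr M borel Y)"
    by (simp add: integral_distr)
  also have "\<dots> = (\<integral>x. g (sd Y * x) \<partial>std_normal_distribution)"
    unfolding law_mem[OF Y] by (simp add: integral_distr)
  finally show ?thesis .
qed

lemma integrable_mem_iff:
  fixes g :: "real \<Rightarrow> 'b::{banach, second_countable_topology}"
  assumes Y: "Y \<in> H" and [measurable]: "g \<in> borel_measurable borel"
  shows "integrable M (\<lambda>\<omega>. g (Y \<omega>)) \<longleftrightarrow> integrable std_normal_distribution (\<lambda>x. g (sd Y * x))"
proof -
  note [measurable] = measurable_mem[OF Y]
  have "integrable M (\<lambda>\<omega>. g (Y \<omega>)) \<longleftrightarrow> integrable (distr M borel Y) g"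
    by (simp add: integrable_distr_eq)
  also have "\<dots> \<longleftrightarrow> integrable std_normal_distribution (\<lambda>x. g (sd Y * x))"
    unfolding law_mem[OF Y] by (simp add: integrable_distr_eq)
  finally show ?thesis .
qed

lemma integrable_power_mem: "Y \<in> H \<Longrightarrow> integrable M (\<lambda>\<omega>. Y \<omega> ^ k)"
  by (subst integrable_mem_iff[of Y "\<lambda>y. y ^ k"])
     (auto simp: power_mult_distrib integrable_std_normal_distribution_moment)

lemma integrable_mem: "Y \<in> H \<Longrightarrow> integrable M Y"
  using integrable_power_mem[of Y 1] by simp

lemma integrable_mult_mem:
  assumes Y: "Y \<in> H" and Z: "Z \<in> H"
  shows "integrable M (\<lambda>\<omega>. Y \<omega> * Z \<omega>)"
proof (rule Bochner_Integration.integrable_bound)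
  show "integrable M (\<lambda>\<omega>. Y \<omega> ^ 2 + Z \<omega> ^ 2)"
    using integrable_power_mem[OF Y, of 2] integrable_power_mem[OF Z, of 2] by simp
  show "AE \<omega> in M. norm (Y \<omega> * Z \<omega>) \<le> norm (Y \<omega> ^ 2 + Z \<omega> ^ 2)"
  proof (rule AE_I2)
    fix \<omega>
    have "2 * \<bar>Y \<omega>\<bar> * \<bar>Z \<omega>\<bar> \<le> Y \<omega> ^ 2 + Z \<omega> ^ 2"
      using sum_squares_bound[of "\<bar>Y \<omega>\<bar>" "\<bar>Z \<omega>\<bar>"] by simp
    moreover have "0 \<le> \<bar>Y \<omega>\<bar> * \<bar>Z \<omega>\<bar>" by simp
    ultimately have "\<bar>Y \<omega>\<bar> * \<bar>Z \<omega>\<bar> \<le> Y \<omega> ^ 2 + Z \<omega> ^ 2" by linarith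
    then show "norm (Y \<omega> * Z \<omega>) \<le> norm (Y \<omega> ^ 2 + Z \<omega> ^ 2)" by (simp add: abs_mult)
  qed
  show "(\<lambda>\<omega>. Y \<omega> * Z \<omega>) \<in> borel_measurable M" using Y Z by measurable
qed

lemma expectation_even_power:
  assumes Y: "Y \<in> H"
  shows "expectation (\<lambda>\<omega>. Y \<omega> ^ (2 * m)) = sd Y ^ (2 * m) * (fact (2 * m) / (2 ^ m * fact m))"
  by (subst expectation_mem[of Y "\<lambda>y. y ^ (2*m)", OF Y])
     (auto simp: power_mult_distrib std_normal_distribution_even_moments)

lemma expectation_cos:
  assumes Y: "Y \<in> H"
  shows "expectation (\<lambda>\<omega>. cos (c + Y \<omega>)) = cos c * exp (- (sd Y)\<^sup>2 / 2)"
proof -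
  interpret N: real_distribution std_normal_distribution by (rule real_dist_normal_dist)
  let ?e = "\<lambda>x. iexp (sd Y * x) :: complex"
  have i: "integrable std_normal_distribution ?e"
    by (rule N.integrable_const_bound[where B=1]) (auto simp: norm_exp_i_times)
  have ch: "(\<integral>x. ?e x \<partial>std_normal_distribution) = complex_of_real (exp (- (sd Y)\<^sup>2 / 2))"
    using fun_cong[OF char_std_normal_distribution, of "sd Y"] by (simp add: char_def)
  have "(\<integral>x. Re (?e x) \<partial>std_normal_distribution) = exp (- (sd Y)\<^sup>2 / 2)"
    "(\<integral>x. Im (?e x) \<partial>std_normal_distribution) = 0"
    using integral_Re[OF i] integral_Im[OF i] unfolding ch by simp_all
  then have cs: "(\<integral>x. cos (sd Y * x) \<partial>std_normal_distribution) = exp (- (sd Y)\<^sup>2 / 2)"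
    "(\<integral>x. sin (sd Y * x) \<partial>std_normal_distribution) = 0"
    by (simp_all add: Re_exp Im_exp)
  have "expectation (\<lambda>\<omega>. cos (c + Y \<omega>)) = (\<integral>x. cos c * cos (sd Y * x) - sin c * sin (sd Y * x) \<partial>std_normal_distribution)"
    by (subst expectation_mem[of Y "\<lambda>y. cos (c + y)", OF Y]) (auto simp: cos_add)
  also have "\<dots> = cos c * exp (- (sd Y)\<^sup>2 / 2)"
    by (subst Bochner_Integration.integral_diff)
       (auto simp: cs intro!: N.integrable_const_bound[where B=1] integrable_mult_right)
  finally show ?thesis .
qed

text \<open>Half of the exponent \<open>x^2 / 2\<close> pays for the tail factor. The other half is,
  up to the factor \<open>sqrt 2\<close>, the normal density of variance 2, whose integral is 1. The
  bound \<open>s\<close> in place of \<open>sd Y\<close> admits degenerate variables.\<close>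

lemma tail_mem:
  assumes Y: "Y \<in> H" and s: "sd Y \<le> s" "0 < s" and t: "0 \<le> t"
  shows "prob {\<omega>\<in>space M. \<bar>Y \<omega>\<bar> > t} \<le> sqrt 2 * exp (- t\<^sup>2 / (4 * s\<^sup>2))"
proof -
  note [measurable] = measurable_mem[OF Y]
  interpret N: real_distribution std_normal_distribution by (rule real_dist_normal_dist)
  interpret N2: prob_space "density lborel (normal_density 0 (sqrt 2))"
    by (rule prob_space_normal_density) simp
  have le: "std_normal_density x * indicator {x. \<bar>sd Y * x\<bar> > t} x
      \<le> sqrt 2 * exp (- t\<^sup>2 / (4 * s\<^sup>2)) * normal_density 0 (sqrt 2) x" for x
  proof (cases "\<bar>sd Y * x\<bar> > t")
    case True
    have "t < sd Y * \<bar>x\<bar>" using True by (simp add: abs_mult)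
    also have "\<dots> \<le> s * \<bar>x\<bar>" using s by (intro mult_right_mono) auto
    finally have "t / s < \<bar>x\<bar>" using s by (simp add: field_simps)
    then have "(t/s)\<^sup>2 \<le> x\<^sup>2" using t s by (metis abs_le_square_iff abs_of_nonneg divide_nonneg_pos less_imp_le)
    then have "exp (- (x\<^sup>2 / 4)) \<le> exp (- t\<^sup>2 / (4 * s\<^sup>2))" by (simp add: power_divide)
    then have "exp (- (x\<^sup>2 / 4)) * exp (- (x\<^sup>2 / 4)) / (sqrt 2 * sqrt pi) \<le> exp (- t\<^sup>2 / (4 * s\<^sup>2)) * exp (- (x\<^sup>2 / 4)) / (sqrt 2 * sqrt pi)"
      by (intro divide_right_mono mult_right_mono) auto
    moreover have "exp (- (x\<^sup>2 / 2)) = exp (- (x\<^sup>2 / 4)) * exp (- (x\<^sup>2 / 4))"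
      by (simp add: mult_exp_exp)
    ultimately have "std_normal_density x \<le> exp (- t\<^sup>2 / (4 * s\<^sup>2)) * exp (- (x\<^sup>2 / 4)) / (sqrt 2 * sqrt pi)"
      by (simp add: std_normal_density_def real_sqrt_mult)
    also have "\<dots> = sqrt 2 * exp (- t\<^sup>2 / (4 * s\<^sup>2)) * normal_density 0 (sqrt 2) x"
      by (simp add: normal_density_def real_sqrt_mult field_simps)
    finally show ?thesis using True by simp
  qed (simp add: normal_density_nonneg)
  have "prob {\<omega>\<in>space M. \<bar>Y \<omega>\<bar> > t} = expectation (\<lambda>\<omega>. indicat_real {y. \<bar>y\<bar> > t} (Y \<omega>))"
  proof -
    have "expectation (\<lambda>\<omega>. indicat_real {y. \<bar>y\<bar> > t} (Y \<omega>)) = expectation (indicat_real {\<omega>\<in>space M. \<bar>Y \<omega>\<bar> > t})"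
      by (intro Bochner_Integration.integral_cong) (auto simp: indicator_def)
    then show ?thesis by (simp add: Int_absorb2)
  qed
  also have "\<dots> = (\<integral>x. indicator {x. \<bar>sd Y * x\<bar> > t} x \<partial>std_normal_distribution)"
    by (subst expectation_mem[OF Y], simp, rule Bochner_Integration.integral_cong) (simp_all add: indicator_def)
  also have "\<dots> = (\<integral>x. std_normal_density x * indicator {x. \<bar>sd Y * x\<bar> > t} x \<partial>lborel)"
    by (subst integral_density) auto
  also have "\<dots> \<le> (\<integral>x. sqrt 2 * exp (- t\<^sup>2 / (4 * s\<^sup>2)) * normal_density 0 (sqrt 2) x \<partial>lborel)"
    using le by (intro integral_mono) (auto intro!: integrable_real_mult_indicator)
  finally show ?thesis by simp
qed

lemma sd_scale: "sd (\<lambda>\<omega>. c * Y \<omega>) = \<bar>c\<bar> * sd Y"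
  by (simp add: sd_def power_mult_distrib real_sqrt_mult)

lemma sd_sq_add:
  assumes Y: "Y \<in> H" and Z: "Z \<in> H"
  shows "(sd (\<lambda>\<omega>. Y \<omega> + Z \<omega>))\<^sup>2 = (sd Y)\<^sup>2 + (sd Z)\<^sup>2 + 2 * expectation (\<lambda>\<omega>. Y \<omega> * Z \<omega>)"
proof -
  have "expectation (\<lambda>\<omega>. (Y \<omega> + Z \<omega>)\<^sup>2) = expectation (\<lambda>\<omega>. (Y \<omega>)\<^sup>2 + (Z \<omega>)\<^sup>2 + 2 * (Y \<omega> * Z \<omega>))"
    by (simp add: power2_sum algebra_simps)
  also have "\<dots> = expectation (\<lambda>\<omega>. (Y \<omega>)\<^sup>2) + expectation (\<lambda>\<omega>. (Z \<omega>)\<^sup>2) + 2 * expectation (\<lambda>\<omega>. Y \<omega> * Z \<omega>)"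
    using integrable_power_mem[OF Y, of 2] integrable_power_mem[OF Z, of 2] integrable_mult_mem[OF Y Z]
    by simp
  finally show ?thesis by (simp add: sd_sq)
qed

lemma Cauchy_Schwarz_mem:
  assumes Y: "Y \<in> H" and Z: "Z \<in> H"
  shows "\<bar>expectation (\<lambda>\<omega>. Y \<omega> * Z \<omega>)\<bar> \<le> sd Y * sd Z"
proof -
  define e where "e = expectation (\<lambda>\<omega>. Y \<omega> * Z \<omega>)"
  have q: "0 \<le> (sd Y)\<^sup>2 + c\<^sup>2 * (sd Z)\<^sup>2 + 2 * c * e" for c
  proof -
    have "0 \<le> (sd (\<lambda>\<omega>. Y \<omega> + c * Z \<omega>))\<^sup>2" by simp
    also have "\<dots> = (sd Y)\<^sup>2 + (sd (\<lambda>\<omega>. c * Z \<omega>))\<^sup>2 + 2 * expectation (\<lambda>\<omega>. c * (Y \<omega> * Z \<omega>))"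
      using sd_sq_add[OF Y scale_mem[OF Z, of c]] by (simp add: algebra_simps)
    finally show ?thesis by (simp add: sd_scale power_mult_distrib e_def)
  qed
  have "e\<^sup>2 \<le> (sd Y)\<^sup>2 * (sd Z)\<^sup>2"
  proof (cases "sd Z = 0")
    case True
    have "e = 0"
    proof (rule ccontr)
      assume "e \<noteq> 0"
      \<comment> \<open>With \<open>sd Z = 0\<close> the quadratic is affine in \<open>c\<close>,
        and at this value it equals -1.\<close>
      then show False using q[of "- ((sd Y)\<^sup>2 + 1) / (2 * e)"] True by (simp add: field_simps)
    qed
    then show ?thesis by simp
  next
    case False
    define D where "D = (sd Z)\<^sup>2"
    have D: "D > 0" using False by (simp add: D_def)
    have "(- e / D)\<^sup>2 * D + 2 * (- e / D) * e = - (e\<^sup>2 / D)"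
      using D by (simp add: field_simps power2_eq_square)
    then have "0 \<le> (sd Y)\<^sup>2 - e\<^sup>2 / D"
      using q[of "- e / D"] unfolding D_def[symmetric] by linarith
    then show ?thesis using D unfolding D_def[symmetric] by (simp add: field_simps)
  qed
  then have "e\<^sup>2 \<le> (sd Y * sd Z)\<^sup>2" by (simp add: power_mult_distrib)
  then have "\<bar>e\<bar> \<le> \<bar>sd Y * sd Z\<bar>" by (simp only: abs_le_square_iff)
  then show ?thesis by (simp add: e_def abs_mult)
qed

lemma sd_add_le:
  assumes Y: "Y \<in> H" and Z: "Z \<in> H"
  shows "sd (\<lambda>\<omega>. Y \<omega> + Z \<omega>) \<le> sd Y + sd Z"
proof -
  have "(sd (\<lambda>\<omega>. Y \<omega> + Z \<omega>))\<^sup>2 \<le> (sd Y + sd Z)\<^sup>2"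
    using Cauchy_Schwarz_mem[OF Y Z] by (simp add: sd_sq_add[OF Y Z] power2_sum)
  then show ?thesis by (rule power2_le_imp_le) simp
qed

section \<open>Orthogonality and independence\<close>

definition gen :: "('w \<Rightarrow> real) set \<Rightarrow> 'w measure" where
  "gen K = sigma (space M) {Y -` B \<inter> space M | Y B. Y \<in> K \<and> B \<in> sets borel}"

lemma space_gen [simp]: "space (gen K) = space M"
  unfolding gen_def by (rule space_measure_of) auto

lemma sets_gen: "sets (gen K) = sigma_sets (space M) {Y -` B \<inter> space M | Y B. Y \<in> K \<and> B \<in> sets borel}"
  unfolding gen_def by (rule sets_measure_of) auto

lemma measurable_gen: "Y \<in> K \<Longrightarrow> Y \<in> borel_measurable (gen K)"
  by (rule measurableI) (auto simp: sets_gen intro!: sigma_sets.Basic)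

lemma gen_mono: "K \<subseteq> L \<Longrightarrow> sets (gen K) \<subseteq> sets (gen L)"
  unfolding sets_gen by (intro sigma_sets_mono') auto

lemma gen_sub:
  assumes "K \<subseteq> H"
  shows "sets (gen K) \<subseteq> events"
  unfolding sets_gen
  by (intro sets.sigma_sets_subset) (use assms in auto)

text \<open>Orthogonality makes variances of sums add, so expectations of cosines of the joint
  family are those of independent copies on the product space. By
  \<open>Cramer_Wold_rectangles\<close> the two laws agree on rectangles, which form an
  intersection-stable generator.\<close>

lemma indep_gen:
  assumes K: "K \<subseteq> H" and L: "L \<subseteq> H"
    and orth: "\<And>Y Z. Y \<in> K \<Longrightarrow> Z \<in> L \<Longrightarrow> expectation (\<lambda>\<omega>. Y \<omega> * Z \<omega>) = 0"
  shows "indep_set (sets (gen K)) (sets (gen L))"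
proof -
  define rect where "rect K = {{\<omega>\<in>space M. \<forall>Y\<in>S. Y \<omega> \<in> B Y} | S B.
       finite S \<and> S \<subseteq> K \<and> (\<forall>Y\<in>S. B Y \<in> sets borel)}" for K :: "('w \<Rightarrow> real) set"
  have Int_rect: "Int_stable (rect K)" for K
  proof (rule Int_stableI)
    fix a b assume "a \<in> rect K" "b \<in> rect K"
    then obtain S B T C where a: "a = {\<omega>\<in>space M. \<forall>Y\<in>S. Y \<omega> \<in> B Y}" "finite S" "S \<subseteq> K" "\<forall>Y\<in>S. B Y \<in> sets borel"
      and b: "b = {\<omega>\<in>space M. \<forall>Y\<in>T. Y \<omega> \<in> C Y}" "finite T" "T \<subseteq> K" "\<forall>Y\<in>T. C Y \<in> sets borel"
      unfolding rect_def by auto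
    define D where "D Y = (if Y \<in> S then B Y else UNIV) \<inter> (if Y \<in> T then C Y else UNIV)" for Y
    have "a \<inter> b = {\<omega>\<in>space M. \<forall>Y\<in>S\<union>T. Y \<omega> \<in> D Y}" unfolding a(1) b(1) D_def by auto
    moreover have "finite (S \<union> T)" "S \<union> T \<subseteq> K" "\<forall>Y\<in>S\<union>T. D Y \<in> sets borel"
      using a b by (auto simp: D_def)
    ultimately show "a \<inter> b \<in> rect K" unfolding rect_def by blast
  qed
  have rect_meas: "{\<omega>\<in>space M. \<forall>Y\<in>S. Y \<omega> \<in> B Y} \<in> sets (gen K)"
    if "finite S" "S \<subseteq> K" "\<forall>Y\<in>S. B Y \<in> sets borel" for S B K
  proof -
    have "{\<omega>\<in>space (gen K). \<forall>Y\<in>S. Y \<omega> \<in> B Y} \<in> sets (gen K)"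
      using that by (intro sets.sets_Collect_finite_All measurable_sets_Collect[OF measurable_gen]) auto
    then show ?thesis by simp
  qed
  have gen_rect: "sets (gen K) = sigma_sets (space M) (rect K)" for K
  proof
    show "sigma_sets (space M) (rect K) \<subseteq> sets (gen K)"
      using rect_meas[of _ K] sets.sigma_sets_subset[of "rect K" "gen K"] by (auto simp: rect_def)
    have "{Y -` B \<inter> space M | Y B. Y \<in> K \<and> B \<in> sets borel} \<subseteq> rect K"
    proof clarify
      fix Y B assume "Y \<in> K" "B \<in> sets (borel :: real measure)"
      then show "Y -` B \<inter> space M \<in> rect K" unfolding rect_def
        by (intro CollectI exI[of _ "{Y}"] exI[of _ "\<lambda>_. B"]) auto
    qed
    then show "sets (gen K) \<subseteq> sigma_sets (space M) (rect K)"
      unfolding sets_gen by (rule sigma_sets_mono')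
  qed
  have "indep_set (rect K) (rect L)"
    proof (rule indep_setI)
    show "rect K \<subseteq> events" "rect L \<subseteq> events"
      using rect_meas[of _ K] rect_meas[of _ L] gen_sub[OF K] gen_sub[OF L] by (auto simp: rect_def)
    fix A1 A2 assume A12: "A1 \<in> rect K" "A2 \<in> rect L"
    show "prob (A1 \<inter> A2) = prob A1 * prob A2"
    proof -
      from A12 obtain S B T C where a: "A1 = {\<omega>\<in>space M. \<forall>Y\<in>S. Y \<omega> \<in> B Y}" "finite S" "S \<subseteq> K" "\<forall>Y\<in>S. B Y \<in> sets borel"
        and b: "A2 = {\<omega>\<in>space M. \<forall>Y\<in>T. Y \<omega> \<in> C Y}" "finite T" "T \<subseteq> L" "\<forall>Y\<in>T. C Y \<in> sets borel"
        unfolding rect_def by auto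
      have SH: "S \<subseteq> H" and TH: "T \<subseteq> H" using a b K L by auto
      interpret P: pair_prob_space M M ..
      let ?N = "M \<Otimes>\<^sub>M M"
      let ?I = "S <+> T"
      \<comment> \<open>Left summands are read on the first factor of the product space and right
        summands on the second, which is independence by construction.\<close>
      let ?U = "\<lambda>i \<omega>. case i of Inl Y \<Rightarrow> Y \<omega> | Inr Y \<Rightarrow> Y \<omega>"
      let ?V = "\<lambda>i \<omega>. case i of Inl Y \<Rightarrow> Y (fst \<omega>) | Inr Y \<Rightarrow> Y (snd \<omega>)"
      let ?B = "\<lambda>i. case i of Inl Y \<Rightarrow> B Y | Inr Y \<Rightarrow> C Y"
      have "measure M {\<omega>\<in>space M. \<forall>i\<in>?I. ?U i \<omega> \<in> ?B i} = measure ?N {\<omega>\<in>space ?N. \<forall>i\<in>?I. ?V i \<omega> \<in> ?B i}"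
      proof (rule Cramer_Wold_rectangles)
        show "prob_space M" "prob_space ?N" by unfold_locales
        show "finite ?I" using a b by simp
        show "?U i \<in> borel_measurable M" if "i \<in> ?I" for i
          using that SH TH by (auto intro: measurable_mem)
        show "?V i \<in> borel_measurable ?N" if "i \<in> ?I" for i
          using that SH TH by (auto intro!: measurable_compose[OF measurable_fst] measurable_compose[OF measurable_snd] measurable_mem)
        show "?B i \<in> sets borel" if "i \<in> ?I" for i using that a b by auto
        fix v :: "('w \<Rightarrow> real) + ('w \<Rightarrow> real) \<Rightarrow> real" and c
        define Y where "Y = (\<lambda>\<omega>. \<Sum>y\<in>S. v (Inl y) * y \<omega>)"
        define Z where "Z = (\<lambda>\<omega>. \<Sum>y\<in>T. v (Inr y) * y \<omega>)"
        have YH: "Y \<in> H" and ZH: "Z \<in> H" unfolding Y_def Z_def using SH TH by (auto intro!: sum_mem scale_mem)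
        note [measurable] = measurable_mem[OF YH] measurable_mem[OF ZH]
        have YZ0: "expectation (\<lambda>\<omega>. Y \<omega> * Z \<omega>) = 0"
        proof -
          have I: "integrable M (\<lambda>\<omega>. (v (Inl y) * v (Inr z)) * (y \<omega> * z \<omega>))" if "y \<in> S" "z \<in> T" for y z
            using that SH TH by (auto intro!: integrable_mult_mem integrable_mult_right)
          have "expectation (\<lambda>\<omega>. Y \<omega> * Z \<omega>) = expectation (\<lambda>\<omega>. \<Sum>y\<in>S. \<Sum>z\<in>T. (v (Inl y) * v (Inr z)) * (y \<omega> * z \<omega>))"
            unfolding Y_def Z_def sum_product by (intro Bochner_Integration.integral_cong refl sum.cong) auto
          also have "\<dots> = (\<Sum>y\<in>S. expectation (\<lambda>\<omega>. \<Sum>z\<in>T. (v (Inl y) * v (Inr z)) * (y \<omega> * z \<omega>)))"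
            by (intro Bochner_Integration.integral_sum Bochner_Integration.integrable_sum I)
          also have "\<dots> = (\<Sum>y\<in>S. \<Sum>z\<in>T. expectation (\<lambda>\<omega>. (v (Inl y) * v (Inr z)) * (y \<omega> * z \<omega>)))"
            by (intro sum.cong refl Bochner_Integration.integral_sum I)
          also have "\<dots> = (\<Sum>y\<in>S. \<Sum>z\<in>T. (v (Inl y) * v (Inr z)) * expectation (\<lambda>\<omega>. y \<omega> * z \<omega>))"
            by simp
          also have "\<dots> = 0" using orth[OF subsetD[OF a(3)] subsetD[OF b(3)]] by simp
          finally show ?thesis .
        qed
        have "expectation (\<lambda>\<omega>. cos (c + (\<Sum>i\<in>?I. v i * ?U i \<omega>))) = expectation (\<lambda>\<omega>. cos (c + (Y \<omega> + Z \<omega>)))"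
          using a b by (simp add: sum.Plus Y_def Z_def)
        also have "\<dots> = cos c * exp (- (sd Y)\<^sup>2 / 2) * exp (- (sd Z)\<^sup>2 / 2)"
          by (subst expectation_cos[OF add_mem[OF YH ZH]])
             (simp add: sd_sq_add[OF YH ZH] YZ0 mult_exp_exp add_divide_distrib)
        also have "\<dots> = expectation (\<lambda>y. cos (c + Y y) * exp (- (sd Z)\<^sup>2 / 2))"
          by (simp add: expectation_cos[OF YH])
        also have "\<dots> = expectation (\<lambda>y. expectation (\<lambda>z. cos ((c + Y y) + Z z)))"
          by (simp add: expectation_cos[OF ZH])
        also have "\<dots> = (\<integral>\<omega>. cos (c + Y (fst \<omega>) + Z (snd \<omega>)) \<partial>?N)"
          by (subst P.integral_fst'[symmetric]) (auto intro!: P.P.integrable_const_bound[where B=1])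
        also have "\<dots> = (\<integral>\<omega>. cos (c + (\<Sum>i\<in>?I. v i * ?V i \<omega>)) \<partial>?N)"
          using a b by (simp add: sum.Plus Y_def Z_def add.assoc)
        finally show "expectation (\<lambda>\<omega>. cos (c + (\<Sum>i\<in>?I. v i * ?U i \<omega>))) = (\<integral>\<omega>. cos (c + (\<Sum>i\<in>?I. v i * ?V i \<omega>)) \<partial>?N)" .
      qed
      moreover have "{\<omega>\<in>space M. \<forall>i\<in>?I. ?U i \<omega> \<in> ?B i} = A1 \<inter> A2"
        unfolding a(1) b(1) Plus_def by (auto simp: ball_Un)
      moreover have "{\<omega>\<in>space ?N. \<forall>i\<in>?I. ?V i \<omega> \<in> ?B i} = A1 \<times> A2"
        unfolding a(1) b(1) Plus_def by (auto simp: ball_Un space_pair_measure)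
      moreover have "A1 \<in> events" "A2 \<in> events"
        using rect_meas[OF a(2-4)] rect_meas[OF b(2-4)] gen_sub[OF K] gen_sub[OF L] a(1) b(1) by auto
      then have "measure ?N (A1 \<times> A2) = prob (A1) * prob (A2)"
        by (simp add: measure_def emeasure_pair_measure_Times enn2real_mult)
      ultimately show ?thesis by simp
    qed
  qed
  then show ?thesis
    unfolding gen_rect using Int_rect by (intro indep_set_sigma_sets)
qed

lemma prob_indep_gen:
  assumes "K \<subseteq> H" "L \<subseteq> H"
    and "\<And>Y Z. Y \<in> K \<Longrightarrow> Z \<in> L \<Longrightarrow> expectation (\<lambda>\<omega>. Y \<omega> * Z \<omega>) = 0"
    and "A \<in> sets (gen K)" "B \<in> sets (gen L)"
  shows "prob (A \<inter> B) = prob A * prob B"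
  using indep_setD[OF indep_gen[OF assms(1-3)] assms(4,5)] .

text \<open>Rotating two independent copies by 45 degrees preserves a centered Gaussian law. In
  \<open>small_ball\<close> this converts closeness of two copies into smallness of one.\<close>

lemma prob_symmetrize:
  assumes fin: "finite I" and Y: "\<And>i. i \<in> I \<Longrightarrow> Y i \<in> H"
    and B: "\<And>i. i \<in> I \<Longrightarrow> B i \<in> sets borel"
  shows "prob {\<omega>\<in>space M. \<forall>i\<in>I. Y i \<omega> \<in> B i} =
    measure (M \<Otimes>\<^sub>M M) {\<omega>\<in>space (M \<Otimes>\<^sub>M M). \<forall>i\<in>I. (Y i (fst \<omega>) - Y i (snd \<omega>)) / sqrt 2 \<in> B i}"
proof (rule Cramer_Wold_rectangles)
  interpret P: pair_prob_space M M ..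
  let ?N = "M \<Otimes>\<^sub>M M"
  show "prob_space M" "prob_space ?N" by unfold_locales
  show "(\<lambda>\<omega>. (Y i (fst \<omega>) - Y i (snd \<omega>)) / sqrt 2) \<in> borel_measurable ?N" if "i \<in> I" for i
  proof -
    note [measurable] = measurable_mem[OF Y[OF that]]
    show ?thesis by measurable
  qed
  fix v c
  define Z where "Z = (\<lambda>\<omega>. \<Sum>i\<in>I. v i * Y i \<omega>)"
  have ZH: "Z \<in> H" unfolding Z_def by (intro sum_mem scale_mem Y)
  note [measurable] = measurable_mem[OF ZH]
  have c1: "expectation (\<lambda>y. cos (c + r * Z y)) = cos c * exp (- (r\<^sup>2 * (sd Z)\<^sup>2) / 2)" for c r
    using expectation_cos[OF scale_mem[OF ZH, of r], of c] by (simp add: sd_scale power_mult_distrib)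
  have "expectation (\<lambda>\<omega>. cos (c + (\<Sum>i\<in>I. v i * Y i \<omega>))) = cos c * exp (- (sd Z)\<^sup>2 / 2)"
    using c1[of c 1] by (simp add: Z_def)
  also have "\<dots> = cos c * exp (- (sd Z)\<^sup>2 / 4) * exp (- (sd Z)\<^sup>2 / 4)"
    by (simp add: mult_exp_exp)
  also have "\<dots> = expectation (\<lambda>y. cos (c + (1 / sqrt 2) * Z y) * exp (- (sd Z)\<^sup>2 / 4))"
    using c1[of c "1 / sqrt 2"] by (simp add: power_divide)
  also have "\<dots> = expectation (\<lambda>y. expectation (\<lambda>z. cos ((c + (1 / sqrt 2) * Z y) + (- 1 / sqrt 2) * Z z)))"
    by (subst c1) (simp add: power_divide)
  also have "\<dots> = (\<integral>\<omega>. cos (c + (1 / sqrt 2) * Z (fst \<omega>) + (- 1 / sqrt 2) * Z (snd \<omega>)) \<partial>?N)"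
    by (subst P.integral_fst'[symmetric]) (auto intro!: P.P.integrable_const_bound[where B=1])
  also have "\<dots> = (\<integral>\<omega>. cos (c + (\<Sum>i\<in>I. v i * ((Y i (fst \<omega>) - Y i (snd \<omega>)) / sqrt 2))) \<partial>?N)"
  proof -
    have "(\<Sum>i\<in>I. v i * ((Y i a - Y i b) / sqrt 2)) = (Z a - Z b) / sqrt 2" for a b
      unfolding Z_def sum_subtractf[symmetric] sum_divide_distrib
      by (intro sum.cong refl) (simp add: algebra_simps)
    then have "c + (1 / sqrt 2) * Z a + (- 1 / sqrt 2) * Z b = c + (\<Sum>i\<in>I. v i * ((Y i a - Y i b) / sqrt 2))" for a b
      by (simp add: diff_divide_distrib)
    then show ?thesis by presburger
  qed
  finally show "expectation (\<lambda>\<omega>. cos (c + (\<Sum>i\<in>I. v i * Y i \<omega>))) =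
      (\<integral>\<omega>. cos (c + (\<Sum>i\<in>I. v i * ((Y i (fst \<omega>) - Y i (snd \<omega>)) / sqrt 2))) \<partial>?N)" .
qed (use fin Y B measurable_mem in auto)

end

section \<open>Small balls by entropy coding\<close>

text \<open>A prior on the integers: its negative logarithm is an idealized code length, and total
  mass at most 1 is Kraft's inequality. The mass \<open>\<delta>\<close> is reserved for nonzero
  values; the divisor 4 gives each sign at most \<open>\<delta> / 2\<close>, because the inverse
  squares sum to at most 2.\<close>

definition code_weight :: "real \<Rightarrow> int \<Rightarrow> real" where
  "code_weight \<delta> k = (if k = 0 then 1 - \<delta> else \<delta> / (4 * (real_of_int k)\<^sup>2))"

lemma sum_inverse_squares_le: "(\<Sum>k=1..n. 1 / (real k)\<^sup>2) \<le> 2"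
proof (cases "n \<ge> 1")
  case True
  then have "(\<Sum>k=1..n. 1 / (real k)\<^sup>2) \<le> 2 - 1 / real n"
  proof (induction n rule: dec_induct)
    case (step n)
    have "1 / (real (Suc n))\<^sup>2 \<le> 1 / (real n * real (Suc n))"
      using step(1) by (intro divide_left_mono) (auto simp: power2_eq_square)
    also have "\<dots> = 1 / real n - 1 / real (Suc n)" using step(1) by (simp add: field_simps)
    finally have "1 / (real (Suc n))\<^sup>2 \<le> 1 / real n - 1 / real (Suc n)" .
    then show ?case using step by simp
  qed simp
  also have "\<dots> \<le> 2" by simp
  finally show ?thesis .
qed simp

lemma sum_code_weight_le_1:
  assumes "0 \<le> \<delta>" "\<delta> \<le> 1" "finite F"
  shows "(\<Sum>k\<in>F. code_weight \<delta> k) \<le> 1"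
proof -
  define n where "n = nat (Max (insert 0 (abs ` F)))"
  have "F \<subseteq> {-int n..int n}"
  proof
    fix k assume "k \<in> F"
    then have "\<bar>k\<bar> \<le> int n" unfolding n_def using assms(3) by (auto intro!: Max_ge)
    then show "k \<in> {-int n..int n}" by auto
  qed
  then have "(\<Sum>k\<in>F. code_weight \<delta> k) \<le> (\<Sum>k\<in>{-int n..int n}. code_weight \<delta> k)"
    using assms by (intro sum_mono2) (auto simp: code_weight_def)
  also have "{-int n..int n} = insert 0 (int ` {1..n} \<union> (\<lambda>k. - int k) ` {1..n})"
  proof (intro set_eqI iffI)
    fix k assume k: "k \<in> {-int n..int n}"
    show "k \<in> insert 0 (int ` {1..n} \<union> (\<lambda>k. - int k) ` {1..n})"
    proof (cases "k > 0")
      case True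
      then have "k = int (nat k)" "nat k \<in> {1..n}" using k by auto
      then show ?thesis by blast
    next
      case False
      then have "k = 0 \<or> k = - int (nat (-k)) \<and> nat (-k) \<in> {1..n}" using k by auto
      then show ?thesis by blast
    qed
  qed auto
  also have "(\<Sum>k\<in>\<dots>. code_weight \<delta> k) = (1 - \<delta>) + ((\<Sum>k\<in>int ` {1..n}. code_weight \<delta> k) + (\<Sum>k\<in>(\<lambda>k. - int k) ` {1..n}. code_weight \<delta> k))"
    by (subst sum.insert) (auto simp: code_weight_def intro!: sum.union_disjoint)
  also have "(\<Sum>k\<in>int ` {1..n}. code_weight \<delta> k) = \<delta> / 4 * (\<Sum>k=1..n. 1 / (real k)\<^sup>2)"
    by (subst sum.reindex) (auto simp: inj_on_def code_weight_def sum_distrib_left intro!: sum.cong)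
  also have "(\<Sum>k\<in>(\<lambda>k. - int k) ` {1..n}. code_weight \<delta> k) = \<delta> / 4 * (\<Sum>k=1..n. 1 / (real k)\<^sup>2)"
    by (subst sum.reindex) (auto simp: inj_on_def code_weight_def sum_distrib_left intro!: sum.cong)
  also have "(1 - \<delta>) + (\<delta> / 4 * (\<Sum>k=1..n. 1 / (real k)\<^sup>2) + \<delta> / 4 * (\<Sum>k=1..n. 1 / (real k)\<^sup>2)) \<le> (1 - \<delta>) + (\<delta> / 4 * 2 + \<delta> / 4 * 2)"
  proof -
    have "\<delta> / 4 * (\<Sum>k=1..n. 1 / (real k)\<^sup>2) \<le> \<delta> / 4 * 2" using assms sum_inverse_squares_le by (intro mult_left_mono) auto
    then show ?thesis by linarith
  qed
  finally show ?thesis by simp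
qed

text \<open>The exponent serves \<open>small_ball_box\<close>: for \<open>i \<le> J\<close> the
  ratio of deviation to precision there is \<open>2 powr (3/2 * (J - i))\<close>. Its cube root
  \<open>2 powr ((J - i) / 2)\<close> grows more slowly than the number of links shrinks as
  \<open>i\<close> moves down from \<open>J\<close>.\<close>

lemma ln_le_cube_root: "1 \<le> x \<Longrightarrow> ln x \<le> 3 * x powr (1/3)" for x :: real
  using ln_add_one_self_le_self[of "x powr (1/3) - 1"] ln_powr[of x "1/3"]
  by (auto simp: ge_one_powr_ge_zero)

lemma cube_root_le: "0 \<le> y \<Longrightarrow> y powr (1/3) \<le> 1 + y\<^sup>2" for y :: real
proof (cases "y \<le> 1")
  case True
  assume "0 \<le> y"
  then have "y powr (1/3) \<le> 1" using True by (simp add: powr_le1)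
  then show ?thesis by (simp add: add_increasing2)
next
  case False
  then have "y powr (1/3) \<le> y powr 2" by (intro powr_mono) auto
  then show ?thesis using False by simp
qed

lemma abs_round_half_le:
  fixes x :: real
  assumes "round x \<noteq> 0"
  shows "\<bar>real_of_int (round x)\<bar> \<le> 2 * \<bar>x\<bar>" "1 \<le> 2 * \<bar>x\<bar>"
proof -
  have "\<bar>real_of_int (round x) - x\<bar> \<le> 1/2" using of_int_round_abs_le by blast
  moreover have "1 \<le> \<bar>real_of_int (round x)\<bar>" using assms by linarith
  ultimately show "\<bar>real_of_int (round x)\<bar> \<le> 2 * \<bar>x\<bar>" "1 \<le> 2 * \<bar>x\<bar>" by linarith+
qed

lemma measurable_round [measurable]: "(round :: real \<Rightarrow> int) \<in> measurable borel (count_space UNIV)"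
  unfolding round_def by measurable

text \<open>The cost of encoding a coordinate whose ratio of standard deviation to precision is \<open>r\<close>.\<close>

definition code_const :: "nat \<Rightarrow> real" where
  "code_const l = 1 + 2 ^ (2 * l + 2) * (fact (2 * (l + 1)) / (2 ^ (l + 1) * fact (l + 1))) * (3 + 2 * real l)
    + 2 * 2 ^ (2 * l + 4) * (fact (2 * (l + 2)) / (2 ^ (l + 2) * fact (l + 2)))"

definition code_cost :: "nat \<Rightarrow> real \<Rightarrow> real" where
  "code_cost l r = (if 1 \<le> r then 33 * r powr (1/3) else code_const l * r ^ (2 * l))"

lemma code_const_ge_1: "1 \<le> code_const l"
  unfolding code_const_def by (simp add: add_increasing2)

lemma code_cost_pos: "0 < r \<Longrightarrow> 0 < code_cost l r"
  using code_const_ge_1[of l] by (simp add: code_cost_def)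

context gaussian_space
begin

lemma expectation_even_power_le:
  assumes Y: "Y \<in> H" and s: "sd Y \<le> s"
  shows "expectation (\<lambda>\<omega>. Y \<omega> ^ (2 * m)) \<le> s ^ (2 * m) * (fact (2 * m) / (2 ^ m * fact m))"
  unfolding expectation_even_power[OF Y] using s by (intro mult_right_mono power_mono) auto

text \<open>For \<open>s / b \<ge> 1\<close> a fixed prior suffices, since its code length is
  logarithmic in the rounded value. For \<open>s / b < 1\<close> nearly all mass sits at 0 and only
  \<open>\<delta> = (s / b) ^ (2 * l) / 2\<close> elsewhere. A nonzero value then costs an extra
  \<open>- ln \<delta>\<close>, but it requires \<open>2 * |Y| \<ge> b\<close>, and high moments
  make the expected cost as small as the power \<open>2 * l\<close> of the ratio.\<close>

lemma code_length_exists: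
  assumes Y: "Y \<in> H" and s: "sd Y \<le> s" "0 < s" and b: "0 < b"
  shows "\<exists>q. (\<forall>k. 0 < q k) \<and> (\<forall>F. finite F \<longrightarrow> (\<Sum>k\<in>F. q k) \<le> 1) \<and>
     integrable M (\<lambda>\<omega>. - ln (q (round (Y \<omega> / b)))) \<and>
     expectation (\<lambda>\<omega>. - ln (q (round (Y \<omega> / b)))) \<le> code_cost l (s / b)"
proof -
  note [measurable] = measurable_mem[OF Y]
  define r where "r = s / b"
  have r: "0 < r" using s b by (simp add: r_def)
  have main: "integrable M (\<lambda>\<omega>. - ln (q (round (Y \<omega> / b)))) \<and>
     expectation (\<lambda>\<omega>. - ln (q (round (Y \<omega> / b)))) \<le> expectation g"
    if q: "\<And>k. 0 < q k" "\<And>k. q k \<le> 1" and gi: "integrable M g"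
      and le: "\<And>\<omega>. - ln (q (round (Y \<omega> / b))) \<le> g \<omega>" for q :: "int \<Rightarrow> real" and g
  proof -
    have nn: "0 \<le> - ln (q k)" for k using q[of k] by (simp add: ln_le_zero_iff)
    have i: "integrable M (\<lambda>\<omega>. - ln (q (round (Y \<omega> / b))))"
    proof (rule Bochner_Integration.integrable_bound[OF gi])
      show "(\<lambda>\<omega>. - ln (q (round (Y \<omega> / b)))) \<in> borel_measurable M"
        by measurable
      show "AE \<omega> in M. norm (- ln (q (round (Y \<omega> / b)))) \<le> norm (g \<omega>)"
      proof (rule AE_I2)
        fix \<omega>
        show "norm (- ln (q (round (Y \<omega> / b)))) \<le> norm (g \<omega>)"
          using nn[of "round (Y \<omega> / b)"] le[of \<omega>] by (simp only: real_norm_def)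
      qed
    qed
    then show ?thesis using integral_mono[OF i gi] le by auto
  qed
  show ?thesis
  proof (cases "1 \<le> r")
    case True
    \<comment> \<open>The 3 dominates \<open>ln 8\<close>. As \<open>Y\<close> has second moment at
      most \<open>s^2\<close>, the expectation is at most \<open>3 + 6 * 5 * r powr (1/3)\<close>,
      which is where 33 in \<open>code_cost\<close> comes from.\<close>
    define g where "g \<omega> = 3 + 6 * r powr (1/3) * (1 + 4 / s\<^sup>2 * Y \<omega> ^ 2)" for \<omega>
    let ?q = "code_weight (1/2)"
    have q: "0 < ?q k" "?q k \<le> 1" for k
    proof -
      have "1 \<le> (real_of_int k)\<^sup>2" if "k \<noteq> 0"
        using that by (metis int_one_le_iff_zero_less of_int_1_le_iff of_int_power zero_less_power2)
      then show "0 < ?q k" "?q k \<le> 1" by (auto simp: code_weight_def field_simps)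
    qed
    have gi: "integrable M g" unfolding g_def
      using integrable_power_mem[OF Y, of 2] by simp
    have "- ln (?q (round (Y \<omega> / b))) \<le> g \<omega>" for \<omega>
    proof -
      define k where "k = round (Y \<omega> / b)"
      have g3: "3 \<le> g \<omega>" unfolding g_def by (simp add: add_nonneg_nonneg)
      have ln2: "ln 2 < (1::real)" using ln_2_less_1 by simp
      show ?thesis
      proof (cases "k = 0")
        case True
        then show ?thesis using g3 ln2 unfolding k_def[symmetric] by (simp add: code_weight_def ln_div)
      next
        case False
        define K where "K = \<bar>real_of_int k\<bar>"
        have K: "1 \<le> K" "K \<le> 2 * \<bar>Y \<omega> / b\<bar>" using abs_round_half_le[of "Y \<omega> / b"] False
          unfolding K_def k_def[symmetric] by linarith+
        have "(real_of_int k)\<^sup>2 = K\<^sup>2" by (simp add: K_def)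
        then have "- ln (?q k) = ln (8 * K\<^sup>2)" using False K by (simp add: code_weight_def ln_div)
        also have "\<dots> = ln 8 + 2 * ln K" using K by (simp add: ln_mult ln_realpow)
        also have "ln (8::real) = 3 * ln 2" using ln_realpow[of 2 3] by simp
        also have "2 * ln K \<le> 6 * K powr (1/3)" using ln_le_cube_root[OF K(1)] by simp
        also have "K powr (1/3) \<le> (r * (2 * \<bar>Y \<omega>\<bar> / s)) powr (1/3)"
          using K b s by (intro powr_mono2) (auto simp: r_def)
        also have "\<dots> = r powr (1/3) * (2 * \<bar>Y \<omega>\<bar> / s) powr (1/3)" by (rule powr_mult)
        also have "(2 * \<bar>Y \<omega>\<bar> / s) powr (1/3) \<le> 1 + (2 * \<bar>Y \<omega>\<bar> / s)\<^sup>2" using s by (intro cube_root_le) auto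
        finally have "- ln (?q k) \<le> 3 * ln 2 + 6 * (r powr (1/3) * (1 + (2 * \<bar>Y \<omega>\<bar> / s)\<^sup>2))"
          by (simp add: mult_left_mono)
        also have "\<dots> \<le> g \<omega>" unfolding g_def using ln2 by (simp add: power_divide power_mult_distrib)
        finally show ?thesis unfolding k_def .
      qed
    qed
    note main[OF q gi this]
    moreover have "expectation g \<le> code_cost l r"
    proof -
      have "expectation g = 3 + 6 * r powr (1/3) * (1 + 4 / s\<^sup>2 * expectation (\<lambda>\<omega>. Y \<omega> ^ 2))"
        unfolding g_def using integrable_power_mem[OF Y, of 2] by (simp add: prob_space)
      also have "\<dots> \<le> 3 + 6 * r powr (1/3) * (1 + 4 / s\<^sup>2 * s\<^sup>2)"
        unfolding sd_sq[symmetric] using s by (intro add_left_mono mult_left_mono power_mono) auto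
      also have "\<dots> = 3 + 30 * r powr (1/3)" using s by simp
      also have "\<dots> \<le> 33 * r powr (1/3)" using True by (simp add: ge_one_powr_ge_zero)
      finally show ?thesis using True by (simp add: code_cost_def)
    qed
    ultimately show ?thesis using q sum_code_weight_le_1[of "1/2"]
      by (intro exI[of _ ?q]) (auto simp: r_def)
  next
    case False
    define \<delta> where "\<delta> = r ^ (2*l) / 2"
    have rl1: "r ^ n \<le> 1" for n using False r by (simp add: power_le_one)
    have \<delta>: "0 < \<delta>" "\<delta> \<le> 1/2" using r rl1[of "2*l"] by (auto simp: \<delta>_def)
    let ?q = "code_weight \<delta>"
    have q: "0 < ?q k" "?q k \<le> 1" for k
    proof -
      have "1 \<le> (real_of_int k)\<^sup>2" if "k \<noteq> 0"
        using that by (metis int_one_le_iff_zero_less of_int_1_le_iff of_int_power zero_less_power2)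
      then show "0 < ?q k" "?q k \<le> 1" using \<delta> by (auto simp: code_weight_def field_simps)
    qed
    \<comment> \<open>For a nonzero rounding \<open>2 * |Y / b| \<ge> 1\<close>, so its even powers
      dominate both constants and linear terms. The order \<open>2 * (l + 1)\<close> leaves two
      powers of \<open>r\<close> beyond \<open>r ^ (2 * l)\<close>, one of which absorbs the factor
      \<open>1 / r\<close>.\<close>
    define g where "g \<omega> = r ^ (2*l) + (3 + 2 * real l / r) * (2/b) ^ (2*(l+1)) * Y \<omega> ^ (2*(l+1)) + 2 * (2/b) ^ (2*(l+2)) * Y \<omega> ^ (2*(l+2))" for \<omega>
    have gi: "integrable M g" unfolding g_def
      by (rule Bochner_Integration.integrable_add[OF Bochner_Integration.integrable_add[OF integrable_const]]; intro integrable_mult_right integrable_power_mem Y)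
    have "- ln (?q (round (Y \<omega> / b))) \<le> g \<omega>" for \<omega>
    proof -
      define k where "k = round (Y \<omega> / b)"
      have even_nn: "0 \<le> Y \<omega> ^ (2 * n)" for n by (simp add: power_mult)
      have "0 \<le> (3 + 2 * real l / r) * (2/b) ^ (2*(l+1)) * Y \<omega> ^ (2*(l+1))" "0 \<le> 2 * (2/b) ^ (2*(l+2)) * Y \<omega> ^ (2*(l+2))"
        by (intro mult_nonneg_nonneg even_nn; use r b in simp)+
      then have g1: "r ^ (2*l) \<le> g \<omega>" unfolding g_def by linarith
      show ?thesis
      proof (cases "k = 0")
        case True
        have "1 + 2 * \<delta> \<le> exp (2 * \<delta>)" by (rule exp_ge_add_one_self)
        have "1 \<le> (1 + 2 * \<delta>) * (1 - \<delta>)" using \<delta> by (simp add: algebra_simps mult_left_le)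
        then have "1 / (1 - \<delta>) \<le> 1 + 2 * \<delta>" using \<delta> by (simp add: field_simps)
        also have "\<dots> \<le> exp (2 * \<delta>)" by fact
        finally have "ln (1 / (1 - \<delta>)) \<le> ln (exp (2 * \<delta>))" using \<delta> by (subst ln_le_cancel_iff) auto
        then have "- ln (1 - \<delta>) \<le> r ^ (2*l)" using \<delta> by (simp add: ln_div \<delta>_def)
        then show ?thesis using g1 unfolding k_def[symmetric] by (simp add: code_weight_def True)
      next
        case False
        define K where "K = \<bar>real_of_int k\<bar>"
        define y where "y = 2 * \<bar>Y \<omega> / b\<bar>"
        have K: "1 \<le> K" "K \<le> y" using abs_round_half_le[of "Y \<omega> / b"] False
          unfolding K_def y_def k_def[symmetric] by linarith+
        have y1: "1 \<le> y" using K by simp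
        have ye: "y ^ (2*n) = (2/b) ^ (2*n) * Y \<omega> ^ (2*n)" for n
          by (simp add: y_def power_mult power_mult_distrib power_divide)
        have "(real_of_int k)\<^sup>2 = K\<^sup>2" by (simp add: K_def)
        then have "- ln (?q k) = ln (8 * K\<^sup>2 / r ^ (2*l))" using False K r by (simp add: code_weight_def ln_div \<delta>_def)
        also have "\<dots> = ln 8 + 2 * ln K + 2 * real l * ln (1 / r)" using K r
          by (simp add: ln_mult ln_div ln_realpow)
        also have "ln (8::real) = 3 * ln 2" using ln_realpow[of 2 3] by simp
        also have "3 * ln 2 + 2 * ln K + 2 * real l * ln (1 / r) \<le> 3 + 2 * y + 2 * real l * (1 / r)"
        proof -
          have "ln K \<le> y" using K ln_bound[of K] by linarith
          moreover have "ln (1/r) \<le> 1/r" using r ln_bound[of "1/r"] by simp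
          then have "2 * real l * ln (1 / r) \<le> 2 * real l * (1 / r)" by (intro mult_left_mono) auto
          moreover have "ln 2 < (1::real)" using ln_2_less_1 by simp
          ultimately show ?thesis by linarith
        qed
        also have "\<dots> = (3 + 2 * real l / r) * 1 + 2 * y" by simp
        also have "\<dots> \<le> (3 + 2 * real l / r) * y ^ (2*(l+1)) + 2 * y ^ (2*(l+2))"
        proof (intro add_mono mult_left_mono)
          show "1 \<le> y ^ (2*(l+1))" using y1 by (rule one_le_power)
          have "y ^ 1 \<le> y ^ (2*(l+2))" using y1 by (intro power_increasing) auto
          then show "y \<le> y ^ (2*(l+2))" by simp
        qed (use r in auto)
        also have "\<dots> \<le> g \<omega>"
        proof -
          have "0 \<le> r ^ (2*l)" using r by simp
          then show ?thesis unfolding g_def ye mult.assoc by linarith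
        qed
        finally show ?thesis unfolding k_def .
      qed
    qed
    note main[OF q gi this]
    moreover have "expectation g \<le> code_cost l r"
    proof -
      define m1 where "m1 = (fact (2 * (l + 1)) / (2 ^ (l + 1) * fact (l + 1)) :: real)"
      define m2 where "m2 = (fact (2 * (l + 2)) / (2 ^ (l + 2) * fact (l + 2)) :: real)"
      have lin: "expectation (\<lambda>\<omega>. c0 + c1 * f1 \<omega> + c2 * f2 \<omega>) = c0 + c1 * expectation f1 + c2 * expectation f2"
        if "integrable M f1" "integrable M f2" for c0 c1 c2 and f1 f2 :: "'w \<Rightarrow> real"
        using that by (simp add: prob_space)
      have e1: "expectation (\<lambda>\<omega>. Y \<omega> ^ (2*(l+1))) \<le> s ^ (2*(l+1)) * m1"
        unfolding m1_def by (rule expectation_even_power_le[OF Y s(1)])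
      have e2: "expectation (\<lambda>\<omega>. Y \<omega> ^ (2*(l+2))) \<le> s ^ (2*(l+2)) * m2"
        unfolding m2_def by (rule expectation_even_power_le[OF Y s(1)])
      have sb: "(2/b) ^ n * (s ^ n * m) = (2 * r) ^ n * m" for n m
        by (simp add: r_def power_divide power_mult_distrib)
      have m: "0 \<le> m1" "0 \<le> m2" by (auto simp: m1_def m2_def)
      have "expectation g = r ^ (2*l) + (3 + 2 * real l / r) * (2/b) ^ (2*(l+1)) * expectation (\<lambda>\<omega>. Y \<omega> ^ (2*(l+1)))
          + 2 * (2/b) ^ (2*(l+2)) * expectation (\<lambda>\<omega>. Y \<omega> ^ (2*(l+2)))"
        unfolding g_def by (rule lin) (rule integrable_power_mem[OF Y])+
      also have "\<dots> \<le> r ^ (2*l) + (3 + 2 * real l / r) * (2/b) ^ (2*(l+1)) * (s ^ (2*(l+1)) * m1)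
          + 2 * (2/b) ^ (2*(l+2)) * (s ^ (2*(l+2)) * m2)"
        by (intro add_mono mult_left_mono order_refl e1 e2) (use r b in simp_all)
      also have "\<dots> = r ^ (2*l) + (3 + 2 * real l / r) * (2 * r) ^ (2*(l+1)) * m1 + 2 * (2 * r) ^ (2*(l+2)) * m2"
        by (simp only: mult.assoc sb)
      also have "(3 + 2 * real l / r) * (2 * r) ^ (2*(l+1)) = (3 * r + 2 * real l) * r * 2 ^ (2*l+2) * r ^ (2*l)"
        using r by (simp add: power_mult_distrib field_simps)
      also have "2 * (2 * r) ^ (2*(l+2)) = 2 * 2 ^ (2*l+4) * r ^ 4 * r ^ (2*l)"
      proof -
        have "2 * (l + 2) = 2 * l + 4" by simp
        then have "(2 * r) ^ (2*(l+2)) = 2 ^ (2*l+4) * (r ^ 4 * r ^ (2*l))"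
          by (simp only: power_mult_distrib power_add mult_ac)
        then show ?thesis by (simp only: mult.assoc)
      qed
      also have "r ^ (2*l) + (3 * r + 2 * real l) * r * 2 ^ (2*l+2) * r ^ (2*l) * m1 + 2 * 2 ^ (2*l+4) * r ^ 4 * r ^ (2*l) * m2
         = (1 + ((3 * r + 2 * real l) * r) * 2 ^ (2*l+2) * m1 + r ^ 4 * (2 * 2 ^ (2*l+4) * m2)) * r ^ (2*l)"
        by (simp add: algebra_simps)
      also have "\<dots> \<le> (1 + (3 + 2 * real l) * 2 ^ (2*l+2) * m1 + 1 * (2 * 2 ^ (2*l+4) * m2)) * r ^ (2*l)"
      proof (intro mult_right_mono add_mono order_refl)
        have "(3 * r + 2 * real l) * r \<le> (3 * 1 + 2 * real l) * 1"
          using r False by (intro mult_mono add_mono) auto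
        then show "(3 * r + 2 * real l) * r \<le> 3 + 2 * real l" by simp
      qed (use m r rl1[of 4] in auto)
      also have "\<dots> = code_cost l r"
        using False by (simp add: code_cost_def code_const_def m1_def m2_def mult_ac)
      finally show ?thesis .
    qed
    ultimately show ?thesis using q sum_code_weight_le_1[of \<delta>] \<delta>
      by (intro exI[of _ ?q]) (auto simp: r_def)
  qed
qed

text \<open>
  A substitute for Sidak's inequality. Rounding each coordinate to precision \<open>a i\<close> gives a discrete
  random vector whose expected code length is at most the sum \<open>h\<close> of the individual ones; so at most
  \<open>exp (2 h)\<close> values carry half of the mass, and two independent copies agree with probability at
  least \<open>exp (- 2 h) / 4\<close>. On that event the symmetrized vector is small.
\<close>

lemma small_ball:
  fixes I :: "'i set" and Y :: "'i \<Rightarrow> 'w \<Rightarrow> real" and s a :: "'i \<Rightarrow> real"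
  assumes fin: "finite I" and Y: "\<And>i. i \<in> I \<Longrightarrow> Y i \<in> H"
    and s: "\<And>i. i \<in> I \<Longrightarrow> sd (Y i) \<le> s i" "\<And>i. i \<in> I \<Longrightarrow> 0 < s i"
    and a: "\<And>i. i \<in> I \<Longrightarrow> 0 < a i"
  shows "prob {\<omega>\<in>space M. \<forall>i\<in>I. \<bar>Y i \<omega>\<bar> \<le> a i} \<ge> exp (- 2 * (\<Sum>i\<in>I. code_cost l (s i / a i))) / 4"
proof (cases "I = {}")
  case True
  then show ?thesis by (simp add: prob_space)
next
  case False
  have "\<forall>i. \<exists>q. i \<in> I \<longrightarrow> (\<forall>k. 0 < q k) \<and> (\<forall>F. finite F \<longrightarrow> (\<Sum>k\<in>F. q k) \<le> 1) \<and>
     integrable M (\<lambda>\<omega>. - ln (q (round (Y i \<omega> / a i)))) \<and>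
     expectation (\<lambda>\<omega>. - ln (q (round (Y i \<omega> / a i)))) \<le> code_cost l (s i / a i)"
    using code_length_exists[OF Y s a] by blast
  then obtain q :: "'i \<Rightarrow> int \<Rightarrow> real" where q: "\<And>i k. i \<in> I \<Longrightarrow> 0 < q i k" "\<And>i F. i \<in> I \<Longrightarrow> finite F \<Longrightarrow> (\<Sum>k\<in>F. q i k) \<le> 1"
    "\<And>i. i \<in> I \<Longrightarrow> integrable M (\<lambda>\<omega>. - ln (q i (round (Y i \<omega> / a i))))"
    "\<And>i. i \<in> I \<Longrightarrow> expectation (\<lambda>\<omega>. - ln (q i (round (Y i \<omega> / a i)))) \<le> code_cost l (s i / a i)"
    by metis
  have q1: "q i k \<le> 1" if "i \<in> I" for i k using q(2)[OF that, of "{k}"] by simp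
  define h where "h = (\<Sum>i\<in>I. code_cost l (s i / a i))"
  have hpos: "0 < h" unfolding h_def using False fin s a by (intro sum_pos code_cost_pos) auto
  define len where "len c = (\<Sum>i\<in>I. - ln (q i (c i)))" for c
  define code where "code \<omega> = (\<lambda>i\<in>I. round (Y i \<omega> / a i))" for \<omega>
  \<comment> \<open>The mean code length is at most \<open>h\<close>, so by Markov's inequality half
    of the mass has code length at most \<open>2 * h\<close>.\<close>
  define T where "T = {c \<in> I \<rightarrow>\<^sub>E (UNIV::int set). len c \<le> 2 * h}"
  \<comment> \<open>Kraft's inequality for the product prior: each element of \<open>T\<close> has
    weight at least \<open>exp (- 2 * h)\<close>, and the weights sum to at most 1.\<close>
  have cardF: "real (card F) \<le> exp (2 * h)" if F: "F \<subseteq> T" "finite F" for F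
  proof -
    define R where "R i = (\<lambda>c. c i) ` F" for i
    have finR: "finite (R i)" for i using F by (simp add: R_def)
    have FR: "F \<subseteq> Pi\<^sub>E I R" using F by (auto simp: R_def T_def PiE_def extensional_def)
    have "real (card F) * exp (- 2 * h) = (\<Sum>c\<in>F. exp (- 2 * h))" by simp
    also have "\<dots> \<le> (\<Sum>c\<in>F. \<Prod>i\<in>I. q i (c i))"
    proof (rule sum_mono)
      fix c assume "c \<in> F"
      then have "- 2 * h \<le> - len c" using F by (auto simp: T_def)
      then have "exp (- 2 * h) \<le> exp (\<Sum>i\<in>I. ln (q i (c i)))" by (simp add: len_def sum_negf)
      also have "\<dots> = (\<Prod>i\<in>I. q i (c i))" using fin q(1) by (simp add: exp_sum)
      finally show "exp (- 2 * h) \<le> (\<Prod>i\<in>I. q i (c i))" .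
    qed
    also have "\<dots> \<le> (\<Sum>c\<in>Pi\<^sub>E I R. \<Prod>i\<in>I. q i (c i))"
      using fin finR FR q(1) by (intro sum_mono2 finite_PiE) (auto intro!: prod_nonneg intro: less_imp_le)
    also have "\<dots> = (\<Prod>i\<in>I. \<Sum>k\<in>R i. q i k)"
      using fin finR by (simp add: prod_sum_PiE)
    also have "\<dots> \<le> 1" using q(1,2) finR by (intro prod_le_1) (auto intro!: sum_nonneg intro: less_imp_le)
    finally have "real (card F) * exp (- 2 * h) * exp (2 * h) \<le> 1 * exp (2 * h)" by (intro mult_right_mono) auto
    then show ?thesis by (simp add: mult.assoc mult_exp_exp)
  qed
  have finT: "finite T"
  proof (rule ccontr)
    assume "infinite T"
    then obtain F where "F \<subseteq> T" "finite F" "card F = nat \<lceil>exp (2 * h)\<rceil> + 1"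
      using infinite_arbitrarily_large by metis
    then show False using cardF[of F] by linarith
  qed
  define E where "E c = {\<omega>\<in>space M. code \<omega> = c}" for c
  have code_eq: "code \<omega> = c \<longleftrightarrow> (\<forall>i\<in>I. round (Y i \<omega> / a i) = c i)" if "c \<in> T" for \<omega> c
    using that by (auto simp: code_def T_def fun_eq_iff PiE_def extensional_def)
  have E_meas [measurable]: "E c \<in> events" if "c \<in> T" for c
  proof -
    have "{\<omega>\<in>space M. \<forall>i\<in>I. round (Y i \<omega> / a i) = c i} \<in> events"
    proof (rule sets.sets_Collect_finite_All[OF _ fin])
      fix i assume "i \<in> I"
      note [measurable] = measurable_mem[OF Y[OF this]]
      show "{\<omega>\<in>space M. round (Y i \<omega> / a i) = c i} \<in> events" by measurable
    qed
    then show ?thesis using code_eq[OF that] by (simp add: E_def)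
  qed
  have disj: "disjoint_family_on E T" by (auto simp: disjoint_family_on_def E_def)
  have half: "1/2 \<le> (\<Sum>c\<in>T. prob (E c))"
  proof -
    have i: "integrable M (\<lambda>\<omega>. len (code \<omega>))"
      unfolding len_def code_def using q(3) by (intro Bochner_Integration.integrable_sum) simp
    have e: "expectation (\<lambda>\<omega>. len (code \<omega>)) \<le> h"
    proof -
      have "expectation (\<lambda>\<omega>. len (code \<omega>)) = expectation (\<lambda>\<omega>. \<Sum>i\<in>I. - ln (q i (round (Y i \<omega> / a i))))"
        unfolding len_def code_def by simp
      also have "\<dots> = (\<Sum>i\<in>I. expectation (\<lambda>\<omega>. - ln (q i (round (Y i \<omega> / a i)))))"
        by (intro Bochner_Integration.integral_sum q(3))
      also have "\<dots> \<le> h" unfolding h_def by (intro sum_mono q(4))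
      finally show ?thesis .
    qed
    have len_nn: "0 \<le> len c" for c unfolding len_def
      using q(1) q1 by (intro sum_nonneg) (simp add: ln_le_zero_iff)
    have "prob {\<omega>\<in>space M. len (code \<omega>) \<ge> 2 * h} \<le> expectation (\<lambda>\<omega>. len (code \<omega>)) / (2 * h)"
      using hpos by (intro integral_Markov_inequality_measure[where A="{}"] i) (auto simp: len_nn)
    also have "\<dots> \<le> h / (2 * h)" using e hpos by (intro divide_right_mono) auto
    finally have m: "prob {\<omega>\<in>space M. len (code \<omega>) \<ge> 2 * h} \<le> 1/2" using hpos by simp
    have Un: "(\<Union>c\<in>T. E c) \<in> events" using finT E_meas by auto
    have len_meas [measurable]: "(\<lambda>\<omega>. len (code \<omega>)) \<in> borel_measurable M" using i by auto
    have "space M - (\<Union>c\<in>T. E c) \<subseteq> {\<omega>\<in>space M. len (code \<omega>) \<ge> 2 * h}"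
      by (auto simp: E_def T_def code_def)
    then have "prob (space M - (\<Union>c\<in>T. E c)) \<le> prob {\<omega>\<in>space M. len (code \<omega>) \<ge> 2 * h}"
      by (intro finite_measure_mono) auto
    then have "1/2 \<le> prob (\<Union>c\<in>T. E c)" using m Un by (simp add: prob_compl)
    also have "\<dots> = (\<Sum>c\<in>T. prob (E c))" using finT E_meas disj by (intro finite_measure_finite_Union) auto
    finally show ?thesis .
  qed
  interpret P: pair_prob_space M M ..
  let ?N = "M \<Otimes>\<^sub>M M"
  \<comment> \<open>Cauchy-Schwarz: a mass of at least one half spread over at most
    \<open>exp (2 * h)\<close> codes collides with an independent copy with probability at least
    \<open>exp (- 2 * h) / 4\<close>.\<close>
  have "(1/2)\<^sup>2 \<le> (\<Sum>c\<in>T. prob (E c) * 1)\<^sup>2" using half by (intro power_mono) auto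
  also have "\<dots> \<le> (\<Sum>c\<in>T. (prob (E c))\<^sup>2) * (\<Sum>c\<in>T. 1\<^sup>2)" by (rule Cauchy_Schwarz_ineq_sum)
  also have "\<dots> \<le> (\<Sum>c\<in>T. (prob (E c))\<^sup>2) * exp (2 * h)"
    using cardF[OF order_refl finT] by (intro mult_left_mono sum_nonneg) auto
  finally have "exp (- 2 * h) * (1/4) \<le> exp (- 2 * h) * ((\<Sum>c\<in>T. (prob (E c))\<^sup>2) * exp (2 * h))"
    by (intro mult_left_mono) (auto simp: power2_eq_square)
  then have lower: "exp (- 2 * h) / 4 \<le> (\<Sum>c\<in>T. (prob (E c))\<^sup>2)" by (simp add: exp_minus field_simps)
  have EE: "E c \<times> E c \<in> sets ?N" if "c \<in> T" for c using E_meas[OF that] by auto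
  let ?D = "{\<omega>\<in>space ?N. \<forall>i\<in>I. (Y i (fst \<omega>) - Y i (snd \<omega>)) / sqrt 2 \<in> {- a i .. a i}}"
  have D: "?D \<in> sets ?N"
  proof (rule sets.sets_Collect_finite_All[OF _ fin])
    fix i assume "i \<in> I"
    note [measurable] = measurable_mem[OF Y[OF this]]
    show "{\<omega>\<in>space ?N. (Y i (fst \<omega>) - Y i (snd \<omega>)) / sqrt 2 \<in> {- a i .. a i}} \<in> sets ?N" by measurable
  qed
  have "(\<Sum>c\<in>T. (prob (E c))\<^sup>2) = (\<Sum>c\<in>T. measure ?N (E c \<times> E c))"
    using E_meas by (intro sum.cong refl) (simp add: measure_def emeasure_pair_measure_Times enn2real_mult power2_eq_square)
  also have "\<dots> = measure ?N (\<Union>c\<in>T. E c \<times> E c)"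
    using finT EE disj by (intro P.finite_measure_finite_Union[symmetric]) (auto simp: disjoint_family_on_def E_def)
  also have "\<dots> \<le> measure ?N ?D"
  proof (rule P.finite_measure_mono[OF _ D], safe)
    fix c x y assume c: "c \<in> T" "x \<in> E c" "y \<in> E c"
    then show "(x, y) \<in> space ?N" by (auto simp: E_def space_pair_measure)
    fix i assume i: "i \<in> I"
    have "round (Y i x / a i) = round (Y i y / a i)"
      using c code_eq[OF c(1)] i by (simp add: E_def)
    moreover have "\<bar>real_of_int (round (Y i x / a i)) - Y i x / a i\<bar> \<le> 1/2" "\<bar>real_of_int (round (Y i y / a i)) - Y i y / a i\<bar> \<le> 1/2"
      using of_int_round_abs_le by blast+
    ultimately have "\<bar>Y i x / a i - Y i y / a i\<bar> \<le> 1" by linarith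
    then have "\<bar>(Y i x - Y i y) / a i\<bar> \<le> 1" by (simp add: diff_divide_distrib)
    then have "\<bar>Y i x - Y i y\<bar> \<le> a i" using a[OF i] by (simp add: abs_divide)
    moreover have "\<bar>(Y i x - Y i y) / sqrt 2\<bar> \<le> \<bar>Y i x - Y i y\<bar>"
      by (simp add: abs_divide divide_le_eq mult_left_le) (simp add: mult_le_cancel_left1)
    ultimately have "\<bar>(Y i x - Y i y) / sqrt 2\<bar> \<le> a i" by linarith
    then have "- a i \<le> (Y i x - Y i y) / sqrt 2" "(Y i x - Y i y) / sqrt 2 \<le> a i" by linarith+
    then show "(Y i (fst (x, y)) - Y i (snd (x, y))) / sqrt 2 \<in> {- a i..a i}" by simp
  qed
  also have "\<dots> = prob {\<omega>\<in>space M. \<forall>i\<in>I. Y i \<omega> \<in> {- a i .. a i}}"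
    by (rule prob_symmetrize[OF fin Y, symmetric]) auto
  also have "{\<omega>\<in>space M. \<forall>i\<in>I. Y i \<omega> \<in> {- a i .. a i}} = {\<omega>\<in>space M. \<forall>i\<in>I. \<bar>Y i \<omega>\<bar> \<le> a i}"
    by (auto simp: abs_le_iff)
  finally show ?thesis using lower by (simp add: h_def)
qed

end

section \<open>Anisotropic dyadic grids and chaining\<close>

text \<open>\<open>p\<close> is the lower corner of the cube and \<open>h\<close> its side; with
  \<open>h \<le> 1\<close> the bounds on cell widths can be written without
  \<open>h\<close>.\<close>

locale grid =
  fixes \<gamma> :: "'n::finite \<Rightarrow> real" and p :: "real ^ 'n" and h :: real
  assumes \<gamma>_pos: "\<And>j. 0 < \<gamma> j" and h_pos: "0 < h" and h_le_1: "h \<le> 1"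
begin

definition Q :: real where "Q = (\<Sum>j\<in>UNIV. 1 + \<gamma> j)"

text \<open>Rounding the exponents to integers keeps the grids of all levels nested. It is also the
  source of the factors \<open>2 ^ CARD('n)\<close> in the counts.\<close>

definition ex :: "nat \<Rightarrow> 'n \<Rightarrow> nat" where "ex k j = nat \<lceil>real k * (1 + \<gamma> j)\<rceil>"

definition Z :: "nat \<Rightarrow> ('n \<Rightarrow> nat) set" where "Z k = {z. \<forall>j. z j < 2 ^ ex k j}"

text \<open>Dropping trailing binary digits in each coordinate yields the ancestor of a cell, across
  any number of levels.\<close>

definition par :: "nat \<Rightarrow> nat \<Rightarrow> ('n \<Rightarrow> nat) \<Rightarrow> ('n \<Rightarrow> nat)" where
  "par k m z = (\<lambda>j. z j div 2 ^ (ex m j - ex k j))"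

definition pt :: "nat \<Rightarrow> ('n \<Rightarrow> nat) \<Rightarrow> real ^ 'n" where
  "pt k z = (\<chi> j. p $ j + h * (real (z j) / 2 ^ ex k j))"

definition sub :: "nat \<Rightarrow> nat \<Rightarrow> ('n \<Rightarrow> nat) \<Rightarrow> ('n \<Rightarrow> nat) set" where
  "sub k m R = {z \<in> Z m. par k m z = R}"

definition cube :: "(real ^ 'n) set" where
  "cube = {x. \<forall>j. p $ j \<le> x $ j \<and> x $ j \<le> p $ j + h}"

lemma Q_ge_1: "1 \<le> Q"
proof -
  have "(\<Sum>j\<in>(UNIV::'n set). 1) \<le> Q" unfolding Q_def using \<gamma>_pos by (intro sum_mono) (simp add: less_imp_le)
  then have "real CARD('n) \<le> Q" by simp
  moreover have "0 < CARD('n)" by (rule zero_less_card_finite)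
  ultimately show ?thesis by linarith
qed

lemma ex_bounds: "real k * (1 + \<gamma> j) \<le> real (ex k j)" "real (ex k j) \<le> real k * (1 + \<gamma> j) + 1"
proof -
  have "0 \<le> real k * (1 + \<gamma> j)" using \<gamma>_pos[of j] by simp
  then have "real (ex k j) = of_int \<lceil>real k * (1 + \<gamma> j)\<rceil>" unfolding ex_def by simp
  then show "real k * (1 + \<gamma> j) \<le> real (ex k j)" "real (ex k j) \<le> real k * (1 + \<gamma> j) + 1" by linarith+
qed

lemma ex_mono: "k \<le> m \<Longrightarrow> ex k j \<le> ex m j"
  unfolding ex_def using \<gamma>_pos[of j] by (intro nat_mono ceiling_mono mult_right_mono) auto

lemma par_mem:
  assumes "k \<le> m" "z \<in> Z m"
  shows "par k m z \<in> Z k"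
proof -
  have "z j div 2 ^ (ex m j - ex k j) < 2 ^ ex k j" for j
  proof (rule less_mult_imp_div_less)
    have "z j < 2 ^ ex m j" using assms by (simp add: Z_def)
    also have "(2::nat) ^ ex m j = 2 ^ ex k j * 2 ^ (ex m j - ex k j)"
      using ex_mono[OF assms(1), of j] by (simp flip: power_add)
    finally show "z j < 2 ^ ex k j * 2 ^ (ex m j - ex k j)" .
  qed
  then show ?thesis by (simp add: Z_def par_def)
qed

lemma par_par:
  assumes "k \<le> l" "l \<le> m"
  shows "par k l (par l m z) = par k m z"
proof
  fix j
  have "(2::nat) ^ (ex m j - ex l j) * 2 ^ (ex l j - ex k j) = 2 ^ (ex m j - ex k j)"
    using ex_mono[OF assms(1), of j] ex_mono[OF assms(2), of j] by (simp flip: power_add)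
  then show "par k l (par l m z) j = par k m z j"
    unfolding par_def by (simp flip: div_mult2_eq)
qed

lemma par_self [simp]: "par k k z = z"
  by (simp add: par_def)

lemma mem_sub: "k \<le> m \<Longrightarrow> z \<in> Z m \<Longrightarrow> z \<in> sub k m (par k m z)"
  by (simp add: sub_def)

lemma par_mem_sub: "k \<le> l \<Longrightarrow> l \<le> m \<Longrightarrow> z \<in> sub k m R \<Longrightarrow> par l m z \<in> sub k l R"
  by (simp add: sub_def par_mem par_par)

lemma Z_PiE: "Z k = Pi\<^sub>E UNIV (\<lambda>j. {..<2 ^ ex k j})"
  by (auto simp: Z_def PiE_def Pi_def)

lemma finite_Z [simp]: "finite (Z k)"
  unfolding Z_PiE by (intro finite_PiE) auto

lemma finite_sub [simp]: "finite (sub k m R)"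
  by (simp add: sub_def)

lemma prod_two_powr: "(\<Prod>j\<in>(UNIV::'n set). (2::real) powr g j) = 2 powr (\<Sum>j\<in>UNIV. g j)"
  by (simp add: powr_sum)

lemma card_Z: "real (card (Z k)) = 2 powr (\<Sum>j\<in>UNIV. real (ex k j))"
  unfolding Z_PiE by (simp add: card_PiE powr_realpow prod_two_powr[symmetric])

lemma card_Z_le: "real (card (Z k)) \<le> 2 ^ CARD('n) * 2 powr (real k * Q)"
proof -
  have "(\<Sum>j\<in>(UNIV::'n set). real (ex k j)) \<le> (\<Sum>j\<in>(UNIV::'n set). real k * (1 + \<gamma> j) + 1)"
    by (intro sum_mono ex_bounds)
  also have "\<dots> = real k * Q + real CARD('n)"
  proof -
    have "(\<Sum>j\<in>(UNIV::'n set). real k * (1 + \<gamma> j)) = real k * Q" by (simp only: Q_def sum_distrib_left)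
    then show ?thesis by (simp only: sum.distrib) simp
  qed
  finally have "2 powr (\<Sum>j\<in>(UNIV::'n set). real (ex k j)) \<le> 2 powr (real k * Q + real CARD('n))" by simp
  then show ?thesis unfolding card_Z by (simp add: powr_add powr_realpow mult.commute)
qed

lemma card_sub:
  assumes "k \<le> m" "R \<in> Z k"
  shows "real (card (sub k m R)) = 2 powr (\<Sum>j\<in>UNIV. real (ex m j) - real (ex k j))"
proof -
  let ?D = "\<lambda>j. 2 ^ (ex m j - ex k j) :: nat"
  have "sub k m R = Pi\<^sub>E UNIV (\<lambda>j. {R j * ?D j ..< R j * ?D j + ?D j})"
  proof (intro set_eqI iffI)
    fix z assume "z \<in> sub k m R"
    then have d: "z j div ?D j = R j" for j by (auto simp: sub_def par_def)
    have "R j * ?D j \<le> z j \<and> z j < R j * ?D j + ?D j" for j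
      using div_times_less_eq_dividend[of "z j" "?D j"] dividend_less_div_times[of "?D j" "z j"] by (simp add: d)
    then show "z \<in> Pi\<^sub>E UNIV (\<lambda>j. {R j * ?D j ..< R j * ?D j + ?D j})" by auto
  next
    fix z assume "z \<in> Pi\<^sub>E UNIV (\<lambda>j. {R j * ?D j ..< R j * ?D j + ?D j})"
    then have z: "R j * ?D j \<le> z j" "z j < R j * ?D j + ?D j" for j by (auto simp: PiE_def Pi_def)
    have d: "z j div ?D j = R j" for j
      using z[of j] by (intro div_nat_eqI) (auto simp: mult.commute)
    have "z j < 2 ^ ex m j" for j
    proof -
      have "z j < (R j + 1) * ?D j" using z(2)[of j] by simp
      also have "\<dots> \<le> 2 ^ ex k j * ?D j"
        using assms(2) by (intro mult_right_mono) (auto simp: Z_def Suc_le_eq)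
      also have "\<dots> = 2 ^ ex m j" using ex_mono[OF assms(1), of j] by (simp flip: power_add)
      finally show ?thesis .
    qed
    then show "z \<in> sub k m R" using d by (auto simp: sub_def Z_def par_def)
  qed
  then have "real (card (sub k m R)) = (\<Prod>j\<in>UNIV. real (?D j))" by (simp add: card_PiE)
  also have "\<dots> = (\<Prod>j\<in>(UNIV::'n set). 2 powr (real (ex m j) - real (ex k j)))"
  proof (intro prod.cong refl)
    fix j
    have "real (ex m j) - real (ex k j) = real (ex m j - ex k j)" using ex_mono[OF assms(1), of j] by simp
    then show "real (?D j) = 2 powr (real (ex m j) - real (ex k j))"
      by (simp only: powr_realpow zero_less_numeral of_nat_power of_nat_numeral)
  qed
  also have "\<dots> = 2 powr (\<Sum>j\<in>UNIV. real (ex m j) - real (ex k j))" by (rule prod_two_powr)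
  finally show ?thesis .
qed

text \<open>Each ceiling in \<open>ex\<close> moves an exponent by at most 1, so the count is
  \<open>2 powr ((m - k) * Q)\<close> up to one factor of 2 per coordinate, in either
  direction.\<close>

lemma card_sub_bounds:
  assumes "k \<le> m" "R \<in> Z k"
  shows "real (card (sub k m R)) \<le> 2 ^ CARD('n) * 2 powr ((real m - real k) * Q)"
    and "2 powr ((real m - real k) * Q) \<le> 2 ^ CARD('n) * real (card (sub k m R))"
proof -
  have s: "(\<Sum>j\<in>(UNIV::'n set). (real m - real k) * (1 + \<gamma> j)) = (real m - real k) * Q"
    unfolding Q_def sum_distrib_left ..
  have "(\<Sum>j\<in>(UNIV::'n set). real (ex m j) - real (ex k j)) \<le> (\<Sum>j\<in>(UNIV::'n set). (real m - real k) * (1 + \<gamma> j) + 1)"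
    using ex_bounds by (intro sum_mono) (smt (verit) left_diff_distrib)
  then have "(\<Sum>j\<in>(UNIV::'n set). real (ex m j) - real (ex k j)) \<le> (real m - real k) * Q + real CARD('n)"
    by (simp add: sum.distrib s)
  then have "2 powr (\<Sum>j\<in>(UNIV::'n set). real (ex m j) - real (ex k j)) \<le> 2 powr ((real m - real k) * Q + real CARD('n))" by simp
  then show "real (card (sub k m R)) \<le> 2 ^ CARD('n) * 2 powr ((real m - real k) * Q)"
    unfolding card_sub[OF assms] by (simp add: powr_add powr_realpow mult.commute)
  have "(\<Sum>j\<in>(UNIV::'n set). (real m - real k) * (1 + \<gamma> j)) \<le> (\<Sum>j\<in>(UNIV::'n set). (real (ex m j) - real (ex k j)) + 1)"
    using ex_bounds by (intro sum_mono) (smt (verit) left_diff_distrib)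
  then have "(real m - real k) * Q \<le> (\<Sum>j\<in>(UNIV::'n set). real (ex m j) - real (ex k j)) + real CARD('n)"
    unfolding s by (simp add: sum.distrib)
  then have "2 powr ((real m - real k) * Q) \<le> 2 powr ((\<Sum>j\<in>(UNIV::'n set). real (ex m j) - real (ex k j)) + real CARD('n))" by simp
  then show "2 powr ((real m - real k) * Q) \<le> 2 ^ CARD('n) * real (card (sub k m R))"
    unfolding card_sub[OF assms] by (simp add: powr_add powr_realpow mult.commute)
qed

lemma pt_mem_cube: "z \<in> Z k \<Longrightarrow> pt k z \<in> cube"
proof -
  assume z: "z \<in> Z k"
  have "real (z j) / 2 ^ ex k j \<le> 1" for j
  proof -
    have "z j < 2 ^ ex k j" using z by (simp add: Z_def)
    then have "real (z j) \<le> 2 ^ ex k j" by (metis less_imp_le of_nat_le_iff of_nat_numeral of_nat_power)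
    then show ?thesis by simp
  qed
  then have "h * (real (z j) / 2 ^ ex k j) \<le> h * 1" for j using h_pos by (intro mult_left_mono) auto
  then show ?thesis using h_pos by (simp add: cube_def pt_def)
qed

lemma pt_par_dist:
  assumes "k \<le> m"
  shows "\<bar>pt m z $ j - pt k (par k m z) $ j\<bar> \<le> 2 powr (- (real k * (1 + \<gamma> j)))"
proof -
  let ?D = "2 ^ (ex m j - ex k j) :: nat"
  have em: "(2::real) ^ ex m j = 2 ^ ex k j * real ?D"
    using ex_mono[OF assms, of j] by (simp flip: power_add)
  define q where "q = z j div ?D"
  define r where "r = z j mod ?D"
  have zj: "real (z j) = real q * real ?D + real r"
    unfolding q_def r_def by (metis div_mult_mod_eq of_nat_add of_nat_mult)
  have r: "real r \<le> real ?D" unfolding r_def by (intro of_nat_mono less_imp_le mod_less_divisor) simp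
  have "real (z j) / 2 ^ ex m j - real q / 2 ^ ex k j = real r / (2 ^ ex k j * real ?D)"
    unfolding em zj by (simp add: field_simps)
  moreover have "pt m z $ j - pt k (par k m z) $ j = h * (real (z j) / 2 ^ ex m j - real q / 2 ^ ex k j)"
    by (simp only: pt_def par_def q_def vec_lambda_beta right_diff_distrib add_diff_cancel_left)
  ultimately have e1: "pt m z $ j - pt k (par k m z) $ j = h * (real r / real ?D) / 2 ^ ex k j"
    by (simp add: mult.commute)
  have e2: "h * (real r / real ?D) \<le> 1 * 1" using r h_pos h_le_1 by (intro mult_mono) auto
  have e3: "0 \<le> h * (real r / real ?D)" using h_pos by simp
  have "\<bar>pt m z $ j - pt k (par k m z) $ j\<bar> = \<bar>h * (real r / real ?D) / 2 ^ ex k j\<bar>"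
    by (simp only: e1)
  also have "\<dots> = h * (real r / real ?D) / 2 ^ ex k j"
    using e3 by (intro abs_of_nonneg divide_nonneg_nonneg) auto
  also have "\<dots> \<le> 1 / 2 ^ ex k j" using e2 by (intro divide_right_mono) auto
  also have "\<dots> = 2 powr (- real (ex k j))" by (simp add: powr_minus powr_realpow field_simps)
  also have "\<dots> \<le> 2 powr (- (real k * (1 + \<gamma> j)))" using ex_bounds(1)[of k j] by simp
  finally show ?thesis .
qed

definition link :: "(real ^ 'n \<Rightarrow> 'b) \<Rightarrow> nat \<Rightarrow> ('n \<Rightarrow> nat) \<Rightarrow> 'b::ab_group_add" where
  "link f l w = f (pt (Suc l) w) - f (pt l (par l (Suc l) w))"

lemma chaining:
  fixes f :: "real ^ 'n \<Rightarrow> real"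
  assumes "k \<le> m"
  shows "\<bar>f (pt m z) - f (pt k (par k m z))\<bar> \<le> (\<Sum>i<m-k. \<bar>link f (k + i) (par (Suc (k + i)) m z)\<bar>)"
proof -
  define g where "g i = f (pt (k + i) (par (k + i) m z))" for i
  have "g (m - k) - g 0 = (\<Sum>i<m-k. g (Suc i) - g i)" by (simp add: sum_lessThan_telescope)
  also have "\<dots> = (\<Sum>i<m-k. link f (k + i) (par (Suc (k + i)) m z))"
    by (intro sum.cong refl) (simp add: g_def link_def par_par)
  finally have "\<bar>g (m - k) - g 0\<bar> \<le> (\<Sum>i<m-k. \<bar>link f (k + i) (par (Suc (k + i)) m z)\<bar>)"
    by (simp add: sum_abs)
  then show ?thesis using assms by (simp add: g_def)
qed

end

section \<open>Geometric and double exponential sums\<close>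

lemma two_powr_split: "(2::real) powr (a - b / c) = 2 powr a * 2 powr (- b / c)"
  by (simp add: powr_add[symmetric])

text \<open>With \<open>x = 2 powr (i / 2) / 2\<close>, the exponential of \<open>- x\<close> is
  eventually below \<open>x\<close> to the power \<open>- k\<close>, which is of order
  \<open>2 powr (- i * k / 2)\<close>. Taking \<open>k \<ge> 2 * (q + 1)\<close> outweighs
  \<open>2 powr (i * q)\<close> and leaves \<open>2 powr - i\<close>.\<close>

lemma double_exponential_decay:
  fixes q :: real
  assumes "0 < q"
  shows "(\<lambda>i::nat. 2 powr ((real i + 1) * q) * exp (- (2 powr (real i / 2)) / 2)) \<in> O(\<lambda>i. (1/2) ^ i)"
proof (rule bigoI)
  define k where "k = nat \<lceil>2 * (q + 1)\<rceil>"
  have k: "2 * (q + 1) \<le> real k" unfolding k_def by linarith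
  define x where "x i = 2 powr (real i / 2) / 2" for i :: nat
  have xpos: "0 < x i" for i by (simp add: x_def)
  have "filterlim x at_top sequentially" unfolding x_def by real_asymp
  from filterlim_compose[OF tendsto_power_div_exp_0 this, of k]
  have "\<forall>\<^sub>F i in sequentially. x i ^ k / exp (x i) < 1" by (rule order_tendstoD) simp
  then show "\<forall>\<^sub>F i in sequentially. norm (2 powr ((real i + 1) * q) * exp (- (2 powr (real i / 2)) / 2))
      \<le> 2 ^ k * 2 powr q * norm ((1/2::real) ^ i)"
  proof eventually_elim
    case (elim i)
    have xk: "x i ^ k = 2 powr (real i * real k / 2) / 2 ^ k"
    proof -
      have "(2 powr (real i / 2)) ^ k = (2 powr (real i / 2)) powr real k"
        by (rule powr_realpow[symmetric]) simp
      then show ?thesis by (simp add: x_def power_divide powr_powr)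
    qed
    have "exp (- x i) \<le> 1 / x i ^ k" using elim xpos[of i] by (simp add: exp_minus field_simps)
    moreover have "1 / x i ^ k = 2 ^ k * 2 powr (- (real i * real k / 2))"
      unfolding xk by (simp only: powr_minus_divide divide_divide_eq_right mult_1 times_divide_eq_right mult_1_right)
    ultimately have b1: "exp (- x i) \<le> 2 ^ k * 2 powr (- (real i * real k / 2))"
      by (simp only:)
    have "q + 1 = 2 * (q + 1) / 2" by simp
    also have "\<dots> \<le> real k / 2" using k by (rule divide_right_mono) simp
    finally have "q + 1 \<le> real k / 2" .
    then have "real i * (q + 1) \<le> real i * (real k / 2)" by (rule mult_left_mono) simp
    then have "- (real i * real k / 2) \<le> - (real i * (q + 1))"
      unfolding times_divide_eq_right by (rule le_imp_neg_le)
    then have b2: "2 powr (- (real i * real k / 2)) \<le> (2::real) powr (- (real i * (q + 1)))"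
      by (rule powr_mono) simp
    have "(2::real) ^ k * 2 powr (- (real i * real k / 2)) \<le> 2 ^ k * 2 powr (- (real i * (q + 1)))"
      by (rule mult_left_mono[OF b2]) simp
    with b1 have b3: "exp (- x i) \<le> 2 ^ k * 2 powr (- (real i * (q + 1)))" by (rule order_trans)
    have "2 powr ((real i + 1) * q) * exp (- x i) \<le> 2 powr ((real i + 1) * q) * (2 ^ k * 2 powr (- (real i * (q + 1))))"
      by (rule mult_left_mono[OF b3]) simp
    moreover have "2 powr ((real i + 1) * q) * 2 powr (- (real i * (q + 1))) = 2 powr q * 2 powr (- real i)"
      unfolding powr_add[symmetric] by (rule arg_cong[where f="(powr) 2"]) (simp add: algebra_simps)
    moreover have "2 powr (- real i) = (1/2::real) ^ i" by (simp add: powr_minus powr_realpow power_one_over inverse_eq_divide)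
    ultimately have "2 powr ((real i + 1) * q) * exp (- x i) \<le> 2 ^ k * (2 powr q * (1/2) ^ i)"
      by (simp only: mult.left_commute[of "2 powr ((real i + 1) * q)" "2 ^ k"])
    then show ?case by (simp add: x_def mult.assoc)
  qed
qed

text \<open>The ratio \<open>2 powr (- 1 / 4)\<close> is at most \<open>6 / 7\<close>, because
  \<open>(6 / 7) ^ 4 = 1296 / 2401\<close> exceeds \<open>1 / 2\<close>; the geometric series then
  stays below \<open>1 / (1 - 6 / 7)\<close>.\<close>

lemma sum_powr_quarter_le: "(\<Sum>i<n. 2 powr (- real i / 4)) \<le> 7"
proof -
  define x where "x = (2::real) powr (- 1 / 4)"
  have x: "0 < x" by (simp add: x_def)
  have "x ^ 4 = x powr (real 4)" by (rule powr_realpow[OF x, symmetric])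
  also have "\<dots> = 1/2" unfolding x_def powr_powr by (simp add: powr_minus)
  also have "\<dots> \<le> (6/7) ^ 4" by (simp add: power_divide)
  finally have x67: "x \<le> 6/7" using power_le_imp_le_base[of x 3 "6/7"] by simp
  have e: "2 powr (- real i / 4) = x ^ i" for i
    unfolding powr_realpow[OF x, symmetric] unfolding x_def powr_powr by simp
  have "(\<Sum>i<n. x ^ i) * (1 - x) = 1 - x ^ n" using x67 x
    by (subst sum_gp_strict) (auto simp: field_simps)
  also have "\<dots> \<le> 1" using x by simp
  finally have "(\<Sum>i<n. x ^ i) * (1 - x) \<le> 1" .
  moreover have "(\<Sum>i<n. x ^ i) * (1/7) \<le> (\<Sum>i<n. x ^ i) * (1 - x)"
    using x67 x by (intro mult_left_mono sum_nonneg) auto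
  ultimately show ?thesis unfolding e by linarith
qed

lemma sum_powr_half_le: "(\<Sum>i<n. 2 powr (- real i / 2)) \<le> 7"
  by (rule order_trans[OF sum_mono sum_powr_quarter_le]) simp

lemma sum_powr_half_centered_le: "(\<Sum>i<n. 2 powr (- \<bar>real i - real J\<bar> / 2)) \<le> 14"
proof -
  let ?g = "\<lambda>i. 2 powr (- \<bar>real i - real J\<bar> / 2)"
  have "(\<Sum>i<n. ?g i) \<le> (\<Sum>i\<in>{..<J} \<union> (\<lambda>i. J + i) ` {..<n}. ?g i)"
  proof (intro sum_mono2 subsetI)
    fix i assume "i \<in> {..<n}"
    then show "i \<in> {..<J} \<union> (\<lambda>i. J + i) ` {..<n}"
      by (cases "i < J") (auto intro!: image_eqI[of _ _ "i - J"])
  qed auto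
  also have "\<dots> = (\<Sum>i<J. ?g i) + (\<Sum>i\<in>(\<lambda>i. J + i) ` {..<n}. ?g i)"
    by (intro sum.union_disjoint) auto
  also have "(\<Sum>i\<in>(\<lambda>i. J + i) ` {..<n}. ?g i) = (\<Sum>i<n. 2 powr (- real i / 2))"
    by (subst sum.reindex) (auto simp: inj_on_def)
  also have "(\<Sum>i<J. ?g i) \<le> (\<Sum>i<J. 2 powr (- real i / 2))"
  proof -
    have "(\<Sum>i<J. ?g i) = (\<Sum>i<J. ?g (J - Suc i))" by (rule sum.nat_diff_reindex[symmetric])
    also have "\<dots> \<le> (\<Sum>i<J. 2 powr (- real i / 2))"
      by (intro sum_mono) (auto simp: of_nat_diff)
    finally show ?thesis .
  qed
  finally show ?thesis using sum_powr_half_le[of J] sum_powr_half_le[of n] by linarith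
qed

section \<open>Oscillation of a Gaussian field over a grid box\<close>

locale gaussian_grid = gaussian_space M H + grid \<gamma> p h
  for M :: "'w measure" and H and \<gamma> :: "'n::finite \<Rightarrow> real" and p h
begin

lemma link_apply: "link (\<lambda>t. f t \<omega>) l w = f (pt (Suc l) w) \<omega> - f (pt l (par l (Suc l) w)) \<omega>"
  by (simp add: link_def)

lemma link_mem:
  assumes "\<And>t. t \<in> cube \<Longrightarrow> f t \<in> H" "w \<in> Z (Suc l)"
  shows "(\<lambda>\<omega>. link (\<lambda>t. f t \<omega>) l w) \<in> H"
  unfolding link_apply using assms by (intro diff_mem assms(1) pt_mem_cube par_mem) auto

text \<open>If the oscillation exceeds \<open>T\<close>, then some link of the chain exceeds its
  share \<open>\<tau> i\<close>; the rest is a union bound over the links below the box, level by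
  level.\<close>

lemma osc_tail:
  assumes km: "k \<le> m" and R: "R \<in> Z k" and f: "\<And>t. t \<in> cube \<Longrightarrow> f t \<in> H"
    and s: "\<And>i w. w \<in> Z (Suc (k + i)) \<Longrightarrow> sd (\<lambda>\<omega>. link (\<lambda>t. f t \<omega>) (k + i) w) \<le> s i" "\<And>i. 0 < s i"
    and \<tau>: "\<And>i. 0 \<le> \<tau> i" "(\<Sum>i<m-k. \<tau> i) \<le> T"
  shows "prob {\<omega>\<in>space M. \<exists>z\<in>sub k m R. \<bar>f (pt m z) \<omega> - f (pt k R) \<omega>\<bar> > T}
    \<le> (\<Sum>i<m-k. 2 ^ CARD('n) * 2 powr ((real i + 1) * Q) * (sqrt 2 * exp (- (\<tau> i)\<^sup>2 / (4 * (s i)\<^sup>2))))"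
proof -
  define L where "L i w = {\<omega>\<in>space M. \<bar>link (\<lambda>t. f t \<omega>) (k + i) w\<bar> > \<tau> i}" for i w
  have wZ: "w \<in> Z (Suc (k + i))" if "w \<in> sub k (Suc (k + i)) R" for i w using that by (simp add: sub_def)
  have L_ev: "L i w \<in> events" if "w \<in> sub k (Suc (k + i)) R" for i w
  proof -
    note [measurable] = measurable_mem[OF link_mem[OF f wZ[OF that]]]
    show ?thesis unfolding L_def by measurable
  qed
  have "{\<omega>\<in>space M. \<exists>z\<in>sub k m R. \<bar>f (pt m z) \<omega> - f (pt k R) \<omega>\<bar> > T}
     \<subseteq> (\<Union>i<m-k. \<Union>w\<in>sub k (Suc (k + i)) R. L i w)"
  proof (rule subsetI, rule ccontr)
    fix \<omega> assume a: "\<omega> \<in> {\<omega>\<in>space M. \<exists>z\<in>sub k m R. \<bar>f (pt m z) \<omega> - f (pt k R) \<omega>\<bar> > T}"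
      and n: "\<omega> \<notin> (\<Union>i<m-k. \<Union>w\<in>sub k (Suc (k + i)) R. L i w)"
    then obtain z where z: "z \<in> sub k m R" "\<bar>f (pt m z) \<omega> - f (pt k R) \<omega>\<bar> > T" by auto
    have "\<bar>f (pt m z) \<omega> - f (pt k R) \<omega>\<bar> \<le> (\<Sum>i<m-k. \<bar>link (\<lambda>t. f t \<omega>) (k + i) (par (Suc (k + i)) m z)\<bar>)"
      using chaining[OF km, of "\<lambda>t. f t \<omega>" z] z(1) by (simp add: sub_def)
    also have "\<dots> \<le> (\<Sum>i<m-k. \<tau> i)"
    proof (rule sum_mono)
      fix i assume i: "i \<in> {..<m-k}"
      then have "par (Suc (k + i)) m z \<in> sub k (Suc (k + i)) R" using z(1) by (intro par_mem_sub) auto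
      then show "\<bar>link (\<lambda>t. f t \<omega>) (k + i) (par (Suc (k + i)) m z)\<bar> \<le> \<tau> i"
        using n a i by (force simp: L_def)
    qed
    finally show False using z(2) \<tau>(2) by linarith
  qed
  then have "prob {\<omega>\<in>space M. \<exists>z\<in>sub k m R. \<bar>f (pt m z) \<omega> - f (pt k R) \<omega>\<bar> > T}
     \<le> prob (\<Union>i<m-k. \<Union>w\<in>sub k (Suc (k + i)) R. L i w)"
    using L_ev by (intro finite_measure_mono) auto
  also have "\<dots> \<le> (\<Sum>i<m-k. prob (\<Union>w\<in>sub k (Suc (k + i)) R. L i w))"
    using L_ev by (intro finite_measure_subadditive_finite) auto
  also have "\<dots> \<le> (\<Sum>i<m-k. \<Sum>w\<in>sub k (Suc (k + i)) R. prob (L i w))"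
    using L_ev by (intro sum_mono finite_measure_subadditive_finite) auto
  also have "\<dots> \<le> (\<Sum>i<m-k. 2 ^ CARD('n) * 2 powr ((real i + 1) * Q) * (sqrt 2 * exp (- (\<tau> i)\<^sup>2 / (4 * (s i)\<^sup>2))))"
  proof (rule sum_mono)
    fix i
    have "(\<Sum>w\<in>sub k (Suc (k + i)) R. prob (L i w)) \<le> (\<Sum>w\<in>sub k (Suc (k + i)) R. sqrt 2 * exp (- (\<tau> i)\<^sup>2 / (4 * (s i)\<^sup>2)))"
      unfolding L_def using s \<tau> by (intro sum_mono tail_mem link_mem[OF f]) (auto dest: wZ)
    also have "\<dots> = real (card (sub k (Suc (k + i)) R)) * (sqrt 2 * exp (- (\<tau> i)\<^sup>2 / (4 * (s i)\<^sup>2)))" by simp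
    also have "\<dots> \<le> 2 ^ CARD('n) * 2 powr ((real i + 1) * Q) * (sqrt 2 * exp (- (\<tau> i)\<^sup>2 / (4 * (s i)\<^sup>2)))"
      using card_sub_bounds(1)[of k "Suc (k + i)" R] R by (intro mult_right_mono) (auto simp: add.commute)
    finally show "(\<Sum>w\<in>sub k (Suc (k + i)) R. prob (L i w)) \<le> 2 ^ CARD('n) * 2 powr ((real i + 1) * Q) * (sqrt 2 * exp (- (\<tau> i)\<^sup>2 / (4 * (s i)\<^sup>2)))" .
  qed
  finally show ?thesis .
qed

text \<open>The index gives \<open>l \<ge> Q + 1\<close>. Fine links cost
  \<open>2 powr (- (i - J) * l)\<close> each, and this has to outrun their number, which grows like
  \<open>2 powr (i * Q)\<close>.\<close>

definition ball_const :: real where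
  "ball_const = 14 * 2 ^ CARD('n) * 2 powr Q * (33 + code_const (nat \<lceil>Q\<rceil> + 1))"

lemma ball_const_pos: "0 < ball_const"
  unfolding ball_const_def using code_const_ge_1[of "nat \<lceil>Q\<rceil> + 1"] by simp

text \<open>The allowance of a link peaks at \<open>i = J\<close> and falls geometrically on both
  sides, so all allowances add up to a multiple of the target. The number of links times the coding
  cost of one also peaks near \<open>i = J\<close>: coarser links are few, and finer ones are small
  enough to be cheap. This produces the exponent \<open>2 powr (J * Q)\<close>.\<close>

lemma small_ball_box:
  fixes f :: "'c::finite \<Rightarrow> real ^ 'n \<Rightarrow> 'w \<Rightarrow> real"
  assumes km: "k \<le> m" and R: "R \<in> Z k" and f: "\<And>c t. t \<in> cube \<Longrightarrow> f c t \<in> H"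
    and A: "0 < A"
    and s: "\<And>c i w. w \<in> Z (Suc (k + i)) \<Longrightarrow> sd (\<lambda>\<omega>. link (\<lambda>t. f c t \<omega>) (k + i) w) \<le> A * 2 powr - (real k + real i)"
  shows "prob {\<omega>\<in>space M. \<forall>c. \<forall>z\<in>sub k m R. \<bar>f c (pt m z) \<omega> - f c (pt k R) \<omega>\<bar> \<le> 14 * A * 2 powr - (real k + real J)}
    \<ge> exp (- 2 * (real CARD('c) * ball_const * 2 powr (real J * Q))) / 4"
proof -
  define l where "l = nat \<lceil>Q\<rceil> + 1"
  have lQ: "Q + 1 \<le> real l" unfolding l_def by linarith
  define I where "I = (UNIV :: 'c set) \<times> (SIGMA i:{..<m-k}. sub k (Suc (k + i)) R)"
  define Y where "Y = (\<lambda>(c, i, w) \<omega>. link (\<lambda>t. f c t \<omega>) (k + i) w)"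
  define s' where "s' i = A * 2 powr - (real k + real i)" for i :: nat
  define a where "a i = A * 2 powr (- (real k + real J) - \<bar>real i - real J\<bar> / 2)" for i :: nat
  have ratio: "s' i / a i = 2 powr (real J - real i + \<bar>real i - real J\<bar> / 2)" for i
    using A by (simp add: s'_def a_def powr_diff[symmetric] algebra_simps)
  have wZ: "w \<in> Z (Suc (k + i))" if "w \<in> sub k (Suc (k + i)) R" for i w using that by (simp add: sub_def)
  have finI: "finite I" unfolding I_def by auto
  have "exp (- 2 * (\<Sum>x\<in>I. code_cost l (s' (fst (snd x)) / a (fst (snd x))))) / 4 \<le> prob {\<omega>\<in>space M. \<forall>x\<in>I. \<bar>Y x \<omega>\<bar> \<le> a (fst (snd x))}"
  proof (rule small_ball[OF finI])
    fix x assume "x \<in> I"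
    then obtain c i w where x: "x = (c, i, w)" "w \<in> sub k (Suc (k + i)) R" unfolding I_def by auto
    show "Y x \<in> H" unfolding Y_def x using link_mem[of "f c", OF f wZ[OF x(2)]] by simp
    show "sd (Y x) \<le> s' (fst (snd x))" unfolding Y_def x using s[OF wZ[OF x(2)], of c] by (simp add: s'_def)
    show "0 < s' (fst (snd x))" "0 < a (fst (snd x))" using A by (auto simp: s'_def a_def)
  qed
  moreover have "(\<Sum>x\<in>I. code_cost l (s' (fst (snd x)) / a (fst (snd x)))) \<le> real CARD('c) * ball_const * 2 powr (real J * Q)"
  proof -
    \<comment> \<open>Either case leaves a summable factor \<open>2 powr (- |i - J| / 2)\<close>:
      for coarse links since \<open>Q \<ge> 1\<close> while the cost grows with rate 1/2, for fine
      links since \<open>l \<ge> Q + 1/2\<close>.\<close>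
    have cost: "2 powr ((real i + 1) * Q) * code_cost l (s' i / a i) \<le> (33 + code_const l) * (2 powr (real J * Q + Q) * 2 powr (- \<bar>real i - real J\<bar> / 2))" for i
    proof (cases "i \<le> J")
      case True
      then have "code_cost l (s' i / a i) = 33 * 2 powr ((real J - real i) / 2)"
      proof -
        have "(real J - real i + \<bar>real i - real J\<bar> / 2) * (1 / 3) = (real J - real i) / 2"
        proof -
          have "\<bar>real i - real J\<bar> = real J - real i" using True by simp
          then show ?thesis by (simp only:) (simp add: field_simps)
        qed
        then have "(2 powr (real J - real i + \<bar>real i - real J\<bar> / 2)) powr (1/3) = 2 powr ((real J - real i) / 2)"
          by (simp only: powr_powr)
        moreover have "1 \<le> 2 powr (real J - real i + \<bar>real i - real J\<bar> / 2)" using True by (simp add: ge_one_powr_ge_zero)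
        ultimately show ?thesis unfolding ratio code_cost_def by simp
      qed
      then have "2 powr ((real i + 1) * Q) * code_cost l (s' i / a i) = 33 * 2 powr ((real i + 1) * Q + (real J - real i) / 2)"
        by (simp add: powr_add)
      also have "\<dots> \<le> 33 * 2 powr (real J * Q + Q - \<bar>real i - real J\<bar> / 2)"
      proof -
        have "(real J - real i) * 1 \<le> (real J - real i) * Q" using True Q_ge_1 by (intro mult_left_mono) auto
        then have "(real i + 1) * Q + (real J - real i) / 2 \<le> real J * Q + Q - \<bar>real i - real J\<bar> / 2"
          using True by (simp add: algebra_simps)
        then show ?thesis by simp
      qed
      also have "\<dots> \<le> (33 + code_const l) * 2 powr (real J * Q + Q - \<bar>real i - real J\<bar> / 2)"
        using code_const_ge_1[of l] by (intro mult_right_mono) auto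
      finally show ?thesis by (simp add: powr_add[symmetric])
    next
      case False
      have "\<bar>real i - real J\<bar> = real i - real J" using False by simp
      then have ab: "real J - real i + \<bar>real i - real J\<bar> / 2 = - (real i - real J) / 2"
        by (simp only:) (simp add: field_simps)
      have "(2::real) powr (- (real i - real J) / 2) < 2 powr 0" using False by (intro powr_less_mono) auto
      then have lt: "\<not> 1 \<le> (2::real) powr (- (real i - real J) / 2)" by simp
      have "((2::real) powr (- (real i - real J) / 2)) ^ (2 * l) = (2 powr (- (real i - real J) / 2)) powr real (2 * l)"
        by (rule powr_realpow[symmetric]) simp
      also have "\<dots> = 2 powr (- (real i - real J) * real l)"
        unfolding powr_powr by (rule arg_cong[where f="(powr) 2"]) simp
      finally have "code_cost l (s' i / a i) = code_const l * 2 powr (- (real i - real J) * real l)"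
        unfolding ratio code_cost_def ab using lt by simp
      then have "2 powr ((real i + 1) * Q) * code_cost l (s' i / a i) = code_const l * 2 powr ((real i + 1) * Q - (real i - real J) * real l)"
        by (simp add: powr_add powr_diff powr_minus field_simps)
      also have "\<dots> \<le> code_const l * 2 powr (real J * Q + Q - \<bar>real i - real J\<bar> / 2)"
      proof -
        have "(real i - real J) * (Q + 1/2) \<le> (real i - real J) * real l" using False lQ by (intro mult_left_mono) auto
        then have "(real i + 1) * Q - (real i - real J) * real l \<le> real J * Q + Q - \<bar>real i - real J\<bar> / 2"
          using False by (simp add: algebra_simps)
        then show ?thesis using code_const_ge_1[of l] by (intro mult_left_mono) auto
      qed
      also have "\<dots> \<le> (33 + code_const l) * 2 powr (real J * Q + Q - \<bar>real i - real J\<bar> / 2)"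
        by (intro mult_right_mono) auto
      finally show ?thesis by (simp add: powr_add[symmetric])
    qed
    have "(\<Sum>x\<in>I. code_cost l (s' (fst (snd x)) / a (fst (snd x))))
        = (\<Sum>c\<in>(UNIV::'c set). \<Sum>i<m-k. \<Sum>w\<in>sub k (Suc (k + i)) R. code_cost l (s' i / a i))"
    proof -
      have "(\<Sum>i<m-k. \<Sum>w\<in>sub k (Suc (k + i)) R. code_cost l (s' i / a i))
          = (\<Sum>y\<in>(SIGMA i:{..<m-k}. sub k (Suc (k + i)) R). code_cost l (s' (fst y) / a (fst y)))"
        by (subst sum.Sigma) (auto simp: case_prod_beta)
      then show ?thesis unfolding I_def by (simp only: sum.cartesian_product split_def)
    qed
    also have "\<dots> = real CARD('c) * (\<Sum>i<m-k. real (card (sub k (Suc (k + i)) R)) * code_cost l (s' i / a i))" by simp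
    also have "\<dots> \<le> real CARD('c) * (\<Sum>i<m-k. 2 ^ CARD('n) * ((33 + code_const l) * (2 powr (real J * Q + Q) * 2 powr (- \<bar>real i - real J\<bar> / 2))))"
    proof (intro mult_left_mono sum_mono)
      fix i
      have "real (card (sub k (Suc (k + i)) R)) * code_cost l (s' i / a i) \<le> (2 ^ CARD('n) * 2 powr ((real i + 1) * Q)) * code_cost l (s' i / a i)"
        using card_sub_bounds(1)[of k "Suc (k + i)" R] R A code_cost_pos[of "s' i / a i" l]
        by (intro mult_right_mono) (auto simp: add.commute s'_def a_def)
      also have "\<dots> = 2 ^ CARD('n) * (2 powr ((real i + 1) * Q) * code_cost l (s' i / a i))" by simp
      also have "\<dots> \<le> 2 ^ CARD('n) * ((33 + code_const l) * (2 powr (real J * Q + Q) * 2 powr (- \<bar>real i - real J\<bar> / 2)))"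
        by (intro mult_left_mono cost) auto
      finally show "real (card (sub k (Suc (k + i)) R)) * code_cost l (s' i / a i) \<le> 2 ^ CARD('n) * ((33 + code_const l) * (2 powr (real J * Q + Q) * 2 powr (- \<bar>real i - real J\<bar> / 2)))" .
    qed auto
    also have "\<dots> = real CARD('c) * (2 ^ CARD('n) * (33 + code_const l) * 2 powr (real J * Q + Q)) * (\<Sum>i<m-k. 2 powr (- \<bar>real i - real J\<bar> / 2))"
      by (simp add: sum_distrib_left mult_ac)
    also have "\<dots> \<le> real CARD('c) * (2 ^ CARD('n) * (33 + code_const l) * 2 powr (real J * Q + Q)) * 14"
      using code_const_ge_1[of l] by (intro mult_left_mono sum_powr_half_centered_le) auto
    also have "\<dots> = real CARD('c) * ball_const * 2 powr (real J * Q)"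
      unfolding ball_const_def l_def[symmetric] by (simp add: powr_add)
    finally show ?thesis .
  qed
  then have "exp (- 2 * (real CARD('c) * ball_const * 2 powr (real J * Q))) / 4 \<le> exp (- 2 * (\<Sum>x\<in>I. code_cost l (s' (fst (snd x)) / a (fst (snd x))))) / 4"
    by simp
  moreover have "prob {\<omega>\<in>space M. \<forall>x\<in>I. \<bar>Y x \<omega>\<bar> \<le> a (fst (snd x))}
     \<le> prob {\<omega>\<in>space M. \<forall>c. \<forall>z\<in>sub k m R. \<bar>f c (pt m z) \<omega> - f c (pt k R) \<omega>\<bar> \<le> 14 * A * 2 powr - (real k + real J)}"
  proof (rule finite_measure_mono)
    show "{\<omega>\<in>space M. \<forall>x\<in>I. \<bar>Y x \<omega>\<bar> \<le> a (fst (snd x))} \<subseteq> {\<omega>\<in>space M. \<forall>c. \<forall>z\<in>sub k m R. \<bar>f c (pt m z) \<omega> - f c (pt k R) \<omega>\<bar> \<le> 14 * A * 2 powr - (real k + real J)}"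
    proof safe
      fix \<omega> c z assume \<omega>: "\<forall>x\<in>I. \<bar>Y x \<omega>\<bar> \<le> a (fst (snd x))" and z: "z \<in> sub k m R"
      have "\<bar>f c (pt m z) \<omega> - f c (pt k R) \<omega>\<bar> \<le> (\<Sum>i<m-k. \<bar>link (\<lambda>t. f c t \<omega>) (k + i) (par (Suc (k + i)) m z)\<bar>)"
        using chaining[OF km, of "\<lambda>t. f c t \<omega>" z] z(1) by (simp add: sub_def)
      also have "\<dots> \<le> (\<Sum>i<m-k. a i)"
      proof (rule sum_mono)
        fix i assume i: "i \<in> {..<m-k}"
        then have "par (Suc (k + i)) m z \<in> sub k (Suc (k + i)) R" using z(1) by (intro par_mem_sub) auto
        then have "(c, i, par (Suc (k + i)) m z) \<in> I" using i by (auto simp: I_def)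
        from bspec[OF \<omega> this] show "\<bar>link (\<lambda>t. f c t \<omega>) (k + i) (par (Suc (k + i)) m z)\<bar> \<le> a i"
          by (simp add: Y_def)
      qed
      also have "\<dots> = A * 2 powr - (real k + real J) * (\<Sum>i<m-k. 2 powr (- \<bar>real i - real J\<bar> / 2))"
        by (simp add: a_def sum_distrib_left powr_add[symmetric] mult.assoc)
      also have "\<dots> \<le> A * 2 powr - (real k + real J) * 14"
        using A by (intro mult_left_mono sum_powr_half_centered_le) auto
      finally show "\<bar>f c (pt m z) \<omega> - f c (pt k R) \<omega>\<bar> \<le> 14 * A * 2 powr - (real k + real J)" by simp
    qed
    have ev: "{\<omega>\<in>space M. \<bar>f c (pt m z) \<omega> - f c (pt k R) \<omega>\<bar> \<le> 14 * A * 2 powr - (real k + real J)} \<in> events" if "z \<in> sub k m R" for c z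
    proof -
      have "pt m z \<in> cube" "pt k R \<in> cube" using that R by (auto simp: sub_def intro: pt_mem_cube)
      note [measurable] = measurable_mem[OF f[OF this(1)]] measurable_mem[OF f[OF this(2)]]
      show ?thesis by measurable
    qed
    have "{\<omega>\<in>space M. \<forall>c\<in>UNIV. \<forall>z\<in>sub k m R. \<bar>f c (pt m z) \<omega> - f c (pt k R) \<omega>\<bar> \<le> 14 * A * 2 powr - (real k + real J)} \<in> events"
      by (intro sets.sets_Collect_finite_All ev finite_sub finite)
    then show "{\<omega>\<in>space M. \<forall>c. \<forall>z\<in>sub k m R. \<bar>f c (pt m z) \<omega> - f c (pt k R) \<omega>\<bar> \<le> 14 * A * 2 powr - (real k + real J)} \<in> events"
      by (simp only: ball_UNIV)
  qed
  ultimately show ?thesis by linarith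
qed

text \<open>The contribution of level \<open>i\<close> to the union bound of \<open>osc_tail\<close>
  when the Gaussian exponent there is \<open>2 powr (i / 2) / 2\<close>.\<close>

definition tail_term :: "nat \<Rightarrow> real" where
  "tail_term i = 2 ^ CARD('n) * 2 powr ((real i + 1) * Q) * (sqrt 2 * exp (- (2 powr (real i / 2)) / 2))"

lemma summable_tail_term: "summable tail_term"
proof (rule summable_comparison_test_bigo)
  show "summable (\<lambda>i. norm ((1/2::real) ^ i))" by simp
  have "(\<lambda>i. (2 ^ CARD('n) * sqrt 2) * (2 powr ((real i + 1) * Q) * exp (- (2 powr (real i / 2)) / 2))) \<in> O(\<lambda>i. (1/2) ^ i)"
    using double_exponential_decay[of Q] Q_ge_1 by (subst landau_o.big.cmult_in_iff) auto
  then show "tail_term \<in> O(\<lambda>i. (1/2) ^ i)" unfolding tail_term_def by (simp add: mult_ac)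
qed

definition tail_const :: real where "tail_const = (\<Sum>i. tail_term i)"

lemma tail_term_nonneg: "0 \<le> tail_term i"
  by (simp add: tail_term_def)

lemma sum_tail_term_le: "(\<Sum>i<n. tail_term i) \<le> tail_const"
  unfolding tail_const_def by (rule sum_le_suminf[OF summable_tail_term]) (auto simp: tail_term_nonneg)

text \<open>The links shrink like \<open>2 powr (- i / 2)\<close> but the thresholds only like
  \<open>2 powr (- i / 4)\<close>, so the Gaussian exponent is \<open>D * 2 powr (i / 2)\<close>.
  This splits into a part summable against the number of links and the common factor
  \<open>exp (- D / 2)\<close>.\<close>

lemma osc_tail_box:
  assumes km: "k \<le> m" and R: "R \<in> Z k" and f: "\<And>t. t \<in> cube \<Longrightarrow> f t \<in> H"
    and b: "0 < b"
    and s: "\<And>i w. w \<in> Z (Suc (k + i)) \<Longrightarrow> sd (\<lambda>\<omega>. link (\<lambda>t. f t \<omega>) (k + i) w) \<le> b * 2 powr (- real k - real i / 2)"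
    and D: "D = (r / (2 * b))\<^sup>2" "1 \<le> D" and r: "0 < r"
  shows "prob {\<omega>\<in>space M. \<exists>z\<in>sub k m R. \<bar>f (pt m z) \<omega> - f (pt k R) \<omega>\<bar> > 7 * r * 2 powr - real k}
    \<le> tail_const * exp (- D / 2)"
proof -
  let ?s = "\<lambda>i. b * 2 powr (- real k - real i / 2)" and ?\<tau> = "\<lambda>i. r * 2 powr (- real k - real i / 4)"
  have "prob {\<omega>\<in>space M. \<exists>z\<in>sub k m R. \<bar>f (pt m z) \<omega> - f (pt k R) \<omega>\<bar> > 7 * r * 2 powr - real k}
    \<le> (\<Sum>i<m-k. 2 ^ CARD('n) * 2 powr ((real i + 1) * Q) * (sqrt 2 * exp (- (?\<tau> i)\<^sup>2 / (4 * (?s i)\<^sup>2))))"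
  proof (rule osc_tail[OF km R f s])
    have "(\<Sum>i<m-k. ?\<tau> i) = r * 2 powr (- real k) * (\<Sum>i<m-k. 2 powr (- real i / 4))"
      by (simp only: sum_distrib_left two_powr_split mult.assoc)
    also have "\<dots> \<le> r * 2 powr (- real k) * 7"
      using r by (intro mult_left_mono sum_powr_quarter_le) auto
    finally show "(\<Sum>i<m-k. ?\<tau> i) \<le> 7 * r * 2 powr - real k" by simp
  qed (use b r in auto)
  also have "\<dots> \<le> (\<Sum>i<m-k. tail_term i * exp (- D / 2))"
  proof (rule sum_mono)
    fix i
    have "(?\<tau> i)\<^sup>2 / (4 * (?s i)\<^sup>2) = (?\<tau> i / (2 * ?s i))\<^sup>2" by (simp add: power_divide power_mult_distrib)
    also have "?\<tau> i / (2 * ?s i) = r / (2 * b) * 2 powr (real i / 4)"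
    proof -
      have "2 powr (- real k - real i / 4) = 2 powr (- real k - real i / 2) * 2 powr (real i / 4)"
        by (subst powr_add[symmetric], rule arg_cong[where f="(powr) 2"]) simp
      then show ?thesis using b by simp
    qed
    also have "(r / (2 * b) * 2 powr (real i / 4))\<^sup>2 = D * 2 powr (real i / 2)"
      by (simp only: D(1) power_mult_distrib) (simp add: power2_eq_square powr_add[symmetric])
    finally have e: "- (?\<tau> i)\<^sup>2 / (4 * (?s i)\<^sup>2) = - (D * 2 powr (real i / 2))" by simp
    have x: "1 \<le> 2 powr (real i / 2)" by (simp add: ge_one_powr_ge_zero)
    \<comment> \<open>For \<open>x = 2 powr (i / 2)\<close> this product together with
      \<open>D * x \<ge> 1\<close> gives \<open>2 * D * x \<ge> D + x\<close>, the announced split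
      of the exponent.\<close>
    have "0 \<le> (D - 1) * (2 powr (real i / 2) - 1)" using D(2) x by (intro mult_nonneg_nonneg) auto
    then have "D + 2 powr (real i / 2) \<le> D * 2 powr (real i / 2) + 1" by (simp add: algebra_simps)
    moreover have "1 * 1 \<le> D * 2 powr (real i / 2)" using D(2) x by (intro mult_mono) auto
    ultimately have "exp (- (?\<tau> i)\<^sup>2 / (4 * (?s i)\<^sup>2)) \<le> exp (- (2 powr (real i / 2)) / 2) * exp (- D / 2)"
      unfolding e by (simp add: mult_exp_exp field_simps)
    then have "2 ^ CARD('n) * 2 powr ((real i + 1) * Q) * (sqrt 2 * exp (- (?\<tau> i)\<^sup>2 / (4 * (?s i)\<^sup>2)))
       \<le> 2 ^ CARD('n) * 2 powr ((real i + 1) * Q) * (sqrt 2 * (exp (- (2 powr (real i / 2)) / 2) * exp (- D / 2)))"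
      by (intro mult_left_mono) auto
    then show "2 ^ CARD('n) * 2 powr ((real i + 1) * Q) * (sqrt 2 * exp (- (?\<tau> i)\<^sup>2 / (4 * (?s i)\<^sup>2))) \<le> tail_term i * exp (- D / 2)"
      by (simp add: tail_term_def mult.assoc)
  qed
  also have "\<dots> = (\<Sum>i<m-k. tail_term i) * exp (- D / 2)" by (simp add: sum_distrib_right)
  also have "\<dots> \<le> tail_const * exp (- D / 2)" by (intro mult_right_mono sum_tail_term_le) auto
  finally show ?thesis .
qed

text \<open>Chosen so that \<open>mod_const^2 / 4 = (Q + 1) * ln 2\<close>, which turns the Gaussian
  tails of \<open>modulus_tail\<close> into powers of 2.\<close>

definition mod_const :: real where "mod_const = 2 * sqrt ((Q + 1) * ln 2)"

text \<open>Thresholds carrying the factor \<open>k\<close> have Gaussian exponent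
  \<open>(Q + 1) * ln 2 * k^2 * 2 ^ i\<close>, and \<open>k^2 * 2 ^ i \<ge> k + i\<close>. This
  beats the \<open>2 powr (k * Q)\<close> boxes together with the
  \<open>2 powr ((i + 1) * Q)\<close> links in each, and leaves \<open>2 powr - k\<close>.\<close>

lemma modulus_tail:
  assumes km: "k \<le> m" and k: "1 \<le> k" and f: "\<And>t. t \<in> cube \<Longrightarrow> f t \<in> H"
    and A: "0 < A"
    and s: "\<And>i w. w \<in> Z (Suc (k + i)) \<Longrightarrow> sd (\<lambda>\<omega>. link (\<lambda>t. f t \<omega>) (k + i) w) \<le> A * 2 powr - (real k + real i)"
  shows "prob {\<omega>\<in>space M. \<exists>R\<in>Z k. \<exists>z\<in>sub k m R. \<bar>f (pt m z) \<omega> - f (pt k R) \<omega>\<bar> > 7 * A * mod_const * (real k * 2 powr - real k)}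
    \<le> 14 * 2 ^ CARD('n) * 2 ^ CARD('n) * 2 powr Q * 2 powr - real k"
proof -
  let ?s = "\<lambda>i. A * 2 powr - (real k + real i)" and ?\<tau> = "\<lambda>i. A * mod_const * real k * 2 powr (- real k - real i / 2)"
  let ?T = "7 * A * mod_const * (real k * 2 powr - real k)"
  let ?E = "\<lambda>R. {\<omega>\<in>space M. \<exists>z\<in>sub k m R. \<bar>f (pt m z) \<omega> - f (pt k R) \<omega>\<bar> > ?T}"
  have mc: "0 \<le> mod_const" "mod_const\<^sup>2 = 4 * ((Q + 1) * ln 2)" unfolding mod_const_def using Q_ge_1
    by (auto simp: power_mult_distrib)
  have E_ev: "?E R \<in> events" if "R \<in> Z k" for R
  proof -
    have "{\<omega>\<in>space M. \<bar>f (pt m z) \<omega> - f (pt k R) \<omega>\<bar> > ?T} \<in> events" if z: "z \<in> sub k m R" for z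
    proof -
      have "pt m z \<in> cube" "pt k R \<in> cube" using z \<open>R \<in> Z k\<close> by (auto simp: sub_def intro: pt_mem_cube)
      note [measurable] = measurable_mem[OF f[OF this(1)]] measurable_mem[OF f[OF this(2)]]
      show ?thesis by measurable
    qed
    from sets.sets_Collect_finite_Ex[OF this finite_sub] show ?thesis .
  qed
  have bound: "prob (?E R) \<le> 2 ^ CARD('n) * 2 powr Q * sqrt 2 * 7 * 2 powr (- real k * (Q + 1))" if R: "R \<in> Z k" for R
  proof -
    have "prob (?E R) \<le> (\<Sum>i<m-k. 2 ^ CARD('n) * 2 powr ((real i + 1) * Q) * (sqrt 2 * exp (- (?\<tau> i)\<^sup>2 / (4 * (?s i)\<^sup>2))))"
    proof (rule osc_tail[OF km R f s])
      have "(\<Sum>i<m-k. ?\<tau> i) = A * mod_const * real k * 2 powr (- real k) * (\<Sum>i<m-k. 2 powr (- real i / 2))"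
        by (simp only: sum_distrib_left two_powr_split mult.assoc)
      also have "\<dots> \<le> A * mod_const * real k * 2 powr (- real k) * 7"
        using A mc by (intro mult_left_mono sum_powr_half_le) auto
      finally show "(\<Sum>i<m-k. ?\<tau> i) \<le> ?T" by simp
    qed (use A mc in auto)
    also have "\<dots> \<le> (\<Sum>i<m-k. 2 ^ CARD('n) * 2 powr Q * sqrt 2 * 2 powr (- real k * (Q + 1)) * 2 powr (- real i / 2))"
    proof (rule sum_mono)
      fix i
      have "(?\<tau> i)\<^sup>2 / (4 * (?s i)\<^sup>2) = (?\<tau> i / (2 * ?s i))\<^sup>2" by (simp add: power_divide power_mult_distrib)
      also have "?\<tau> i / (2 * ?s i) = mod_const / 2 * real k * 2 powr (real i / 2)"
      proof -
        have "2 powr (- real k - real i / 2) = 2 powr - (real k + real i) * 2 powr (real i / 2)"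
          by (subst powr_add[symmetric], rule arg_cong[where f="(powr) 2"]) simp
        then show ?thesis using A by simp
      qed
      also have "(mod_const / 2 * real k * 2 powr (real i / 2))\<^sup>2 = (Q + 1) * ln 2 * ((real k)\<^sup>2 * 2 powr (real i))"
        by (simp add: power_mult_distrib power_divide mc powr_power)
      finally have e: "- (?\<tau> i)\<^sup>2 / (4 * (?s i)\<^sup>2) = - ((Q + 1) * ln 2 * ((real k)\<^sup>2 * 2 powr (real i)))" by simp
      have "real k + real i \<le> (real k)\<^sup>2 * 2 powr real i"
      proof -
        have "real k * 1 \<le> real k * real k" using k by (intro mult_left_mono) auto
        moreover have "1 + real i \<le> 2 powr real i" by (metis powr_realpow add.commute less_exp of_nat_Suc of_nat_le_iff of_nat_numeral of_nat_power Suc_leI zero_less_numeral)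
        ultimately have "real k * (1 + real i) \<le> (real k)\<^sup>2 * 2 powr real i"
          unfolding power2_eq_square by (intro mult_mono) auto
        moreover have "1 * real i \<le> real k * real i" using k by (intro mult_right_mono) auto
        ultimately show ?thesis by (simp add: algebra_simps)
      qed
      then have "(Q + 1) * ln 2 * (real k + real i) \<le> (Q + 1) * ln 2 * ((real k)\<^sup>2 * 2 powr (real i))"
        using Q_ge_1 by (intro mult_left_mono) auto
      then have "exp (- (?\<tau> i)\<^sup>2 / (4 * (?s i)\<^sup>2)) \<le> exp (- ((Q + 1) * ln 2 * (real k + real i)))"
        unfolding e by simp
      also have "\<dots> = 2 powr (- (Q + 1) * (real k + real i))" by (simp add: powr_def algebra_simps)
      finally have "2 ^ CARD('n) * 2 powr ((real i + 1) * Q) * (sqrt 2 * exp (- (?\<tau> i)\<^sup>2 / (4 * (?s i)\<^sup>2)))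
        \<le> 2 ^ CARD('n) * 2 powr ((real i + 1) * Q) * (sqrt 2 * 2 powr (- (Q + 1) * (real k + real i)))"
        by (intro mult_left_mono) auto
      also have "\<dots> = 2 ^ CARD('n) * 2 powr Q * sqrt 2 * 2 powr (- real k * (Q + 1)) * 2 powr (- real i)"
        by (simp add: powr_add[symmetric] algebra_simps)
      also have "\<dots> \<le> 2 ^ CARD('n) * 2 powr Q * sqrt 2 * 2 powr (- real k * (Q + 1)) * 2 powr (- real i / 2)"
        by (intro mult_left_mono) auto
      finally show "2 ^ CARD('n) * 2 powr ((real i + 1) * Q) * (sqrt 2 * exp (- (?\<tau> i)\<^sup>2 / (4 * (?s i)\<^sup>2)))
        \<le> 2 ^ CARD('n) * 2 powr Q * sqrt 2 * 2 powr (- real k * (Q + 1)) * 2 powr (- real i / 2)" .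
    qed
    also have "\<dots> = 2 ^ CARD('n) * 2 powr Q * sqrt 2 * 2 powr (- real k * (Q + 1)) * (\<Sum>i<m-k. 2 powr (- real i / 2))"
      by (simp add: sum_distrib_left)
    also have "\<dots> \<le> 2 ^ CARD('n) * 2 powr Q * sqrt 2 * 2 powr (- real k * (Q + 1)) * 7"
      by (intro mult_left_mono sum_powr_half_le) auto
    finally show ?thesis by (simp add: mult_ac)
  qed
  have "{\<omega>\<in>space M. \<exists>R\<in>Z k. \<exists>z\<in>sub k m R. \<bar>f (pt m z) \<omega> - f (pt k R) \<omega>\<bar> > ?T} = (\<Union>R\<in>Z k. ?E R)" by auto
  moreover have "prob (\<Union>R\<in>Z k. ?E R) \<le> (\<Sum>R\<in>Z k. prob (?E R))"
    by (rule finite_measure_subadditive_finite[OF finite_Z]) (use E_ev in blast)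
  ultimately have "prob {\<omega>\<in>space M. \<exists>R\<in>Z k. \<exists>z\<in>sub k m R. \<bar>f (pt m z) \<omega> - f (pt k R) \<omega>\<bar> > ?T} \<le> (\<Sum>R\<in>Z k. prob (?E R))"
    by (simp only:)
  also have "\<dots> \<le> real (card (Z k)) * (2 ^ CARD('n) * 2 powr Q * sqrt 2 * 7 * 2 powr (- real k * (Q + 1)))"
    using sum_bounded_above[of "Z k" "\<lambda>R. prob (?E R)"] bound by simp
  also have "\<dots> \<le> (2 ^ CARD('n) * 2 powr (real k * Q)) * (2 ^ CARD('n) * 2 powr Q * 2 * 7 * 2 powr (- real k * (Q + 1)))"
  proof (intro mult_mono card_Z_le)
    show "sqrt 2 \<le> (2::real)" using real_le_lsqrt[of 2 2] by simp
  qed auto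
  also have "\<dots> = 14 * 2 ^ CARD('n) * 2 ^ CARD('n) * 2 powr Q * 2 powr - real k"
  proof -
    have "2 powr (real k * Q) * 2 powr (- real k * (Q + 1)) = 2 powr - real k"
      by (simp add: powr_add[symmetric] algebra_simps)
    then show ?thesis by (simp add: mult_ac)
  qed
  finally show ?thesis .
qed

end

section \<open>Noise-driven fields\<close>

context gaussian_space
begin

lemma sd_cong_AE:
  assumes "Y \<in> borel_measurable M" "Z \<in> borel_measurable M" "AE \<omega> in M. Y \<omega> = Z \<omega>"
  shows "sd Y = sd Z"
  unfolding sd_def using assms by (intro arg_cong[where f=sqrt] integral_cong_AE) auto

text \<open>For Gaussian families pairwise orthogonality already gives mutual independence: each
  family is orthogonal to the union of the earlier ones.\<close>

lemma prob_Inter_gen: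
  fixes K :: "nat \<Rightarrow> ('w \<Rightarrow> real) set" and L :: nat
  assumes K: "\<And>l. K l \<subseteq> H"
    and orth: "\<And>i j Y Z. i \<noteq> j \<Longrightarrow> Y \<in> K i \<Longrightarrow> Z \<in> K j \<Longrightarrow> expectation (\<lambda>\<omega>. Y \<omega> * Z \<omega>) = 0"
    and A: "\<And>l. A l \<in> sets (gen (K l))"
  shows "prob {\<omega>\<in>space M. \<forall>l<L. \<omega> \<in> A l} = (\<Prod>l<L. prob (A l))"
proof (induction L)
  case (Suc L)
  have "{\<omega>\<in>space M. \<forall>l<Suc L. \<omega> \<in> A l} = {\<omega>\<in>space M. \<forall>l<L. \<omega> \<in> A l} \<inter> A L"
    using sets.sets_into_space[OF A, of L] by (auto simp: less_Suc_eq)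
  moreover have "prob ({\<omega>\<in>space M. \<forall>l<L. \<omega> \<in> A l} \<inter> A L) = prob {\<omega>\<in>space M. \<forall>l<L. \<omega> \<in> A l} * prob (A L)"
  proof (rule prob_indep_gen[where K = "\<Union>l<L. K l" and L = "K L"])
    have "{\<omega>\<in>space (gen (\<Union>l<L. K l)). \<forall>l\<in>{..<L}. \<omega> \<in> A l} \<in> sets (gen (\<Union>l<L. K l))"
    proof (rule sets.sets_Collect_finite_All)
      fix l assume "l \<in> {..<L}"
      then have "A l \<in> sets (gen (\<Union>l<L. K l))" using A[of l] gen_mono[of "K l" "\<Union>l<L. K l"] by blast
      then show "{\<omega>\<in>space (gen (\<Union>l<L. K l)). \<omega> \<in> A l} \<in> sets (gen (\<Union>l<L. K l))"
        by (simp only: Collect_conj_eq Collect_mem_eq sets.Int sets.top)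
    qed simp
    then show "{\<omega>\<in>space M. \<forall>l<L. \<omega> \<in> A l} \<in> sets (gen (\<Union>l<L. K l))"
      by (simp only: space_gen lessThan_iff Ball_def)
    show "\<Union> (K ` {..<L}) \<subseteq> H" using K by blast
    show "K L \<subseteq> H" by (rule K)
    show "expectation (\<lambda>\<omega>. Y \<omega> * Z \<omega>) = 0" if "Y \<in> \<Union> (K ` {..<L})" "Z \<in> K L" for Y Z
      using that by (auto intro: orth[of _ L])
    show "A L \<in> sets (gen (K L))" by (rule A)
  qed
  ultimately show ?case using Suc by simp
qed (simp add: prob_space)

end

text \<open>The right endpoint is an extended real, so that one band estimate covers half-lines as
  well; the half-lines yield the low-frequency bound.\<close>

definition freq_band :: "real \<Rightarrow> ereal \<Rightarrow> real set" where
  "freq_band a b = {x. a \<le> x \<and> ereal x < b}"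

lemma sets_borel_Rplus: "A \<in> sets borel_Rplus \<longleftrightarrow> A \<in> sets borel \<and> A \<subseteq> {0..}"
  by (auto simp: sets_restrict_space image_iff Int_absorb1)

lemma freq_band_real: "freq_band a (ereal b) = {a..<b}"
  by (auto simp: freq_band_def)

lemma freq_band_infinity: "freq_band a \<infinity> = {a..}"
  by (auto simp: freq_band_def)

text \<open>\<open>W_low\<close> and \<open>W_high\<close> are the band estimate of the assumption
  for single components, with infinite and finite right endpoint respectively. In the first case the
  defect of the band is the low-frequency part itself.\<close>

locale noise = gaussian_space M H for M :: "'w measure" and H +
  fixes W :: "real set \<Rightarrow> real ^ 'n::finite \<Rightarrow> 'w \<Rightarrow> real ^ 'd::finite" and E :: "(real ^ 'n) set"
    and \<gamma> :: "'n \<Rightarrow> real" and a0 c0 :: real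
  assumes gamma_pos: "\<And>j. 0 < \<gamma> j" and a0_nonneg: "0 \<le> a0" and c0_pos: "0 < c0"
    and W_mem: "\<And>A t k. A \<in> sets borel_Rplus \<Longrightarrow> t \<in> E \<Longrightarrow> (\<lambda>\<omega>. W A t \<omega> $ k) \<in> H"
    and W_orth: "\<And>A B s t i j. A \<in> sets borel_Rplus \<Longrightarrow> B \<in> sets borel_Rplus \<Longrightarrow> A \<inter> B = {} \<Longrightarrow> s \<in> E \<Longrightarrow> t \<in> E \<Longrightarrow>
        expectation (\<lambda>\<omega>. W A s \<omega> $ i * W B t \<omega> $ j) = 0"
    and W_add: "\<And>A B t. A \<in> sets borel_Rplus \<Longrightarrow> B \<in> sets borel_Rplus \<Longrightarrow> A \<subseteq> B \<Longrightarrow> t \<in> E \<Longrightarrow>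
        AE \<omega> in M. W B t \<omega> = W A t \<omega> + W (B - A) t \<omega>"
    and W_low: "\<And>a s t k. a0 \<le> a \<Longrightarrow> s \<in> E \<Longrightarrow> t \<in> E \<Longrightarrow>
        sd (\<lambda>\<omega>. W {0..<a} s \<omega> $ k - W {0..<a} t \<omega> $ k) \<le> c0 * (\<Sum>j\<in>UNIV. a powr \<gamma> j * \<bar>s $ j - t $ j\<bar>)"
    and W_high: "\<And>a b s t k. a0 \<le> a \<Longrightarrow> a < b \<Longrightarrow> s \<in> E \<Longrightarrow> t \<in> E \<Longrightarrow>
        sd (\<lambda>\<omega>. (W {0..} s \<omega> $ k - W {a..<b} s \<omega> $ k) - (W {0..} t \<omega> $ k - W {a..<b} t \<omega> $ k))
          \<le> c0 * ((\<Sum>j\<in>UNIV. a powr \<gamma> j * \<bar>s $ j - t $ j\<bar>) + 1 / b)"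
begin

lemma Rplus_sets [simp]: "{0..} \<in> sets borel_Rplus" "0 \<le> a \<Longrightarrow> {a..<b} \<in> sets borel_Rplus"
  by (auto simp: sets_borel_Rplus)

lemma Rplus_diff: "A \<in> sets borel_Rplus \<Longrightarrow> B \<in> sets borel_Rplus \<Longrightarrow> B - A \<in> sets borel_Rplus"
  by auto

definition incr :: "real set \<Rightarrow> real ^ 'n \<Rightarrow> real ^ 'n \<Rightarrow> 'd \<Rightarrow> 'w \<Rightarrow> real" where
  "incr A s t k = (\<lambda>\<omega>. W A s \<omega> $ k - W A t \<omega> $ k)"

lemma incr_mem: "A \<in> sets borel_Rplus \<Longrightarrow> s \<in> E \<Longrightarrow> t \<in> E \<Longrightarrow> incr A s t k \<in> H"
  unfolding incr_def by (intro diff_mem W_mem)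

lemma incr_add:
  assumes "A \<in> sets borel_Rplus" "B \<in> sets borel_Rplus" "A \<subseteq> B" "s \<in> E" "t \<in> E"
  shows "AE \<omega> in M. incr B s t k \<omega> = incr A s t k \<omega> + incr (B - A) s t k \<omega>"
  using W_add[OF assms(1-4)] W_add[OF assms(1-3,5)] by eventually_elim (simp add: incr_def)

lemma W_orth_incr:
  assumes "A \<in> sets borel_Rplus" "B \<in> sets borel_Rplus" "A \<inter> B = {}" "s \<in> E" "t \<in> E" "s' \<in> E" "t' \<in> E"
  shows "expectation (\<lambda>\<omega>. incr A s t i \<omega> * incr B s' t' j \<omega>) = 0"
proof -
  have I: "integrable M (\<lambda>\<omega>. W A x \<omega> $ i * W B y \<omega> $ j)" if "x \<in> E" "y \<in> E" for x y
    using assms that by (intro integrable_mult_mem W_mem)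
  have "expectation (\<lambda>\<omega>. incr A s t i \<omega> * incr B s' t' j \<omega>) =
     expectation (\<lambda>\<omega>. (W A s \<omega> $ i * W B s' \<omega> $ j - W A s \<omega> $ i * W B t' \<omega> $ j) - (W A t \<omega> $ i * W B s' \<omega> $ j - W A t \<omega> $ i * W B t' \<omega> $ j))"
    by (simp add: incr_def algebra_simps)
  also have "\<dots> = 0" using assms I W_orth[OF assms(1-3)] by simp
  finally show ?thesis .
qed

text \<open>The increments over \<open>A\<close> and over \<open>B - A\<close> are orthogonal, so
  their variances add.\<close>

lemma sd_incr_mono:
  assumes "A \<in> sets borel_Rplus" "B \<in> sets borel_Rplus" "A \<subseteq> B" "s \<in> E" "t \<in> E"
  shows "sd (incr A s t k) \<le> sd (incr B s t k)"
proof -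
  have C: "B - A \<in> sets borel_Rplus" using assms by (intro Rplus_diff)
  have m: "incr A s t k \<in> H" "incr B s t k \<in> H" "incr (B - A) s t k \<in> H"
    using assms C by (auto intro: incr_mem)
  have "sd (incr B s t k) = sd (\<lambda>\<omega>. incr A s t k \<omega> + incr (B - A) s t k \<omega>)"
    using m by (intro sd_cong_AE incr_add[OF assms] borel_measurable_add measurable_mem)
  moreover have "(sd (\<lambda>\<omega>. incr A s t k \<omega> + incr (B - A) s t k \<omega>))\<^sup>2 = (sd (incr A s t k))\<^sup>2 + (sd (incr (B - A) s t k))\<^sup>2"
    using assms C W_orth_incr[of A "B - A" s t s t k k] by (simp add: sd_sq_add[OF m(1,3)])
  ultimately have "(sd (incr A s t k))\<^sup>2 \<le> (sd (incr B s t k))\<^sup>2" by simp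
  then show ?thesis by (rule power2_le_imp_le) simp
qed

lemma incr_compl:
  assumes "A \<in> sets borel_Rplus" "s \<in> E" "t \<in> E"
  shows "sd (\<lambda>\<omega>. incr {0..} s t k \<omega> - incr A s t k \<omega>) = sd (incr ({0..} - A) s t k)"
proof -
  have sub: "A \<subseteq> {0..}" using assms(1) by (simp add: sets_borel_Rplus)
  have C: "{0..} - A \<in> sets borel_Rplus" using assms by (intro Rplus_diff) auto
  show ?thesis
  proof (rule sd_cong_AE)
    show "AE \<omega> in M. incr {0..} s t k \<omega> - incr A s t k \<omega> = incr ({0..} - A) s t k \<omega>"
      using incr_add[OF assms(1) Rplus_sets(1) sub assms(2,3), of k] by eventually_elim simp
    show "(\<lambda>\<omega>. incr {0..} s t k \<omega> - incr A s t k \<omega>) \<in> borel_measurable M" "incr ({0..} - A) s t k \<in> borel_measurable M"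
      using assms C by (auto intro!: measurable_mem incr_mem diff_mem)
  qed
qed

lemma incr_compl_le:
  assumes "A \<in> sets borel_Rplus" "s \<in> E" "t \<in> E"
  shows "sd (\<lambda>\<omega>. incr {0..} s t k \<omega> - incr A s t k \<omega>) \<le> sd (incr {0..} s t k)"
  unfolding incr_compl[OF assms] using assms by (intro sd_incr_mono Rplus_diff) auto

lemma incr_high:
  assumes "a0 \<le> a" "a < b" "s \<in> E" "t \<in> E"
  shows "sd (\<lambda>\<omega>. incr {0..} s t k \<omega> - incr {a..<b} s t k \<omega>) \<le> c0 * ((\<Sum>j\<in>UNIV. a powr \<gamma> j * \<bar>s $ j - t $ j\<bar>) + 1 / b)"
proof -
  have "(\<lambda>\<omega>. incr {0..} s t k \<omega> - incr {a..<b} s t k \<omega>) = (\<lambda>\<omega>. (W {0..} s \<omega> $ k - W {a..<b} s \<omega> $ k) - (W {0..} t \<omega> $ k - W {a..<b} t \<omega> $ k))"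
    by (auto simp: incr_def)
  then show ?thesis using W_high[OF assms] by simp
qed

text \<open>Cut out the band from \<open>a0\<close> to \<open>b\<close>. Its increment is dominated
  by that of all frequencies below \<open>b\<close>, where \<open>W_low\<close> applies; what
  remains is exactly the defect that \<open>W_high\<close> controls.\<close>

lemma sd_incr_le:
  assumes "a0 < b" "s \<in> E" "t \<in> E"
  shows "sd (incr {0..} s t k) \<le> 2 * c0 * ((\<Sum>j\<in>UNIV. b powr \<gamma> j * \<bar>s $ j - t $ j\<bar>) + 1 / b)"
proof -
  let ?V = "incr {a0..<b} s t k"
  let ?Z = "\<lambda>\<omega>. incr {0..} s t k \<omega> - ?V \<omega>"
  have b0: "0 < b" using assms a0_nonneg by simp
  have m: "?V \<in> H" "?Z \<in> H" using assms a0_nonneg by (auto intro!: incr_mem diff_mem)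
  have "sd (incr {0..} s t k) = sd (\<lambda>\<omega>. ?V \<omega> + ?Z \<omega>)" by simp
  also have "\<dots> \<le> sd ?V + sd ?Z" by (rule sd_add_le[OF m])
  also have "sd ?V \<le> sd (incr {0..<b} s t k)" using assms a0_nonneg by (intro sd_incr_mono) auto
  also have "\<dots> \<le> c0 * (\<Sum>j\<in>UNIV. b powr \<gamma> j * \<bar>s $ j - t $ j\<bar>)"
    unfolding incr_def using assms by (intro W_low) auto
  also have "sd ?Z \<le> c0 * ((\<Sum>j\<in>UNIV. a0 powr \<gamma> j * \<bar>s $ j - t $ j\<bar>) + 1 / b)"
    using assms by (intro incr_high) auto
  also have "\<dots> \<le> c0 * ((\<Sum>j\<in>UNIV. b powr \<gamma> j * \<bar>s $ j - t $ j\<bar>) + 1 / b)"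
    using assms a0_nonneg c0_pos gamma_pos
    by (intro mult_left_mono add_right_mono sum_mono mult_right_mono powr_mono2) (auto simp: less_imp_le)
  finally have "sd (incr {0..} s t k) \<le> c0 * (\<Sum>j\<in>UNIV. b powr \<gamma> j * \<bar>s $ j - t $ j\<bar>) + c0 * ((\<Sum>j\<in>UNIV. b powr \<gamma> j * \<bar>s $ j - t $ j\<bar>) + 1 / b)"
    by simp
  also have "\<dots> \<le> c0 * ((\<Sum>j\<in>UNIV. b powr \<gamma> j * \<bar>s $ j - t $ j\<bar>) + 1 / b) + c0 * ((\<Sum>j\<in>UNIV. b powr \<gamma> j * \<bar>s $ j - t $ j\<bar>) + 1 / b)"
    using c0_pos b0 by (intro add_right_mono mult_left_mono) auto
  finally show ?thesis by simp
qed

text \<open>Frequencies outside \<open>A\<close> are uncorrelated with \<open>W A\<close>. Hence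
  covariances of the whole field with a low-frequency variable are as smooth as the low-frequency
  part.\<close>

lemma expectation_total_mult:
  assumes "A \<in> sets borel_Rplus" "s \<in> E" "t \<in> E"
  shows "expectation (\<lambda>\<omega>. W {0..} t \<omega> $ i * W A s \<omega> $ j) = expectation (\<lambda>\<omega>. W A t \<omega> $ i * W A s \<omega> $ j)"
proof -
  have sub: "A \<subseteq> {0..}" using assms(1) by (simp add: sets_borel_Rplus)
  have C: "{0..} - A \<in> sets borel_Rplus" using assms by (intro Rplus_diff) auto
  have I: "integrable M (\<lambda>\<omega>. W B t \<omega> $ i * W A s \<omega> $ j)" if "B \<in> sets borel_Rplus" for B
    using assms that by (intro integrable_mult_mem W_mem)
  have "expectation (\<lambda>\<omega>. W {0..} t \<omega> $ i * W A s \<omega> $ j) = expectation (\<lambda>\<omega>. W A t \<omega> $ i * W A s \<omega> $ j + W ({0..} - A) t \<omega> $ i * W A s \<omega> $ j)"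
  proof (rule integral_cong_AE)
    show "AE \<omega> in M. W {0..} t \<omega> $ i * W A s \<omega> $ j = W A t \<omega> $ i * W A s \<omega> $ j + W ({0..} - A) t \<omega> $ i * W A s \<omega> $ j"
      using W_add[OF assms(1) Rplus_sets(1) sub assms(3)] by eventually_elim (simp add: algebra_simps)
  qed (use I[OF assms(1)] I[OF C] I[OF Rplus_sets(1)] in auto)
  also have "\<dots> = expectation (\<lambda>\<omega>. W A t \<omega> $ i * W A s \<omega> $ j) + expectation (\<lambda>\<omega>. W ({0..} - A) t \<omega> $ i * W A s \<omega> $ j)"
    using I[OF assms(1)] I[OF C] by simp
  also have "expectation (\<lambda>\<omega>. W ({0..} - A) t \<omega> $ i * W A s \<omega> $ j) = 0"
    using assms C by (intro W_orth) auto
  finally show ?thesis by simp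
qed

end

section \<open>Extracting a noise from the assumption\<close>

lemma sd_component_le_L2_nrm:
  fixes V :: "'w \<Rightarrow> real ^ 'd"
  assumes "gaussian_space M H" and V: "\<And>k. (\<lambda>\<omega>. V \<omega> $ k) \<in> H"
  shows "gaussian_space.sd M (\<lambda>\<omega>. V \<omega> $ k) \<le> L2_nrm M V"
proof -
  interpret gaussian_space M H by fact
  have n2: "(norm (V \<omega>))\<^sup>2 = (\<Sum>k\<in>UNIV. (V \<omega> $ k)\<^sup>2)" for \<omega>
    by (simp add: norm_vec_def L2_set_def sum_nonneg)
  have "expectation (\<lambda>\<omega>. (V \<omega> $ k)\<^sup>2) \<le> expectation (\<lambda>\<omega>. (norm (V \<omega>))\<^sup>2)"
  proof (rule integral_mono)
    show "integrable M (\<lambda>\<omega>. (V \<omega> $ k)\<^sup>2)" by (rule integrable_power_mem[OF V])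
    show "integrable M (\<lambda>\<omega>. (norm (V \<omega>))\<^sup>2)" unfolding n2
      by (intro Bochner_Integration.integrable_sum integrable_power_mem[OF V])
    show "(V \<omega> $ k)\<^sup>2 \<le> (norm (V \<omega>))\<^sup>2" for \<omega>
      unfolding n2 by (rule member_le_sum) auto
  qed
  then show ?thesis by (simp add: sd_def L2_nrm_def)
qed

text \<open>\<open>H\<close> is the span of all components of the noise at times in the enlarged
  interval. Normality of its members is joint normality of the noise; their means vanish by the
  noise property, which is assumed at those times.\<close>

lemma noise_of_assumption_A1:
  fixes X :: "real ^ 'n \<Rightarrow> 'w \<Rightarrow> real ^ 'd"
  assumes "prob_space M" and A1: "assumption_A1 M X lo hi \<epsilon>0 \<gamma>" and cX: "\<forall>t. centered M (X t)"
  obtains H W a0 c0 where "noise M H W (enlarged lo hi \<epsilon>0) \<gamma> a0 c0"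
    and "\<And>t. t \<in> enlarged lo hi \<epsilon>0 \<Longrightarrow> AE \<omega> in M. W {0..} t \<omega> = X t \<omega>"
    and "\<And>t. t \<in> enlarged lo hi \<epsilon>0 \<Longrightarrow> \<exists>\<nu>. gaussian_noise M \<nu> (\<lambda>A. W A t)"
proof -
  interpret prob_space M by fact
  let ?E = "enlarged lo hi \<epsilon>0" and ?S = "sets borel_Rplus"
  obtain W :: "real set \<Rightarrow> real ^ 'n \<Rightarrow> 'w \<Rightarrow> real ^ 'd" and a0 c0
    where gf: "gaussian_field M (?S \<times> UNIV) (\<lambda>(A, t). W A t)"
      and gn: "\<And>t. t \<in> ?E \<Longrightarrow> (\<exists>\<nu>. gaussian_noise M \<nu> (\<lambda>A. W A t))"
      and WX: "\<And>t. t \<in> ?E \<Longrightarrow> AE \<omega> in M. W {0..} t \<omega> = X t \<omega>"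
      and ind: "\<And>A B. A \<in> ?S \<Longrightarrow> B \<in> ?S \<Longrightarrow> A \<inter> B = {} \<Longrightarrow> indep_fields M (W A) (W B)"
      and a0: "0 \<le> a0" and c0: "0 < c0"
      and bnd: "\<And>a b s t. s \<in> ?E \<Longrightarrow> t \<in> ?E \<Longrightarrow> a0 \<le> a \<Longrightarrow> ereal a < b \<Longrightarrow>
         L2_nrm M (\<lambda>\<omega>. W (freq_band a b) s \<omega> - X s \<omega> - W (freq_band a b) t \<omega> + X t \<omega>)
                \<le> c0 * ((\<Sum>j\<in>UNIV. a powr \<gamma> j * \<bar>s $ j - t $ j\<bar>) + real_of_ereal (inverse b))"
    using A1 unfolding assumption_A1_def freq_band_def by auto
  have Wc: "centered M (W A t)" "W A t \<in> borel_measurable M" if "A \<in> ?S" "t \<in> ?E" for A t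
    using gn[OF that(2)] that(1) by (auto simp: gaussian_noise_def)
  have Xm: "X t \<in> borel_measurable M" for t using cX unfolding centered_def by (blast intro: borel_measurable_integrable)
  define H where "H = {\<lambda>\<omega>. \<Sum>i\<in>J. v i \<bullet> W (fst i) (snd i) \<omega> | J v. finite J \<and> J \<subseteq> ?S \<times> ?E}"
  have HI: "(\<lambda>\<omega>. \<Sum>i\<in>J. v i \<bullet> W (fst i) (snd i) \<omega>) \<in> H" if "finite J" "J \<subseteq> ?S \<times> ?E" for J v
    using that unfolding H_def by blast
  have HE: "\<exists>J v. finite J \<and> J \<subseteq> ?S \<times> ?E \<and> Y = (\<lambda>\<omega>. \<Sum>i\<in>J. v i \<bullet> W (fst i) (snd i) \<omega>)" if "Y \<in> H" for Y
    using that unfolding H_def by blast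
  have gs: "gaussian_space M H"
  proof unfold_locales
    show "(\<lambda>_. 0) \<in> H" using HI[of "{}"] by simp
    show "(\<lambda>\<omega>. c * Y \<omega>) \<in> H" if Y: "Y \<in> H" for c Y
    proof -
      obtain J v where J: "finite J" "J \<subseteq> ?S \<times> ?E" and Yeq: "Y = (\<lambda>\<omega>. \<Sum>i\<in>J. v i \<bullet> W (fst i) (snd i) \<omega>)"
        using HE[OF Y] by blast
      have "(\<lambda>\<omega>. c * Y \<omega>) = (\<lambda>\<omega>. \<Sum>i\<in>J. (c *\<^sub>R v i) \<bullet> W (fst i) (snd i) \<omega>)"
        by (simp add: Yeq sum_distrib_left)
      also have "\<dots> \<in> H" by (rule HI[OF J])
      finally show ?thesis .
    qed
    show "(\<lambda>\<omega>. Y \<omega> + Y' \<omega>) \<in> H" if Y: "Y \<in> H" "Y' \<in> H" for Y Y'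
    proof -
      obtain J v where J: "finite J" "J \<subseteq> ?S \<times> ?E" and Yeq: "Y = (\<lambda>\<omega>. \<Sum>i\<in>J. v i \<bullet> W (fst i) (snd i) \<omega>)"
        using HE[OF Y(1)] by blast
      obtain J' v' where J': "finite J'" "J' \<subseteq> ?S \<times> ?E" and Yeq': "Y' = (\<lambda>\<omega>. \<Sum>i\<in>J'. v' i \<bullet> W (fst i) (snd i) \<omega>)"
        using HE[OF Y(2)] by blast
      define w where "w i = (if i \<in> J then v i else 0) + (if i \<in> J' then v' i else 0)" for i
      have "Y \<omega> + Y' \<omega> = (\<Sum>i\<in>J \<union> J'. w i \<bullet> W (fst i) (snd i) \<omega>)" for \<omega>
      proof -
        have "Y \<omega> = (\<Sum>i\<in>J \<union> J'. (if i \<in> J then v i else 0) \<bullet> W (fst i) (snd i) \<omega>)"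
          unfolding Yeq using J J' by (intro sum.mono_neutral_cong_left) auto
        moreover have "Y' \<omega> = (\<Sum>i\<in>J \<union> J'. (if i \<in> J' then v' i else 0) \<bullet> W (fst i) (snd i) \<omega>)"
          unfolding Yeq' using J J' by (intro sum.mono_neutral_cong_left) auto
        ultimately show ?thesis by (simp add: w_def inner_add_left sum.distrib)
      qed
      then show ?thesis using HI[of "J \<union> J'" w] J J' by simp
    qed
    show "normal_rv M Y" if Y: "Y \<in> H" for Y
    proof -
      obtain J v where J: "finite J" "J \<subseteq> ?S \<times> ?E" and Yeq: "Y = (\<lambda>\<omega>. \<Sum>i\<in>J. v i \<bullet> W (fst i) (snd i) \<omega>)"
        using HE[OF Y] by blast
      have "J \<subseteq> ?S \<times> UNIV" using J by auto
      then have "normal_rv M (\<lambda>\<omega>. \<Sum>i\<in>J. v i \<bullet> (case i of (A, t) \<Rightarrow> W A t) \<omega>)"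
        using gf J(1) unfolding gaussian_field_def by blast
      then show ?thesis by (simp add: Yeq case_prod_beta)
    qed
    show "expectation Y = 0" if Y: "Y \<in> H" for Y
    proof -
      obtain J v where J: "finite J" "J \<subseteq> ?S \<times> ?E" and Yeq: "Y = (\<lambda>\<omega>. \<Sum>i\<in>J. v i \<bullet> W (fst i) (snd i) \<omega>)"
        using HE[OF Y] by blast
      have c: "integrable M (W (fst i) (snd i))" "expectation (W (fst i) (snd i)) = 0" if "i \<in> J" for i
        using Wc(1)[of "fst i" "snd i"] that J by (auto simp: centered_def)
      have "expectation Y = (\<Sum>i\<in>J. expectation (\<lambda>\<omega>. v i \<bullet> W (fst i) (snd i) \<omega>))"
        unfolding Yeq using c by (intro Bochner_Integration.integral_sum) auto
      also have "\<dots> = 0"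
      proof (intro sum.neutral ballI)
        fix i assume "i \<in> J"
        then show "expectation (\<lambda>\<omega>. v i \<bullet> W (fst i) (snd i) \<omega>) = 0"
          using c[of i] by (subst integral_inner_right) auto
      qed
      finally show ?thesis .
    qed
  qed
  interpret gaussian_space M H by (rule gs)
  have mem: "(\<lambda>\<omega>. W A t \<omega> $ k) \<in> H" if "A \<in> ?S" "t \<in> ?E" for A t k
    using HI[of "{(A, t)}" "\<lambda>_. axis k 1"] that by (simp add: inner_axis' )
  have component: "(\<lambda>f. f x $ i :: real) \<in> borel_measurable (Pi\<^sub>M UNIV (\<lambda>_. borel))" for x :: "real ^ 'n" and i :: 'd
  proof -
    have "(\<lambda>f. f x) \<in> Pi\<^sub>M UNIV (\<lambda>_. borel) \<rightarrow>\<^sub>M (borel :: (real ^ 'd) measure)"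
      by (rule measurable_component_singleton) simp
    moreover have "(\<lambda>y :: real ^ 'd. y $ i) \<in> borel_measurable borel"
      by (intro borel_measurable_continuous_onI continuous_intros)
    ultimately have "(\<lambda>y :: real ^ 'd. y $ i) \<circ> (\<lambda>f. f x) \<in> borel_measurable (Pi\<^sub>M UNIV (\<lambda>_. borel))"
      by (rule measurable_comp)
    then show ?thesis by (simp add: comp_def)
  qed
  have "noise M H W ?E \<gamma> a0 c0"
  proof unfold_locales
    show "0 < \<gamma> j" for j using A1 by (simp add: assumption_A1_def)
    show "0 \<le> a0" "0 < c0" by fact+
    show "(\<lambda>\<omega>. W A t \<omega> $ k) \<in> H" if "A \<in> ?S" "t \<in> ?E" for A t k using mem[OF that] .
    show "expectation (\<lambda>\<omega>. W A s \<omega> $ i * W B t \<omega> $ j) = 0"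
      if "A \<in> ?S" "B \<in> ?S" "A \<inter> B = {}" "s \<in> ?E" "t \<in> ?E" for A B s t i j
    proof -
      have iv: "indep_var (Pi\<^sub>M UNIV (\<lambda>_. borel)) (\<lambda>\<omega> t. W A t \<omega>) (Pi\<^sub>M UNIV (\<lambda>_. borel)) (\<lambda>\<omega> t. W B t \<omega>)"
        using ind[OF that(1-3)] by (simp add: indep_fields_def)
      have "indep_var borel ((\<lambda>f. f s $ i) \<circ> (\<lambda>\<omega> t. W A t \<omega>)) borel ((\<lambda>f. f t $ j) \<circ> (\<lambda>\<omega> t. W B t \<omega>))"
        by (rule indep_var_compose[OF iv]) (rule component)+
      then have "indep_var borel (\<lambda>\<omega>. W A s \<omega> $ i) borel (\<lambda>\<omega>. W B t \<omega> $ j)" by (simp add: comp_def)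
      from indep_var_lebesgue_integral[OF this]
      show ?thesis using mem[OF that(1,4)] mem[OF that(2,5)] by (simp add: integrable_mem mean_mem)
    qed
    show add: "AE \<omega> in M. W B t \<omega> = W A t \<omega> + W (B - A) t \<omega>"
      if asm: "A \<in> ?S" "B \<in> ?S" "A \<subseteq> B" "t \<in> ?E" for A B t
    proof -
      obtain \<nu> where "gaussian_noise M \<nu> (\<lambda>A. W A t)" using gn[OF asm(4)] by auto
      moreover have "B - A \<in> ?S" using asm by auto
      ultimately have "AE \<omega> in M. W (A \<union> (B - A)) t \<omega> = W A t \<omega> + W (B - A) t \<omega>"
        using asm(1) unfolding gaussian_noise_def by (metis Diff_disjoint)
      then show ?thesis using asm(3) by (simp add: Un_absorb1)
    qed
    have R: "{0..} \<in> ?S" "\<And>a b. 0 \<le> a \<Longrightarrow> {a..<b} \<in> ?S" "\<And>a. 0 \<le> a \<Longrightarrow> {a..} \<in> ?S"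
      by (auto simp: sets_borel_Rplus)
    show "sd (\<lambda>\<omega>. W {0..<a} s \<omega> $ k - W {0..<a} t \<omega> $ k) \<le> c0 * (\<Sum>j\<in>UNIV. a powr \<gamma> j * \<bar>s $ j - t $ j\<bar>)"
      if a: "a0 \<le> a" and s: "s \<in> ?E" and t: "t \<in> ?E" for a s t k
    proof -
      have a': "0 \<le> a" using a a0 by simp
      let ?V = "\<lambda>\<omega>. W {0..<a} s \<omega> - W {0..<a} t \<omega>"
      have d: "{0..} - {0..<a} = {a..}" using a' by auto
      have "sd (\<lambda>\<omega>. ?V \<omega> $ k) \<le> L2_nrm M ?V"
        using s t a' R by (intro sd_component_le_L2_nrm[OF gs]) (auto intro!: diff_mem mem)
      \<comment> \<open>For an infinite right endpoint the defect is low-frequency: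
        \<open>W {a..} - X = - W {0..<a}\<close> almost surely.\<close>
      also have "L2_nrm M ?V = L2_nrm M (\<lambda>\<omega>. W (freq_band a \<infinity>) s \<omega> - X s \<omega> - W (freq_band a \<infinity>) t \<omega> + X t \<omega>)"
        unfolding L2_nrm_def freq_band_infinity
      proof (intro arg_cong[where f=sqrt] integral_cong_AE)
        have sub: "{0..<a} \<subseteq> {0..}" and r: "{0..<a} \<in> ?S" using R(2)[of 0 a] by auto
        have XW: "AE \<omega> in M. X x \<omega> = W {0..<a} x \<omega> + W {a..} x \<omega>" if "x \<in> ?E" for x
          using add[OF r R(1) sub that] WX[OF that] unfolding d by eventually_elim simp
        have "AE \<omega> in M. X s \<omega> = W {0..<a} s \<omega> + W {a..} s \<omega>" by (rule XW[OF s])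
        moreover have "AE \<omega> in M. X t \<omega> = W {0..<a} t \<omega> + W {a..} t \<omega>" by (rule XW[OF t])
        ultimately show "AE \<omega> in M. (norm (?V \<omega>))\<^sup>2 = (norm (W {a..} s \<omega> - X s \<omega> - W {a..} t \<omega> + X t \<omega>))\<^sup>2"
        proof eventually_elim
          case (elim \<omega>)
          have "W {a..} s \<omega> - X s \<omega> - W {a..} t \<omega> + X t \<omega> = - ?V \<omega>" using elim by simp
          then show ?case by (metis norm_minus_cancel)
        qed
      qed (use Wc(2) Xm s t R a' in measurable)
      also have "\<dots> \<le> c0 * (\<Sum>j\<in>UNIV. a powr \<gamma> j * \<bar>s $ j - t $ j\<bar>)"
        using bnd[OF s t a, of \<infinity>] by simp
      finally show ?thesis by simp
    qed
    show "sd (\<lambda>\<omega>. (W {0..} s \<omega> $ k - W {a..<b} s \<omega> $ k) - (W {0..} t \<omega> $ k - W {a..<b} t \<omega> $ k))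
          \<le> c0 * ((\<Sum>j\<in>UNIV. a powr \<gamma> j * \<bar>s $ j - t $ j\<bar>) + 1 / b)"
      if a: "a0 \<le> a" and ab: "a < b" and s: "s \<in> ?E" and t: "t \<in> ?E" for a b s t k
    proof -
      have a': "0 \<le> a" using a a0 by simp
      let ?V = "\<lambda>\<omega>. (W {0..} s \<omega> - W {a..<b} s \<omega>) - (W {0..} t \<omega> - W {a..<b} t \<omega>)"
      have "sd (\<lambda>\<omega>. ?V \<omega> $ k) \<le> L2_nrm M ?V"
        using s t a' R by (intro sd_component_le_L2_nrm[OF gs]) (auto intro!: diff_mem mem)
      also have "L2_nrm M ?V = L2_nrm M (\<lambda>\<omega>. W (freq_band a (ereal b)) s \<omega> - X s \<omega> - W (freq_band a (ereal b)) t \<omega> + X t \<omega>)"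
        unfolding L2_nrm_def freq_band_real
      proof (intro arg_cong[where f=sqrt] integral_cong_AE)
        show "AE \<omega> in M. (norm (?V \<omega>))\<^sup>2 = (norm (W {a..<b} s \<omega> - X s \<omega> - W {a..<b} t \<omega> + X t \<omega>))\<^sup>2"
          using WX[OF s] WX[OF t]
        proof eventually_elim
          case (elim \<omega>)
          have "W {a..<b} s \<omega> - X s \<omega> - W {a..<b} t \<omega> + X t \<omega> = - ?V \<omega>" using elim by simp
          then show ?case by (metis norm_minus_cancel)
        qed
      qed (use Wc(2) Xm s t R a' in measurable)
      also have "\<dots> \<le> c0 * ((\<Sum>j\<in>UNIV. a powr \<gamma> j * \<bar>s $ j - t $ j\<bar>) + 1 / b)"
        using bnd[OF s t a, of "ereal b"] ab a' by (simp add: inverse_eq_divide)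
      finally show ?thesis by simp
    qed
  qed
  then show ?thesis using WX gn that by blast
qed

section \<open>Calm scales\<close>

locale noise_grid = noise M H W E \<gamma> a0 c0 + grid \<gamma> p h
  for M :: "'w measure" and H and W :: "real set \<Rightarrow> real ^ 'n::finite \<Rightarrow> 'w \<Rightarrow> real ^ 'd::finite"
    and E \<gamma> a0 c0 p h +
  assumes cube_E: "cube \<subseteq> E"

sublocale noise_grid \<subseteq> gaussian_grid M H \<gamma> p h ..

context noise_grid
begin

definition comp :: "real set \<Rightarrow> 'd \<Rightarrow> real ^ 'n \<Rightarrow> 'w \<Rightarrow> real" where
  "comp A c t = (\<lambda>\<omega>. W A t \<omega> $ c)"

lemma comp_mem: "A \<in> sets borel_Rplus \<Longrightarrow> t \<in> cube \<Longrightarrow> comp A c t \<in> H"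
  unfolding comp_def using cube_E by (intro W_mem) auto

lemma link_comp: "w \<in> Z (Suc l) \<Longrightarrow> (\<lambda>\<omega>. link (\<lambda>t. comp A c t \<omega>) l w) = incr A (pt (Suc l) w) (pt l (par l (Suc l) w)) c"
  by (simp add: link_def comp_def incr_def)

lemma pt_E: "w \<in> Z (Suc l) \<Longrightarrow> pt (Suc l) w \<in> E \<and> pt l (par l (Suc l) w) \<in> E"
  using cube_E pt_mem_cube[of w "Suc l"] pt_mem_cube[of "par l (Suc l) w" l] par_mem[of l "Suc l" w] by auto

definition mesh_const :: real where "mesh_const = 2 * c0 * (real CARD('n) + 1)"

lemma mesh_const_pos: "0 < mesh_const"
  using c0_pos by (simp add: mesh_const_def)

text \<open>The choice \<open>b = 2 ^ l\<close> in \<open>sd_incr_le\<close> balances all terms: a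
  step in direction \<open>j\<close> has length at most
  \<open>2 powr (- l * (1 + \<gamma> j))\<close>, so each \<open>b powr \<gamma> j\<close> multiple
  of it, like \<open>1 / b\<close>, is at most \<open>2 powr - l\<close>. The grid exponents
  \<open>1 + \<gamma> j\<close> are made for this.\<close>

lemma sd_link_total:
  assumes w: "w \<in> Z (Suc l)" and l: "a0 < 2 ^ l"
  shows "sd (\<lambda>\<omega>. link (\<lambda>t. comp {0..} c t \<omega>) l w) \<le> mesh_const * 2 powr - real l"
proof -
  let ?s = "pt (Suc l) w" and ?t = "pt l (par l (Suc l) w)"
  have "sd (incr {0..} ?s ?t c) \<le> 2 * c0 * ((\<Sum>j\<in>UNIV. (2 ^ l) powr \<gamma> j * \<bar>?s $ j - ?t $ j\<bar>) + 1 / 2 ^ l)"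
    using pt_E[OF w] by (intro sd_incr_le l) auto
  also have "\<dots> \<le> 2 * c0 * ((\<Sum>j\<in>(UNIV::'n set). 2 powr - real l) + 2 powr - real l)"
  proof (intro mult_left_mono add_mono sum_mono)
    fix j
    have "(2 ^ l) powr \<gamma> j * \<bar>?s $ j - ?t $ j\<bar> \<le> (2 powr real l) powr \<gamma> j * 2 powr (- (real l * (1 + \<gamma> j)))"
      using pt_par_dist[of l "Suc l" w j] by (intro mult_mono) (auto simp: powr_realpow)
    also have "\<dots> = 2 powr - real l"
      unfolding powr_powr powr_add[symmetric] by (rule arg_cong[where f="(powr) 2"]) (simp add: algebra_simps)
    finally show "(2 ^ l) powr \<gamma> j * \<bar>?s $ j - ?t $ j\<bar> \<le> 2 powr - real l" .
  next
    show "1 / 2 ^ l \<le> (2::real) powr - real l" by (simp add: powr_minus powr_realpow field_simps)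
  qed (use c0_pos in auto)
  also have "\<dots> = mesh_const * 2 powr - real l" by (simp add: mesh_const_def algebra_simps)
  finally show ?thesis unfolding link_comp[OF w] .
qed

text \<open>The common suppression rate outside a band. Inserting 1 lets it also bound the
  contribution \<open>2 powr - u\<close> of the frequencies above the band.\<close>

definition \<beta> :: real where "\<beta> = Min (insert 1 (range \<gamma>))"

lemma \<beta>: "0 < \<beta>" "\<beta> \<le> 1" "\<beta> \<le> \<gamma> j"
proof -
  show "0 < \<beta>" unfolding \<beta>_def using gamma_pos by (subst Min_gr_iff) auto
  show "\<beta> \<le> 1" "\<beta> \<le> \<gamma> j" unfolding \<beta>_def by (intro Min_le; simp)+
qed

abbreviation band :: "nat \<Rightarrow> nat \<Rightarrow> real set" where
  "band k u \<equiv> {2 ^ (k - u) ..< 2 ^ (k + u)}"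

abbreviation rest :: "nat \<Rightarrow> nat \<Rightarrow> 'd \<Rightarrow> real ^ 'n \<Rightarrow> 'w \<Rightarrow> real" where
  "rest k u c t \<equiv> (\<lambda>\<omega>. comp {0..} c t \<omega> - comp (band k u) c t \<omega>)"

lemma link_rest:
  "w \<in> Z (Suc l) \<Longrightarrow> (\<lambda>\<omega>. link (\<lambda>t. rest k u c t \<omega>) l w) =
     (\<lambda>\<omega>. incr {0..} (pt (Suc l) w) (pt l (par l (Suc l) w)) c \<omega> - incr (band k u) (pt (Suc l) w) (pt l (par l (Suc l) w)) c \<omega>)"
  by (rule ext) (simp add: link_def comp_def incr_def)

text \<open>A geometric mean of two bounds. The bound for the total increment decays in
  \<open>i\<close> but sees no gain from the band; the defect estimate gains
  \<open>2 powr (- u * \<beta>)\<close> but does not decay in \<open>i\<close>. The mean has half of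
  each exponent, so chaining still converges.\<close>

lemma sd_link_rest:
  assumes w: "w \<in> Z (Suc (k + i))" and u: "u \<le> k" "1 \<le> u" and k: "a0 < 2 ^ (k - u)"
  shows "sd (\<lambda>\<omega>. link (\<lambda>t. rest k u c t \<omega>) (k + i) w) \<le> mesh_const * 2 powr (- (real u * \<beta> / 2)) * 2 powr (- real k - real i / 2)"
proof -
  let ?s = "pt (Suc (k + i)) w" and ?t = "pt (k + i) (par (k + i) (Suc (k + i)) w)"
  let ?x = "sd (\<lambda>\<omega>. incr {0..} ?s ?t c \<omega> - incr (band k u) ?s ?t c \<omega>)"
  have EE: "?s \<in> E" "?t \<in> E" using pt_E[OF w] by auto
  have k2: "a0 < 2 ^ (k + i)"
  proof -
    have "(2::real) ^ (k - u) \<le> 2 ^ (k + i)" by (intro power_increasing) auto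
    then show ?thesis using k by linarith
  qed
  have "?x \<le> sd (incr {0..} ?s ?t c)" using EE by (intro incr_compl_le) auto
  also have "\<dots> \<le> mesh_const * 2 powr - real (k + i)"
    using sd_link_total[OF w k2, of c] unfolding link_comp[OF w] .
  finally have x1: "?x \<le> mesh_const * 2 powr - real (k + i)" .
  have "?x \<le> c0 * ((\<Sum>j\<in>UNIV. (2 ^ (k - u)) powr \<gamma> j * \<bar>?s $ j - ?t $ j\<bar>) + 1 / 2 ^ (k + u))"
    using EE k u by (intro incr_high) (auto intro!: power_strict_increasing)
  also have "\<dots> \<le> c0 * ((\<Sum>j\<in>(UNIV::'n set). 2 powr (- real k - real u * \<beta>)) + 2 powr (- real k - real u * \<beta>))"
  proof (intro mult_left_mono add_mono sum_mono)
    fix j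
    have "\<bar>?s $ j - ?t $ j\<bar> \<le> 2 powr (- (real (k + i) * (1 + \<gamma> j)))" by (rule pt_par_dist) simp
    also have "\<dots> \<le> 2 powr (- (real k * (1 + \<gamma> j)))" using gamma_pos[of j] by (simp add: mult_right_mono)
    finally have "(2 ^ (k - u)) powr \<gamma> j * \<bar>?s $ j - ?t $ j\<bar> \<le> (2 powr real (k - u)) powr \<gamma> j * 2 powr (- (real k * (1 + \<gamma> j)))"
      by (intro mult_mono) (auto simp: powr_realpow)
    also have "\<dots> = 2 powr (- real k - real u * \<gamma> j)"
      unfolding powr_powr powr_add[symmetric] using u by (intro arg_cong[where f="(powr) 2"]) (simp add: algebra_simps of_nat_diff)
    also have "\<dots> \<le> 2 powr (- real k - real u * \<beta>)" using \<beta>(3)[of j] by (simp add: mult_left_mono)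
    finally show "(2 ^ (k - u)) powr \<gamma> j * \<bar>?s $ j - ?t $ j\<bar> \<le> 2 powr (- real k - real u * \<beta>)" .
  next
    have "1 / 2 ^ (k + u) = (2::real) powr (- real (k + u))" by (simp only: powr_minus_divide powr_realpow zero_less_numeral)
    also have "\<dots> \<le> 2 powr (- real k - real u * \<beta>)" using \<beta>(2) by (simp add: mult_left_le)
    finally show "1 / 2 ^ (k + u) \<le> (2::real) powr (- real k - real u * \<beta>)" .
  qed (use c0_pos in auto)
  also have "\<dots> = mesh_const / 2 * 2 powr (- real k - real u * \<beta>)" by (simp add: mesh_const_def algebra_simps)
  also have "\<dots> \<le> mesh_const * 2 powr (- real k - real u * \<beta>)" using mesh_const_pos by simp
  finally have x2: "?x \<le> mesh_const * 2 powr (- real k - real u * \<beta>)" .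
  let ?y = "mesh_const * 2 powr (- (real u * \<beta> / 2)) * 2 powr (- real k - real i / 2)"
  have "?x\<^sup>2 \<le> (mesh_const * 2 powr - real (k + i)) * (mesh_const * 2 powr (- real k - real u * \<beta>))"
    unfolding power2_eq_square using x1 x2 mesh_const_pos by (intro mult_mono) auto
  also have "\<dots> = ?y\<^sup>2"
  proof -
    have "2 powr - real (k + i) * 2 powr (- real k - real u * \<beta>) = ((2::real) powr (- (real u * \<beta> / 2)) * 2 powr (- real k - real i / 2))\<^sup>2"
      unfolding power2_eq_square powr_add[symmetric] by (rule arg_cong[where f="(powr) 2"]) (simp add: algebra_simps)
    then show ?thesis by (simp only: power_mult_distrib power2_eq_square[of mesh_const] mult_ac)
  qed
  finally have "?x \<le> ?y" by (rule power2_le_imp_le) (use mesh_const_pos in simp)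
  then show ?thesis unfolding link_rest[OF w] .
qed

text \<open>The first summand is the small-ball bound for the band part, the second the chaining
  bound for the frequencies outside the band.\<close>

definition osc_const :: real where "osc_const = 14 * mesh_const + 7"

text \<open>Oscillation is observed on the finite grid of level \<open>m\<close>, which makes this
  an event; \<open>m\<close> stays free, and the probability bounds do not depend on it.\<close>

definition calm :: "nat \<Rightarrow> nat \<Rightarrow> nat \<Rightarrow> ('n \<Rightarrow> nat) \<Rightarrow> ('d \<Rightarrow> real ^ 'n \<Rightarrow> 'w \<Rightarrow> real) \<Rightarrow> real \<Rightarrow> 'w set" where
  "calm m J k R f K = {\<omega>\<in>space M. \<forall>c. \<forall>z\<in>sub k m R. \<bar>f c (pt m z) \<omega> - f c (pt k R) \<omega>\<bar> \<le> K * 2 powr - (real k + real J)}"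

lemma calm_gen:
  assumes "\<And>c t. t \<in> cube \<Longrightarrow> f c t \<in> K" "R \<in> Z k"
  shows "calm m J k R f x \<in> sets (gen K)"
proof -
  have "{\<omega>\<in>space (gen K). \<bar>f c (pt m z) \<omega> - f c (pt k R) \<omega>\<bar> \<le> x * 2 powr - (real k + real J)} \<in> sets (gen K)"
    if "z \<in> sub k m R" for c z
  proof -
    have "pt m z \<in> cube" "pt k R \<in> cube" using that assms(2) by (auto simp: sub_def intro: pt_mem_cube)
    note [measurable] = measurable_gen[OF assms(1)[OF this(1)]] measurable_gen[OF assms(1)[OF this(2)]]
    show ?thesis by measurable
  qed
  then have "{\<omega>\<in>space (gen K). \<forall>c\<in>UNIV. \<forall>z\<in>sub k m R. \<bar>f c (pt m z) \<omega> - f c (pt k R) \<omega>\<bar> \<le> x * 2 powr - (real k + real J)} \<in> sets (gen K)"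
    by (intro sets.sets_Collect_finite_All finite_sub finite) 
  then show ?thesis by (simp only: calm_def space_gen ball_UNIV)
qed

text \<open>Centres spaced by \<open>2 * u\<close>, so that successive bands adjoin without
  overlapping and the first one starts at frequency \<open>2 ^ n\<close>.\<close>

definition lev :: "nat \<Rightarrow> nat \<Rightarrow> nat \<Rightarrow> nat" where "lev n u l = n + (2 * l + 1) * u"

lemma lev_band: "band (lev n u l) u = {2 ^ (n + 2 * l * u) ..< 2 ^ (n + 2 * Suc l * u)}"
proof -
  have "lev n u l - u = n + 2 * l * u" "lev n u l + u = n + 2 * Suc l * u" by (auto simp: lev_def algebra_simps)
  then show ?thesis by (simp only:)
qed

lemma band_disjoint:
  assumes "l \<noteq> l'"
  shows "band (lev n u l) u \<inter> band (lev n u l') u = {}"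
proof -
  have "band (lev n u l) u \<inter> band (lev n u l') u = {}" if "l < l'" for l l'
  proof -
    have "Suc l * u \<le> l' * u" using that by (intro mult_right_mono) auto
    then have "n + 2 * Suc l * u \<le> n + 2 * l' * u" by (simp only: mult.assoc)
    then have "(2::real) ^ (n + 2 * Suc l * u) \<le> 2 ^ (n + 2 * l' * u)" by (intro power_increasing) auto
    then show ?thesis unfolding lev_band by auto
  qed
  then show ?thesis using assms by (metis Int_commute linorder_neqE_nat)
qed

text \<open>The band parts of different levels are independent, and each is calm with probability
  bounded below by \<open>small_ball_box\<close>. The parts outside the bands are dependent across
  levels; their tails are so small that a union bound handles them.\<close>

lemma prob_no_calm_level:
  assumes u: "1 \<le> u" and n: "a0 < 2 ^ n" and L: "2 * L * u \<le> n" and m: "2 * n \<le> m"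
    and R: "\<And>l. l < L \<Longrightarrow> R l \<in> Z (lev n u l)"
    and D: "D = 2 powr (real u * \<beta> - 2 * real J) / (4 * mesh_const\<^sup>2)" "1 \<le> D"
  shows "prob {\<omega>\<in>space M. \<forall>l<L. \<omega> \<notin> calm m J (lev n u l) (R l) (comp {0..}) osc_const}
    \<le> (1 - exp (- 2 * (real CARD('d) * ball_const * 2 powr (real J * Q))) / 4) ^ L
      + real L * (real CARD('d) * (tail_const * exp (- D / 2)))"
proof -
  define K where "K l = {comp (band (lev n u l) u) c t | c t. t \<in> cube}" for l
  define P where "P = exp (- 2 * (real CARD('d) * ball_const * 2 powr (real J * Q))) / 4"
  \<comment> \<open>The value outside \<open>l < L\<close> is a harmless default:
    \<open>prob_Inter_gen\<close> asks for measurability at every index.\<close>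
  define VG where "VG l = (if l < L then calm m J (lev n u l) (R l) (comp (band (lev n u l) u)) (14 * mesh_const) else {})" for l
  define ZB where "ZB l c = {\<omega>\<in>space M. \<exists>z\<in>sub (lev n u l) m (R l). \<bar>rest (lev n u l) u c (pt m z) \<omega> - rest (lev n u l) u c (pt (lev n u l) (R l)) \<omega>\<bar> > 7 * 2 powr - real J * 2 powr - real (lev n u l)}" for l c
  have bandS: "band k u \<in> sets borel_Rplus" for k by (intro Rplus_sets) simp
  have bsub: "band k u \<subseteq> {0..}" for k using bandS[of k] unfolding sets_borel_Rplus by blast
  have KH: "K l \<subseteq> H" for l unfolding K_def using bandS by (auto intro: comp_mem)
  have VGgen: "VG l \<in> sets (gen (K l))" for l
    unfolding VG_def using R[of l] by (auto intro!: calm_gen simp: K_def)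
  have VGev: "VG l \<in> events" for l using VGgen gen_sub[OF KH] by blast
  have levm: "lev n u l \<le> m" "lev n u l \<le> 2 * n" "u \<le> lev n u l" "a0 < 2 ^ (lev n u l - u)" if "l < L" for l
  proof -
    have "(2 * l + 1) * u \<le> 2 * L * u" using that by (intro mult_right_mono) auto
    then show "lev n u l \<le> 2 * n" using L by (simp add: lev_def)
    then show "lev n u l \<le> m" using m by simp
    show "u \<le> lev n u l" by (simp add: lev_def)
    have "(2::real) ^ n \<le> 2 ^ (lev n u l - u)" by (intro power_increasing) (auto simp: lev_def)
    then show "a0 < 2 ^ (lev n u l - u)" using n by linarith
  qed
  have rest_mem: "rest (lev n u l) u c t \<in> H" if "t \<in> cube" for l c t
    using that bandS by (intro diff_mem comp_mem) auto
  have ZBev: "ZB l c \<in> events" if l: "l < L" for l c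
  proof -
    have "{\<omega>\<in>space M. \<bar>rest (lev n u l) u c (pt m z) \<omega> - rest (lev n u l) u c (pt (lev n u l) (R l)) \<omega>\<bar> > 7 * 2 powr - real J * 2 powr - real (lev n u l)} \<in> events"
      if z: "z \<in> sub (lev n u l) m (R l)" for z
    proof -
      have c: "pt m z \<in> cube" "pt (lev n u l) (R l) \<in> cube" using z R[OF l] by (auto simp: sub_def intro: pt_mem_cube)
      note [measurable] = measurable_mem[OF rest_mem[OF c(1)]] measurable_mem[OF rest_mem[OF c(2)]]
      show ?thesis by measurable
    qed
    from sets.sets_Collect_finite_Ex[OF this finite_sub] show ?thesis unfolding ZB_def .
  qed
  have ZBp: "prob (ZB l c) \<le> tail_const * exp (- D / 2)" if l: "l < L" for l c
    unfolding ZB_def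
  proof (rule osc_tail_box[OF levm(1)[OF l] R[OF l] rest_mem])
    show "sd (\<lambda>\<omega>. link (\<lambda>t. rest (lev n u l) u c t \<omega>) (lev n u l + i) w) \<le> (mesh_const * 2 powr (- (real u * \<beta> / 2))) * 2 powr (- real (lev n u l) - real i / 2)"
      if "w \<in> Z (Suc (lev n u l + i))" for i w
      using that levm[OF l] u by (intro sd_link_rest) auto
    show "D = (2 powr - real J / (2 * (mesh_const * 2 powr (- (real u * \<beta> / 2)))))\<^sup>2"
    proof -
      have "(2 powr - real J / (2 * (mesh_const * 2 powr (- (real u * \<beta> / 2)))))\<^sup>2 = (2 powr - real J / 2 powr (- (real u * \<beta> / 2)))\<^sup>2 / (4 * mesh_const\<^sup>2)"
        by (simp add: power_divide power_mult_distrib)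
      also have "(2 powr - real J / 2 powr (- (real u * \<beta> / 2)))\<^sup>2 = 2 powr (real u * \<beta> - 2 * real J)"
        unfolding power2_eq_square powr_diff[symmetric] powr_add[symmetric] by (rule arg_cong[where f="(powr) 2"]) (simp add: algebra_simps)
      finally show ?thesis by (simp add: D(1))
    qed
  qed (use mesh_const_pos D in auto)
  have VGp: "P \<le> prob (VG l)" if l: "l < L" for l
  proof -
    have "P \<le> prob {\<omega>\<in>space M. \<forall>c. \<forall>z\<in>sub (lev n u l) m (R l). \<bar>comp (band (lev n u l) u) c (pt m z) \<omega> - comp (band (lev n u l) u) c (pt (lev n u l) (R l)) \<omega>\<bar> \<le> 14 * mesh_const * 2 powr - (real (lev n u l) + real J)}"
      unfolding P_def
    proof (rule small_ball_box[OF levm(1)[OF l] R[OF l] comp_mem[OF bandS] mesh_const_pos])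
      fix c i w assume w: "w \<in> Z (Suc (lev n u l + i))"
      have "(2::real) ^ n \<le> 2 ^ (lev n u l + i)" by (intro power_increasing) (auto simp: lev_def)
      then have a: "a0 < 2 ^ (lev n u l + i)" using n by linarith
      have "sd (incr (band (lev n u l) u) (pt (Suc (lev n u l + i)) w) (pt (lev n u l + i) (par (lev n u l + i) (Suc (lev n u l + i)) w)) c)
         \<le> sd (incr {0..} (pt (Suc (lev n u l + i)) w) (pt (lev n u l + i) (par (lev n u l + i) (Suc (lev n u l + i)) w)) c)"
        using pt_E[OF w] bandS bsub by (intro sd_incr_mono) auto
      also have "\<dots> \<le> mesh_const * 2 powr - real (lev n u l + i)"
        using sd_link_total[OF w a, of c] unfolding link_comp[OF w] .
      finally show "sd (\<lambda>\<omega>. link (\<lambda>t. comp (band (lev n u l) u) c t \<omega>) (lev n u l + i) w) \<le> mesh_const * 2 powr - (real (lev n u l) + real i)"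
        unfolding link_comp[OF w] by simp
    qed
    then show ?thesis using l by (simp add: VG_def calm_def)
  qed
  have subset: "{\<omega>\<in>space M. \<forall>l<L. \<omega> \<notin> calm m J (lev n u l) (R l) (comp {0..}) osc_const}
     \<subseteq> {\<omega>\<in>space M. \<forall>l<L. \<omega> \<in> space M - VG l} \<union> (\<Union>l<L. \<Union>c\<in>UNIV. ZB l c)"
  proof (rule subsetI, rule ccontr)
    fix \<omega> assume a: "\<omega> \<in> {\<omega>\<in>space M. \<forall>l<L. \<omega> \<notin> calm m J (lev n u l) (R l) (comp {0..}) osc_const}"
      and b: "\<omega> \<notin> {\<omega>\<in>space M. \<forall>l<L. \<omega> \<in> space M - VG l} \<union> (\<Union>l<L. \<Union>c\<in>UNIV. ZB l c)"
    from a b obtain l where l: "l < L" "\<omega> \<in> VG l" "\<omega> \<in> space M" by auto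
    have "\<omega> \<in> calm m J (lev n u l) (R l) (comp {0..}) osc_const"
      unfolding calm_def
    proof (intro CollectI conjI allI ballI)
      show "\<omega> \<in> space M" by fact
      fix c z assume z: "z \<in> sub (lev n u l) m (R l)"
      let ?k = "lev n u l" and ?B = "band (lev n u l) u"
      have "\<bar>comp ?B c (pt m z) \<omega> - comp ?B c (pt ?k (R l)) \<omega>\<bar> \<le> 14 * mesh_const * 2 powr - (real ?k + real J)"
        using l z by (simp add: VG_def calm_def)
      moreover have "\<bar>rest ?k u c (pt m z) \<omega> - rest ?k u c (pt ?k (R l)) \<omega>\<bar> \<le> 7 * 2 powr - real J * 2 powr - real ?k"
      proof -
        have "\<omega> \<notin> ZB l c" using b l(1) by blast
        then have "\<not> 7 * 2 powr - real J * 2 powr - real ?k < \<bar>rest ?k u c (pt m z) \<omega> - rest ?k u c (pt ?k (R l)) \<omega>\<bar>"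
          unfolding ZB_def using l(3) z by blast
        then show ?thesis by (rule leI)
      qed
      moreover have "7 * 2 powr - real J * 2 powr - real ?k = 7 * 2 powr - (real ?k + real J)"
        unfolding mult.assoc powr_add[symmetric] by (simp only: minus_add_distrib add.commute)
      ultimately show "\<bar>comp {0..} c (pt m z) \<omega> - comp {0..} c (pt ?k (R l)) \<omega>\<bar> \<le> osc_const * 2 powr - (real ?k + real J)"
        unfolding osc_const_def distrib_right by linarith
    qed
    then show False using a l(1) by blast
  qed
  have Vc: "space M - VG l \<in> sets (gen (K l))" for l
    using VGgen[of l] sets.compl_sets[of "VG l" "gen (K l)"] by simp
  have ev1: "{\<omega>\<in>space M. \<forall>l<L. \<omega> \<in> space M - VG l} \<in> events"
  proof -
    have "{\<omega>\<in>space M. \<forall>l\<in>{..<L}. \<omega> \<in> space M - VG l} \<in> events"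
    proof (rule sets.sets_Collect_finite_All)
      fix l
      have "{\<omega>\<in>space M. \<omega> \<in> space M - VG l} = space M - VG l" by auto
      then show "{\<omega>\<in>space M. \<omega> \<in> space M - VG l} \<in> events" using VGev[of l] by simp
    qed simp
    then show ?thesis by (simp only: lessThan_iff Ball_def)
  qed
  have ev2: "(\<Union>l<L. \<Union>c\<in>UNIV. ZB l c) \<in> events" using ZBev by auto
  have "prob {\<omega>\<in>space M. \<forall>l<L. \<omega> \<notin> calm m J (lev n u l) (R l) (comp {0..}) osc_const}
     \<le> prob ({\<omega>\<in>space M. \<forall>l<L. \<omega> \<in> space M - VG l} \<union> (\<Union>l<L. \<Union>c\<in>UNIV. ZB l c))"
    by (rule finite_measure_mono[OF subset sets.Un[OF ev1 ev2]])
  also have "\<dots> \<le> prob {\<omega>\<in>space M. \<forall>l<L. \<omega> \<in> space M - VG l} + prob (\<Union>l<L. \<Union>c\<in>UNIV. ZB l c)"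
    by (rule measure_Un_le[OF ev1 ev2])
  also have "prob {\<omega>\<in>space M. \<forall>l<L. \<omega> \<in> space M - VG l} = (\<Prod>l<L. prob (space M - VG l))"
  proof (rule prob_Inter_gen[OF KH _ Vc])
    fix i j Y Y' assume ij: "i \<noteq> j" "Y \<in> K i" "Y' \<in> K j"
    then obtain c t c' t' where "t \<in> cube" "t' \<in> cube" and Y: "Y = (\<lambda>\<omega>. W (band (lev n u i) u) t \<omega> $ c)"
      "Y' = (\<lambda>\<omega>. W (band (lev n u j) u) t' \<omega> $ c')" unfolding K_def comp_def by blast
    then have "t \<in> E" "t' \<in> E" using cube_E by auto
    then show "expectation (\<lambda>\<omega>. Y \<omega> * Y' \<omega>) = 0"
      unfolding Y by (rule W_orth[OF bandS bandS band_disjoint[OF ij(1)]])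
  qed
  also have "\<dots> \<le> (\<Prod>l<L. 1 - P)"
    using VGp VGev by (intro prod_mono) (auto simp: prob_compl)
  also have "\<dots> = (1 - P) ^ L" by simp
  also have "prob (\<Union>l<L. \<Union>c\<in>UNIV. ZB l c) \<le> (\<Sum>l<L. prob (\<Union>c\<in>UNIV. ZB l c))"
    using ZBev by (intro finite_measure_subadditive_finite) auto
  also have "\<dots> \<le> (\<Sum>l<L. \<Sum>c\<in>UNIV. prob (ZB l c))"
    using ZBev by (intro sum_mono finite_measure_subadditive_finite) auto
  also have "\<dots> \<le> (\<Sum>l<L. \<Sum>c\<in>(UNIV::'d set). tail_const * exp (- D / 2))"
    by (intro sum_mono ZBp) auto
  also have "\<dots> = real L * (real CARD('d) * (tail_const * exp (- D / 2)))" by simp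
  finally show ?thesis by (simp add: P_def)
qed

end

section \<open>Hitting from a single point of a pinned field\<close>

text \<open>Induction over the coordinates by Tonelli: each integration replaces one density by its
  bound and contributes one factor \<open>c\<close>.\<close>

lemma nn_integral_PiM_density_le:
  fixes g :: "'i \<Rightarrow> real \<Rightarrow> ennreal"
  assumes fin: "finite I"
    and g: "\<And>i. g i \<in> borel_measurable borel" "\<And>i x. g i x \<le> c"
    and sf: "\<And>i. sigma_finite_measure (density lborel (g i))"
    and f: "f \<in> borel_measurable (Pi\<^sub>M I (\<lambda>_. borel))"
  shows "(\<integral>\<^sup>+x. f x \<partial>Pi\<^sub>M I (\<lambda>i. density lborel (g i))) \<le> c ^ card I * (\<integral>\<^sup>+x. f x \<partial>Pi\<^sub>M I (\<lambda>_. lborel))"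
  using fin f
proof (induction I arbitrary: f)
  case empty
  interpret P: product_sigma_finite "\<lambda>i. density lborel (g i)" by (rule product_sigma_finite.intro) (rule sf)
  interpret L: product_sigma_finite "\<lambda>i. lborel :: real measure" by (rule product_sigma_finite.intro) (rule sigma_finite_lborel)
  show ?case by (simp add: P.nn_integral_empty L.nn_integral_empty)
next
  case (insert i I)
  interpret P: product_sigma_finite "\<lambda>i. density lborel (g i)" by (rule product_sigma_finite.intro) (rule sf)
  interpret L: product_sigma_finite "\<lambda>i. lborel :: real measure" by (rule product_sigma_finite.intro) (rule sigma_finite_lborel)
  have sP: "sets (Pi\<^sub>M J (\<lambda>i. density lborel (g i))) = sets (Pi\<^sub>M J (\<lambda>_. borel))" for J
    by (intro sets_PiM_cong) auto
  have sL: "sets (Pi\<^sub>M J (\<lambda>_. lborel :: real measure)) = sets (Pi\<^sub>M J (\<lambda>_. borel))" for J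
    by (intro sets_PiM_cong) auto
  have fP: "f \<in> borel_measurable (Pi\<^sub>M (insert i I) (\<lambda>i. density lborel (g i)))"
    using insert.prems by (subst measurable_cong_sets[OF sP refl])
  have fL: "f \<in> borel_measurable (Pi\<^sub>M (insert i I) (\<lambda>_. lborel))"
    using insert.prems by (subst measurable_cong_sets[OF sL refl])
  have upd: "(\<lambda>(x, y). x(i := y)) \<in> Pi\<^sub>M I (\<lambda>_. borel) \<Otimes>\<^sub>M borel \<rightarrow>\<^sub>M Pi\<^sub>M (insert i I) (\<lambda>_. borel :: real measure)"
    by (rule measurable_add_dim)
  have f2: "(\<lambda>(x, y). f (x(i := y))) \<in> borel_measurable (Pi\<^sub>M I (\<lambda>_. borel) \<Otimes>\<^sub>M lborel)"
  proof -
    have "f \<circ> (\<lambda>(x, y). x(i := y)) \<in> borel_measurable (Pi\<^sub>M I (\<lambda>_. borel) \<Otimes>\<^sub>M borel)"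
      by (rule measurable_comp[OF upd insert.prems])
    then have "(\<lambda>(x, y). f (x(i := y))) \<in> borel_measurable (Pi\<^sub>M I (\<lambda>_. borel) \<Otimes>\<^sub>M borel)"
      by (simp add: comp_def case_prod_beta)
    moreover have "sets (Pi\<^sub>M I (\<lambda>_. borel :: real measure) \<Otimes>\<^sub>M lborel) = sets (Pi\<^sub>M I (\<lambda>_. borel) \<Otimes>\<^sub>M (borel :: real measure))"
      by (intro sets_pair_measure_cong) auto
    ultimately show ?thesis by (subst measurable_cong_sets[OF _ refl]) auto
  qed
  have inner: "(\<lambda>x. \<integral>\<^sup>+y. f (x(i := y)) \<partial>lborel) \<in> borel_measurable (Pi\<^sub>M I (\<lambda>_. borel))"
    using lborel.borel_measurable_nn_integral[OF f2] by simp
  have fy: "(\<lambda>y. f (x(i := y))) \<in> borel_measurable borel" if "x \<in> space (Pi\<^sub>M I (\<lambda>_. borel :: real measure))" for x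
    using measurable_Pair2[OF f2 that] by simp
  have "(\<integral>\<^sup>+x. f x \<partial>Pi\<^sub>M (insert i I) (\<lambda>i. density lborel (g i)))
      = (\<integral>\<^sup>+x. (\<integral>\<^sup>+y. f (x(i := y)) \<partial>density lborel (g i)) \<partial>Pi\<^sub>M I (\<lambda>i. density lborel (g i)))"
    using insert.hyps fP by (rule P.product_nn_integral_insert)
  also have "\<dots> \<le> (\<integral>\<^sup>+x. c * (\<integral>\<^sup>+y. f (x(i := y)) \<partial>lborel) \<partial>Pi\<^sub>M I (\<lambda>i. density lborel (g i)))"
  proof (rule nn_integral_mono)
    fix x assume "x \<in> space (Pi\<^sub>M I (\<lambda>i. density lborel (g i)))"
    then have x: "x \<in> space (Pi\<^sub>M I (\<lambda>_. borel :: real measure))" by (simp add: space_PiM)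
    note [measurable] = fy[OF x] g(1)[of i]
    have "(\<integral>\<^sup>+y. f (x(i := y)) \<partial>density lborel (g i)) = (\<integral>\<^sup>+y. g i y * f (x(i := y)) \<partial>lborel)"
      by (rule nn_integral_density) auto
    also have "\<dots> \<le> (\<integral>\<^sup>+y. c * f (x(i := y)) \<partial>lborel)"
      using g(2) by (intro nn_integral_mono mult_right_mono) auto
    also have "\<dots> = c * (\<integral>\<^sup>+y. f (x(i := y)) \<partial>lborel)" by (rule nn_integral_cmult) simp
    finally show "(\<integral>\<^sup>+y. f (x(i := y)) \<partial>density lborel (g i)) \<le> c * (\<integral>\<^sup>+y. f (x(i := y)) \<partial>lborel)" .
  qed
  also have "\<dots> \<le> c ^ card I * (\<integral>\<^sup>+x. c * (\<integral>\<^sup>+y. f (x(i := y)) \<partial>lborel) \<partial>Pi\<^sub>M I (\<lambda>_. lborel))"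
    by (rule insert.IH) (use inner in measurable)
  also have "(\<integral>\<^sup>+x. c * (\<integral>\<^sup>+y. f (x(i := y)) \<partial>lborel) \<partial>Pi\<^sub>M I (\<lambda>_. lborel)) = c * (\<integral>\<^sup>+x. (\<integral>\<^sup>+y. f (x(i := y)) \<partial>lborel) \<partial>Pi\<^sub>M I (\<lambda>_. lborel))"
    using inner by (intro nn_integral_cmult) (subst measurable_cong_sets[OF sL refl])
  also have "(\<integral>\<^sup>+x. (\<integral>\<^sup>+y. f (x(i := y)) \<partial>lborel) \<partial>Pi\<^sub>M I (\<lambda>_. lborel)) = (\<integral>\<^sup>+x. f x \<partial>Pi\<^sub>M (insert i I) (\<lambda>_. lborel))"
    using insert.hyps fL by (rule L.product_nn_integral_insert[symmetric])
  finally show ?case using insert.hyps by (simp add: mult_ac)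
qed

context gaussian_space
begin

lemma density_mem:
  assumes Y: "Y \<in> H" and s: "0 < sd Y"
  shows "distr M borel Y = density lborel (\<lambda>x. ennreal (normal_density 0 (sd Y) x))"
proof -
  interpret N: real_distribution std_normal_distribution by (rule real_dist_normal_dist)
  have "distributed std_normal_distribution lborel (\<lambda>x. x) std_normal_density"
    unfolding distributed_def by (auto intro!: distr_id2[symmetric] simp: distr_id2)
  from N.normal_density_affine[OF this, of "sd Y" 0]
  have "distributed std_normal_distribution lborel (\<lambda>x. sd Y * x) (normal_density 0 (sd Y))"
    using s by simp
  then have "distr std_normal_distribution lborel (\<lambda>x. sd Y * x) = density lborel (\<lambda>x. ennreal (normal_density 0 (sd Y) x))"
    by (simp add: distributed_def)
  moreover have "distr std_normal_distribution lborel (\<lambda>x. sd Y * x) = distr std_normal_distribution borel (\<lambda>x. sd Y * x)"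
    by (rule distr_cong) auto
  ultimately show ?thesis using law_mem[OF Y] by simp
qed

lemma prob_rectangle:
  fixes I :: "'i set"
  assumes "finite I" and Y: "\<And>i. i \<in> I \<Longrightarrow> Y i \<in> H"
    and orth: "\<And>i j. i \<in> I \<Longrightarrow> j \<in> I \<Longrightarrow> i \<noteq> j \<Longrightarrow> expectation (\<lambda>\<omega>. Y i \<omega> * Y j \<omega>) = 0"
    and B: "\<And>i. i \<in> I \<Longrightarrow> B i \<in> sets borel"
  shows "prob {\<omega>\<in>space M. \<forall>i\<in>I. Y i \<omega> \<in> B i} = (\<Prod>i\<in>I. prob {\<omega>\<in>space M. Y i \<omega> \<in> B i})"
  using assms
proof (induction I)
  case empty
  then show ?case by (simp add: prob_space)
next
  case (insert k I)
  have "{\<omega>\<in>space M. \<forall>i\<in>insert k I. Y i \<omega> \<in> B i} = {\<omega>\<in>space M. Y k \<omega> \<in> B k} \<inter> {\<omega>\<in>space M. \<forall>i\<in>I. Y i \<omega> \<in> B i}"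
    by auto
  moreover have "prob ({\<omega>\<in>space M. Y k \<omega> \<in> B k} \<inter> {\<omega>\<in>space M. \<forall>i\<in>I. Y i \<omega> \<in> B i}) = prob {\<omega>\<in>space M. Y k \<omega> \<in> B k} * prob {\<omega>\<in>space M. \<forall>i\<in>I. Y i \<omega> \<in> B i}"
  proof (rule prob_indep_gen[of "{Y k}" "Y ` I"])
    show "{Y k} \<subseteq> H" "Y ` I \<subseteq> H" using insert.prems by auto
    show "expectation (\<lambda>\<omega>. Z \<omega> * Z' \<omega>) = 0" if "Z \<in> {Y k}" "Z' \<in> Y ` I" for Z Z'
    proof -
      obtain i where "i \<in> I" "Z' = Y i" using \<open>Z' \<in> Y ` I\<close> by auto
      then show ?thesis using that insert.prems(2)[of k i] insert.hyps by auto
    qed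
    have "{\<omega>\<in>space (gen {Y k}). Y k \<omega> \<in> B k} \<in> sets (gen {Y k})"
      using insert.prems(3)[of k] by (intro measurable_sets_Collect[OF measurable_gen]) auto
    then show "{\<omega>\<in>space M. Y k \<omega> \<in> B k} \<in> sets (gen {Y k})" by simp
    have "{\<omega>\<in>space (gen (Y ` I)). \<forall>i\<in>I. Y i \<omega> \<in> B i} \<in> sets (gen (Y ` I))"
      using insert.prems insert.hyps by (intro sets.sets_Collect_finite_All measurable_sets_Collect[OF measurable_gen]) auto
    then show "{\<omega>\<in>space M. \<forall>i\<in>I. Y i \<omega> \<in> B i} \<in> sets (gen (Y ` I))" by simp
  qed
  moreover have "prob {\<omega>\<in>space M. \<forall>i\<in>I. Y i \<omega> \<in> B i} = (\<Prod>i\<in>I. prob {\<omega>\<in>space M. Y i \<omega> \<in> B i})"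
    using insert.prems by (intro insert.IH) auto
  ultimately show ?case using insert.hyps by simp
qed

text \<open>Orthogonal Gaussian coordinates are independent, so the law is a product of normal laws,
  each with density at most \<open>1 / (sqrt (2 * pi) * \<sigma>)\<close>.\<close>

lemma law_orthogonal_le_lborel:
  fixes Y :: "'d::finite \<Rightarrow> 'w \<Rightarrow> real"
  assumes Y: "\<And>i. Y i \<in> H" and \<sigma>: "\<And>i. sd (Y i) = \<sigma>" "0 < \<sigma>"
    and orth: "\<And>i j. i \<noteq> j \<Longrightarrow> expectation (\<lambda>\<omega>. Y i \<omega> * Y j \<omega>) = 0"
    and S: "S \<in> sets borel"
  shows "emeasure (distr M borel (\<lambda>\<omega>. \<chi> i. Y i \<omega>)) S \<le> ennreal ((1 / (sqrt (2 * pi) * \<sigma>)) ^ CARD('d)) * emeasure lborel S"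
proof -
  let ?B = "Basis :: (real ^ 'd) set"
  define y where "y \<omega> = (\<chi> i. Y i \<omega>)" for \<omega>
  have yb: "y \<omega> \<bullet> axis i 1 = Y i \<omega>" for \<omega> i by (simp add: y_def inner_axis)
  have Bax: "\<exists>i. b = axis i 1" if "b \<in> ?B" for b using that by (auto simp: Basis_vec_def)
  have ybH: "(\<lambda>\<omega>. y \<omega> \<bullet> b) \<in> H" and ybsd: "sd (\<lambda>\<omega>. y \<omega> \<bullet> b) = \<sigma>" if b: "b \<in> ?B" for b
    using Bax[OF b] Y \<sigma> by (auto simp: yb)
  have ym [measurable]: "y \<in> borel_measurable M"
    unfolding borel_measurable_euclidean_space[of y] using measurable_mem[OF ybH] by auto
  define g where "g = (\<lambda>_::real^'d. \<lambda>x. ennreal (normal_density 0 \<sigma> x))"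
  let ?c = "ennreal (1 / (sqrt (2 * pi) * \<sigma>))"
  have gc: "g b x \<le> ?c" for b x
    unfolding g_def using \<sigma> by (intro ennreal_leI) (simp add: normal_density_def real_sqrt_mult divide_right_mono)
  have psd: "prob_space (density lborel (g b))" for b
    unfolding g_def by (rule prob_space_normal_density[OF \<sigma>(2)])
  have sfd: "sigma_finite_measure (density lborel (g b))" for b
    using psd by (rule prob_space_imp_sigma_finite)
  have law: "distr M borel (\<lambda>\<omega>. y \<omega> \<bullet> b) = density lborel (g b)" if "b \<in> ?B" for b
    using density_mem[OF ybH[OF that]] ybsd[OF that] \<sigma>(2) by (simp add: g_def)
  interpret P: product_sigma_finite "\<lambda>b. density lborel (g b)" by (rule product_sigma_finite.intro) (rule sfd)
  have tup: "(\<lambda>\<omega>. \<lambda>b\<in>?B. y \<omega> \<bullet> b) \<in> M \<rightarrow>\<^sub>M Pi\<^sub>M ?B (\<lambda>_. borel)"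
    by (rule measurable_restrict) (use measurable_mem[OF ybH] in auto)
  have sP: "sets (Pi\<^sub>M ?B (\<lambda>b. density lborel (g b))) = sets (Pi\<^sub>M ?B (\<lambda>_. borel))"
    by (intro sets_PiM_cong) auto
  have joint: "distr M (Pi\<^sub>M ?B (\<lambda>_. borel)) (\<lambda>\<omega>. \<lambda>b\<in>?B. y \<omega> \<bullet> b) = Pi\<^sub>M ?B (\<lambda>b. density lborel (g b))"
  proof (rule P.PiM_eqI)
    show "finite ?B" by simp
    show "sets (distr M (Pi\<^sub>M ?B (\<lambda>_. borel)) (\<lambda>\<omega>. \<lambda>b\<in>?B. y \<omega> \<bullet> b)) = sets (Pi\<^sub>M ?B (\<lambda>b. density lborel (g b)))"
      by (simp only: sets_distr sP)
    fix A assume "\<And>i. i \<in> ?B \<Longrightarrow> A i \<in> sets (density lborel (g i))"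
    then have A: "A b \<in> sets borel" if "b \<in> ?B" for b using that by simp
    have "emeasure (distr M (Pi\<^sub>M ?B (\<lambda>_. borel)) (\<lambda>\<omega>. \<lambda>b\<in>?B. y \<omega> \<bullet> b)) (Pi\<^sub>E ?B A)
       = emeasure M {\<omega>\<in>space M. \<forall>b\<in>?B. y \<omega> \<bullet> b \<in> A b}"
    proof (subst emeasure_distr[OF tup])
      show "Pi\<^sub>E ?B A \<in> sets (Pi\<^sub>M ?B (\<lambda>_. borel))" using A by (intro sets_PiM_I_finite) auto
      show "emeasure M ((\<lambda>\<omega>. \<lambda>b\<in>?B. y \<omega> \<bullet> b) -` Pi\<^sub>E ?B A \<inter> space M) = emeasure M {\<omega>\<in>space M. \<forall>b\<in>?B. y \<omega> \<bullet> b \<in> A b}"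
        by (rule arg_cong[where f="emeasure M"]) auto
    qed
    also have "\<dots> = ennreal (\<Prod>b\<in>?B. prob {\<omega>\<in>space M. y \<omega> \<bullet> b \<in> A b})"
    proof -
      have "prob {\<omega>\<in>space M. \<forall>b\<in>?B. y \<omega> \<bullet> b \<in> A b} = (\<Prod>b\<in>?B. prob {\<omega>\<in>space M. y \<omega> \<bullet> b \<in> A b})"
      proof (rule prob_rectangle[OF _ ybH _ A])
        fix b b' assume bb: "b \<in> ?B" "b' \<in> ?B" "b \<noteq> b'"
        then obtain i j where "b = axis i 1" "b' = axis j 1" "i \<noteq> j" using Bax by metis
        then show "expectation (\<lambda>\<omega>. (y \<omega> \<bullet> b) * (y \<omega> \<bullet> b')) = 0" using orth by (simp add: yb)
      qed auto
      then show ?thesis by (simp add: emeasure_eq_measure)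
    qed
    also have "\<dots> = (\<Prod>b\<in>?B. emeasure (density lborel (g b)) (A b))"
    proof -
      have "emeasure (density lborel (g b)) (A b) = ennreal (prob {\<omega>\<in>space M. y \<omega> \<bullet> b \<in> A b})" if b: "b \<in> ?B" for b
      proof -
        have "emeasure (density lborel (g b)) (A b) = emeasure M ((\<lambda>\<omega>. y \<omega> \<bullet> b) -` A b \<inter> space M)"
          unfolding law[OF b, symmetric] using A[OF b] measurable_mem[OF ybH[OF b]] by (intro emeasure_distr) auto
        also have "(\<lambda>\<omega>. y \<omega> \<bullet> b) -` A b \<inter> space M = {\<omega>\<in>space M. y \<omega> \<bullet> b \<in> A b}" by auto
        finally show ?thesis by (simp add: emeasure_eq_measure)
      qed
      then show ?thesis by (simp add: prod_ennreal)
    qed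
    finally show "emeasure (distr M (Pi\<^sub>M ?B (\<lambda>_. borel)) (\<lambda>\<omega>. \<lambda>b\<in>?B. y \<omega> \<bullet> b)) (Pi\<^sub>E ?B A) = (\<Prod>i\<in>?B. emeasure (density lborel (g i)) (A i))" .
  qed
  let ?T = "\<lambda>f. \<Sum>b\<in>?B. f b *\<^sub>R b"
  have Tm: "?T \<in> Pi\<^sub>M ?B (\<lambda>_. borel) \<rightarrow>\<^sub>M borel" by measurable
  define A where "A = ?T -` S \<inter> space (Pi\<^sub>M ?B (\<lambda>_. borel :: real measure))"
  have A: "A \<in> sets (Pi\<^sub>M ?B (\<lambda>_. borel))" unfolding A_def by (rule measurable_sets[OF Tm S])
  have "emeasure (distr M borel y) S = emeasure M (y -` S \<inter> space M)" using S by (intro emeasure_distr) auto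
  also have "y -` S \<inter> space M = (\<lambda>\<omega>. \<lambda>b\<in>?B. y \<omega> \<bullet> b) -` A \<inter> space M"
    by (auto simp: A_def space_PiM euclidean_representation)
  also have "emeasure M \<dots> = emeasure (Pi\<^sub>M ?B (\<lambda>b. density lborel (g b))) A"
    unfolding joint[symmetric] by (rule emeasure_distr[OF tup A, symmetric])
  also have "\<dots> = (\<integral>\<^sup>+x. indicator A x \<partial>Pi\<^sub>M ?B (\<lambda>b. density lborel (g b)))"
    using A sP by simp
  also have "\<dots> \<le> ?c ^ card ?B * (\<integral>\<^sup>+x. indicator A x \<partial>Pi\<^sub>M ?B (\<lambda>_. lborel))"
    by (rule nn_integral_PiM_density_le[OF _ _ gc sfd]) (use A in \<open>auto simp: g_def\<close>)
  also have "(\<integral>\<^sup>+x. indicator A x \<partial>Pi\<^sub>M ?B (\<lambda>_. lborel)) = emeasure (Pi\<^sub>M ?B (\<lambda>_. lborel)) A"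
  proof (rule nn_integral_indicator)
    have "sets (Pi\<^sub>M ?B (\<lambda>_. lborel :: real measure)) = sets (Pi\<^sub>M ?B (\<lambda>_. borel))" by (intro sets_PiM_cong) auto
    then show "A \<in> sets (Pi\<^sub>M ?B (\<lambda>_. lborel))" using A by simp
  qed
  also have "\<dots> = emeasure lborel S"
  proof -
    have sL: "sets (Pi\<^sub>M ?B (\<lambda>_. lborel :: real measure)) = sets (Pi\<^sub>M ?B (\<lambda>_. borel))" by (intro sets_PiM_cong) auto
    have "?T \<in> Pi\<^sub>M ?B (\<lambda>_. lborel) \<rightarrow>\<^sub>M borel" using Tm by (subst measurable_cong_sets[OF sL refl])
    then have "emeasure (distr (Pi\<^sub>M ?B (\<lambda>_. lborel)) borel ?T) S = emeasure (Pi\<^sub>M ?B (\<lambda>_. lborel)) (?T -` S \<inter> space (Pi\<^sub>M ?B (\<lambda>_. lborel)))"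
      using S by (intro emeasure_distr)
    moreover have "distr (Pi\<^sub>M ?B (\<lambda>_. lborel)) borel ?T = (lborel :: (real ^ 'd) measure)"
      by (subst (2) lborel_def) (simp only: lborel_eq_real[symmetric])
    ultimately show ?thesis by (simp add: A_def space_PiM)
  qed
  also have "?c ^ card ?B = ennreal ((1 / (sqrt (2 * pi) * \<sigma>)) ^ CARD('d))"
    using \<sigma> by (subst ennreal_power) auto
  finally show ?thesis by (simp add: y_def[abs_def])
qed

end

section \<open>Volumes of closed neighbourhoods\<close>

lemma closed_closed_nbhd: "closed (closed_nbhd F r)"
proof (cases "F = {}")
  case False
  have "closed_nbhd F r = {x. infdist x F \<le> r}" using False by (simp add: closed_nbhd_def)
  moreover have "closed {x. infdist x F \<le> r}" by (intro closed_Collect_le continuous_intros)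
  ultimately show ?thesis by simp
qed (simp add: closed_nbhd_def)

lemma bounded_closed_nbhd:
  assumes "bounded F"
  shows "bounded (closed_nbhd F r)"
proof -
  obtain a e where F: "F \<subseteq> cball a e" using assms by (auto simp: bounded_subset_cball)
  have "closed_nbhd F r \<subseteq> cball a (e + (\<bar>r\<bar> + 1))"
  proof
    fix x assume "x \<in> closed_nbhd F r"
    then have "F \<noteq> {}" "infdist x F < \<bar>r\<bar> + 1" by (auto simp: closed_nbhd_def)
    then obtain y where "y \<in> F" "dist x y < \<bar>r\<bar> + 1" by (auto simp: infdist_def cInf_less_iff split: if_splits)
    then show "x \<in> cball a (e + (\<bar>r\<bar> + 1))" using F dist_triangle[of a x y] by (force simp: dist_commute)
  qed
  then show ?thesis using bounded_cball bounded_subset by blast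
qed

lemma infdist_less_obtain:
  assumes "infdist x F < r" "F \<noteq> {}"
  obtains y where "y \<in> F" "dist x y < r"
  using assms by (auto simp: infdist_def cInf_less_iff split: if_splits)

text \<open>A largest \<open>r\<close>-separated subset is a net, and the balls of radius
  \<open>r / 2\<close> around its points are disjoint and lie in the neighbourhood. Boundedness
  makes the volume of the neighbourhood finite, which caps the cardinality of separated
  sets.\<close>

lemma separated_net_exists:
  fixes F :: "'a::euclidean_space set"
  assumes F: "bounded F" and r: "0 < r"
  obtains P where "finite P" "P \<subseteq> F" "\<And>x. x \<in> F \<Longrightarrow> \<exists>p\<in>P. dist x p < r"
    and "ennreal (real (card P)) * emeasure lborel (ball (0::'a) (r/2)) \<le> emeasure lborel (closed_nbhd F r)"
proof -
  define sep where "sep P \<longleftrightarrow> finite P \<and> P \<subseteq> F \<and> (\<forall>x\<in>P. \<forall>y\<in>P. x \<noteq> y \<longrightarrow> r \<le> dist x y)" for P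
  have ball_eq: "emeasure lborel (ball c (r/2)) = ennreal (unit_ball_vol DIM('a) * (r/2) ^ DIM('a))" for c :: 'a
    using r by (simp add: emeasure_ball)
  define v where "v = unit_ball_vol DIM('a) * (r/2) ^ DIM('a)"
  have v: "0 < v" unfolding v_def using r by (simp add: unit_ball_vol_pos)
  have pack: "ennreal (real (card P)) * emeasure lborel (ball (0::'a) (r/2)) \<le> emeasure lborel (closed_nbhd F r)"
    if P: "sep P" for P
  proof -
    have "ennreal (real (card P)) * emeasure lborel (ball (0::'a) (r/2)) = (\<Sum>p\<in>P. emeasure lborel (ball p (r/2)))"
      unfolding ball_eq by (simp add: ennreal_of_nat_eq_real_of_nat)
    also have "\<dots> = emeasure lborel (\<Union>p\<in>P. ball p (r/2))"
    proof (rule sum_emeasure)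
      show "disjoint_family_on (\<lambda>p. ball p (r/2)) P"
        unfolding disjoint_family_on_def
      proof (intro ballI impI)
        fix x y assume "x \<in> P" "y \<in> P" "x \<noteq> y"
        then have "r \<le> dist x y" using P by (auto simp: sep_def)
        then show "ball x (r/2) \<inter> ball y (r/2) = {}" by (intro disjoint_ballI) simp
      qed
    qed (use P in \<open>auto simp: sep_def\<close>)
    also have "\<dots> \<le> emeasure lborel (closed_nbhd F r)"
    proof (rule emeasure_mono)
      show "(\<Union>p\<in>P. ball p (r/2)) \<subseteq> closed_nbhd F r"
      proof
        fix x assume "x \<in> (\<Union>p\<in>P. ball p (r/2))"
        then obtain p where p: "p \<in> F" "dist p x < r/2" using P by (auto simp: sep_def)
        then have "infdist x F \<le> dist x p" by (intro infdist_le)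
        then show "x \<in> closed_nbhd F r" using p r by (auto simp: closed_nbhd_def dist_commute)
      qed
      show "closed_nbhd F r \<in> sets lborel" by (simp add: borel_closed closed_closed_nbhd)
    qed
    finally show ?thesis .
  qed
  define V where "V = measure lborel (closed_nbhd F r)"
  have "compact (closed_nbhd F r)"
    using F by (simp add: compact_eq_bounded_closed closed_closed_nbhd bounded_closed_nbhd)
  then have "emeasure lborel (closed_nbhd F r) < \<infinity>" by (rule emeasure_compact_finite)
  then have V: "emeasure lborel (closed_nbhd F r) = ennreal V" unfolding V_def by (intro emeasure_eq_ennreal_measure) auto
  have cardb: "card P \<le> nat \<lceil>V / v\<rceil>" if "sep P" for P
  proof -
    have "ennreal (real (card P) * v) \<le> ennreal V" using pack[OF that] v unfolding V ball_eq v_def[symmetric]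
      by (simp add: ennreal_mult)
    then have "real (card P) * v \<le> V" by (simp add: V_def)
    then have "real (card P) \<le> V / v" using v by (simp add: field_simps)
    then show ?thesis by linarith
  qed
  have "sep {}" by (simp add: sep_def)
  then have "\<exists>P. sep P \<and> (\<forall>P'. sep P' \<longrightarrow> card P' \<le> card P)"
    by (rule ex_has_greatest_nat[where b = "Suc (nat \<lceil>V / v\<rceil>)"]) (use cardb in \<open>auto simp: less_Suc_eq_le\<close>)
  then obtain P where P: "sep P" "\<And>P'. sep P' \<Longrightarrow> card P' \<le> card P" by blast
  have "\<exists>p\<in>P. dist x p < r" if x: "x \<in> F" for x
  proof (rule ccontr)
    assume "\<not> (\<exists>p\<in>P. dist x p < r)"
    then have far: "\<And>p. p \<in> P \<Longrightarrow> r \<le> dist x p" by force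
    then have "x \<notin> P" using r by force
    moreover have "sep (insert x P)" using P(1) x far by (auto simp: sep_def dist_commute)
    then have "card (insert x P) \<le> card P" by (rule P(2))
    ultimately show False using P(1) by (simp add: sep_def)
  qed
  then show ?thesis using that[of P] P(1) pack[OF P(1)] by (auto simp: sep_def)
qed

text \<open>The library computes the measure of a linear image only over well-ordered index types;
  covering the neighbourhood by balls needs no more than that the map is expanding.\<close>

lemma emeasure_expanding_preimage_le:
  fixes F :: "(real ^ 'd) set" and f :: "real ^ 'd \<Rightarrow> real ^ 'd"
  assumes D: "sets D = sets borel" "\<And>S. S \<in> sets borel \<Longrightarrow> emeasure D S \<le> ennreal c * emeasure lborel S" and c: "0 \<le> c"
    and F: "bounded F" and r: "0 < r"
    and f: "continuous_on UNIV f" "\<And>y y'. dist y y' \<le> 2 * dist (f y) (f y')"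
  shows "emeasure D {y. f y \<in> closed_nbhd F r} \<le> ennreal (c * 24 ^ CARD('d)) * emeasure lborel (closed_nbhd F r)"
proof -
  obtain P where P: "finite P" "P \<subseteq> F" "\<And>x. x \<in> F \<Longrightarrow> \<exists>p\<in>P. dist x p < r"
    and vol: "ennreal (real (card P)) * emeasure lborel (ball (0::real^'d) (r/2)) \<le> emeasure lborel (closed_nbhd F r)"
    using separated_net_exists[OF F r] by blast
  define w where "w = unit_ball_vol (real CARD('d))"
  have w: "0 \<le> w" unfolding w_def by simp
  \<comment> \<open>The infimum in \<open>infdist\<close> may not be attained, so a point of
    \<open>F\<close> is found within \<open>2 * r\<close>, and the net adds another
    \<open>r\<close>. Two images in a ball of radius \<open>3 * r\<close> are at most
    \<open>6 * r\<close> apart, their preimages at most \<open>12 * r\<close>, which is 24 times the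
    packing radius \<open>r / 2\<close>.\<close>
  define S where "S p = {y. f y \<in> ball p (3 * r)}" for p
  have Sb: "S p \<in> sets borel" for p
    unfolding S_def using f(1) by (intro borel_open open_vimage[of "ball p (3*r)" f, unfolded vimage_def]) auto
  have Sp: "emeasure D (S p) \<le> ennreal (c * (w * (12 * r) ^ CARD('d)))" for p
  proof (cases "S p = {}")
    case False
    then obtain y0 where y0: "y0 \<in> S p" by auto
    have "S p \<subseteq> cball y0 (12 * r)"
    proof
      fix y assume "y \<in> S p"
      then have "dist (f y0) (f y) \<le> 6 * r" using y0 dist_triangle[of "f y0" "f y" p] by (auto simp: S_def dist_commute)
      then show "y \<in> cball y0 (12 * r)" using f(2)[of y0 y] by simp
    qed
    then have "emeasure lborel (S p) \<le> emeasure lborel (cball y0 (12 * r))"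
      by (intro emeasure_mono) auto
    also have "\<dots> = ennreal (w * (12 * r) ^ CARD('d))" using r by (simp add: emeasure_cball w_def)
    finally have "ennreal c * emeasure lborel (S p) \<le> ennreal c * ennreal (w * (12 * r) ^ CARD('d))" by (intro mult_left_mono) auto
    also have "\<dots> = ennreal (c * (w * (12 * r) ^ CARD('d)))" using c w r by (intro ennreal_mult[symmetric]) auto
    finally show ?thesis using D(2)[OF Sb[of p]] by (rule order_trans[rotated])
  qed simp
  have "{y. f y \<in> closed_nbhd F r} \<subseteq> (\<Union>p\<in>P. S p)"
  proof
    fix y assume "y \<in> {y. f y \<in> closed_nbhd F r}"
    then have "infdist (f y) F < 2 * r" "F \<noteq> {}" using r by (auto simp: closed_nbhd_def)
    then obtain z where z: "z \<in> F" "dist (f y) z < 2 * r" by (rule infdist_less_obtain)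
    obtain p where p: "p \<in> P" "dist z p < r" using P(3)[OF z(1)] by auto
    have "dist p (f y) < 3 * r" using dist_triangle[of p "f y" z] z p by (simp add: dist_commute)
    then show "y \<in> (\<Union>p\<in>P. S p)" using p(1) by (auto simp: S_def)
  qed
  then have "emeasure D {y. f y \<in> closed_nbhd F r} \<le> emeasure D (\<Union>p\<in>P. S p)"
    using P(1) Sb D(1) by (intro emeasure_mono sets.finite_UN) auto
  also have "\<dots> \<le> (\<Sum>p\<in>P. emeasure D (S p))"
    using P(1) Sb D(1) by (intro emeasure_subadditive_finite) auto
  also have "\<dots> \<le> (\<Sum>p\<in>P. ennreal (c * (w * (12 * r) ^ CARD('d))))" by (intro sum_mono Sp)
  also have "\<dots> = ennreal (real (card P)) * ennreal (c * (w * (12 * r) ^ CARD('d)))"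
    by (simp add: ennreal_of_nat_eq_real_of_nat)
  also have "c * (w * (12 * r) ^ CARD('d)) = (c * 24 ^ CARD('d)) * (w * (r/2) ^ CARD('d))"
  proof -
    have "12 * r = 24 * (r / 2)" by simp
    then have "(12 * r) ^ CARD('d) = 24 ^ CARD('d) * (r/2) ^ CARD('d)" by (simp only: power_mult_distrib)
    then show ?thesis by (simp only: mult_ac)
  qed
  also have "ennreal ((c * 24 ^ CARD('d)) * (w * (r/2) ^ CARD('d))) = ennreal (c * 24 ^ CARD('d)) * emeasure lborel (ball (0::real^'d) (r/2))"
  proof -
    have "emeasure lborel (ball (0::real^'d) (r/2)) = ennreal (w * (r/2) ^ CARD('d))"
      using r by (simp add: emeasure_ball w_def)
    moreover have "0 \<le> c * 24 ^ CARD('d)" "0 \<le> w * (r/2) ^ CARD('d)" using c w r by simp_all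
    ultimately show ?thesis by (simp only: ennreal_mult)
  qed
  also have "ennreal (real (card P)) * (ennreal (c * 24 ^ CARD('d)) * emeasure lborel (ball (0::real^'d) (r/2)))
     = ennreal (c * 24 ^ CARD('d)) * (ennreal (real (card P)) * emeasure lborel (ball (0::real^'d) (r/2)))"
    by (simp add: mult_ac)
  also have "\<dots> \<le> ennreal (c * 24 ^ CARD('d)) * emeasure lborel (closed_nbhd F r)"
    by (intro mult_left_mono vol) simp
  finally show ?thesis .
qed

section \<open>The pinned field and its residual\<close>

locale pinned = noise_grid M H W E \<gamma> a0 c0 p h
  for M :: "'w measure" and H and W :: "real set \<Rightarrow> real ^ 'n::finite \<Rightarrow> 'w \<Rightarrow> real ^ 'd::finite"
    and E \<gamma> a0 c0 p h +
  fixes t0 :: "real ^ 'n" and a \<nu> :: real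
  assumes t0_E: "t0 \<in> E" and a_ge: "a0 \<le> a" and nu_pos: "0 < \<nu>"
    and cov: "\<And>i j. expectation (\<lambda>\<omega>. W {0..<a} t0 \<omega> $ i * W {0..<a} t0 \<omega> $ j) = (if i = j then \<nu> else 0)"
begin

definition pin :: "'d \<Rightarrow> 'w \<Rightarrow> real" where "pin j = (\<lambda>\<omega>. W {0..<a} t0 \<omega> $ j)"

text \<open>Regression coefficients on the pinned vector. The covariance of a noise value is a
  multiple of the identity, so division by \<open>\<nu>\<close> replaces a matrix inversion.\<close>

definition proj :: "real ^ 'n \<Rightarrow> 'd \<Rightarrow> 'd \<Rightarrow> real" where
  "proj s i j = expectation (\<lambda>\<omega>. W {0..} s \<omega> $ i * pin j \<omega>) / \<nu>"

definition residual :: "'d \<Rightarrow> real ^ 'n \<Rightarrow> 'w \<Rightarrow> real" where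
  "residual i s = (\<lambda>\<omega>. comp {0..} i s \<omega> - (\<Sum>j\<in>UNIV. proj s i j * pin j \<omega>))"

lemma low_set: "{0..<a} \<in> sets borel_Rplus"
  by (rule Rplus_sets) simp

lemma pin_mem: "pin j \<in> H"
  unfolding pin_def using low_set t0_E by (rule W_mem)

lemma sd_pin: "sd (pin j) = sqrt \<nu>"
  using cov[of j j] by (simp add: sd_def pin_def power2_eq_square)

lemma residual_mem: "s \<in> cube \<Longrightarrow> residual i s \<in> H"
  unfolding residual_def by (intro diff_mem comp_mem sum_mem scale_mem pin_mem Rplus_sets)

lemma residual_orth:
  assumes s: "s \<in> cube"
  shows "expectation (\<lambda>\<omega>. residual i s \<omega> * pin j \<omega>) = 0"
proof -
  have I1: "integrable M (\<lambda>\<omega>. comp {0..} i s \<omega> * pin j \<omega>)"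
    using s by (intro integrable_mult_mem comp_mem pin_mem Rplus_sets)
  have I2: "integrable M (\<lambda>\<omega>. proj s i k * (pin k \<omega> * pin j \<omega>))" for k
    by (intro integrable_mult_right integrable_mult_mem pin_mem)
  have "expectation (\<lambda>\<omega>. residual i s \<omega> * pin j \<omega>) = expectation (\<lambda>\<omega>. comp {0..} i s \<omega> * pin j \<omega> - (\<Sum>k\<in>UNIV. proj s i k * (pin k \<omega> * pin j \<omega>)))"
    by (simp add: residual_def left_diff_distrib sum_distrib_right mult.assoc)
  also have "\<dots> = expectation (\<lambda>\<omega>. comp {0..} i s \<omega> * pin j \<omega>) - (\<Sum>k\<in>UNIV. expectation (\<lambda>\<omega>. proj s i k * (pin k \<omega> * pin j \<omega>)))"
    using I1 I2 by (subst Bochner_Integration.integral_diff) (auto simp: Bochner_Integration.integral_sum)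
  also have "(\<Sum>k\<in>UNIV. expectation (\<lambda>\<omega>. proj s i k * (pin k \<omega> * pin j \<omega>))) = (\<Sum>k\<in>UNIV. if k = j then proj s i j * \<nu> else 0)"
    using cov by (intro sum.cong refl) (auto simp: pin_def)
  also have "\<dots> = expectation (\<lambda>\<omega>. comp {0..} i s \<omega> * pin j \<omega>)"
    using nu_pos by (simp add: proj_def comp_def)
  finally show ?thesis by simp
qed

definition proj_const :: real where "proj_const = c0 * (\<Sum>j\<in>(UNIV::'n set). a powr \<gamma> j) / sqrt \<nu>"

lemma proj_const_nonneg: "0 \<le> proj_const"
  unfolding proj_const_def using c0_pos nu_pos by (intro divide_nonneg_nonneg mult_nonneg_nonneg sum_nonneg) auto

text \<open>By \<open>expectation_total_mult\<close> the coefficients see frequencies below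
  \<open>a\<close> only, where increments are Lipschitz in time by \<open>W_low\<close>;
  Cauchy-Schwarz transfers this to the coefficients.\<close>

lemma proj_Lipschitz:
  assumes st: "s \<in> E" "t \<in> E" and \<delta>: "\<And>j. \<bar>s $ j - t $ j\<bar> \<le> \<delta>"
  shows "\<bar>proj s i k - proj t i k\<bar> \<le> proj_const * \<delta>"
proof -
  have e: "proj x i k = expectation (\<lambda>\<omega>. W {0..<a} x \<omega> $ i * pin k \<omega>) / \<nu>" if "x \<in> E" for x
    unfolding proj_def pin_def using expectation_total_mult[OF low_set t0_E that] by simp
  have I: "integrable M (\<lambda>\<omega>. W {0..<a} x \<omega> $ i * pin k \<omega>)" if "x \<in> E" for x
    using that low_set by (intro integrable_mult_mem W_mem pin_mem)
  have "proj s i k - proj t i k = expectation (\<lambda>\<omega>. incr {0..<a} s t i \<omega> * pin k \<omega>) / \<nu>"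
    unfolding e[OF st(1)] e[OF st(2)] diff_divide_distrib[symmetric]
    using I[OF st(1)] I[OF st(2)] by (simp add: incr_def left_diff_distrib)
  then have "\<bar>proj s i k - proj t i k\<bar> = \<bar>expectation (\<lambda>\<omega>. incr {0..<a} s t i \<omega> * pin k \<omega>)\<bar> / \<nu>"
    using nu_pos by (simp add: abs_divide)
  also have "\<dots> \<le> sd (incr {0..<a} s t i) * sqrt \<nu> / \<nu>"
    using Cauchy_Schwarz_mem[OF incr_mem[OF low_set st, of i] pin_mem[of k]] nu_pos
    by (intro divide_right_mono) (auto simp: sd_pin)
  also have "\<dots> = sd (incr {0..<a} s t i) / sqrt \<nu>"
  proof -
    have "sqrt \<nu> / \<nu> = 1 / sqrt \<nu>" using nu_pos by (simp add: frac_eq_eq)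
    then show ?thesis by (metis mult.right_neutral times_divide_eq_right)
  qed
  also have "\<dots> \<le> c0 * (\<Sum>j\<in>UNIV. a powr \<gamma> j * \<bar>s $ j - t $ j\<bar>) / sqrt \<nu>"
    using W_low[OF a_ge st, of i] nu_pos by (intro divide_right_mono) (auto simp: incr_def)
  also have "\<dots> \<le> c0 * (\<Sum>j\<in>UNIV. a powr \<gamma> j * \<delta>) / sqrt \<nu>"
    using c0_pos nu_pos \<delta> by (intro divide_right_mono mult_left_mono sum_mono) auto
  also have "\<dots> = proj_const * \<delta>" by (simp add: proj_const_def sum_distrib_right[symmetric])
  finally show ?thesis .
qed

lemma proj_t0: "proj t0 i j = (if i = j then 1 else 0)"
  unfolding proj_def pin_def expectation_total_mult[OF low_set t0_E t0_E] cov using nu_pos by simp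

definition residuals :: "('w \<Rightarrow> real) set" where "residuals = {residual i s | i s. s \<in> cube}"

text \<open>The density bound for the pinned vector times the covering constant of
  \<open>emeasure_expanding_preimage_le\<close>.\<close>

definition hit_const :: real where
  "hit_const = (1 / (sqrt (2 * pi) * sqrt \<nu>)) ^ CARD('d) * 24 ^ CARD('d)"

lemma hit_const_pos: "0 < hit_const"
  unfolding hit_const_def using nu_pos by simp

text \<open>Given the residuals, the field at \<open>s\<close> is a fixed vector plus a linear image
  of the independent pins. \<open>near\<close> keeps this linear map close to the identity, so it
  contracts distances at most by a factor of 2, and the conditional probability of hitting is
  bounded by the volume, whatever the residuals are.\<close>

lemma prob_hit_le:
  assumes s: "s \<in> cube" and A: "A \<in> sets (gen residuals)"
    and near: "\<And>i j. \<bar>proj s i j - (if i = j then 1 else 0)\<bar> \<le> 1 / (2 * real CARD('d) * real CARD('d))"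
    and F: "bounded F" and r: "0 < r"
  shows "prob (A \<inter> {\<omega>\<in>space M. W {0..} s \<omega> \<in> closed_nbhd F r}) \<le> prob A * (hit_const * measure lborel (closed_nbhd F r))"
proof -
  let ?G = "closed_nbhd F r"
  let ?Y = "\<lambda>\<omega>. \<chi> j. pin j \<omega>" and ?V = "\<lambda>\<omega>. \<chi> i. residual i s \<omega>"
  let ?S = "gen residuals" and ?T = "borel :: (real ^ 'd) measure"
  define c where "c = (1 / (sqrt (2 * pi) * sqrt \<nu>)) ^ CARD('d)"
  have c0: "0 \<le> c" unfolding c_def using nu_pos by simp
  define L where "L y = (\<chi> i. \<Sum>j\<in>UNIV. proj s i j * y $ j)" for y :: "real ^ 'd"
  have resH: "residuals \<subseteq> H" unfolding residuals_def using residual_mem by auto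
  have Yc: "(\<lambda>\<omega>. ?Y \<omega> \<bullet> b) \<in> borel_measurable (gen (range pin))" if b: "b \<in> Basis" for b
  proof -
    obtain i where "b = axis i 1" using b by (auto simp: Basis_vec_def)
    then show ?thesis by (simp add: inner_axis measurable_gen)
  qed
  have Yg: "?Y \<in> borel_measurable (gen (range pin))"
    unfolding borel_measurable_euclidean_space[of ?Y] using Yc by auto
  have Vc: "(\<lambda>\<omega>. ?V \<omega> \<bullet> b) \<in> borel_measurable ?S" if b: "b \<in> Basis" for b
  proof -
    obtain i where "b = axis i 1" using b by (auto simp: Basis_vec_def)
    moreover have "residual i s \<in> residuals" for i unfolding residuals_def using s by auto
    ultimately show ?thesis by (simp add: inner_axis measurable_gen)
  qed
  have Vg: "?V \<in> borel_measurable ?S"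
    unfolding borel_measurable_euclidean_space[of ?V] using Vc by auto
  have pinH: "range pin \<subseteq> H" using pin_mem by auto
  have idm: "(\<lambda>\<omega>. \<omega>) \<in> M \<rightarrow>\<^sub>M ?S"
    using gen_sub[OF resH] by (intro measurableI) (auto intro: sets.Int)
  have Ym: "?Y \<in> borel_measurable M"
  proof (rule measurableI)
    show "?Y -` B \<inter> space M \<in> events" if "B \<in> sets borel" for B
      using measurable_sets[OF Yg that] gen_sub[OF pinH] by auto
  qed auto
  \<comment> \<open>\<open>?R\<close> is the probability restricted to the events decided by the
    residuals, obtained as the image under the identity. Independence then says that
    \<open>\<omega>\<close> and the pins have a product law.\<close>
  let ?D = "distr M ?T ?Y" and ?R = "distr M ?S (\<lambda>\<omega>. \<omega>)"
  interpret D: prob_space ?D by (rule prob_space_distr[OF Ym])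
  interpret R: prob_space ?R by (rule prob_space_distr[OF idm])
  have pairm: "(\<lambda>\<omega>. (\<omega>, ?Y \<omega>)) \<in> M \<rightarrow>\<^sub>M ?S \<Otimes>\<^sub>M ?T" by (rule measurable_Pair[OF idm Ym])
  have ReqM: "emeasure ?R A' = emeasure M A'" if "A' \<in> sets ?S" for A'
    using that idm sets.sets_into_space[OF that] by (subst emeasure_distr) (auto simp: Int_absorb2)
  have joint: "?R \<Otimes>\<^sub>M ?D = distr M (?S \<Otimes>\<^sub>M ?T) (\<lambda>\<omega>. (\<omega>, ?Y \<omega>))"
  proof (rule pair_measure_eqI)
    show "sigma_finite_measure ?R" "sigma_finite_measure ?D" by unfold_locales
    show "sets (?R \<Otimes>\<^sub>M ?D) = sets (distr M (?S \<Otimes>\<^sub>M ?T) (\<lambda>\<omega>. (\<omega>, ?Y \<omega>)))"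
      unfolding sets_distr by (rule sets_pair_measure_cong) simp_all
    fix A' B assume "A' \<in> sets ?R" "B \<in> sets ?D"
    then have A': "A' \<in> sets ?S" and B: "B \<in> sets ?T" by simp_all
    have YB: "?Y -` B \<inter> space M \<in> sets (gen (range pin))" using measurable_sets[OF Yg B] by simp
    have "emeasure (distr M (?S \<Otimes>\<^sub>M ?T) (\<lambda>\<omega>. (\<omega>, ?Y \<omega>))) (A' \<times> B) = emeasure M ((\<lambda>\<omega>. (\<omega>, ?Y \<omega>)) -` (A' \<times> B) \<inter> space M)"
      using A' B by (intro emeasure_distr pairm) auto
    also have "(\<lambda>\<omega>. (\<omega>, ?Y \<omega>)) -` (A' \<times> B) \<inter> space M = A' \<inter> (?Y -` B \<inter> space M)"
      using sets.sets_into_space[OF A'] by auto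
    also have "emeasure M \<dots> = ennreal (prob A' * prob (?Y -` B \<inter> space M))"
      unfolding emeasure_eq_measure
      using prob_indep_gen[OF resH pinH _ A' YB] residual_orth by (auto simp: residuals_def)
    also have "\<dots> = emeasure ?R A' * emeasure ?D B"
      unfolding ReqM[OF A'] emeasure_distr[OF Ym B] by (simp add: emeasure_eq_measure ennreal_mult)
    finally show "emeasure ?R A' * emeasure ?D B = emeasure (distr M (?S \<Otimes>\<^sub>M ?T) (\<lambda>\<omega>. (\<omega>, ?Y \<omega>))) (A' \<times> B)" ..
  qed
  have Dle: "emeasure ?D S \<le> ennreal c * emeasure lborel S" if "S \<in> sets borel" for S
    unfolding c_def using cov nu_pos that
    by (intro law_orthogonal_le_lborel pin_mem sd_pin) (auto simp: pin_def)
  have Lc: "continuous_on UNIV L" unfolding L_def by (intro continuous_intros)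
  have L_expand: "dist y y' \<le> 2 * dist (x + L y) (x + L y')" for x y y'
  proof -
    define z where "z = y - y'"
    have Lz: "L y - L y' = L z" by (simp add: L_def z_def vec_eq_iff right_diff_distrib sum_subtractf)
    \<comment> \<open>Each of the \<open>CARD('d)^2\<close> entries of \<open>L - id\<close> is at
      most \<open>1 / (2 * CARD('d)^2)\<close>; summed up, they leave half of the norm.\<close>
    have "norm (L z - z) \<le> (\<Sum>i\<in>UNIV. \<bar>(L z - z) $ i\<bar>)" by (rule norm_le_l1_cart)
    also have "\<dots> \<le> (\<Sum>i\<in>(UNIV::'d set). norm z / (2 * real CARD('d)))"
    proof (rule sum_mono)
      fix i
      have "(L z - z) $ i = (\<Sum>j\<in>UNIV. (proj s i j - (if i = j then 1 else 0)) * z $ j)"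
        by (simp add: L_def left_diff_distrib sum_subtractf if_distrib[of "\<lambda>x. x * _"] cong: if_cong)
      also have "\<bar>\<dots>\<bar> \<le> (\<Sum>j\<in>UNIV. \<bar>(proj s i j - (if i = j then 1 else 0)) * z $ j\<bar>)" by (rule sum_abs)
      also have "\<dots> \<le> (\<Sum>j\<in>(UNIV::'d set). 1 / (2 * real CARD('d) * real CARD('d)) * norm z)"
      proof (rule sum_mono)
        fix j
        have "\<bar>proj s i j - (if i = j then 1 else 0)\<bar> * \<bar>z $ j\<bar> \<le> 1 / (2 * real CARD('d) * real CARD('d)) * norm z"
          by (intro mult_mono near component_le_norm_cart) auto
        then show "\<bar>(proj s i j - (if i = j then 1 else 0)) * z $ j\<bar> \<le> 1 / (2 * real CARD('d) * real CARD('d)) * norm z"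
          by (simp only: abs_mult)
      qed
      also have "\<dots> = norm z / (2 * real CARD('d))" by simp
      finally show "\<bar>(L z - z) $ i\<bar> \<le> norm z / (2 * real CARD('d))" .
    qed
    also have "\<dots> = norm z / 2" by simp
    finally have "norm (L z - z) \<le> norm z / 2" .
    then have "norm z \<le> 2 * norm (L z)" using norm_triangle_ineq2[of z "L z"] by (simp add: norm_minus_commute)
    then show ?thesis by (simp add: dist_norm Lz z_def)
  qed
  have hit: "emeasure ?D {y. x + L y \<in> ?G} \<le> ennreal (hit_const * measure lborel ?G)" for x
  proof -
    have "emeasure ?D {y. x + L y \<in> ?G} \<le> ennreal (c * 24 ^ CARD('d)) * emeasure lborel ?G"
      by (rule emeasure_expanding_preimage_le[OF _ Dle c0 F r _ L_expand]) (auto intro!: continuous_intros Lc)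
    also have "emeasure lborel ?G = ennreal (measure lborel ?G)"
      using emeasure_compact_finite[of ?G] F
      by (intro emeasure_eq_ennreal_measure) (auto simp: compact_eq_bounded_closed closed_closed_nbhd bounded_closed_nbhd)
    finally show ?thesis by (simp add: hit_const_def c_def[symmetric] ennreal_mult c0)
  qed
  define C where "C = {x \<in> space (?S \<Otimes>\<^sub>M ?T). fst x \<in> A \<and> ?V (fst x) + L (snd x) \<in> ?G}"
  have C: "C \<in> sets (?S \<Otimes>\<^sub>M ?T)"
  proof -
    have Gb: "?G \<in> sets borel" using closed_closed_nbhd by (rule borel_closed)
    have Lm: "L \<in> borel_measurable borel" using Lc by (rule borel_measurable_continuous_onI)
    note [measurable] = Vg A Gb Lm
    show ?thesis unfolding C_def by measurable
  qed
  have WVL: "W {0..} s \<omega> = ?V \<omega> + L (?Y \<omega>)" for \<omega>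
    by (simp add: vec_eq_iff residual_def L_def comp_def)
  have "emeasure M (A \<inter> {\<omega>\<in>space M. W {0..} s \<omega> \<in> ?G}) = emeasure (distr M (?S \<Otimes>\<^sub>M ?T) (\<lambda>\<omega>. (\<omega>, ?Y \<omega>))) C"
  proof (subst emeasure_distr[OF _ C])
    show "(\<lambda>\<omega>. (\<omega>, ?Y \<omega>)) \<in> M \<rightarrow>\<^sub>M ?S \<Otimes>\<^sub>M ?T" by (rule pairm)
    show "emeasure M (A \<inter> {\<omega>\<in>space M. W {0..} s \<omega> \<in> ?G}) = emeasure M ((\<lambda>\<omega>. (\<omega>, ?Y \<omega>)) -` C \<inter> space M)"
      using sets.sets_into_space[OF A] by (intro arg_cong[where f="emeasure M"]) (auto simp: C_def WVL space_pair_measure)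
  qed
  also have "\<dots> = (\<integral>\<^sup>+\<omega>. emeasure ?D (Pair \<omega> -` C) \<partial>?R)"
    unfolding joint[symmetric] using C by (intro D.emeasure_pair_measure_alt) (simp add: sets_pair_measure_cong[of ?R ?S ?D ?T])
  also have "\<dots> \<le> (\<integral>\<^sup>+\<omega>. ennreal (hit_const * measure lborel ?G) * indicator A \<omega> \<partial>?R)"
  proof (rule nn_integral_mono)
    fix \<omega> assume "\<omega> \<in> space ?R"
    show "emeasure ?D (Pair \<omega> -` C) \<le> ennreal (hit_const * measure lborel ?G) * indicator A \<omega>"
    proof (cases "\<omega> \<in> A")
      case True
      then have "Pair \<omega> -` C = {y. ?V \<omega> + L y \<in> ?G}"
        using sets.sets_into_space[OF A] by (auto simp: C_def space_pair_measure)
      then show ?thesis using hit True by simp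
    next
      case False
      then have "Pair \<omega> -` C = {}" by (auto simp: C_def)
      then show ?thesis by simp
    qed
  qed
  also have "\<dots> = ennreal (hit_const * measure lborel ?G) * emeasure ?R A"
    using A by (subst nn_integral_cmult_indicator) auto
  also have "emeasure ?R A = emeasure M A"
    by (rule ReqM[OF A])
  finally have "ennreal (prob (A \<inter> {\<omega>\<in>space M. W {0..} s \<omega> \<in> ?G})) \<le> ennreal (hit_const * measure lborel ?G * prob A)"
    using hit_const_pos by (simp add: emeasure_eq_measure ennreal_mult less_imp_le)
  then show ?thesis using hit_const_pos by (simp add: mult_ac)
qed

end

section \<open>Covering by first calm boxes\<close>

lemma closed_nbhd_shift:
  assumes "x \<in> closed_nbhd F s" "dist x y \<le> r"
  shows "y \<in> closed_nbhd F (r + s)"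
  using assms infdist_triangle[of y F x] by (auto simp: closed_nbhd_def dist_commute)

lemma closed_nbhd_mono: "r \<le> s \<Longrightarrow> closed_nbhd F r \<subseteq> closed_nbhd F s"
  by (auto simp: closed_nbhd_def)

context pinned
begin

definition pin_bound :: "real \<Rightarrow> 'w set" where
  "pin_bound y = {\<omega>\<in>space M. \<forall>j. \<bar>pin j \<omega>\<bar> \<le> y}"

lemma pin_bound_event: "pin_bound y \<in> events"
proof -
  have "{\<omega>\<in>space M. \<forall>j\<in>UNIV. \<bar>pin j \<omega>\<bar> \<le> y} \<in> events"
  proof (rule sets.sets_Collect_finite_All)
    fix j
    note [measurable] = measurable_mem[OF pin_mem[of j]]
    show "{\<omega>\<in>space M. \<bar>pin j \<omega>\<bar> \<le> y} \<in> events" by measurable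
  qed simp
  then show ?thesis by (simp only: pin_bound_def ball_UNIV)
qed

lemma prob_pin_bound:
  assumes "0 \<le> y"
  shows "prob (space M - pin_bound y) \<le> real CARD('d) * (sqrt 2 * exp (- y\<^sup>2 / (4 * \<nu>)))"
proof -
  have ev: "{\<omega>\<in>space M. \<bar>pin j \<omega>\<bar> > y} \<in> events" for j
  proof -
    note [measurable] = measurable_mem[OF pin_mem[of j]]
    show ?thesis by measurable
  qed
  have "prob (space M - pin_bound y) \<le> prob (\<Union>j\<in>UNIV. {\<omega>\<in>space M. \<bar>pin j \<omega>\<bar> > y})"
    using ev by (intro finite_measure_mono) (auto simp: pin_bound_def not_le)
  also have "\<dots> \<le> (\<Sum>j\<in>UNIV. prob {\<omega>\<in>space M. \<bar>pin j \<omega>\<bar> > y})"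
    using ev by (intro finite_measure_subadditive_finite) auto
  also have "\<dots> \<le> (\<Sum>j\<in>(UNIV::'d set). sqrt 2 * exp (- y\<^sup>2 / (4 * \<nu>)))"
  proof (rule sum_mono)
    fix j
    show "prob {\<omega>\<in>space M. \<bar>pin j \<omega>\<bar> > y} \<le> sqrt 2 * exp (- y\<^sup>2 / (4 * \<nu>))"
      using tail_mem[OF pin_mem[of j], of "sqrt \<nu>" y] nu_pos assms by (simp add: sd_pin)
  qed
  finally show ?thesis by simp
qed

definition fluct :: "'d \<Rightarrow> real ^ 'n \<Rightarrow> 'w \<Rightarrow> real" where
  "fluct i s = (\<lambda>\<omega>. \<Sum>j\<in>UNIV. proj s i j * pin j \<omega>)"

lemma comp_split: "comp {0..} i s \<omega> = residual i s \<omega> + fluct i s \<omega>"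
  by (simp add: residual_def fluct_def)

text \<open>Regression coefficients are Lipschitz in time, and a box of level \<open>k\<close> has
  sides at most \<open>2 powr (- k * (1 + \<beta>))\<close>, far below \<open>2 powr - k\<close>.
  Once the pins are bounded, calmness of the field and of its residual thus differ only by a
  constant.\<close>

lemma fluct_osc:
  assumes km: "k \<le> m" and z: "z \<in> sub k m R" and R: "R \<in> Z k" and \<omega>: "\<omega> \<in> pin_bound y" and y: "0 \<le> y"
  shows "\<bar>fluct i (pt m z) \<omega> - fluct i (pt k R) \<omega>\<bar> \<le> real CARD('d) * proj_const * y * 2 powr (- (real k * (1 + \<beta>)))"
proof -
  have zZ: "z \<in> Z m" "par k m z = R" using z by (auto simp: sub_def)
  have E2: "pt m z \<in> E" "pt k R \<in> E" using pt_mem_cube[OF zZ(1)] pt_mem_cube[OF R] cube_E by auto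
  have d: "\<bar>pt m z $ j - pt k R $ j\<bar> \<le> 2 powr (- (real k * (1 + \<beta>)))" for j
  proof -
    have "\<bar>pt m z $ j - pt k R $ j\<bar> \<le> 2 powr (- (real k * (1 + \<gamma> j)))"
      using pt_par_dist[OF km, of z j] zZ by simp
    also have "\<dots> \<le> 2 powr (- (real k * (1 + \<beta>)))" using \<beta>(3)[of j] by (simp add: mult_left_mono)
    finally show ?thesis .
  qed
  have "fluct i (pt m z) \<omega> - fluct i (pt k R) \<omega> = (\<Sum>j\<in>UNIV. (proj (pt m z) i j - proj (pt k R) i j) * pin j \<omega>)"
    by (simp add: fluct_def sum_subtractf left_diff_distrib)
  also have "\<bar>\<dots>\<bar> \<le> (\<Sum>j\<in>UNIV. \<bar>(proj (pt m z) i j - proj (pt k R) i j) * pin j \<omega>\<bar>)" by (rule sum_abs)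
  also have "\<dots> \<le> (\<Sum>j\<in>(UNIV::'d set). (proj_const * 2 powr (- (real k * (1 + \<beta>)))) * y)"
  proof (rule sum_mono)
    fix j
    have "\<bar>proj (pt m z) i j - proj (pt k R) i j\<bar> * \<bar>pin j \<omega>\<bar> \<le> (proj_const * 2 powr (- (real k * (1 + \<beta>)))) * y"
      using \<omega> y proj_const_nonneg by (intro mult_mono proj_Lipschitz E2 d) (auto simp: pin_bound_def)
    then show "\<bar>(proj (pt m z) i j - proj (pt k R) i j) * pin j \<omega>\<bar> \<le> (proj_const * 2 powr (- (real k * (1 + \<beta>)))) * y"
      by (simp only: abs_mult)
  qed
  also have "\<dots> = real CARD('d) * proj_const * y * 2 powr (- (real k * (1 + \<beta>)))" by (simp add: mult_ac)
  finally show ?thesis .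
qed

definition hits :: "nat \<Rightarrow> (real ^ 'd) set \<Rightarrow> real \<Rightarrow> 'w set" where
  "hits m F \<eta> = {\<omega>\<in>space M. \<exists>z\<in>Z m. W {0..} (pt m z) \<omega> \<in> closed_nbhd F \<eta>}"

lemma W_measurable:
  assumes "s \<in> cube"
  shows "W {0..} s \<in> borel_measurable M"
proof -
  have "(\<lambda>\<omega>. W {0..} s \<omega> \<bullet> b) \<in> borel_measurable M" if b: "b \<in> Basis" for b
  proof -
    obtain i where "b = axis i 1" using b by (auto simp: Basis_vec_def)
    then show ?thesis using measurable_mem[OF comp_mem[OF Rplus_sets(1) assms, of i]] by (simp add: inner_axis comp_def)
  qed
  then show ?thesis unfolding borel_measurable_euclidean_space[of "W {0..} s"] by auto
qed

lemma hit_event: "s \<in> cube \<Longrightarrow> {\<omega>\<in>space M. W {0..} s \<omega> \<in> closed_nbhd F \<eta>} \<in> events"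
  using measurable_sets[OF W_measurable, of s "closed_nbhd F \<eta>"]
  by (simp add: borel_closed closed_closed_nbhd vimage_def Int_def conj_commute)

text \<open>Per component, \<open>osc_const + 1\<close> for the residual and 1 for the regression
  part; the factor \<open>CARD('d)\<close> passes to the norm, and the last 1 pays for the
  neighbourhood \<open>\<eta>\<close>.\<close>

definition total_osc :: real where "total_osc = real CARD('d) * (osc_const + 2) + 1"
text \<open>The 7 of \<open>modulus_tail\<close> appears doubled because the leaves have level
  \<open>2 * n\<close>, while the radius is written as a multiple of \<open>n\<close>.\<close>

definition leaf_osc :: real where "leaf_osc = real CARD('d) * (14 * mesh_const * mod_const) + 1"

lemma dist_total_le:
  assumes "\<And>c. \<bar>comp {0..} c s \<omega> - comp {0..} c t \<omega>\<bar> \<le> x"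
  shows "dist (W {0..} s \<omega>) (W {0..} t \<omega>) \<le> real CARD('d) * x"
proof -
  have "dist (W {0..} s \<omega>) (W {0..} t \<omega>) \<le> (\<Sum>c\<in>UNIV. \<bar>(W {0..} s \<omega> - W {0..} t \<omega>) $ c\<bar>)"
    unfolding dist_norm by (rule norm_le_l1_cart)
  also have "\<dots> \<le> (\<Sum>c\<in>(UNIV::'d set). x)" using assms by (intro sum_mono) (simp add: comp_def)
  finally show ?thesis by simp
qed

text \<open>\<open>P l R\<close> stands for the probability that \<open>R\<close> is a first calm
  box, and \<open>2 powr (- (k l * Q))\<close> is its relative volume up to constants. Distributing
  the volume over the cells of level \<open>k'\<close> turns the double sum into an average, over
  these cells, of the probabilities along one chain of ancestors, which add up to at most 1.\<close>

lemma sum_first_calm_le: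
  fixes P :: "nat \<Rightarrow> ('n \<Rightarrow> nat) \<Rightarrow> real"
  assumes P: "\<And>z. z \<in> Z k' \<Longrightarrow> (\<Sum>l<L. P l (par (k l) k' z)) \<le> 1" "\<And>l R. 0 \<le> P l R"
    and k: "\<And>l. l < L \<Longrightarrow> k l \<le> k'"
  shows "(\<Sum>l<L. \<Sum>R\<in>Z (k l). P l R * 2 powr (- (real (k l) * Q))) \<le> 2 ^ CARD('n) * 2 ^ CARD('n)"
proof -
  have "(\<Sum>R\<in>Z (k l). P l R * 2 powr (- (real (k l) * Q))) \<le> (\<Sum>z\<in>Z k'. 2 ^ CARD('n) * 2 powr (- (real k' * Q)) * P l (par (k l) k' z))"
    if l: "l < L" for l
  proof -
    have "(\<Sum>R\<in>Z (k l). P l R * 2 powr (- (real (k l) * Q))) \<le> (\<Sum>R\<in>Z (k l). \<Sum>z\<in>sub (k l) k' R. 2 ^ CARD('n) * 2 powr (- (real k' * Q)) * P l (par (k l) k' z))"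
    proof (rule sum_mono)
      fix R assume R: "R \<in> Z (k l)"
      have "2 powr (- (real (k l) * Q)) = 2 powr (- (real k' * Q)) * 2 powr ((real k' - real (k l)) * Q)"
        unfolding powr_add[symmetric] by (rule arg_cong[where f="(powr) 2"]) (simp add: algebra_simps)
      also have "\<dots> \<le> 2 powr (- (real k' * Q)) * (2 ^ CARD('n) * real (card (sub (k l) k' R)))"
        by (intro mult_left_mono card_sub_bounds(2) k l R) simp
      finally have "P l R * 2 powr (- (real (k l) * Q)) \<le> P l R * (2 powr (- (real k' * Q)) * (2 ^ CARD('n) * real (card (sub (k l) k' R))))"
        using P(2) by (intro mult_left_mono)
      also have "\<dots> = (\<Sum>z\<in>sub (k l) k' R. 2 ^ CARD('n) * 2 powr (- (real k' * Q)) * P l R)" by simp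
      also have "\<dots> = (\<Sum>z\<in>sub (k l) k' R. 2 ^ CARD('n) * 2 powr (- (real k' * Q)) * P l (par (k l) k' z))"
        by (intro sum.cong refl) (simp add: sub_def)
      finally show "P l R * 2 powr (- (real (k l) * Q)) \<le> (\<Sum>z\<in>sub (k l) k' R. 2 ^ CARD('n) * 2 powr (- (real k' * Q)) * P l (par (k l) k' z))" .
    qed
    also have "\<dots> = (\<Sum>z\<in>Z k'. 2 ^ CARD('n) * 2 powr (- (real k' * Q)) * P l (par (k l) k' z))"
      unfolding sub_def using k[OF l] by (intro sum.group) (auto intro: par_mem)
    finally show ?thesis .
  qed
  then have "(\<Sum>l<L. \<Sum>R\<in>Z (k l). P l R * 2 powr (- (real (k l) * Q))) \<le> (\<Sum>l<L. \<Sum>z\<in>Z k'. 2 ^ CARD('n) * 2 powr (- (real k' * Q)) * P l (par (k l) k' z))"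
    by (intro sum_mono) auto
  also have "\<dots> = 2 ^ CARD('n) * 2 powr (- (real k' * Q)) * (\<Sum>z\<in>Z k'. \<Sum>l<L. P l (par (k l) k' z))"
    by (subst sum.swap) (simp add: sum_distrib_left)
  also have "\<dots> \<le> 2 ^ CARD('n) * 2 powr (- (real k' * Q)) * (\<Sum>z\<in>Z k'. 1)"
    by (intro mult_left_mono sum_mono P(1)) auto
  also have "\<dots> \<le> 2 ^ CARD('n) * 2 powr (- (real k' * Q)) * (2 ^ CARD('n) * 2 powr (real k' * Q))"
    using card_Z_le[of k'] by (intro mult_left_mono) auto
  also have "\<dots> = 2 ^ CARD('n) * 2 ^ CARD('n) * (2 powr (- (real k' * Q)) * 2 powr (real k' * Q))" by simp
  also have "2 powr (- (real k' * Q)) * 2 powr (real k' * Q) = 1" by (simp add: powr_add[symmetric])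
  finally show ?thesis by simp
qed

text \<open>The summands bound, in order: a pin exceeding \<open>n\<close>, failure of the modulus
  of continuity at level \<open>2 * n\<close>, a hit in a first calm box, and a hit in a cell of
  level \<open>2 * n\<close> without calm ancestor.\<close>

lemma prob_hits_le:
  assumes near: "\<And>s i j. s \<in> cube \<Longrightarrow> \<bar>proj s i j - (if i = j then 1 else 0)\<bar> \<le> 1 / (2 * real CARD('d) * real CARD('d))"
    and F: "bounded F"
    and n: "1 \<le> n" "a0 < 2 ^ n" and u: "1 \<le> u" "J \<le> u" and L: "2 * L * u \<le> n" and m: "2 * n \<le> m"
    and smooth: "real CARD('d) * proj_const * real n * 2 powr (- (real n * \<beta>)) \<le> 2 powr - real J"
    and D: "D = 2 powr (real u * \<beta> - 2 * real J) / (4 * mesh_const\<^sup>2)" "1 \<le> D"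
    and v1: "\<And>l. l < L \<Longrightarrow> measure lborel (closed_nbhd F (total_osc * 2 powr - (real (lev n u l) + real J))) \<le> v1 * 2 powr (- (real (lev n u l) * Q))"
    and v2: "measure lborel (closed_nbhd F (leaf_osc * (real n * 2 powr - real (2 * n)))) \<le> v2 * 2 powr (- (real (2 * n) * Q))"
    and v: "0 \<le> v1" "0 \<le> v2"
  defines "p1 \<equiv> real CARD('d) * (sqrt 2 * exp (- (real n)\<^sup>2 / (4 * \<nu>)))"
  shows "prob (hits m F (2 powr - real (2 * n))) \<le>
     p1 + real CARD('d) * (14 * 2 ^ CARD('n) * 2 ^ CARD('n) * 2 powr Q * 2 powr - real (2 * n))
     + 2 ^ CARD('n) * 2 ^ CARD('n) * (hit_const * v1)
     + 2 ^ CARD('n) * (hit_const * v2) * (((1 - exp (- 2 * (real CARD('d) * ball_const * 2 powr (real J * Q))) / 4) ^ L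
      + real L * (real CARD('d) * (tail_const * exp (- D / 2)))) + p1)"
proof -
  define q where "q = (1 - exp (- 2 * (real CARD('d) * ball_const * 2 powr (real J * Q))) / 4) ^ L
      + real L * (real CARD('d) * (tail_const * exp (- D / 2)))"
  define \<eta> where "\<eta> = (2::real) powr - real (2 * n)"
  define k where "k = lev n u"
  define b where "b = real CARD('d) * proj_const * real n"
  let ?PB = "pin_bound (real n)"
  have kl: "n \<le> k l" "k l \<le> 2 * n" "k l + J \<le> 2 * n" "k l \<le> m" if "l < L" for l
  proof -
    have "(2 * l + 2) * u \<le> 2 * L * u" using that by (intro mult_right_mono) auto
    then have "k l + u \<le> 2 * n" using L by (simp add: k_def lev_def)
    then show "k l \<le> 2 * n" "k l + J \<le> 2 * n" "k l \<le> m" using u m by auto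
    show "n \<le> k l" by (simp add: k_def lev_def)
  qed
  have oscpos: "0 \<le> osc_const" using mesh_const_pos by (simp add: osc_const_def)
  have mc: "0 \<le> mod_const" unfolding mod_const_def using Q_ge_1 by simp
  have d0: "0 < real CARD('d)" by simp
  \<comment> \<open>As \<open>n \<le> k l\<close>, the hypothesis \<open>smooth\<close>, stated at
    scale \<open>n\<close>, makes the regression part negligible on boxes of every level
    used.\<close>
  have fl: "\<bar>fluct i (pt m z) \<omega> - fluct i (pt (k l) R) \<omega>\<bar> \<le> 2 powr - (real (k l) + real J)"
    if "l < L" "z \<in> sub (k l) m R" "R \<in> Z (k l)" "\<omega> \<in> ?PB" for i z \<omega> l R
  proof -
    have "\<bar>fluct i (pt m z) \<omega> - fluct i (pt (k l) R) \<omega>\<bar> \<le> b * 2 powr (- (real (k l) * (1 + \<beta>)))"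
      unfolding b_def using that kl by (intro fluct_osc) auto
    also have "\<dots> \<le> b * (2 powr (- (real n * \<beta>)) * 2 powr - real (k l))"
    proof (rule mult_left_mono)
      have "real n * \<beta> \<le> real (k l) * \<beta>" using kl(1)[OF that(1)] \<beta>(1) by (intro mult_right_mono) auto
      then show "2 powr (- (real (k l) * (1 + \<beta>))) \<le> 2 powr (- (real n * \<beta>)) * 2 powr - real (k l)"
        unfolding powr_add[symmetric] by (intro powr_mono) (auto simp: algebra_simps)
      show "0 \<le> b" unfolding b_def using proj_const_nonneg by simp
    qed
    also have "\<dots> = (b * 2 powr (- (real n * \<beta>))) * 2 powr - real (k l)" by simp
    also have "\<dots> \<le> 2 powr - real J * 2 powr - real (k l)"
      using smooth unfolding b_def by (rule mult_right_mono) simp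
    also have "\<dots> = 2 powr - (real (k l) + real J)" unfolding powr_add[symmetric] by (simp add: algebra_simps)
    finally show ?thesis .
  qed
  \<comment> \<open>Calmness is tested on the residual, with the constant enlarged by 1 for the
    regression part; this makes the event independent of the pins.\<close>
  define G where "G l R = calm m J (k l) R residual (osc_const + 1)" for l R
  have Ggen: "G l R \<in> sets (gen residuals)" if "R \<in> Z (k l)" for l R
    unfolding G_def by (rule calm_gen[OF _ that]) (auto simp: residuals_def)
  have resH: "residuals \<subseteq> H" unfolding residuals_def using residual_mem by auto
  have calmG: "\<omega> \<in> G l R" if "l < L" "R \<in> Z (k l)" "\<omega> \<in> ?PB" "\<omega> \<in> calm m J (k l) R (comp {0..}) osc_const" for l R \<omega>
    unfolding G_def calm_def
  proof (intro CollectI conjI allI ballI)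
    show "\<omega> \<in> space M" using that(3) by (simp add: pin_bound_def)
    fix c z assume z: "z \<in> sub (k l) m R"
    have "\<bar>comp {0..} c (pt m z) \<omega> - comp {0..} c (pt (k l) R) \<omega>\<bar> \<le> osc_const * 2 powr - (real (k l) + real J)"
      using that(4) z by (simp add: calm_def)
    then show "\<bar>residual c (pt m z) \<omega> - residual c (pt (k l) R) \<omega>\<bar> \<le> (osc_const + 1) * 2 powr - (real (k l) + real J)"
      using fl[OF that(1) z that(2,3), of c] unfolding comp_split distrib_right by linarith
  qed
  have near_hit: "W {0..} (pt (k l) R) \<omega> \<in> closed_nbhd F (total_osc * 2 powr - (real (k l) + real J))"
    if l: "l < L" and R: "R \<in> Z (k l)" and z: "z \<in> sub (k l) m R" and \<omega>: "\<omega> \<in> G l R" "\<omega> \<in> ?PB"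
      and h: "W {0..} (pt m z) \<omega> \<in> closed_nbhd F \<eta>" for l R z \<omega>
  proof -
    let ?x = "2 powr - (real (k l) + real J)"
    have "dist (W {0..} (pt m z) \<omega>) (W {0..} (pt (k l) R) \<omega>) \<le> real CARD('d) * ((osc_const + 2) * ?x)"
    proof (rule dist_total_le)
      fix c
      have "\<bar>residual c (pt m z) \<omega> - residual c (pt (k l) R) \<omega>\<bar> \<le> (osc_const + 1) * ?x"
        using \<omega>(1) z unfolding G_def calm_def by blast
      then show "\<bar>comp {0..} c (pt m z) \<omega> - comp {0..} c (pt (k l) R) \<omega>\<bar> \<le> (osc_const + 2) * ?x"
        using fl[OF l z R \<omega>(2), of c] unfolding comp_split distrib_right by linarith
    qed
    from closed_nbhd_shift[OF h this]
    have "W {0..} (pt (k l) R) \<omega> \<in> closed_nbhd F (real CARD('d) * ((osc_const + 2) * ?x) + \<eta>)" .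
    moreover have "\<eta> \<le> ?x" unfolding \<eta>_def using kl(3)[OF l] by (intro powr_mono) auto
    then have "real CARD('d) * ((osc_const + 2) * ?x) + \<eta> \<le> total_osc * ?x"
      by (simp add: total_osc_def distrib_right mult.assoc)
    ultimately show ?thesis using closed_nbhd_mono by blast
  qed
  \<comment> \<open>Excluding calm ancestors at earlier levels makes these events disjoint along
    each chain, as \<open>sum_first_calm_le\<close> demands, and they are still decided by the
    residuals.\<close>
  define first where "first l R = G l R \<inter> {\<omega>\<in>space M. \<forall>l'<l. \<omega> \<notin> G l' (par (k l') (k l) R)}" for l R
  have k_mono: "k l' \<le> k l" if "l' \<le> l" for l' l using that by (simp add: k_def lev_def)
  have none_gen: "{\<omega>\<in>space M. \<forall>l'<l. \<omega> \<notin> G l' (par (k l') K R)} \<in> sets (gen residuals)"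
    if R: "R \<in> Z K" and K: "\<And>l'. l' < l \<Longrightarrow> k l' \<le> K" for l K R
  proof -
    have "{\<omega>\<in>space (gen residuals). \<forall>l'\<in>{..<l}. \<omega> \<notin> G l' (par (k l') K R)} \<in> sets (gen residuals)"
    proof (rule sets.sets_Collect_finite_All)
      fix l' assume "l' \<in> {..<l}"
      then have "G l' (par (k l') K R) \<in> sets (gen residuals)" using R K by (intro Ggen par_mem) auto
      then have "space (gen residuals) - G l' (par (k l') K R) \<in> sets (gen residuals)" by (rule sets.compl_sets)
      moreover have "space (gen residuals) - G l' (par (k l') K R) = {\<omega>\<in>space (gen residuals). \<omega> \<notin> G l' (par (k l') K R)}" by auto
      ultimately show "{\<omega>\<in>space (gen residuals). \<omega> \<notin> G l' (par (k l') K R)} \<in> sets (gen residuals)" by simp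
    qed simp
    then show ?thesis by (simp only: space_gen lessThan_iff Ball_def)
  qed
  have first_gen: "first l R \<in> sets (gen residuals)" if "R \<in> Z (k l)" for l R
    unfolding first_def using that k_mono by (intro sets.Int Ggen none_gen) auto
  define none where "none z = {\<omega>\<in>space M. \<forall>l<L. \<omega> \<notin> G l (par (k l) (2 * n) z)}" for z
  have none_gen': "none z \<in> sets (gen residuals)" if "z \<in> Z (2 * n)" for z
    unfolding none_def using that kl by (intro none_gen) auto
  define hitR where "hitR l R = {\<omega>\<in>space M. W {0..} (pt (k l) R) \<omega> \<in> closed_nbhd F (total_osc * 2 powr - (real (k l) + real J))}" for l R
  define hitz where "hitz z = {\<omega>\<in>space M. W {0..} (pt (2 * n) z) \<omega> \<in> closed_nbhd F (leaf_osc * (real n * 2 powr - real (2 * n)))}" for z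
  define T where "T = 7 * mesh_const * mod_const * (real (2 * n) * 2 powr - real (2 * n))"
  define rough where "rough c = {\<omega>\<in>space M. \<exists>R\<in>Z (2 * n). \<exists>z\<in>sub (2 * n) m R. \<bar>comp {0..} c (pt m z) \<omega> - comp {0..} c (pt (2 * n) R) \<omega>\<bar> > T}" for c
  have rough_ev: "rough c \<in> events" for c
  proof -
    have "{\<omega>\<in>space M. \<bar>comp {0..} c (pt m z) \<omega> - comp {0..} c (pt (2 * n) R) \<omega>\<bar> > T} \<in> events"
      if "R \<in> Z (2 * n)" "z \<in> sub (2 * n) m R" for R z
    proof -
      have "pt m z \<in> cube" "pt (2 * n) R \<in> cube" using that by (auto simp: sub_def intro: pt_mem_cube)
      note [measurable] = measurable_mem[OF comp_mem[OF Rplus_sets(1) this(1)]] measurable_mem[OF comp_mem[OF Rplus_sets(1) this(2)]]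
      show ?thesis by measurable
    qed
    then show ?thesis unfolding rough_def by (intro sets.sets_Collect_finite_Ex finite_Z finite_sub)
  qed
  have rough_p: "prob (rough c) \<le> 14 * 2 ^ CARD('n) * 2 ^ CARD('n) * 2 powr Q * 2 powr - real (2 * n)" for c
    unfolding rough_def T_def
  proof (rule modulus_tail[OF m _ comp_mem[OF Rplus_sets(1)] mesh_const_pos])
    show "1 \<le> 2 * n" using n by simp
    fix i w assume w: "w \<in> Z (Suc (2 * n + i))"
    have "(2::real) ^ n \<le> 2 ^ (2 * n + i)" by (intro power_increasing) auto
    then have "a0 < 2 ^ (2 * n + i)" using n by linarith
    from sd_link_total[OF w this, of c]
    show "sd (\<lambda>\<omega>. link (\<lambda>t. comp {0..} c t \<omega>) (2 * n + i) w) \<le> mesh_const * 2 powr - (real (2 * n) + real i)" by simp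
  qed
  have subset: "hits m F \<eta> \<subseteq> (space M - ?PB) \<union> ((\<Union>c\<in>UNIV. rough c) \<union> ((\<Union>l<L. \<Union>R\<in>Z (k l). first l R \<inter> hitR l R) \<union> (\<Union>z\<in>Z (2 * n). none z \<inter> hitz z)))"
  proof (rule subsetI, rule ccontr)
    fix \<omega> assume h: "\<omega> \<in> hits m F \<eta>"
      and not: "\<omega> \<notin> (space M - ?PB) \<union> ((\<Union>c\<in>UNIV. rough c) \<union> ((\<Union>l<L. \<Union>R\<in>Z (k l). first l R \<inter> hitR l R) \<union> (\<Union>z\<in>Z (2 * n). none z \<inter> hitz z)))"
    from h obtain z where \<omega>: "\<omega> \<in> space M" and z: "z \<in> Z m" and hz: "W {0..} (pt m z) \<omega> \<in> closed_nbhd F \<eta>"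
      by (auto simp: hits_def)
    have PB: "\<omega> \<in> ?PB" and nr: "\<And>c. \<omega> \<notin> rough c" using not \<omega> by auto
    define z2 where "z2 = par (2 * n) m z"
    have z2: "z2 \<in> Z (2 * n)" "z \<in> sub (2 * n) m z2" unfolding z2_def using par_mem[OF m z] mem_sub[OF m z] by auto
    have parz: "par (k l) (2 * n) z2 = par (k l) m z" if "l < L" for l
      unfolding z2_def using kl[OF that] m by (intro par_par) auto
    show False
    proof (cases "\<omega> \<in> none z2")
      case True
      have "dist (W {0..} (pt m z) \<omega>) (W {0..} (pt (2 * n) z2) \<omega>) \<le> real CARD('d) * T"
      proof (rule dist_total_le)
        fix c
        show "\<bar>comp {0..} c (pt m z) \<omega> - comp {0..} c (pt (2 * n) z2) \<omega>\<bar> \<le> T"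
          using nr[of c] z2 \<omega> unfolding rough_def by (simp add: not_less Bex_def)
      qed
      from closed_nbhd_shift[OF hz this]
      have "W {0..} (pt (2 * n) z2) \<omega> \<in> closed_nbhd F (real CARD('d) * T + \<eta>)" .
      moreover have "real CARD('d) * T + \<eta> \<le> leaf_osc * (real n * 2 powr - real (2 * n))"
      proof -
        have "1 * \<eta> \<le> real n * \<eta>" using n by (intro mult_right_mono) (auto simp: \<eta>_def)
        moreover have "leaf_osc * (real n * 2 powr - real (2 * n)) = real CARD('d) * T + real n * \<eta>"
          unfolding T_def leaf_osc_def \<eta>_def by (simp add: algebra_simps)
        ultimately show ?thesis by linarith
      qed
      ultimately have "\<omega> \<in> hitz z2" unfolding hitz_def using closed_nbhd_mono \<omega> by blast
      then show False using not True z2 by blast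
    next
      case False
      then have ex: "\<exists>l. l < L \<and> \<omega> \<in> G l (par (k l) (2 * n) z2)" using \<omega> by (auto simp: none_def)
      define l where "l = (LEAST l. l < L \<and> \<omega> \<in> G l (par (k l) (2 * n) z2))"
      have l: "l < L" "\<omega> \<in> G l (par (k l) (2 * n) z2)" using LeastI_ex[OF ex] by (auto simp: l_def)
      define R where "R = par (k l) m z"
      have R: "R \<in> Z (k l)" "z \<in> sub (k l) m R" unfolding R_def using kl(4)[OF l(1)] z by (auto intro: par_mem mem_sub)
      have GR: "\<omega> \<in> G l R" using l parz by (simp add: R_def)
      have "\<omega> \<notin> G l' (par (k l') (k l) R)" if l': "l' < l" for l'
      proof -
        have "\<omega> \<notin> G l' (par (k l') (2 * n) z2)" using not_less_Least[OF l'[unfolded l_def]] l' l(1) by (auto simp: l_def[symmetric])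
        moreover have "par (k l') (2 * n) z2 = par (k l') (k l) R"
          unfolding R_def parz[OF less_trans[OF l' l(1)]] using l' kl(4)[OF l(1)] k_mono[of l' l] by (intro par_par[symmetric]) auto
        ultimately show ?thesis by simp
      qed
      then have "\<omega> \<in> first l R" using GR \<omega> by (simp add: first_def)
      moreover have "\<omega> \<in> hitR l R" unfolding hitR_def using near_hit[OF l(1) R GR PB hz] \<omega> by simp
      ultimately show False using not l(1) R(1) by blast
    qed
  qed
  have cubeR: "pt (k l) R \<in> cube" if "R \<in> Z (k l)" for l R using that by (rule pt_mem_cube)
  have hitR_ev: "hitR l R \<in> events" if "R \<in> Z (k l)" for l R
    unfolding hitR_def by (rule hit_event[OF cubeR[OF that]])
  have hitz_ev: "hitz z \<in> events" if "z \<in> Z (2 * n)" for z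
    unfolding hitz_def by (rule hit_event[OF pt_mem_cube[OF that]])
  have gen_ev: "A \<in> events" if "A \<in> sets (gen residuals)" for A using that gen_sub[OF resH] by auto
  have evA: "space M - ?PB \<in> events" using pin_bound_event by auto
  have evB: "(\<Union>c\<in>UNIV. rough c) \<in> events" using rough_ev by auto
  have evFi: "first l R \<inter> hitR l R \<in> events" if "R \<in> Z (k l)" for l R
    using gen_ev[OF first_gen[OF that]] hitR_ev[OF that] by auto
  have evNi: "none z \<inter> hitz z \<in> events" if "z \<in> Z (2 * n)" for z
    using gen_ev[OF none_gen'[OF that]] hitz_ev[OF that] by auto
  have evC: "(\<Union>l<L. \<Union>R\<in>Z (k l). first l R \<inter> hitR l R) \<in> events"
    by (intro sets.finite_UN finite_Z finite_lessThan evFi)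
  have evD: "(\<Union>z\<in>Z (2 * n). none z \<inter> hitz z) \<in> events"
    by (intro sets.finite_UN finite_Z evNi)
  have pA: "prob (space M - ?PB) \<le> p1" unfolding p1_def by (rule prob_pin_bound) simp
  have pB: "prob (\<Union>c\<in>UNIV. rough c) \<le> real CARD('d) * (14 * 2 ^ CARD('n) * 2 ^ CARD('n) * 2 powr Q * 2 powr - real (2 * n))"
  proof -
    have "prob (\<Union>c\<in>UNIV. rough c) \<le> (\<Sum>c\<in>UNIV. prob (rough c))"
      by (rule finite_measure_subadditive_finite) (use rough_ev in auto)
    also have "\<dots> \<le> (\<Sum>c\<in>(UNIV::'d set). 14 * 2 ^ CARD('n) * 2 ^ CARD('n) * 2 powr Q * 2 powr - real (2 * n))"
      by (intro sum_mono rough_p)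
    finally show ?thesis by simp
  qed
  have rpos: "0 < total_osc * 2 powr - (real (k l) + real J)" for l
  proof -
    have "0 < total_osc" unfolding total_osc_def using oscpos by (intro add_nonneg_pos) auto
    then show ?thesis by simp
  qed
  have rpos2: "0 < leaf_osc * (real n * 2 powr - real (2 * n))"
  proof -
    have "0 < leaf_osc" unfolding leaf_osc_def using mesh_const_pos mc by (intro add_nonneg_pos) auto
    then show ?thesis using n by simp
  qed
  have pC: "prob (\<Union>l<L. \<Union>R\<in>Z (k l). first l R \<inter> hitR l R) \<le> 2 ^ CARD('n) * 2 ^ CARD('n) * (hit_const * v1)"
  proof -
    have "prob (\<Union>l<L. \<Union>R\<in>Z (k l). first l R \<inter> hitR l R) \<le> (\<Sum>l<L. prob (\<Union>R\<in>Z (k l). first l R \<inter> hitR l R))"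
      by (rule finite_measure_subadditive_finite) (auto intro!: sets.finite_UN evFi)
    also have "\<dots> \<le> (\<Sum>l<L. \<Sum>R\<in>Z (k l). prob (first l R \<inter> hitR l R))"
      by (intro sum_mono finite_measure_subadditive_finite finite_Z) (auto intro!: evFi)
    also have "\<dots> \<le> (\<Sum>l<L. \<Sum>R\<in>Z (k l). hit_const * v1 * (prob (first l R) * 2 powr (- (real (k l) * Q))))"
    proof (intro sum_mono)
      fix l R assume l: "l \<in> {..<L}" and R: "R \<in> Z (k l)"
      have "prob (first l R \<inter> hitR l R) \<le> prob (first l R) * (hit_const * measure lborel (closed_nbhd F (total_osc * 2 powr - (real (k l) + real J))))"
        unfolding hitR_def by (rule prob_hit_le[OF cubeR[OF R] first_gen[OF R] near[OF cubeR[OF R]] F rpos])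
      also have "\<dots> \<le> prob (first l R) * (hit_const * (v1 * 2 powr (- (real (k l) * Q))))"
        using v1[of l] l hit_const_pos unfolding k_def by (intro mult_left_mono) auto
      finally show "prob (first l R \<inter> hitR l R) \<le> hit_const * v1 * (prob (first l R) * 2 powr (- (real (k l) * Q)))" by (simp add: mult_ac)
    qed
    also have "\<dots> = hit_const * v1 * (\<Sum>l<L. \<Sum>R\<in>Z (k l). prob (first l R) * 2 powr (- (real (k l) * Q)))"
      by (simp add: sum_distrib_left)
    also have "\<dots> \<le> hit_const * v1 * (2 ^ CARD('n) * 2 ^ CARD('n))"
    proof (rule mult_left_mono)
      show "(\<Sum>l<L. \<Sum>R\<in>Z (k l). prob (first l R) * 2 powr (- (real (k l) * Q))) \<le> 2 ^ CARD('n) * 2 ^ CARD('n)"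
      proof (rule sum_first_calm_le[where k' = "2 * n"])
        fix z assume z: "z \<in> Z (2 * n)"
        have ev: "first l (par (k l) (2 * n) z) \<in> events" if "l < L" for l
          using z kl(2)[OF that] by (intro gen_ev first_gen par_mem) auto
        have "(\<Sum>l<L. prob (first l (par (k l) (2 * n) z))) = prob (\<Union>l<L. first l (par (k l) (2 * n) z))"
        proof (rule finite_measure_finite_Union[symmetric])
          show "disjoint_family_on (\<lambda>l. first l (par (k l) (2 * n) z)) {..<L}"
            unfolding disjoint_family_on_def
          proof (intro ballI impI)
            have "first l (par (k l) (2 * n) z) \<inter> first l' (par (k l') (2 * n) z) = {}" if "l < l'" "l' < L" for l l'
            proof -
              have "par (k l) (k l') (par (k l') (2 * n) z) = par (k l) (2 * n) z"
                using that kl(2)[of l'] k_mono[of l l'] by (intro par_par) auto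
              then show ?thesis using that unfolding first_def by auto
            qed
            then show "first l (par (k l) (2 * n) z) \<inter> first l' (par (k l') (2 * n) z) = {}"
              if "l \<in> {..<L}" "l' \<in> {..<L}" "l \<noteq> l'" for l l'
              using that by (metis Int_commute lessThan_iff linorder_neqE_nat)
          qed
        qed (use ev in auto)
        then show "(\<Sum>l<L. prob (first l (par (k l) (2 * n) z))) \<le> 1" by simp
      qed (use kl in auto)
      show "0 \<le> hit_const * v1" using hit_const_pos v by simp
    qed
    finally show ?thesis by (simp add: mult_ac)
  qed
  \<comment> \<open>While the pins are bounded, a calm box for the field is calm for the residual.
    So absence of calm residuals means absence of calm scales for the field, up to the probability
    of a large pin.\<close>
  have pnone: "prob (none z) \<le> q + p1" if z: "z \<in> Z (2 * n)" for z
  proof -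
    let ?N = "{\<omega>\<in>space M. \<forall>l<L. \<omega> \<notin> calm m J (lev n u l) (par (k l) (2 * n) z) (comp {0..}) osc_const}"
    have RZ: "par (k l) (2 * n) z \<in> Z (k l)" if "l < L" for l using z kl(2)[OF that] by (intro par_mem)
    have Nev: "?N \<in> events"
    proof -
      have "{\<omega>\<in>space M. \<forall>l\<in>{..<L}. \<omega> \<notin> calm m J (lev n u l) (par (k l) (2 * n) z) (comp {0..}) osc_const} \<in> events"
      proof (rule sets.sets_Collect_finite_All)
        fix l assume "l \<in> {..<L}"
        then have "calm m J (lev n u l) (par (k l) (2 * n) z) (comp {0..}) osc_const \<in> sets (gen H)"
          using RZ[of l] comp_mem[OF Rplus_sets(1)] unfolding k_def by (intro calm_gen) auto
        then have "calm m J (lev n u l) (par (k l) (2 * n) z) (comp {0..}) osc_const \<in> events" using gen_sub[of H] by auto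
        then have "space M - calm m J (lev n u l) (par (k l) (2 * n) z) (comp {0..}) osc_const \<in> events" by (rule sets.compl_sets)
        moreover have "space M - calm m J (lev n u l) (par (k l) (2 * n) z) (comp {0..}) osc_const = {\<omega>\<in>space M. \<omega> \<notin> calm m J (lev n u l) (par (k l) (2 * n) z) (comp {0..}) osc_const}" by auto
        ultimately show "{\<omega>\<in>space M. \<omega> \<notin> calm m J (lev n u l) (par (k l) (2 * n) z) (comp {0..}) osc_const} \<in> events" by simp
      qed simp
      then show ?thesis by (simp only: lessThan_iff Ball_def)
    qed
    have "none z \<subseteq> ?N \<union> (space M - ?PB)"
    proof
      fix \<omega> assume \<omega>: "\<omega> \<in> none z"
      show "\<omega> \<in> ?N \<union> (space M - ?PB)"
      proof (cases "\<omega> \<in> ?PB")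
        case True
        have "\<omega> \<notin> calm m J (lev n u l) (par (k l) (2 * n) z) (comp {0..}) osc_const" if "l < L" for l
          using calmG[OF that RZ[OF that] True] \<omega> that unfolding none_def k_def by blast
        then show ?thesis using \<omega> unfolding none_def by blast
      next
        case False
        then show ?thesis using \<omega> unfolding none_def by blast
      qed
    qed
    then have "prob (none z) \<le> prob (?N \<union> (space M - ?PB))"
      by (rule finite_measure_mono) (rule sets.Un[OF Nev evA])
    also have "\<dots> \<le> prob ?N + prob (space M - ?PB)" by (rule measure_Un_le[OF Nev evA])
    finally have "prob (none z) \<le> prob ?N + prob (space M - ?PB)" .
    also have "prob ?N \<le> q"
      unfolding q_def using RZ unfolding k_def by (intro prob_no_calm_level u n L m D) auto
    finally show ?thesis using pA by linarith
  qed
  have qp: "0 \<le> q + p1"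
  proof (cases "Z (2 * n) = {}")
    case True
    have "(\<lambda>_. 0) \<in> Z (2 * n)" by (simp add: Z_def)
    then show ?thesis using True by auto
  next
    case False
    then show ?thesis using pnone measure_nonneg order_trans by blast
  qed
  have pD: "prob (\<Union>z\<in>Z (2 * n). none z \<inter> hitz z) \<le> 2 ^ CARD('n) * (hit_const * v2) * (q + p1)"
  proof -
    have "prob (\<Union>z\<in>Z (2 * n). none z \<inter> hitz z) \<le> (\<Sum>z\<in>Z (2 * n). prob (none z \<inter> hitz z))"
      by (intro finite_measure_subadditive_finite finite_Z) (auto intro!: evNi)
    also have "\<dots> \<le> (\<Sum>z\<in>Z (2 * n). (q + p1) * (hit_const * (v2 * 2 powr (- (real (2 * n) * Q)))))"
    proof (rule sum_mono)
      fix z assume z: "z \<in> Z (2 * n)"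
      have "prob (none z \<inter> hitz z) \<le> prob (none z) * (hit_const * measure lborel (closed_nbhd F (leaf_osc * (real n * 2 powr - real (2 * n)))))"
        unfolding hitz_def by (rule prob_hit_le[OF pt_mem_cube[OF z] none_gen'[OF z] near[OF pt_mem_cube[OF z]] F rpos2])
      also have "\<dots> \<le> (q + p1) * (hit_const * (v2 * 2 powr (- (real (2 * n) * Q))))"
        using pnone[OF z] v2 hit_const_pos qp by (intro mult_mono mult_left_mono) auto
      finally show "prob (none z \<inter> hitz z) \<le> (q + p1) * (hit_const * (v2 * 2 powr (- (real (2 * n) * Q))))" .
    qed
    also have "\<dots> = real (card (Z (2 * n))) * ((q + p1) * (hit_const * (v2 * 2 powr (- (real (2 * n) * Q)))))" by simp
    also have "\<dots> \<le> (2 ^ CARD('n) * 2 powr (real (2 * n) * Q)) * ((q + p1) * (hit_const * (v2 * 2 powr (- (real (2 * n) * Q)))))"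
      using qp hit_const_pos v by (intro mult_right_mono card_Z_le) auto
    also have "\<dots> = 2 ^ CARD('n) * (hit_const * v2) * (q + p1) * (2 powr (real (2 * n) * Q) * 2 powr (- (real (2 * n) * Q)))"
      by (simp only: mult_ac)
    also have "2 powr (real (2 * n) * Q) * 2 powr (- (real (2 * n) * Q)) = 1"
      unfolding powr_add[symmetric] by simp
    finally show ?thesis by simp
  qed
  have "prob (hits m F \<eta>) \<le> prob ((space M - ?PB) \<union> ((\<Union>c\<in>UNIV. rough c) \<union> ((\<Union>l<L. \<Union>R\<in>Z (k l). first l R \<inter> hitR l R) \<union> (\<Union>z\<in>Z (2 * n). none z \<inter> hitz z))))"
    by (rule finite_measure_mono[OF subset]) (intro sets.Un evA evB evC evD)
  also have "\<dots> \<le> prob (space M - ?PB) + (prob (\<Union>c\<in>UNIV. rough c) + (prob (\<Union>l<L. \<Union>R\<in>Z (k l). first l R \<inter> hitR l R) + prob (\<Union>z\<in>Z (2 * n). none z \<inter> hitz z)))"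
    by (rule order_trans[OF measure_Un_le[OF evA sets.Un[OF evB sets.Un[OF evC evD]]] add_left_mono[OF
         order_trans[OF measure_Un_le[OF evB sets.Un[OF evC evD]] add_left_mono[OF measure_Un_le[OF evC evD]]]]])
  finally show ?thesis using pA pB pC pD unfolding q_def \<eta>_def by linarith
qed

end

section \<open>Vanishing hitting probability\<close>

lemma stretched_exponential_limit:
  fixes a \<delta> :: real
  assumes "0 < \<delta>" "0 < a"
  shows "(\<lambda>n::nat. real n powr a * exp (- (real n powr \<delta>))) \<longlonglongrightarrow> 0"
  using assms by real_asymp

lemma gaussian_decay_limit:
  fixes a c :: real
  assumes "0 < c" "0 < a"
  shows "(\<lambda>n::nat. real n powr a * exp (- (real n)\<^sup>2 / c)) \<longlonglongrightarrow> 0"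
  using assms by real_asymp

lemma log_power_ratio_limit:
  fixes \<kappa> :: real
  assumes "\<kappa> < 1"
  shows "(\<lambda>n::nat. ln (2 * real n) powr \<kappa> / ln (real n)) \<longlonglongrightarrow> 0"
  using assms by real_asymp

lemma log_power_le_linear:
  fixes \<kappa> :: real
  assumes "\<kappa> < 1"
  shows "\<forall>\<^sub>F n::nat in sequentially. ln (2 * real n) powr \<kappa> \<le> real n"
  using assms by real_asymp

lemma polynomial_beats_log:
  fixes \<beta> \<tau> c A :: real
  assumes "0 < \<beta>" "0 < \<tau>" "0 < c" "0 < A"
  shows "\<forall>\<^sub>F n::nat in sequentially. A * (\<tau> * ln (real n)) powr c \<le> real n powr \<beta>"
  using assms by real_asymp

lemma exponential_beats_all:
  fixes \<beta> \<tau> c A :: real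
  assumes "0 < \<beta>" "0 < \<tau>" "0 < c" "0 < A"
  shows "\<forall>\<^sub>F n::nat in sequentially. A * real n * (\<tau> * ln (real n)) powr c \<le> 2 powr (real n * \<beta>)"
  using assms by real_asymp

context pinned
begin

text \<open>\<open>n\<close> is fixed first and yields \<open>\<eta> = 2 powr - (2 * n)\<close>; the
  bound then holds at every observation level \<open>m \<ge> 2 * n\<close>. This uniformity allows
  the passage from grid points to all points.\<close>

lemma hits_small:
  assumes near: "\<And>s i j. s \<in> cube \<Longrightarrow> \<bar>proj s i j - (if i = j then 1 else 0)\<bar> \<le> 1 / (2 * real CARD('d) * real CARD('d))"
    and F: "bounded F" and r0: "0 < r0" and CF: "0 < CF" and \<kappa>: "0 \<le> \<kappa>" "\<kappa> < 1"
    and vol: "\<And>r. 0 < r \<Longrightarrow> r < r0 \<Longrightarrow> measure lborel (closed_nbhd F r) \<le> CF * r powr Q * (ln (ln (1 / r))) powr \<kappa>"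
    and \<epsilon>: "0 < \<epsilon>"
  shows "\<exists>\<eta>>0. \<exists>m0. \<forall>m\<ge>m0. prob (hits m F \<eta>) \<le> \<epsilon>"
proof -
  have Q: "0 < Q" using Q_ge_1 by simp
  \<comment> \<open>With \<open>2 powr (J * Q) \<le> \<tau> * ln n\<close> the small-ball exponent
    is at most \<open>ln n / 2\<close>, so one trial succeeds with probability at least
    \<open>n powr (- 1/2) / 4\<close>.\<close>
  define \<tau> where "\<tau> = 1 / (4 * real CARD('d) * ball_const)"
  have \<tau>: "0 < \<tau>" unfolding \<tau>_def using ball_const_pos by simp
  have Qinv: "0 < 1 / Q" "0 < 2 / Q" using Q by simp_all
  have m8: "0 < 8 * mesh_const\<^sup>2" using mesh_const_pos by simp
  have \<beta>2: "0 < \<beta> / 2" using \<beta>(1) by simp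
  have dp: "0 < real CARD('d) * proj_const + 1" using proj_const_nonneg by (simp add: add_nonneg_pos)
  \<comment> \<open>For large \<open>n\<close> the largest integer with
    \<open>2 powr (J * Q) \<le> \<tau> * ln n\<close>; rounding down costs the factor
    \<open>2 powr Q\<close> seen in \<open>v1\<close>.\<close>
  define J where "J n = nat \<lfloor>log 2 (\<tau> * ln (real n)) / Q\<rfloor>" for n :: nat
  \<comment> \<open>Now \<open>2 powr u \<ge> n\<close>, so the suppression
    \<open>2 powr (u * \<beta>)\<close> outside a band is at least a power of \<open>n\<close>,
    whereas \<open>2 powr (2 * J)\<close> is at most a power of \<open>ln n\<close>. Hence
    \<open>D\<close> grows like a power of \<open>n\<close>.\<close>
  define u where "u n = nat \<lceil>log 2 (real n)\<rceil>" for n :: nat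
  \<comment> \<open>As many bands of length \<open>2 * u\<close> as fit between the scales
    \<open>n\<close> and \<open>2 * n\<close>.\<close>
  define L where "L n = n div (2 * u n)" for n :: nat
  define D where "D n = 2 powr (real (u n) * \<beta> - 2 * real (J n)) / (4 * mesh_const\<^sup>2)" for n
  define q where "q n = (1 - exp (- 2 * (real CARD('d) * ball_const * 2 powr (real (J n) * Q))) / 4) ^ L n
      + real (L n) * (real CARD('d) * (tail_const * exp (- D n / 2)))" for n
  define p1 where "p1 n = real CARD('d) * (sqrt 2 * exp (- (real n)\<^sup>2 / (4 * \<nu>)))" for n :: nat
  \<comment> \<open>In a calm box the power \<open>Q\<close> of the radius is the box volume times
    \<open>2 powr (- J * Q)\<close>, a gain of order \<open>1 / ln n\<close>. In the leaves,
    governed by \<open>v2\<close>, the modulus of continuity loses a factor \<open>n powr Q\<close>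
    instead.\<close>
  define v1 where "v1 n = CF * total_osc powr Q * (2 powr Q / (\<tau> * ln (real n))) * ln (2 * real n) powr \<kappa>" for n :: nat
  define v2 where "v2 n = CF * (leaf_osc * real n) powr Q * ln (2 * real n) powr \<kappa>" for n :: nat
  \<comment> \<open>Below \<open>exp (- 1)\<close> the double logarithm is nonnegative, so its power
    \<open>\<kappa>\<close> is monotone; for radii at least \<open>2 powr - (2 * n)\<close> it is at
    most \<open>ln (2 * n)\<close>.\<close>
  define r1 where "r1 = min r0 (exp (- 1))"
  have r1: "0 < r1" using r0 by (simp add: r1_def)
  have mc: "0 \<le> mod_const" unfolding mod_const_def using Q by simp
  have T1: "1 \<le> total_osc" unfolding total_osc_def osc_const_def using mesh_const_pos by simp
  have T2: "1 \<le> leaf_osc" unfolding leaf_osc_def using mesh_const_pos mc by simp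
  have tailc: "0 \<le> tail_const" using sum_tail_term_le[of 0] by simp
  have lnn: "\<forall>\<^sub>F n::nat in sequentially. 1 \<le> \<tau> * ln (real n)" using \<tau> by real_asymp
  have J_bounds: "\<forall>\<^sub>F n in sequentially. 2 powr (real (J n) * Q) \<le> \<tau> * ln (real n) \<and> 2 powr (- (real (J n) * Q)) \<le> 2 powr Q / (\<tau> * ln (real n))
      \<and> 2 powr real (J n) \<le> (\<tau> * ln (real n)) powr (1 / Q)"
    using lnn
  proof eventually_elim
    case (elim n)
    define y where "y = \<tau> * ln (real n)"
    have y: "1 \<le> y" using elim by (simp add: y_def)
    have "0 \<le> log 2 y / Q" using y Q by simp
    then have Jr: "real (J n) = of_int \<lfloor>log 2 y / Q\<rfloor>" by (simp add: J_def y_def)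
    have j1: "real (J n) \<le> log 2 y / Q" and j2: "log 2 y / Q \<le> real (J n) + 1" unfolding Jr by linarith+
    have a1: "real (J n) * Q \<le> log 2 y" using j1 Q by (simp add: pos_le_divide_eq)
    have a2: "log 2 y - Q \<le> real (J n) * Q" using j2 Q by (simp add: pos_divide_le_eq algebra_simps)
    have py: "2 powr log 2 y = y" using y by simp
    have "2 powr (real (J n) * Q) \<le> 2 powr log 2 y" using a1 by simp
    moreover have "2 powr (- (real (J n) * Q)) \<le> 2 powr (Q - log 2 y)" using a2 by simp
    moreover have "2 powr real (J n) \<le> 2 powr (log 2 y * (1 / Q))" using j1 by simp
    ultimately show ?case unfolding powr_powr[symmetric] powr_diff py y_def[symmetric] by simp
  qed
  have u_low: "real n \<le> 2 powr real (u n)" if "1 \<le> n" for n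
  proof -
    have "log 2 (real n) \<le> real (u n)" unfolding u_def by linarith
    then have "2 powr log 2 (real n) \<le> 2 powr real (u n)" by simp
    then show ?thesis using that by simp
  qed
  have u_up: "\<forall>\<^sub>F n in sequentially. real (u n) \<le> 3 * ln (real n)"
  proof -
    have "\<forall>\<^sub>F n::nat in sequentially. log 2 (real n) + 1 \<le> 3 * ln (real n)"
    proof -
      have "\<forall>\<^sub>F n::nat in sequentially. 2 \<le> ln (real n)" by real_asymp
      then show ?thesis
      proof eventually_elim
        case (elim n)
        define a where "a = log 2 (real n)"
        have l2: "2 \<le> 3 * ln (2::real)" using ln2_ge_two_thirds by simp
        have a0: "0 \<le> a" using elim unfolding a_def log_def by simp
        have "ln (real n) = a * ln 2" unfolding a_def log_def by simp
        moreover have "a * 2 \<le> a * (3 * ln 2)" using l2 a0 by (rule mult_left_mono)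
        ultimately have "2 * a \<le> 3 * ln (real n)" by simp
        then show ?case using elim unfolding a_def[symmetric] by linarith
      qed
    qed
    moreover have "\<forall>\<^sub>F n::nat in sequentially. 1 \<le> n" by (rule eventually_ge_at_top)
    ultimately show ?thesis
    proof eventually_elim
      case (elim n)
      then have "0 \<le> log 2 (real n)" by simp
      then have "real (u n) \<le> log 2 (real n) + 1" unfolding u_def by linarith
      then show ?case using elim by linarith
    qed
  qed
  have u1: "\<forall>\<^sub>F n in sequentially. 1 \<le> u n \<and> J n \<le> u n"
    using J_bounds polynomial_beats_log[OF zero_less_one \<tau> Qinv(1) zero_less_one] eventually_ge_at_top[of 2]
  proof eventually_elim
    case (elim n)
    then have "2 powr real (J n) \<le> real n" using \<tau> Q by simp
    also have "\<dots> \<le> 2 powr real (u n)" using elim by (intro u_low) simp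
    finally have "J n \<le> u n" by simp
    moreover have "2 powr 1 \<le> 2 powr real (u n)" using u_low[of n] elim by simp
    then have "1 \<le> real (u n)" by (subst (asm) powr_le_cancel_iff) auto
    ultimately show ?case by simp
  qed
  have L_low: "\<forall>\<^sub>F n in sequentially. real n / (6 * ln (real n)) - 1 \<le> real (L n)"
    using u1 u_up
  proof eventually_elim
    case (elim n)
    have "n < Suc (L n) * (2 * u n)" using elim dividend_less_div_times[of "2 * u n" n] by (simp add: L_def algebra_simps)
    then have "real n < (real (L n) + 1) * (2 * real (u n))"
      by (metis of_nat_less_iff of_nat_mult of_nat_Suc of_nat_numeral add.commute)
    then have "real n / (2 * real (u n)) \<le> real (L n) + 1" using elim by (simp add: pos_divide_le_eq)
    moreover have "real n / (6 * ln (real n)) \<le> real n / (2 * real (u n))"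
      using elim by (intro divide_left_mono mult_pos_pos) auto
    ultimately have "real n / (6 * ln (real n)) \<le> real (L n) + 1" by (rule order_trans[rotated])
    then show ?case by (simp only: diff_le_eq)
  qed
  have L_up: "2 * L n * u n \<le> n" "L n \<le> n" for n
  proof -
    have "L n * (2 * u n) \<le> n" unfolding L_def by (rule div_times_less_eq_dividend)
    then show "2 * L n * u n \<le> n" by (simp only: mult_ac)
    show "L n \<le> n" unfolding L_def by (rule div_le_dividend)
  qed
  have D_low: "\<forall>\<^sub>F n in sequentially. 2 * real n powr (\<beta> / 2) \<le> D n"
    using J_bounds polynomial_beats_log[OF \<beta>2 \<tau> Qinv(2) m8] eventually_ge_at_top[of 1] lnn
  proof eventually_elim
    case (elim n)
    let ?y = "\<tau> * ln (real n)"
    have m2: "0 < mesh_const\<^sup>2" using mesh_const_pos by simp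
    have yp: "8 * mesh_const\<^sup>2 * ?y powr (2 / Q) \<le> real n powr (\<beta> / 2)" using elim(2) \<beta>(1) \<tau> Q m2 by simp
    have "?y \<noteq> 0" using elim(4) by linarith
    then have yQ: "0 < ?y powr (2 / Q)" by (rule powr_gt_zero[THEN iffD2])
    have "(2 powr real (J n))\<^sup>2 \<le> (?y powr (1 / Q))\<^sup>2" using elim(1) by (intro power_mono) auto
    then have J2: "2 powr (2 * real (J n)) \<le> ?y powr (2 / Q)"
      by (simp add: power2_eq_square powr_add[symmetric])
    have "real n powr \<beta> \<le> (2 powr real (u n)) powr \<beta>" using u_low[of n] elim(3) \<beta>(1) by (intro powr_mono2) auto
    then have "real n powr \<beta> \<le> 2 powr (real (u n) * \<beta>)" by (simp add: powr_powr)
    then have "real n powr \<beta> / ?y powr (2 / Q) \<le> 2 powr (real (u n) * \<beta>) / 2 powr (2 * real (J n))"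
      using J2 by (intro frac_le) auto
    then have "real n powr \<beta> / ?y powr (2 / Q) / (4 * mesh_const\<^sup>2) \<le> D n"
      unfolding D_def powr_diff using m2 by (intro divide_right_mono) auto
    moreover have "2 * real n powr (\<beta> / 2) \<le> real n powr \<beta> / ?y powr (2 / Q) / (4 * mesh_const\<^sup>2)"
    proof -
      have "real n powr \<beta> = real n powr (\<beta> / 2) * real n powr (\<beta> / 2)" by (simp add: powr_add[symmetric])
      moreover have "real n powr (\<beta> / 2) * (8 * mesh_const\<^sup>2 * ?y powr (2 / Q)) \<le> real n powr (\<beta> / 2) * real n powr (\<beta> / 2)"
        using yp by (intro mult_left_mono) auto
      ultimately have "2 * real n powr (\<beta> / 2) * (?y powr (2 / Q) * (4 * mesh_const\<^sup>2)) \<le> real n powr \<beta>" by (simp add: mult_ac)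
      then show ?thesis using yQ m2 by (simp add: pos_le_divide_eq mult_ac)
    qed
    ultimately show ?case by (rule order_trans[rotated])
  qed
  have D1: "\<forall>\<^sub>F n in sequentially. 1 \<le> D n"
    using D_low eventually_ge_at_top[of 1]
  proof eventually_elim
    case (elim n)
    have "1 \<le> real n powr (\<beta> / 2)" using elim(2) \<beta>(1) by (intro ge_one_powr_ge_zero) auto
    then show ?case using elim(1) by linarith
  qed
  \<comment> \<open>About \<open>n / (6 * ln n)\<close> independent trials, each succeeding with
    probability at least \<open>n powr (- 1/2) / 4\<close>, all fail with probability at most
    \<open>exp (- (n powr (1/4)))\<close>. The second summand is the failure outside the
    bands.\<close>
  have q_up: "\<forall>\<^sub>F n in sequentially. q n \<le> exp (- (real n powr (1/4))) + real n * (real CARD('d) * (tail_const * exp (- (real n powr (\<beta> / 2)))))"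
  proof -
    have pL: "\<forall>\<^sub>F n::nat in sequentially. real n powr (1/4) \<le> real n powr (- 1/2) / 4 * (real n / (6 * ln (real n)) - 1)" by real_asymp
    show ?thesis
      using pL J_bounds L_low D_low eventually_ge_at_top[of 1]
    proof eventually_elim
      case (elim n)
      define P where "P = exp (- 2 * (real CARD('d) * ball_const * 2 powr (real (J n) * Q))) / 4"
      have "real CARD('d) * ball_const * 2 powr (real (J n) * Q) \<le> real CARD('d) * ball_const * (\<tau> * ln (real n))"
        using elim(2) ball_const_pos by (intro mult_left_mono) auto
      also have "\<dots> = ln (real n) / 4" unfolding \<tau>_def using ball_const_pos by simp
      finally have "exp (- (ln (real n) / 2)) \<le> exp (- 2 * (real CARD('d) * ball_const * 2 powr (real (J n) * Q)))" by simp
      moreover have "exp (- (ln (real n) / 2)) = real n powr (- 1/2)" using elim(5) by (simp add: powr_def)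
      ultimately have P1: "real n powr (- 1/2) / 4 \<le> P" unfolding P_def by simp
      have "0 \<le> real CARD('d) * ball_const * 2 powr (real (J n) * Q)" using ball_const_pos by simp
      then have e1: "exp (- 2 * (real CARD('d) * ball_const * 2 powr (real (J n) * Q))) \<le> 1" by simp
      have "P \<le> 1 / 4" unfolding P_def by (rule divide_right_mono[OF e1]) simp
      moreover have "0 \<le> P" by (simp add: P_def)
      ultimately have P0: "0 \<le> P" "P \<le> 1" by simp_all
      have "real n powr (- 1/2) / 4 * (real n / (6 * ln (real n)) - 1) \<le> real n powr (- 1/2) / 4 * real (L n)"
        using elim(3) by (intro mult_left_mono) auto
      also have "\<dots> \<le> P * real (L n)" using P1 by (intro mult_right_mono) auto
      finally have PL: "real n powr (1/4) \<le> P * real (L n)" by (rule order_trans[OF elim(1)])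
      have "1 - P \<le> exp (- P)" using exp_ge_add_one_self[of "- P"] by simp
      then have "(1 - P) ^ L n \<le> exp (- P) ^ L n" using P0 by (intro power_mono) auto
      also have "\<dots> = exp (- (P * real (L n)))" by (simp add: exp_of_nat_mult[symmetric] mult.commute)
      also have "\<dots> \<le> exp (- (real n powr (1/4)))" using PL by simp
      finally have A: "(1 - P) ^ L n \<le> exp (- (real n powr (1/4)))" .
      have "exp (- D n / 2) \<le> exp (- (real n powr (\<beta> / 2)))" using elim(4) by simp
      then have "real (L n) * (real CARD('d) * (tail_const * exp (- D n / 2))) \<le> real n * (real CARD('d) * (tail_const * exp (- (real n powr (\<beta> / 2)))))"
        using L_up(2)[of n] tailc by (intro mult_mono mult_left_mono) auto
      then show ?case using A unfolding q_def P_def by linarith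
    qed
  qed
  have smooth: "\<forall>\<^sub>F n in sequentially. real CARD('d) * proj_const * real n * 2 powr (- (real n * \<beta>)) \<le> 2 powr - real (J n)"
    using J_bounds exponential_beats_all[OF \<beta>(1) \<tau> Qinv(1) dp] eventually_ge_at_top[of 1]
  proof eventually_elim
    case (elim n)
    have c: "0 \<le> real CARD('d) * proj_const" using proj_const_nonneg by simp
    have "real CARD('d) * proj_const * real n * 2 powr real (J n) \<le> (real CARD('d) * proj_const + 1) * real n * (\<tau> * ln (real n)) powr (1 / Q)"
      using elim(1) c by (intro mult_mono) auto
    also have "\<dots> \<le> 2 powr (real n * \<beta>)" using elim(2) Q c by simp
    finally have "real CARD('d) * proj_const * real n * 2 powr real (J n) * (2 powr (- (real n * \<beta>)) * 2 powr - real (J n)) \<le> 2 powr (real n * \<beta>) * (2 powr (- (real n * \<beta>)) * 2 powr - real (J n))"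
      by (rule mult_right_mono) simp
    then show ?case by (simp add: powr_minus field_simps)
  qed
  have vb: "measure lborel (closed_nbhd F r) \<le> CF * r powr Q * ln (2 * real n) powr \<kappa>"
    if r: "2 powr - real (2 * n) \<le> r" "r < r1" and n: "1 \<le> n" for r n
  proof -
    have rp: "0 < r" using r(1) by (rule less_le_trans[rotated]) simp
    have "measure lborel (closed_nbhd F r) \<le> CF * r powr Q * (ln (ln (1 / r))) powr \<kappa>"
      using rp r(2) by (intro vol) (auto simp: r1_def)
    also have "\<dots> \<le> CF * r powr Q * ln (2 * real n) powr \<kappa>"
    proof (intro mult_left_mono powr_mono2)
      have "ln r \<le> ln (exp (- 1))" using rp r(2) by (subst ln_le_cancel_iff) (auto simp: r1_def)
      then have l1: "1 \<le> ln (1 / r)" using rp by (simp add: ln_div)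
      then show "0 \<le> ln (ln (1 / r))" by simp
      have "ln (2 powr - real (2 * n)) \<le> ln r" using r(1) rp by (subst ln_le_cancel_iff) auto
      then have "ln (1 / r) \<le> real (2 * n) * ln 2" using rp by (simp add: ln_div ln_powr)
      also have "\<dots> \<le> real (2 * n) * 1" using ln_2_less_1 by (intro mult_left_mono) auto
      finally have "ln (1 / r) \<le> 2 * real n" by simp
      then show "ln (ln (1 / r)) \<le> ln (2 * real n)" using l1 n by (subst ln_le_cancel_iff) auto
    qed (use \<kappa> CF in auto)
    finally show ?thesis .
  qed
  have small1: "\<forall>\<^sub>F n::nat in sequentially. total_osc * 2 powr - real n < r1"
  proof (rule order_tendstoD)
    show "(\<lambda>n::nat. total_osc * 2 powr - real n) \<longlonglongrightarrow> 0" by real_asymp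
  qed (use r1 in auto)
  have small2: "\<forall>\<^sub>F n::nat in sequentially. leaf_osc * (real n * 2 powr - real (2 * n)) < r1"
  proof (rule order_tendstoD)
    show "(\<lambda>n::nat. leaf_osc * (real n * 2 powr - real (2 * n))) \<longlonglongrightarrow> 0"
      by (rule tendsto_mult_right_zero) real_asymp
  qed (use r1 in auto)
  have V1: "\<forall>\<^sub>F n in sequentially. \<forall>l<L n. measure lborel (closed_nbhd F (total_osc * 2 powr - (real (lev n (u n) l) + real (J n)))) \<le> v1 n * 2 powr (- (real (lev n (u n) l) * Q))"
    using small1 J_bounds u1 eventually_ge_at_top[of 1]
  proof eventually_elim
    case (elim n)
    show ?case
    proof (intro allI impI)
    fix l assume l: "l < L n"
    let ?k = "lev n (u n) l" and ?J = "J n"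
    have "(2 * l + 2) * u n \<le> 2 * L n * u n" using l by (intro mult_right_mono) auto
    then have "?k + u n \<le> 2 * n" using L_up(1)[of n] by (simp add: lev_def)
    then have kJ: "?k + ?J \<le> 2 * n" using elim(3) by simp
    have "n \<le> ?k" by (simp add: lev_def)
    have "measure lborel (closed_nbhd F (total_osc * 2 powr - (real ?k + real ?J))) \<le> CF * (total_osc * 2 powr - (real ?k + real ?J)) powr Q * ln (2 * real n) powr \<kappa>"
    proof (rule vb)
      have "2 powr - real (2 * n) \<le> 1 * 2 powr - (real ?k + real ?J)" using kJ by simp
      also have "\<dots> \<le> total_osc * 2 powr - (real ?k + real ?J)" using T1 by (intro mult_right_mono) auto
      finally show "2 powr - real (2 * n) \<le> total_osc * 2 powr - (real ?k + real ?J)" .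
      have "total_osc * 2 powr - (real ?k + real ?J) \<le> total_osc * 2 powr - real n" using \<open>n \<le> ?k\<close> T1 by (intro mult_left_mono) auto
      then show "total_osc * 2 powr - (real ?k + real ?J) < r1" using elim(1) by linarith
    qed (use elim in auto)
    also have "(total_osc * 2 powr - (real ?k + real ?J)) powr Q = total_osc powr Q * (2 powr (- (real ?J * Q)) * 2 powr (- (real ?k * Q)))"
    proof -
      have "(2 powr - (real ?k + real ?J)) powr Q = 2 powr (- (real ?J * Q)) * 2 powr (- (real ?k * Q))"
        unfolding powr_powr powr_add[symmetric] by (rule arg_cong[where f="(powr) 2"]) (simp add: algebra_simps)
      then show ?thesis using T1 by (simp add: powr_mult)
    qed
    also have "CF * (total_osc powr Q * (2 powr (- (real ?J * Q)) * 2 powr (- (real ?k * Q)))) * ln (2 * real n) powr \<kappa>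
       \<le> CF * (total_osc powr Q * ((2 powr Q / (\<tau> * ln (real n))) * 2 powr (- (real ?k * Q)))) * ln (2 * real n) powr \<kappa>"
      using elim(2) CF by (intro mult_right_mono mult_left_mono) auto
    also have "\<dots> = v1 n * 2 powr (- (real ?k * Q))" by (simp add: v1_def mult_ac)
    finally show "measure lborel (closed_nbhd F (total_osc * 2 powr - (real ?k + real ?J))) \<le> v1 n * 2 powr (- (real ?k * Q))" .
    qed
  qed
  have V2: "\<forall>\<^sub>F n in sequentially. measure lborel (closed_nbhd F (leaf_osc * (real n * 2 powr - real (2 * n)))) \<le> v2 n * 2 powr (- (real (2 * n) * Q))"
    using small2 eventually_ge_at_top[of 1]
  proof eventually_elim
    case (elim n)
    have "measure lborel (closed_nbhd F (leaf_osc * (real n * 2 powr - real (2 * n)))) \<le> CF * (leaf_osc * (real n * 2 powr - real (2 * n))) powr Q * ln (2 * real n) powr \<kappa>"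
    proof (rule vb)
      have "1 * 1 \<le> leaf_osc * real n" using T2 elim(2) by (intro mult_mono) auto
      then have "1 * 2 powr - real (2 * n) \<le> (leaf_osc * real n) * 2 powr - real (2 * n)" by (intro mult_right_mono) auto
      then show "2 powr - real (2 * n) \<le> leaf_osc * (real n * 2 powr - real (2 * n))" by (simp add: mult.assoc)
    qed (use elim in auto)
    also have "(leaf_osc * (real n * 2 powr - real (2 * n))) powr Q = (leaf_osc * real n) powr Q * 2 powr (- (real (2 * n) * Q))"
    proof -
      have "(2 powr - real (2 * n)) powr Q = 2 powr (- (real (2 * n) * Q))" unfolding powr_powr by simp
      moreover have "leaf_osc * (real n * 2 powr - real (2 * n)) = (leaf_osc * real n) * 2 powr - real (2 * n)" by simp
      ultimately show ?thesis using T2 by (simp only: powr_mult)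
    qed
    finally show ?case by (simp add: v2_def mult_ac)
  qed
  have a0n: "\<forall>\<^sub>F n::nat in sequentially. a0 < 2 ^ n" by real_asymp
  define bound where "bound n = p1 n + real CARD('d) * (14 * 2 ^ CARD('n) * 2 ^ CARD('n) * 2 powr Q * 2 powr - real (2 * n))
     + 2 ^ CARD('n) * 2 ^ CARD('n) * (hit_const * v1 n) + 2 ^ CARD('n) * (hit_const * v2 n) * (q n + p1 n)" for n
  \<comment> \<open>An eventual upper bound for \<open>q + p1\<close>. It decays faster than any
    power, so it survives the factor \<open>n powr (Q + 1)\<close> into which \<open>v2\<close> is
    absorbed.\<close>
  define w where "w n = exp (- (real n powr (1/4))) + real n * (real CARD('d) * (tail_const * exp (- (real n powr (\<beta> / 2))))) + p1 n" for n :: nat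
  have p1_lim: "p1 \<longlonglongrightarrow> 0"
  proof -
    have "(\<lambda>n::nat. exp (- (real n)\<^sup>2 / (4 * \<nu>))) \<longlonglongrightarrow> 0" using nu_pos by real_asymp
    then show ?thesis unfolding p1_def by (intro tendsto_mult_right_zero)
  qed
  \<comment> \<open>\<open>\<kappa> < 1\<close> makes the gain \<open>1 / ln n\<close> of the calm
    boxes beat the logarithmic factor of the volume bound.\<close>
  have v1_lim: "v1 \<longlonglongrightarrow> 0"
  proof -
    have "v1 = (\<lambda>n. (CF * total_osc powr Q * (2 powr Q / \<tau>)) * (ln (2 * real n) powr \<kappa> / ln (real n)))"
      by (auto simp: v1_def)
    then show ?thesis using log_power_ratio_limit[OF \<kappa>(2)] by (simp only: tendsto_mult_right_zero)
  qed
  have w_lim: "(\<lambda>n. real n powr (Q + 1) * w n) \<longlonglongrightarrow> 0"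
  proof -
    have "(\<lambda>n. real n powr (Q + 1) * exp (- (real n powr (1/4))) + (real CARD('d) * tail_const) * (real n powr (Q + 2) * exp (- (real n powr (\<beta> / 2))))
        + (real CARD('d) * sqrt 2) * (real n powr (Q + 1) * exp (- (real n)\<^sup>2 / (4 * \<nu>)))) \<longlonglongrightarrow> 0 + 0 + 0"
      using Q \<beta>(1) nu_pos
      by (intro tendsto_add tendsto_mult_right_zero stretched_exponential_limit gaussian_decay_limit) auto
    moreover have "real n powr (Q + 2) = real n powr (Q + 1) * real n" for n
      by (cases "n = 0") (auto simp: powr_add power2_eq_square)
    ultimately show ?thesis unfolding w_def p1_def by (simp add: algebra_simps)
  qed
  have bound_lim: "\<forall>\<^sub>F n in sequentially. bound n < \<epsilon>"
  proof -
    have le: "\<forall>\<^sub>F n in sequentially. bound n \<le> p1 n + real CARD('d) * (14 * 2 ^ CARD('n) * 2 ^ CARD('n) * 2 powr Q * 2 powr - real (2 * n))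
       + 2 ^ CARD('n) * 2 ^ CARD('n) * (hit_const * v1 n) + (2 ^ CARD('n) * hit_const * CF * leaf_osc powr Q) * (real n powr (Q + 1) * w n)"
      using q_up log_power_le_linear[OF \<kappa>(2)] eventually_ge_at_top[of 1]
    proof eventually_elim
      case (elim n)
      have w0: "0 \<le> w n" unfolding w_def p1_def using tailc by simp
      have "v2 n * (q n + p1 n) \<le> v2 n * w n"
        using elim(1) CF unfolding w_def v2_def by (intro mult_left_mono) auto
      also have "\<dots> \<le> (CF * leaf_osc powr Q * real n powr (Q + 1)) * w n"
      proof (rule mult_right_mono[OF _ w0])
        have "v2 n \<le> CF * (leaf_osc * real n) powr Q * real n" unfolding v2_def using elim(2) CF by (intro mult_left_mono) auto
        also have "(leaf_osc * real n) powr Q = leaf_osc powr Q * real n powr Q" by (rule powr_mult)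
        also have "CF * (leaf_osc powr Q * real n powr Q) * real n = CF * leaf_osc powr Q * real n powr (Q + 1)"
          using elim(3) by (simp add: powr_add)
        finally show "v2 n \<le> CF * leaf_osc powr Q * real n powr (Q + 1)" .
      qed
      finally have "(2 ^ CARD('n) * hit_const) * (v2 n * (q n + p1 n)) \<le> (2 ^ CARD('n) * hit_const) * ((CF * leaf_osc powr Q * real n powr (Q + 1)) * w n)"
        by (rule mult_left_mono) (use hit_const_pos in simp)
      then show ?case unfolding bound_def by (simp only: mult.assoc)
    qed
    have two: "(\<lambda>n::nat. 2 powr - real (2 * n)) \<longlonglongrightarrow> 0" by real_asymp
    have "(\<lambda>n. p1 n + real CARD('d) * (14 * 2 ^ CARD('n) * 2 ^ CARD('n) * 2 powr Q * 2 powr - real (2 * n))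
       + 2 ^ CARD('n) * 2 ^ CARD('n) * (hit_const * v1 n) + (2 ^ CARD('n) * hit_const * CF * leaf_osc powr Q) * (real n powr (Q + 1) * w n)) \<longlonglongrightarrow> 0 + 0 + 0 + 0"
      by (intro tendsto_add tendsto_mult_right_zero p1_lim v1_lim w_lim two)
    then have "\<forall>\<^sub>F n in sequentially. p1 n + real CARD('d) * (14 * 2 ^ CARD('n) * 2 ^ CARD('n) * 2 powr Q * 2 powr - real (2 * n))
       + 2 ^ CARD('n) * 2 ^ CARD('n) * (hit_const * v1 n) + (2 ^ CARD('n) * hit_const * CF * leaf_osc powr Q) * (real n powr (Q + 1) * w n) < \<epsilon>"
      using \<epsilon> by (intro order_tendstoD) auto
    with le show ?thesis by eventually_elim linarith
  qed
  have "\<forall>\<^sub>F n in sequentially. \<forall>m\<ge>2 * n. prob (hits m F (2 powr - real (2 * n))) \<le> \<epsilon>"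
    using bound_lim V1 V2 a0n u1 smooth D1 eventually_ge_at_top[of 1] lnn
  proof eventually_elim
    case (elim n)
    show ?case
    proof (intro allI impI)
    fix m assume mn: "2 * n \<le> m"
    have v: "0 \<le> v1 n" "0 \<le> v2 n" using elim(9) CF \<tau> unfolding v1_def v2_def by auto
    have "prob (hits m F (2 powr - real (2 * n))) \<le> bound n"
      unfolding bound_def q_def p1_def
    proof (rule prob_hits_le[OF near F _ _ _ _ L_up(1)])
      show "\<And>l. l < L n \<Longrightarrow> measure lborel (closed_nbhd F (total_osc * 2 powr - (real (lev n (u n) l) + real (J n)))) \<le> v1 n * 2 powr (- (real (lev n (u n) l) * Q))"
        using elim(2) by blast
      show "D n = 2 powr (real (u n) * \<beta> - 2 * real (J n)) / (4 * mesh_const\<^sup>2)" by (rule D_def)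
    qed (use elim v mn in auto)
    then show "prob (hits m F (2 powr - real (2 * n))) \<le> \<epsilon>" using elim(1) by linarith
    qed
  qed
  from eventually_happens'[OF sequentially_bot this]
  obtain n where "\<forall>m\<ge>2 * n. prob (hits m F (2 powr - real (2 * n))) \<le> \<epsilon>" ..
  then show ?thesis by (intro exI[of _ "2 powr - real (2 * n)"]) auto
qed

section \<open>From grid points to the whole cube\<close>

lemma hits_event [measurable]: "hits m F \<eta> \<in> events"
proof -
  have "hits m F \<eta> = (\<Union>z\<in>Z m. {\<omega>\<in>space M. W {0..} (pt m z) \<omega> \<in> closed_nbhd F \<eta>})"
    by (auto simp: hits_def)
  also have "\<dots> \<in> events"
    by (intro sets.finite_UN finite_Z hit_event pt_mem_cube)
  finally show ?thesis .
qed

definition grid_approx :: "real ^ 'n \<Rightarrow> nat \<Rightarrow> 'n \<Rightarrow> nat" where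
  "grid_approx t m j = nat \<lfloor>(t $ j - p $ j) / h * 2 ^ ex m j\<rfloor>"

text \<open>Rounding down gives an index in \<open>Z m\<close> only while the coordinate stays
  strictly below the upper face, whose index \<open>2 ^ ex m j\<close> is excluded; hence the
  half-open cube.\<close>

lemma grid_approx:
  assumes t: "\<And>j. p $ j \<le> t $ j \<and> t $ j < p $ j + h"
  shows "grid_approx t m \<in> Z m" "\<bar>pt m (grid_approx t m) $ j - t $ j\<bar> \<le> 2 powr - real m"
proof -
  define y where "y j = (t $ j - p $ j) / h" for j
  have y: "0 \<le> y j" "y j < 1" for j using t[of j] h_pos by (auto simp: y_def)
  have yz: "0 \<le> y j * 2 ^ ex m j" "y j * 2 ^ ex m j < 2 ^ ex m j" for j using y[of j] by auto
  have z: "real (grid_approx t m j) = of_int \<lfloor>y j * 2 ^ ex m j\<rfloor>" for j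
    unfolding grid_approx_def y_def[symmetric] using yz(1)[of j] by simp
  have "real (grid_approx t m j) < 2 ^ ex m j" for j
  proof -
    have "real (grid_approx t m j) \<le> y j * 2 ^ ex m j" unfolding z by simp
    then show ?thesis using yz(2)[of j] by (rule le_less_trans)
  qed
  then have "grid_approx t m j < 2 ^ ex m j" for j
    by (metis of_nat_less_iff of_nat_numeral of_nat_power)
  then show "grid_approx t m \<in> Z m" by (simp add: Z_def)
  have "\<bar>real (grid_approx t m j) - y j * 2 ^ ex m j\<bar> \<le> 1" unfolding z by linarith
  then have "\<bar>real (grid_approx t m j) - y j * 2 ^ ex m j\<bar> / 2 ^ ex m j \<le> 1 / 2 ^ ex m j" by (rule divide_right_mono) simp
  moreover have "\<bar>real (grid_approx t m j) / 2 ^ ex m j - y j\<bar> = \<bar>real (grid_approx t m j) - y j * 2 ^ ex m j\<bar> / 2 ^ ex m j"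
  proof -
    have "real (grid_approx t m j) / 2 ^ ex m j - y j = (real (grid_approx t m j) - y j * 2 ^ ex m j) / 2 ^ ex m j"
      by (simp add: diff_divide_distrib)
    then show ?thesis by (simp add: abs_divide)
  qed
  ultimately have a: "\<bar>real (grid_approx t m j) / 2 ^ ex m j - y j\<bar> \<le> 1 / 2 ^ ex m j" by simp
  have "pt m (grid_approx t m) $ j - t $ j = h * (real (grid_approx t m j) / 2 ^ ex m j - y j)"
  proof -
    have "h * y j = t $ j - p $ j" using h_pos by (simp add: y_def)
    then show ?thesis unfolding pt_def vec_lambda_beta right_diff_distrib by simp
  qed
  then have "\<bar>pt m (grid_approx t m) $ j - t $ j\<bar> = h * \<bar>real (grid_approx t m j) / 2 ^ ex m j - y j\<bar>"
    using h_pos by (simp add: abs_mult)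
  also have "\<dots> \<le> 1 * (1 / 2 ^ ex m j)" using a h_pos h_le_1 by (intro mult_mono) auto
  also have "\<dots> = 2 powr - real (ex m j)" by (simp only: mult_1 powr_minus_divide powr_realpow zero_less_numeral)
  also have "\<dots> \<le> 2 powr - real m"
  proof -
    have "real m * 1 \<le> real m * (1 + \<gamma> j)" using gamma_pos[of j] by (intro mult_left_mono) auto
    then have "real m \<le> real (ex m j)" using ex_bounds(1)[of m j] by simp
    then show ?thesis by simp
  qed
  finally show "\<bar>pt m (grid_approx t m) $ j - t $ j\<bar> \<le> 2 powr - real m" .
qed

lemma grid_approx_tendsto:
  assumes t: "\<And>j. p $ j \<le> t $ j \<and> t $ j < p $ j + h"
  shows "(\<lambda>m. pt m (grid_approx t m)) \<longlonglongrightarrow> t"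
proof (rule vec_tendstoI)
  fix j
  have "(\<lambda>m. pt m (grid_approx t m) $ j - t $ j) \<longlonglongrightarrow> 0"
  proof (rule Lim_null_comparison)
    show "\<forall>\<^sub>F m in sequentially. norm (pt m (grid_approx t m) $ j - t $ j) \<le> 2 powr - real m"
      using grid_approx(2)[OF t] by simp
    show "(\<lambda>m. 2 powr - real m) \<longlonglongrightarrow> 0" by real_asymp
  qed
  then show "(\<lambda>m. pt m (grid_approx t m) $ j) \<longlonglongrightarrow> t $ j" by (rule LIM_zero_cancel)
qed

text \<open>By continuity, a hit at \<open>t\<close> makes the grid points approaching
  \<open>t\<close> hit every closed neighbourhood of \<open>F\<close> at all sufficiently fine
  levels. The hitting event need not be measurable for a merely bounded \<open>F\<close>, so it is
  enclosed in the measurable null set \<open>N\<close>.\<close>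

lemma AE_no_hit:
  assumes X: "\<And>\<omega>. \<omega> \<in> space M \<Longrightarrow> continuous_on UNIV (\<lambda>t. X t \<omega>)"
    and WX: "\<And>t. t \<in> E \<Longrightarrow> AE \<omega> in M. W {0..} t \<omega> = X t \<omega>"
    and near: "\<And>s i j. s \<in> cube \<Longrightarrow> \<bar>proj s i j - (if i = j then 1 else 0)\<bar> \<le> 1 / (2 * real CARD('d) * real CARD('d))"
    and F: "bounded F" and r0: "0 < r0" and CF: "0 < CF" and \<kappa>: "0 \<le> \<kappa>" "\<kappa> < 1"
    and vol: "\<And>r. 0 < r \<Longrightarrow> r < r0 \<Longrightarrow> measure lborel (closed_nbhd F r) \<le> CF * r powr Q * (ln (ln (1 / r))) powr \<kappa>"
  shows "AE \<omega> in M. \<forall>t. (\<forall>j. p $ j \<le> t $ j \<and> t $ j < p $ j + h) \<longrightarrow> X t \<omega> \<notin> F"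
proof -
  define B where "B \<eta> = {\<omega>\<in>space M. \<exists>m0. \<forall>m\<ge>m0. \<omega> \<in> hits m F \<eta>}" for \<eta>
  have B_event: "B \<eta> \<in> events" for \<eta> unfolding B_def by measurable
  have B_le: "prob (B \<eta>) \<le> \<epsilon>" if \<eta>: "\<forall>m\<ge>m1. prob (hits m F \<eta>) \<le> \<epsilon>" for \<eta> \<epsilon> m1
  proof -
    define C where "C i = {\<omega>\<in>space M. \<forall>m\<ge>i. \<omega> \<in> hits m F \<eta>}" for i
    have C_event: "C i \<in> events" for i unfolding C_def by measurable
    have "(\<lambda>i. prob (C i)) \<longlonglongrightarrow> prob (\<Union>i. C i)"
      by (rule finite_Lim_measure_incseq) (use C_event in \<open>auto simp: C_def incseq_def\<close>)
    moreover have "(\<Union>i. C i) = B \<eta>" by (auto simp: B_def C_def)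
    moreover have "prob (C i) \<le> \<epsilon>" for i
    proof -
      have "prob (C i) \<le> prob (hits (max i m1) F \<eta>)"
        by (rule finite_measure_mono) (auto simp: C_def)
      also have "\<dots> \<le> \<epsilon>" using \<eta> by simp
      finally show ?thesis .
    qed
    ultimately show ?thesis by (metis LIMSEQ_le_const2)
  qed
  have "\<forall>k::nat. \<exists>\<eta>>0. prob (B \<eta>) \<le> 1 / real (Suc k)"
  proof
    fix k :: nat
    obtain \<eta> m1 where "\<eta> > 0" "\<forall>m\<ge>m1. prob (hits m F \<eta>) \<le> 1 / real (Suc k)"
      using hits_small[OF near F r0 CF \<kappa> vol, of "1 / real (Suc k)"] by auto
    then show "\<exists>\<eta>>0. prob (B \<eta>) \<le> 1 / real (Suc k)" using B_le by blast
  qed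
  then obtain \<eta> where \<eta>: "\<And>k. 0 < \<eta> k" "\<And>k. prob (B (\<eta> k)) \<le> 1 / real (Suc k)" by metis
  define N where "N = (\<Inter>k. B (\<eta> k))"
  have N_event: "N \<in> events" unfolding N_def using B_event by auto
  have "prob N \<le> 1 / real (Suc k)" for k
  proof -
    have "prob N \<le> prob (B (\<eta> k))" unfolding N_def using B_event by (intro finite_measure_mono) auto
    then show ?thesis using \<eta>(2)[of k] by (rule order_trans)
  qed
  then have "prob N \<le> 0"
    by (intro LIMSEQ_le_const[OF lim_inverse_n'[THEN LIMSEQ_Suc]]) auto
  then have "emeasure M N = 0" by (simp add: emeasure_eq_measure measure_le_0_iff)
  then have "N \<in> null_sets M" using N_event by auto
  then have "AE \<omega> in M. \<omega> \<notin> N" by (rule AE_not_in)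
  moreover have "AE \<omega> in M. \<forall>m. \<forall>z\<in>Z m. W {0..} (pt m z) \<omega> = X (pt m z) \<omega>"
  proof -
    have "AE \<omega> in M. W {0..} (pt m z) \<omega> = X (pt m z) \<omega>" if "z \<in> Z m" for m z
      using pt_mem_cube[OF that] cube_E by (intro WX) auto
    then show ?thesis by (simp add: AE_all_countable AE_finite_all)
  qed
  ultimately show ?thesis
    using AE_space
  proof eventually_elim
    case (elim \<omega>)
    show ?case
    proof (intro allI impI notI)
      fix t assume t: "\<forall>j. p $ j \<le> t $ j \<and> t $ j < p $ j + h" and hit: "X t \<omega> \<in> F"
      have t': "\<And>j. p $ j \<le> t $ j \<and> t $ j < p $ j + h" using t by blast
      have "(\<lambda>m. X (pt m (grid_approx t m)) \<omega>) \<longlonglongrightarrow> X t \<omega>"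
        by (rule continuous_on_tendsto_compose[OF X[OF elim(3)] grid_approx_tendsto[OF t']]) auto
      moreover have "\<omega> \<in> B e" if e: "0 < e" and lim: "(\<lambda>m. X (pt m (grid_approx t m)) \<omega>) \<longlonglongrightarrow> X t \<omega>" for e
      proof -
        obtain m0 where m0: "\<And>m. m \<ge> m0 \<Longrightarrow> dist (X (pt m (grid_approx t m)) \<omega>) (X t \<omega>) < e"
          using metric_LIMSEQ_D[OF lim e] by blast
        have "\<omega> \<in> hits m F e" if m: "m \<ge> m0" for m
        proof -
          have "infdist (X (pt m (grid_approx t m)) \<omega>) F \<le> dist (X (pt m (grid_approx t m)) \<omega>) (X t \<omega>)"
            by (rule infdist_le[OF hit])
          also have "\<dots> \<le> e" using m0[OF m] by simp
          finally have "X (pt m (grid_approx t m)) \<omega> \<in> closed_nbhd F e" using hit by (auto simp: closed_nbhd_def)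
          moreover have zm: "grid_approx t m \<in> Z m" by (rule grid_approx(1)[OF t'])
          moreover have "W {0..} (pt m (grid_approx t m)) \<omega> = X (pt m (grid_approx t m)) \<omega>" using elim(2) zm by blast
          ultimately have "W {0..} (pt m (grid_approx t m)) \<omega> \<in> closed_nbhd F e" by (simp only:)
          then show ?thesis unfolding hits_def using elim(3) zm by blast
        qed
        then show ?thesis unfolding B_def using elim(3) by blast
      qed
      ultimately have "\<omega> \<in> N" unfolding N_def using \<eta>(1) by blast
      then show False using elim(1) by blast
    qed
  qed
qed

end

text \<open>If \<open>m = Q\<close>, the hypothesis on \<open>\<kappa>\<close> already says
  \<open>\<kappa> < 1\<close>. If \<open>m > Q\<close>, the surplus power of \<open>r\<close>
  absorbs the double logarithm, and \<open>\<kappa>' = 0\<close> works.\<close>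

lemma volume_bound_reduce:
  fixes V :: "real \<Rightarrow> ennreal"
  assumes V: "\<forall>\<^sub>F r in at_right 0. V r \<le> ennreal (C * r powr m * (ln (ln (1 / r))) powr \<kappa>)"
    and C: "0 < C" and Q: "0 < Q" "Q \<le> m" and \<kappa>: "0 \<le> \<kappa>" "\<kappa> < m / Q"
  obtains r0 \<kappa>' where "0 < r0" "0 \<le> \<kappa>'" "\<kappa>' < 1"
    "\<And>r. 0 < r \<Longrightarrow> r < r0 \<Longrightarrow> enn2real (V r) \<le> C * r powr Q * (ln (ln (1 / r))) powr \<kappa>'"
proof -
  have "\<exists>\<kappa>'. 0 \<le> \<kappa>' \<and> \<kappa>' < 1 \<and> (\<forall>\<^sub>F r in at_right 0. r powr m * (ln (ln (1 / r))) powr \<kappa> \<le> r powr Q * (ln (ln (1 / r))) powr \<kappa>')"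
  proof (cases "m = Q")
    case True
    then show ?thesis using \<kappa> Q by (intro exI[of _ \<kappa>]) auto
  next
    case False
    define e where "e = m - Q"
    have e: "0 < e" "m = Q + e" using False Q by (auto simp: e_def)
    have lim: "((\<lambda>r::real. r powr e * (ln (ln (1 / r))) powr \<kappa>) \<longlongrightarrow> 0) (at_right 0)"
      using e(1) by real_asymp
    have "\<forall>\<^sub>F r::real in at_right 0. r powr e * (ln (ln (1 / r))) powr \<kappa> < 1"
      by (rule order_tendstoD(2)[OF lim]) simp
    moreover have "\<forall>\<^sub>F r::real in at_right 0. 0 < ln (ln (1 / r))" by real_asymp
    ultimately have "\<forall>\<^sub>F r::real in at_right 0. r powr m * (ln (ln (1 / r))) powr \<kappa> \<le> r powr Q * (ln (ln (1 / r))) powr 0"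
    proof eventually_elim
      case (elim r)
      have "r powr m * (ln (ln (1 / r))) powr \<kappa> = r powr Q * (r powr e * (ln (ln (1 / r))) powr \<kappa>)"
        by (simp add: e(2) powr_add)
      also have "\<dots> \<le> r powr Q * 1" using elim(1) by (intro mult_left_mono) auto
      finally show ?case using elim(2) by simp
    qed
    then show ?thesis by (intro exI[of _ 0]) auto
  qed
  then obtain \<kappa>' where \<kappa>': "0 \<le> \<kappa>'" "\<kappa>' < 1"
    "\<forall>\<^sub>F r in at_right 0. r powr m * (ln (ln (1 / r))) powr \<kappa> \<le> r powr Q * (ln (ln (1 / r))) powr \<kappa>'" by blast
  have "\<forall>\<^sub>F r in at_right 0. enn2real (V r) \<le> C * r powr Q * (ln (ln (1 / r))) powr \<kappa>'"
    using V \<kappa>'(3)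
  proof eventually_elim
    case (elim r)
    have "enn2real (V r) \<le> C * r powr m * (ln (ln (1 / r))) powr \<kappa>"
      using elim(1) C by (intro enn2real_leI) auto
    also have "\<dots> = C * (r powr m * (ln (ln (1 / r))) powr \<kappa>)" by (rule mult.assoc)
    also have "\<dots> \<le> C * (r powr Q * (ln (ln (1 / r))) powr \<kappa>')" using elim(2) C by (intro mult_left_mono) auto
    also have "\<dots> = C * r powr Q * (ln (ln (1 / r))) powr \<kappa>'" by (rule mult.assoc[symmetric])
    finally show ?case .
  qed
  then obtain b where "b > 0" "\<forall>r>0. r < b \<longrightarrow> enn2real (V r) \<le> C * r powr Q * (ln (ln (1 / r))) powr \<kappa>'"
    by (auto simp: eventually_at_right_field)
  then show ?thesis using that[of b \<kappa>'] \<kappa>' by blast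
qed

section \<open>Localization and compactness\<close>

theorem theorem2p3:
  fixes M :: "'w measure"
    and X :: "real ^ 'n \<Rightarrow> 'w \<Rightarrow> real ^ 'd"
    and lo hi :: "real ^ 'n"
    and \<epsilon>0 :: real
    and \<gamma> :: "'n \<Rightarrow> real"
    and F :: "(real ^ 'd) set"
    and \<theta> C\<^sub>F \<kappa> :: real
  assumes "prob_space M"
    and "gaussian_field M UNIV X"
    and "\<forall>t. centered M (X t)"
    and "\<forall>\<omega>\<in>space M. continuous_on UNIV (\<lambda>t. X t \<omega>)"
    and "iid_components M X"
    and "\<forall>j. lo $ j < hi $ j"
    and "assumption_A1 M X lo hi \<epsilon>0 \<gamma>"
    and "assumption_A2 M X lo hi \<epsilon>0"
    and "assumption_A3 M X lo hi \<epsilon>0 \<gamma>"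
    and "real CARD('d) \<ge> Q_dim \<gamma>"
    and "bounded F"
    and "0 \<le> \<theta>" and "\<theta> \<le> real CARD('d) - Q_dim \<gamma>"
    and "0 < C\<^sub>F"
    and "0 \<le> \<kappa>" and "\<kappa> < (real CARD('d) - \<theta>) / Q_dim \<gamma>"
    and "\<forall>\<^sub>F r in at_right 0. emeasure lborel (closed_nbhd F r)
           \<le> ennreal (C\<^sub>F * r powr (real CARD('d) - \<theta>) * (ln (ln (1 / r))) powr \<kappa>)"
  shows "AE \<omega> in M. {t. X t \<omega> \<in> F} \<inter> cbox lo hi = {}"
proof -
  let ?E = "enlarged lo hi \<epsilon>0"
  have \<epsilon>0: "0 < \<epsilon>0" and \<gamma>: "\<And>j. 0 < \<gamma> j" using assms(7) by (auto simp: assumption_A1_def)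
  obtain H W a0 c0 where ns: "noise M H W ?E \<gamma> a0 c0"
    and WX: "\<And>t. t \<in> ?E \<Longrightarrow> AE \<omega> in M. W {0..} t \<omega> = X t \<omega>"
    and gn: "\<And>t. t \<in> ?E \<Longrightarrow> \<exists>\<nu>. gaussian_noise M \<nu> (\<lambda>A. W A t)"
  proof (rule noise_of_assumption_A1[OF assms(1,7,3)])
    fix H W a0 c0
    assume *: "noise M H W ?E \<gamma> a0 c0" "\<And>t. t \<in> ?E \<Longrightarrow> AE \<omega> in M. W {0..} t \<omega> = X t \<omega>"
      "\<And>t. t \<in> ?E \<Longrightarrow> \<exists>\<nu>. gaussian_noise M \<nu> (\<lambda>A. W A t)"
    show thesis by (rule that[OF *])
  qed
  interpret noise M H W ?E \<gamma> a0 c0 by (rule ns)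
  obtain d0 where d0: "0 < d0" "\<And>t i. t \<in> ?E \<Longrightarrow> d0 \<le> L2_nrm M (\<lambda>\<omega>. X t \<omega> $ i)"
    using assms(8) by (auto simp: assumption_A2_def)
  have Qd: "Q_dim \<gamma> = (\<Sum>j\<in>UNIV. 1 + \<gamma> j)" by (simp add: Q_dim_def alpha_def divide_inverse)
  have Qpos: "0 < Q_dim \<gamma>" unfolding Qd using \<gamma> by (intro sum_pos) (auto intro: add_pos_pos)
  obtain r0 \<kappa>' where r0: "0 < r0" and \<kappa>': "0 \<le> \<kappa>'" "\<kappa>' < 1"
    and vol: "\<And>r. 0 < r \<Longrightarrow> r < r0 \<Longrightarrow> enn2real (emeasure lborel (closed_nbhd F r)) \<le> C\<^sub>F * r powr Q_dim \<gamma> * (ln (ln (1 / r))) powr \<kappa>'"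
    using volume_bound_reduce[OF assms(17,14) Qpos _ assms(15,16)] assms(13) by (metis diff_ge_0_iff_ge le_diff_eq add.commute)
  have nbhd: "\<exists>U. open U \<and> t0 \<in> U \<and> (AE \<omega> in M. \<forall>t\<in>U. X t \<omega> \<notin> F)" if t0: "t0 \<in> cbox lo hi" for t0
  proof -
    have lohi: "lo $ j \<le> t0 $ j" "t0 $ j \<le> hi $ j" for j using t0 by (auto simp: mem_box_cart)
    have "lo $ j - \<epsilon>0 < t0 $ j \<and> t0 $ j < hi $ j + \<epsilon>0" for j
      using lohi[of j] \<epsilon>0 by linarith
    then have t0E: "t0 \<in> ?E" by (simp add: enlarged_def)
    obtain \<nu>m where \<nu>m: "gaussian_noise M \<nu>m (\<lambda>A. W A t0)" using gn[OF t0E] by auto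
    have cov: "expectation (\<lambda>\<omega>. W A t0 \<omega> $ i * W A t0 \<omega> $ j) = (if i = j then measure \<nu>m A else 0)"
      if A: "A \<in> sets borel_Rplus" for A i j
    proof -
      have "covariance_matrix M (W A t0) = mat (measure \<nu>m A)" using \<nu>m A by (simp add: gaussian_noise_def)
      then have "covariance_matrix M (W A t0) $ i $ j = (if i = j then measure \<nu>m A else 0)" by (simp add: mat_def)
      moreover have "expectation (\<lambda>\<omega>. W A t0 \<omega> $ k) = 0" for k by (rule mean_mem[OF W_mem[OF A t0E]])
      ultimately show ?thesis by (simp add: covariance_matrix_def)
    qed
    have sets\<nu>: "sets \<nu>m = sets borel_Rplus" using \<nu>m by (simp add: gaussian_noise_def)
    have fin\<nu>: "emeasure \<nu>m A \<noteq> \<infinity>" if "A \<in> sets borel_Rplus" for A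
      using \<nu>m that by (auto simp: gaussian_noise_def)
    \<comment> \<open>The total mass of the control measure at \<open>t0\<close> is the variance of
      each component of the field there, which is bounded below by \<open>d0^2\<close>.\<close>
    have pos: "0 < measure \<nu>m {0..}"
    proof -
      fix i :: 'd
      have "d0 \<le> L2_nrm M (\<lambda>\<omega>. X t0 \<omega> $ i)" by (rule d0(2)[OF t0E])
      also have "\<dots> = sqrt (expectation (\<lambda>\<omega>. (W {0..} t0 \<omega> $ i)\<^sup>2))"
      proof -
        have "integrable M (X t0)" using assms(3) by (simp add: centered_def)
        then have "X t0 \<in> borel_measurable M" by (rule borel_measurable_integrable)
        then have "(\<lambda>\<omega>. X t0 \<omega> $ i) \<in> borel_measurable M"
          by (rule measurable_compose[OF _ borel_measurable_continuous_onI]) (intro continuous_intros)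
        moreover have "(\<lambda>\<omega>. W {0..} t0 \<omega> $ i) \<in> borel_measurable M"
          by (rule measurable_mem[OF W_mem[OF Rplus_sets(1) t0E]])
        moreover have "AE \<omega> in M. (X t0 \<omega> $ i)\<^sup>2 = (W {0..} t0 \<omega> $ i)\<^sup>2"
          using WX[OF t0E] by eventually_elim simp
        ultimately have "expectation (\<lambda>\<omega>. (X t0 \<omega> $ i)\<^sup>2) = expectation (\<lambda>\<omega>. (W {0..} t0 \<omega> $ i)\<^sup>2)"
          by (intro integral_cong_AE borel_measurable_power)
        then show ?thesis by (simp add: L2_nrm_def)
      qed
      also have "expectation (\<lambda>\<omega>. (W {0..} t0 \<omega> $ i)\<^sup>2) = measure \<nu>m {0..}"
        using cov[OF Rplus_sets(1), of i i] by (simp add: power2_eq_square)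
      finally have "0 < sqrt (measure \<nu>m {0..})" using d0(1) by linarith
      then show ?thesis by simp
    qed
    \<comment> \<open>Continuity from below supplies a finite cutoff \<open>a \<ge> a0\<close> whose
      low-frequency part already has positive variance, so pinning is nondegenerate.\<close>
    have "(\<lambda>k. measure \<nu>m {0..<a0 + real k}) \<longlonglongrightarrow> measure \<nu>m (\<Union>k. {0..<a0 + real k})"
    proof (rule Lim_measure_incseq)
      show "range (\<lambda>k. {0..<a0 + real k}) \<subseteq> sets \<nu>m" unfolding sets\<nu> using Rplus_sets(2)[of 0] by auto
      show "incseq (\<lambda>k. {0..<a0 + real k})" by (auto simp: incseq_def)
      show "emeasure \<nu>m (\<Union>k. {0..<a0 + real k}) \<noteq> \<infinity>"
        by (intro fin\<nu> sets.countable_UN) (use Rplus_sets(2)[of 0] in auto)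
    qed
    moreover have "(\<Union>k. {0..<a0 + real k}) = {0..}"
    proof (intro set_eqI iffI)
      fix x :: real assume x: "x \<in> {0..}"
      obtain k :: nat where "x < real k" using reals_Archimedean2 by blast
      then have "x < a0 + real k" using a0_nonneg by linarith
      then show "x \<in> (\<Union>k. {0..<a0 + real k})" using x by auto
    qed auto
    ultimately have "(\<lambda>k. measure \<nu>m {0..<a0 + real k}) \<longlonglongrightarrow> measure \<nu>m {0..}" by simp
    from eventually_happens'[OF sequentially_bot order_tendstoD(1)[OF this pos]]
    obtain k where k: "0 < measure \<nu>m {0..<a0 + real k}" by blast
    define a where "a = a0 + real k"
    define \<nu> where "\<nu> = measure \<nu>m {0..<a}"
    have \<nu>: "0 < \<nu>" using k by (simp add: \<nu>_def a_def)
    define R where "R = c0 * (\<Sum>j\<in>(UNIV::'n set). a powr \<gamma> j) / sqrt \<nu>"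
    have R: "0 \<le> R" unfolding R_def using c0_pos \<nu> by (intro divide_nonneg_nonneg mult_nonneg_nonneg sum_nonneg) auto
    define dd where "dd = 1 / (2 * real CARD('d) * real CARD('d))"
    have dd: "0 < dd" by (simp add: dd_def)
    \<comment> \<open>The cube must stay inside the enlarged interval, and the coefficients
      \<open>proj\<close>, which are Lipschitz with constant \<open>R\<close> and the identity at
      \<open>t0\<close>, must stay within \<open>dd\<close> of the identity.\<close>
    define h where "h = min (min 1 \<epsilon>0) (dd / (R + 1))"
    have h: "0 < h" "h \<le> 1" "h \<le> \<epsilon>0" "h \<le> dd / (R + 1)" unfolding h_def using dd R \<epsilon>0 by auto
    have Rh: "R * h \<le> dd"
    proof -
      have "R * h \<le> (R + 1) * h" using h(1) by (intro mult_right_mono) auto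
      also have "\<dots> \<le> (R + 1) * (dd / (R + 1))" using h(4) R by (intro mult_left_mono) auto
      also have "\<dots> = dd" using R by simp
      finally show ?thesis .
    qed
    \<comment> \<open>Centring the cube at \<open>t0\<close> puts \<open>t0\<close> in its interior,
      so the open cubes cover the interval.\<close>
    define hh where "hh = h / 2"
    have "h = hh + hh" "0 < hh" using h(1) by (auto simp: hh_def)
    note hh = this
    define p where "p = (\<chi> j. t0 $ j - hh)"
    interpret grid \<gamma> p h using \<gamma> h by unfold_locales
    have cube_t0: "\<bar>s $ j - t0 $ j\<bar> \<le> hh" if s: "s \<in> cube" for s j
    proof -
      have "p $ j \<le> s $ j" "s $ j \<le> p $ j + h" using s unfolding cube_def by auto
      then show ?thesis using hh(1) by (simp add: p_def)
    qed
    have cubeE: "cube \<subseteq> ?E"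
    proof
      fix s assume s: "s \<in> cube"
      have "lo $ j - \<epsilon>0 < s $ j \<and> s $ j < hi $ j + \<epsilon>0" for j
      proof -
        have "\<bar>s $ j - t0 $ j\<bar> < \<epsilon>0" using cube_t0[OF s, of j] hh h(3) by linarith
        then show ?thesis using lohi[of j] by linarith
      qed
      then show "s \<in> ?E" by (simp add: enlarged_def)
    qed
    interpret pinned M H W ?E \<gamma> a0 c0 p h t0 a \<nu>
    proof unfold_locales
      show "cube \<subseteq> ?E" by (rule cubeE)
      show "t0 \<in> ?E" by (rule t0E)
      show "a0 \<le> a" by (simp add: a_def)
      show "0 < \<nu>" by (rule \<nu>)
      show "expectation (\<lambda>\<omega>. W {0..<a} t0 \<omega> $ i * W {0..<a} t0 \<omega> $ j) = (if i = j then \<nu> else 0)" for i j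
        unfolding \<nu>_def by (rule cov[OF Rplus_sets(2)]) simp
    qed
    have near: "\<bar>proj s i j - (if i = j then 1 else 0)\<bar> \<le> 1 / (2 * real CARD('d) * real CARD('d))" if s: "s \<in> cube" for s i j
    proof -
      have "\<bar>s $ j - t0 $ j\<bar> \<le> h" for j
        using cube_t0[OF s, of j] hh by linarith
      then have "\<bar>proj s i j - proj t0 i j\<bar> \<le> proj_const * h" using s cubeE t0E by (intro proj_Lipschitz) auto
      then have "\<bar>proj s i j - (if i = j then 1 else 0)\<bar> \<le> R * h" unfolding proj_t0 proj_const_def R_def[symmetric] .
      then show ?thesis using Rh unfolding dd_def by (rule order_trans)
    qed
    have ae: "AE \<omega> in M. \<forall>t. (\<forall>j. p $ j \<le> t $ j \<and> t $ j < p $ j + h) \<longrightarrow> X t \<omega> \<notin> F"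
    proof (rule AE_no_hit[OF _ WX near assms(11) r0 assms(14) \<kappa>'])
      show "continuous_on UNIV (\<lambda>t. X t \<omega>)" if "\<omega> \<in> space M" for \<omega> using assms(4) that by blast
      show "measure lborel (closed_nbhd F r) \<le> C\<^sub>F * r powr Q * ln (ln (1 / r)) powr \<kappa>'" if "0 < r" "r < r0" for r
        using vol[OF that] unfolding Q_def Qd by (simp add: measure_def)
    qed
    let ?U = "{x. \<forall>j. p $ j < x $ j \<and> x $ j < p $ j + h}"
    have "?U = (\<Inter>j. {x. p $ j < x $ j} \<inter> {x. x $ j < p $ j + h})" by auto
    also have "open \<dots>"
      by (intro open_INT open_Int ballI open_Collect_less continuous_intros) auto
    finally have "open ?U" .
    moreover have "t0 \<in> ?U" using hh by (simp add: p_def)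
    moreover have "AE \<omega> in M. \<forall>t\<in>?U. X t \<omega> \<notin> F" using ae by eventually_elim (auto intro: less_imp_le)
    ultimately show ?thesis by blast
  qed
  define good where "good U \<longleftrightarrow> (AE \<omega> in M. \<forall>t\<in>U. X t \<omega> \<notin> F)" for U
  have "\<forall>t0\<in>cbox lo hi. \<exists>U. open U \<and> t0 \<in> U \<and> good U"
    unfolding good_def by (intro ballI nbhd)
  from bchoice[OF this] obtain U
    where U: "\<forall>t0\<in>cbox lo hi. open (U t0) \<and> t0 \<in> U t0 \<and> good (U t0)" by (rule exE)
  \<comment> \<open>Compactness reduces uncountably many local exceptional null sets to finitely
    many.\<close>
  have "compact (cbox lo hi)" by (rule compact_cbox)
  moreover have "cbox lo hi \<subseteq> (\<Union>t\<in>cbox lo hi. U t)" using U by blast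
  ultimately obtain T where T: "T \<subseteq> cbox lo hi" "finite T" "cbox lo hi \<subseteq> (\<Union>t\<in>T. U t)"
    using U by (meson compactE_image)
  have "AE \<omega> in M. \<forall>t0\<in>T. \<forall>t\<in>U t0. X t \<omega> \<notin> F"
    unfolding AE_finite_all[OF T(2)] using T(1) U unfolding good_def by blast
  then show ?thesis by eventually_elim (use T(3) in blast)
qed

end
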